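(* The 2-category $\mathsf{Fib}$ of (cloven) fibrations admits the construction of differential objects. In particular, the tangentad of differential objects of a (cloven) Cartesian tangent fibration $\Pi:(\mathbb X',\mathbb T')\to(\mathbb X,\mathbb T)$ is the Cartesian tangent fibration $\mathsf{DO}(\Pi):\mathsf{DO}(\mathbb X',\mathbb T')\to\mathsf{DO}(\mathbb X,\mathbb T)$ which sends $(E,\zeta_E,\sigma_E,\hat p_E)$ to $(\Pi(E),\Pi(\zeta_E),\Pi(\sigma_E),\Pi(\hat p_E))$.
   Context: Composition $\circ$ is in the usual order. A tangent category $(\mathbb X,\mathbb T)$ is a category $\mathbb X$ with a functor $T:\mathbb X\to\mathbb X$ and natural transformations $p:T\Rightarrow\mathrm{id}$, $z:\mathrm{id}\Rightarrow T$, $s:T_2\Rightarrow T$, $l:T\Rightarrow T^2$, $c:T^2\Rightarrow T^2$, where $T_nA$ is the $n$-fold pullback of $p_A$ along itself (required to exist and be preserved by all $T^m$), such that: $(p_A,z_A,s_A)$ is a commutative monoid in $\mathbb X/A$; $Tp\circ l=z\circ p$, $l\circ z=Tz\circ z$, $l\circ s=Ts\circ\langle l\pi_1,l\pi_2\rangle$; $p_T\circ c=Tp$, $c\circ Tz=z_T$, $c\circ Ts=s_T\circ\langle c\,T\pi_1,c\,T\pi_2\rangle$; $Tl\circ l=l_T\circ l$, $c\circ l=l$, $c_T\circ Tc\circ l_T=Tl\circ c$; $c\circ c=\mathrm{id}$, $Tc\circ c_T\circ Tc=c_T\circ Tc\circ c_T$; and the square with top $Ts\circ\langle z_T\pi_1,l\pi_2\rangle:T_2A\to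 T^2A$, left $p\pi_1$, right $Tp$, bottom $z:A\to TA$ is a pullback. It is Cartesian if $\mathbb X$ has (chosen) finite products preserved by $T$. A lax tangent morphism $(F,\alpha):(\mathbb X',\mathbb T')\to(\mathbb X,\mathbb T)$ is a functor $F$ with $\alpha:FT'\Rightarrow TF$ such that $p_F\circ\alpha=Fp'$, $\alpha\circ Fz'=z_F$, $\alpha\circ Fs'=s_F\circ\langle\alpha F\pi_1,\alpha F\pi_2\rangle$, $l_F\circ\alpha=T\alpha\circ\alpha_{T'}\circ Fl'$, $c_F\circ T\alpha\circ\alpha_{T'}=T\alpha\circ\alpha_{T'}\circ Fc'$; strict if $\alpha$ is an identity; $(G,\beta)\circ(F,\alpha)=(GF,\beta_F\circ G\alpha)$. A tangent natural transformation $\varphi:(F,\alpha)\Rightarrow(G,\beta)$ satisfies $T\varphi\circ\alpha=\beta\circ\varphi_{T'}$. $\mathsf{Fib}$: objects are (cloven) fibrations $\Pi:\mathbb X'\to\mathbb X$; 1-morphisms $(F,F')$ are pairs of functors with $\Pi_\bullet F'=F\Pi_\circ$ such that $F'$ sends Cartesian lifts $\varphi_f:f^*E\to E$ of $f$ to Cartesian lifts of $Ff$; 2-morphisms are pairs of natural transformations $(\varphi,\varphi')$ with $\Pi_\bullet\varphi'=\varphi_{\Pi_\circ}$. Tangentads in $\mathsf{Fib}$ are tangent fibrations: (cloven) fibrations $\Pi:(\mathbb X',\mathbb T')\to(\mathbb X,\mathbb T)$ between tangent categories which strictly preserve the tangent structures and for which $(T,T')$ is a 1-morphism of $\mathsf{Fib}$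 (i.e. $T'$ preserves Cartesian lifts). A (lax) morphism of tangent fibrations $(G,\beta;G',\beta'):\Pi_\bullet\to\Pi$ is a 1-morphism $(G,G')$ of $\mathsf{Fib}$ with lax tangent morphism structures $\beta,\beta'$ on $G,G'$ such that $(\beta,\beta')$ is a 2-morphism of $\mathsf{Fib}$; 2-morphisms are pairs of tangent natural transformations forming a 2-morphism of $\mathsf{Fib}$. The hom-category $[\Pi_\bullet\mid\Pi]$ is a tangent category with $\bar T(G,\beta;G',\beta')=(TG,c_G\circ T\beta;T'G',c'_{G'}\circ T'\beta')$ and structural transformations induced from those of $\mathbb T$ and $\mathbb T'$. A (cloven) Cartesian tangent fibration is a tangent fibration between Cartesian tangent categories such that $\Pi$ strictly preserves the chosen finite products and, for Cartesian lifts $\varphi_f:f^*E\to E$, $\varphi_g:g^*F\to F$, the product $\varphi_f\times\varphi_g:f^*E\times g^*F\to E\times F$ is the (cloven) Cartesian lift of $f\times g$ onto $E\times F$. Then $[\Pi_\bullet\mid\Pi]$ is a Cartesian tangent category with objectwise products. A differential object of a Cartesian tangent category is $(A,\zeta_A,\sigma_A,\hat p_A)$ with $(A,\zeta_A:*\to A,\sigma_A:A\times A\to A)$ a commutative monoid and $\hat p_A:TA\to A$ such that $\hat p_A\circ T\zeta_A=\zeta_A$, $\hat p_A\circ T\sigma_A=\sigma_A\circ(\hat p_A\times\hat p_A)$, $\hat p_A\circ z_A=\zeta_A\circ{!}$, $\hat p_A\circ s_A=\sigma_A\circ\langle\hat p_A\pi_1,\hat p_A\pi_2\rangle$, $\hat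 p_A\circ T\hat p_A\circ l_A=\hat p_A$, and $A\xleftarrow{p_A}TA\xrightarrow{\hat p_A}A$ is a product diagram. Morphisms are linear maps: $f\circ\hat p_A=\hat p_B\circ Tf$. They form a Cartesian tangent category $\mathsf{DO}(\mathbb X,\mathbb T)$, with tangent bundle functor $(A,\zeta_A,\sigma_A,\hat p_A)\mapsto(TA,T\zeta_A,T\sigma_A,T\hat p_A\circ c_A)$. A differential object of $[\Pi_\bullet\mid\Pi]$ is pointwise if its product diagram is computed objectwise; concretely it is a morphism $(G,\beta;G',\beta')$ with transformations making each $GA$ a differential object of $(\mathbb X,\mathbb T)$ and each $G'E$ a differential object of $(\mathbb X',\mathbb T')$ over $G\Pi_\bullet(E)$. A Cartesian tangent fibration $\Pi$ admits the construction of differential objects if there are a Cartesian tangent fibration $\mathsf{DO}(\Pi)$, a strict morphism $U:\mathsf{DO}(\Pi)\to\Pi$ and a pointwise differential object $(U;\mathcal Z,\mathcal S,\hat{\mathcal P})$ in $[\mathsf{DO}(\Pi)\mid\Pi]$ such that for every tangent fibration $\Pi_\bullet$ the assignment $H\mapsto(U\circ H;\mathcal Z_H,\mathcal S_H,\hat{\mathcal P}_H)$ is an isomorphism of tangent categories from $[\Pi_\bullet\mid\mathsf{DO}(\Pi)]$ to the tangent category of pointwise differential objects and linear morphisms of $[\Pi_\bullet\mid\Pi]$. $\mathsf{DO}(\Pi)$ is then called the tangentad of differential objects of $\Pi$. $\mathsf{Fib}$ admits the construction of differential objects if every Cartesian tangent fibration does. *)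

theory Defs
  imports Main "HOL-Library.FuncSet"
begin

section \<open>Categories and functors\<close>

record ('o, 'm) category =
  Obj :: "'o set"
  Arr :: "'m set"
  Dom :: "'m \<Rightarrow> 'o"
  Cod :: "'m \<Rightarrow> 'o"
  Id :: "'o \<Rightarrow> 'm"
  Comp :: "'m \<Rightarrow> 'm \<Rightarrow> 'm" (infixl "\<cdot>\<index>" 70)

definition Homs :: "('o, 'm, 'x) category_scheme \<Rightarrow> 'o \<Rightarrow> 'o \<Rightarrow> 'm set" where
  "Homs C A B = {f \<in> Arr C. Dom C f = A \<and> Cod C f = B}"

locale category =
  fixes C :: "('o, 'm, 'x) category_scheme" (structure)
  assumes Dom_in: "f \<in> Arr C \<Longrightarrow> Dom C f \<in> Obj C"
    and Cod_in: "f \<in> Arr C \<Longrightarrow> Cod C f \<in> Obj C"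
    and Id_in: "A \<in> Obj C \<Longrightarrow> Id C A \<in> Homs C A A"
    and Comp_in: "\<lbrakk>f \<in> Homs C X Y; g \<in> Homs C Y Z\<rbrakk> \<Longrightarrow> g \<cdot> f \<in> Homs C X Z"
    and Comp_Id: "f \<in> Homs C X Y \<Longrightarrow> f \<cdot> Id C X = f"
    and Id_Comp: "f \<in> Homs C X Y \<Longrightarrow> Id C Y \<cdot> f = f"
    and Comp_assoc: "\<lbrakk>f \<in> Homs C W X; g \<in> Homs C X Y; h \<in> Homs C Y Z\<rbrakk>
      \<Longrightarrow> (h \<cdot> g) \<cdot> f = h \<cdot> (g \<cdot> f)"

record ('o1, 'm1, 'o2, 'm2) ftr =
  FO :: "'o1 \<Rightarrow> 'o2"
  FA :: "'m1 \<Rightarrow> 'm2"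

definition is_functor ::
  "('o1, 'm1, 'x) category_scheme \<Rightarrow> ('o2, 'm2, 'y) category_scheme \<Rightarrow>
   ('o1, 'm1, 'o2, 'm2) ftr \<Rightarrow> bool" where
  "is_functor C D F \<longleftrightarrow>
     (\<forall>A\<in>Obj C. FO F A \<in> Obj D) \<and>
     (\<forall>f\<in>Arr C. FA F f \<in> Homs D (FO F (Dom C f)) (FO F (Cod C f))) \<and>
     (\<forall>A\<in>Obj C. FA F (Id C A) = Id D (FO F A)) \<and>
     (\<forall>f\<in>Arr C. \<forall>g\<in>Arr C. Cod C f = Dom C g \<longrightarrow>
        FA F (g \<cdot>\<^bsub>C\<^esub> f) = FA F g \<cdot>\<^bsub>D\<^esub> FA F f)"

definition ftr_id :: "('o, 'm, 'o, 'm) ftr" where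
  "ftr_id = \<lparr>FO = (\<lambda>A. A), FA = (\<lambda>f. f)\<rparr>"

definition ftr_comp ::
  "('o2, 'm2, 'o3, 'm3) ftr \<Rightarrow> ('o1, 'm1, 'o2, 'm2) ftr \<Rightarrow> ('o1, 'm1, 'o3, 'm3) ftr"
  (infixl "\<odot>" 70) where
  "G \<odot> F = \<lparr>FO = (\<lambda>A. FO G (FO F A)), FA = (\<lambda>f. FA G (FA F f))\<rparr>"

definition nat_trans ::
  "('o1, 'm1, 'x) category_scheme \<Rightarrow> ('o2, 'm2, 'y) category_scheme \<Rightarrow>
   ('o1, 'm1, 'o2, 'm2) ftr \<Rightarrow> ('o1, 'm1, 'o2, 'm2) ftr \<Rightarrow> ('o1 \<Rightarrow> 'm2) \<Rightarrow> bool" where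
  "nat_trans C D F G \<tau> \<longleftrightarrow>
     (\<forall>A\<in>Obj C. \<tau> A \<in> Homs D (FO F A) (FO G A)) \<and>
     (\<forall>f\<in>Arr C. \<tau> (Cod C f) \<cdot>\<^bsub>D\<^esub> FA F f = FA G f \<cdot>\<^bsub>D\<^esub> \<tau> (Dom C f))"

text \<open>Functors, and families of arrows, which are themselves objects or arrows of some category
  are made extensional (undefined outside the source), so that equality of such objects and
  arrows is the intended one.\<close>

definition ftr_restrict ::
  "('o1, 'm1, 'x) category_scheme \<Rightarrow> ('o1, 'm1, 'o2, 'm2) ftr \<Rightarrow> ('o1, 'm1, 'o2, 'm2) ftr" where
  "ftr_restrict C F = \<lparr>FO = restrict (FO F) (Obj C), FA = restrict (FA F) (Arr C)\<rparr>"

definition full_sub :: "('o, 'm, 'x) category_scheme \<Rightarrow> 'o set \<Rightarrow> ('o, 'm, 'x) category_scheme" where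
  "full_sub C S = C\<lparr>Obj := {A \<in> Obj C. A \<in> S},
                    Arr := {f \<in> Arr C. Dom C f \<in> S \<and> Cod C f \<in> S}\<rparr>"


section \<open>Limits\<close>

definition is_terminal :: "('o, 'm, 'x) category_scheme \<Rightarrow> 'o \<Rightarrow> bool" where
  "is_terminal C U \<longleftrightarrow> U \<in> Obj C \<and> (\<forall>X\<in>Obj C. \<exists>!u. u \<in> Homs C X U)"

definition is_product ::
  "('o, 'm, 'x) category_scheme \<Rightarrow> 'o \<Rightarrow> 'o \<Rightarrow> 'o \<Rightarrow> 'm \<Rightarrow> 'm \<Rightarrow> bool" where
  "is_product C A B P a b \<longleftrightarrow> P \<in> Obj C \<and> a \<in> Homs C P A \<and> b \<in> Homs C P B \<and>
     (\<forall>X. \<forall>f\<in>Homs C X A. \<forall>g\<in>Homs C X B.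
        \<exists>!u. u \<in> Homs C X P \<and> a \<cdot>\<^bsub>C\<^esub> u = f \<and> b \<cdot>\<^bsub>C\<^esub> u = g)"

definition is_pullback ::
  "('o, 'm, 'x) category_scheme \<Rightarrow> 'm \<Rightarrow> 'm \<Rightarrow> 'o \<Rightarrow> 'm \<Rightarrow> 'm \<Rightarrow> bool" where
  "is_pullback C f g P a b \<longleftrightarrow>
     f \<in> Arr C \<and> g \<in> Arr C \<and> Cod C f = Cod C g \<and>
     a \<in> Homs C P (Dom C f) \<and> b \<in> Homs C P (Dom C g) \<and> f \<cdot>\<^bsub>C\<^esub> a = g \<cdot>\<^bsub>C\<^esub> b \<and>
     (\<forall>X. \<forall>h\<in>Homs C X (Dom C f). \<forall>k\<in>Homs C X (Dom C g). f \<cdot>\<^bsub>C\<^esub> h = g \<cdot>\<^bsub>C\<^esub> k \<longrightarrow>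
        (\<exists>!u. u \<in> Homs C X P \<and> a \<cdot>\<^bsub>C\<^esub> u = h \<and> b \<cdot>\<^bsub>C\<^esub> u = k))"

text \<open>The n-fold pullback of an arrow along itself, with projections indexed by 0, ..., n-1;
  only used for n at least 1.\<close>

definition is_npullback ::
  "('o, 'm, 'x) category_scheme \<Rightarrow> nat \<Rightarrow> 'm \<Rightarrow> 'o \<Rightarrow> (nat \<Rightarrow> 'm) \<Rightarrow> bool" where
  "is_npullback C n q P \<pi> \<longleftrightarrow>
     q \<in> Arr C \<and> P \<in> Obj C \<and> (\<forall>i<n. \<pi> i \<in> Homs C P (Dom C q)) \<and>
     (\<forall>i<n. \<forall>j<n. q \<cdot>\<^bsub>C\<^esub> \<pi> i = q \<cdot>\<^bsub>C\<^esub> \<pi> j) \<and>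
     (\<forall>X\<in>Obj C. \<forall>g. (\<forall>i<n. g i \<in> Homs C X (Dom C q)) \<longrightarrow>
        (\<forall>i<n. \<forall>j<n. q \<cdot>\<^bsub>C\<^esub> g i = q \<cdot>\<^bsub>C\<^esub> g j) \<longrightarrow>
        (\<exists>!u. u \<in> Homs C X P \<and> (\<forall>i<n. \<pi> i \<cdot>\<^bsub>C\<^esub> u = g i)))"

definition med2 ::
  "('o, 'm, 'x) category_scheme \<Rightarrow> 'o \<Rightarrow> 'o \<Rightarrow> 'm \<Rightarrow> 'm \<Rightarrow> 'm \<Rightarrow> 'm \<Rightarrow> 'm" where
  "med2 C X P a b f g = (THE u. u \<in> Homs C X P \<and> a \<cdot>\<^bsub>C\<^esub> u = f \<and> b \<cdot>\<^bsub>C\<^esub> u = g)"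

definition ntuple ::
  "('o, 'm, 'x) category_scheme \<Rightarrow> nat \<Rightarrow> 'o \<Rightarrow> 'o \<Rightarrow> (nat \<Rightarrow> 'm) \<Rightarrow> (nat \<Rightarrow> 'm) \<Rightarrow> 'm" where
  "ntuple C n X P \<pi> g = (THE u. u \<in> Homs C X P \<and> (\<forall>i<n. \<pi> i \<cdot>\<^bsub>C\<^esub> u = g i))"


section \<open>Tangent categories\<close>

text \<open>The n-fold pullbacks of the projection (for n at least 1) are chosen: \<open>Tn C n A\<close>
  with projections \<open>pr C n i A\<close> for \<open>i < n\<close>.\<close>

record ('o, 'm) tcat = "('o, 'm) category" +
  Tan :: "('o, 'm, 'o, 'm) ftr"
  pT :: "'o \<Rightarrow> 'm"
  zT :: "'o \<Rightarrow> 'm"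
  sT :: "'o \<Rightarrow> 'm"
  lT :: "'o \<Rightarrow> 'm"
  cT :: "'o \<Rightarrow> 'm"
  Tn :: "nat \<Rightarrow> 'o \<Rightarrow> 'o"
  pr :: "nat \<Rightarrow> nat \<Rightarrow> 'o \<Rightarrow> 'm"

abbreviation TO :: "('o, 'm, 'x) tcat_scheme \<Rightarrow> 'o \<Rightarrow> 'o" where
  "TO C A \<equiv> FO (Tan C) A"

abbreviation TA :: "('o, 'm, 'x) tcat_scheme \<Rightarrow> 'm \<Rightarrow> 'm" where
  "TA C f \<equiv> FA (Tan C) f"

definition TnF :: "('o, 'm, 'x) tcat_scheme \<Rightarrow> nat \<Rightarrow> ('o, 'm, 'o, 'm) ftr" where
  "TnF C n = \<lparr>FO = Tn C n,
     FA = (\<lambda>f. ntuple C n (Tn C n (Dom C f)) (Tn C n (Cod C f)) (\<lambda>i. pr C n i (Cod C f))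
                 (\<lambda>i. TA C f \<cdot>\<^bsub>C\<^esub> pr C n i (Dom C f)))\<rparr>"

text \<open>Pairings into the chosen pullback of the projection along itself, and into its image
  under the tangent bundle functor.\<close>

definition T2pair :: "('o, 'm, 'x) tcat_scheme \<Rightarrow> 'o \<Rightarrow> 'o \<Rightarrow> 'm \<Rightarrow> 'm \<Rightarrow> 'm" where
  "T2pair C X A f g = med2 C X (Tn C 2 A) (pr C 2 0 A) (pr C 2 1 A) f g"

definition TT2pair :: "('o, 'm, 'x) tcat_scheme \<Rightarrow> 'o \<Rightarrow> 'o \<Rightarrow> 'm \<Rightarrow> 'm \<Rightarrow> 'm" where
  "TT2pair C X A f g =
     med2 C X (TO C (Tn C 2 A)) (TA C (pr C 2 0 A)) (TA C (pr C 2 1 A)) f g"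

locale tangent_category = category C for C :: "('o, 'm, 'x) tcat_scheme" (structure) +
  assumes T_functor: "is_functor C C (Tan C)"
    and T_npullback: "\<lbrakk>A \<in> Obj C; 1 \<le> n\<rbrakk> \<Longrightarrow>
      is_npullback C n (((FA (Tan C)) ^^ m) (pT C A)) (((FO (Tan C)) ^^ m) (Tn C n A))
        (\<lambda>i. ((FA (Tan C)) ^^ m) (pr C n i A))"
    and p_nat: "nat_trans C C (Tan C) ftr_id (pT C)"
    and z_nat: "nat_trans C C ftr_id (Tan C) (zT C)"
    and s_nat: "nat_trans C C (TnF C 2) (Tan C) (sT C)"
    and l_nat: "nat_trans C C (Tan C) (Tan C \<odot> Tan C) (lT C)"
    and c_nat: "nat_trans C C (Tan C \<odot> Tan C) (Tan C \<odot> Tan C) (cT C)"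
    and p_z: "A \<in> Obj C \<Longrightarrow> pT C A \<cdot> zT C A = Id C A"
    and p_s: "A \<in> Obj C \<Longrightarrow> pT C A \<cdot> sT C A = pT C A \<cdot> pr C 2 0 A"
    and s_unit: "A \<in> Obj C \<Longrightarrow>
      sT C A \<cdot> T2pair C (TO C A) A (zT C A \<cdot> pT C A) (Id C (TO C A)) = Id C (TO C A)"
    and s_comm: "A \<in> Obj C \<Longrightarrow>
      sT C A \<cdot> T2pair C (Tn C 2 A) A (pr C 2 1 A) (pr C 2 0 A) = sT C A"
    and s_assoc: "A \<in> Obj C \<Longrightarrow>
      sT C A \<cdot> T2pair C (Tn C 3 A) A
                 (sT C A \<cdot> T2pair C (Tn C 3 A) A (pr C 3 0 A) (pr C 3 1 A)) (pr C 3 2 A) =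
      sT C A \<cdot> T2pair C (Tn C 3 A) A
                 (pr C 3 0 A) (sT C A \<cdot> T2pair C (Tn C 3 A) A (pr C 3 1 A) (pr C 3 2 A))"
    and l_p: "A \<in> Obj C \<Longrightarrow> TA C (pT C A) \<cdot> lT C A = zT C A \<cdot> pT C A"
    and l_z: "A \<in> Obj C \<Longrightarrow> lT C A \<cdot> zT C A = TA C (zT C A) \<cdot> zT C A"
    and l_s: "A \<in> Obj C \<Longrightarrow> lT C A \<cdot> sT C A =
      TA C (sT C A) \<cdot> TT2pair C (Tn C 2 A) A (lT C A \<cdot> pr C 2 0 A) (lT C A \<cdot> pr C 2 1 A)"
    and c_p: "A \<in> Obj C \<Longrightarrow> pT C (TO C A) \<cdot> cT C A = TA C (pT C A)"
    and c_z: "A \<in> Obj C \<Longrightarrow> cT C A \<cdot> TA C (zT C A) = zT C (TO C A)"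
    and c_s: "A \<in> Obj C \<Longrightarrow> cT C A \<cdot> TA C (sT C A) =
      sT C (TO C A) \<cdot> T2pair C (TO C (Tn C 2 A)) (TO C A)
                        (cT C A \<cdot> TA C (pr C 2 0 A)) (cT C A \<cdot> TA C (pr C 2 1 A))"
    and l_l: "A \<in> Obj C \<Longrightarrow> TA C (lT C A) \<cdot> lT C A = lT C (TO C A) \<cdot> lT C A"
    and c_l: "A \<in> Obj C \<Longrightarrow> cT C A \<cdot> lT C A = lT C A"
    and c_c_l: "A \<in> Obj C \<Longrightarrow>
      cT C (TO C A) \<cdot> TA C (cT C A) \<cdot> lT C (TO C A) = TA C (lT C A) \<cdot> cT C A"
    and c_c: "A \<in> Obj C \<Longrightarrow> cT C A \<cdot> cT C A = Id C (TO C (TO C A))"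
    and c_braid: "A \<in> Obj C \<Longrightarrow>
      TA C (cT C A) \<cdot> cT C (TO C A) \<cdot> TA C (cT C A) =
      cT C (TO C A) \<cdot> TA C (cT C A) \<cdot> cT C (TO C A)"
    and l_universal: "A \<in> Obj C \<Longrightarrow>
      is_pullback C (zT C A) (TA C (pT C A)) (Tn C 2 A)
        (pT C A \<cdot> pr C 2 0 A)
        (TA C (sT C A) \<cdot> TT2pair C (Tn C 2 A) A
            (zT C (TO C A) \<cdot> pr C 2 0 A) (lT C A \<cdot> pr C 2 1 A))"

definition lax_tangent_morphism ::
  "('o1, 'm1, 'x) tcat_scheme \<Rightarrow> ('o2, 'm2, 'y) tcat_scheme \<Rightarrow>
   ('o1, 'm1, 'o2, 'm2) ftr \<Rightarrow> ('o1 \<Rightarrow> 'm2) \<Rightarrow> bool" where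
  "lax_tangent_morphism C D F \<alpha> \<longleftrightarrow>
     tangent_category C \<and> tangent_category D \<and> is_functor C D F \<and>
     nat_trans C D (F \<odot> Tan C) (Tan D \<odot> F) \<alpha> \<and>
     (\<forall>A\<in>Obj C. pT D (FO F A) \<cdot>\<^bsub>D\<^esub> \<alpha> A = FA F (pT C A)) \<and>
     (\<forall>A\<in>Obj C. \<alpha> A \<cdot>\<^bsub>D\<^esub> FA F (zT C A) = zT D (FO F A)) \<and>
     (\<forall>A\<in>Obj C. \<alpha> A \<cdot>\<^bsub>D\<^esub> FA F (sT C A) =
        sT D (FO F A) \<cdot>\<^bsub>D\<^esub> T2pair D (FO F (Tn C 2 A)) (FO F A)
          (\<alpha> A \<cdot>\<^bsub>D\<^esub> FA F (pr C 2 0 A)) (\<alpha> A \<cdot>\<^bsub>D\<^esub> FA F (pr C 2 1 A))) \<and>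
     (\<forall>A\<in>Obj C. lT D (FO F A) \<cdot>\<^bsub>D\<^esub> \<alpha> A =
        TA D (\<alpha> A) \<cdot>\<^bsub>D\<^esub> \<alpha> (TO C A) \<cdot>\<^bsub>D\<^esub> FA F (lT C A)) \<and>
     (\<forall>A\<in>Obj C. cT D (FO F A) \<cdot>\<^bsub>D\<^esub> TA D (\<alpha> A) \<cdot>\<^bsub>D\<^esub> \<alpha> (TO C A) =
        TA D (\<alpha> A) \<cdot>\<^bsub>D\<^esub> \<alpha> (TO C A) \<cdot>\<^bsub>D\<^esub> FA F (cT C A))"

text \<open>Since the components of a lax structure are arrows \<open>F (T A) \<rightarrow> T (F A)\<close>, this includes
  \<open>F (T A) = T (F A)\<close>, and by naturality the same equation on arrows.\<close>

definition strict_tangent_morphism ::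
  "('o1, 'm1, 'x) tcat_scheme \<Rightarrow> ('o2, 'm2, 'y) tcat_scheme \<Rightarrow>
   ('o1, 'm1, 'o2, 'm2) ftr \<Rightarrow> bool" where
  "strict_tangent_morphism C D F \<longleftrightarrow>
     lax_tangent_morphism C D F (\<lambda>A. Id D (FO F (TO C A)))"

definition tangent_iso ::
  "('o1, 'm1, 'x) tcat_scheme \<Rightarrow> ('o2, 'm2, 'y) tcat_scheme \<Rightarrow>
   ('o1, 'm1, 'o2, 'm2) ftr \<Rightarrow> bool" where
  "tangent_iso C D F \<longleftrightarrow> strict_tangent_morphism C D F \<and>
     bij_betw (FO F) (Obj C) (Obj D) \<and> bij_betw (FA F) (Arr C) (Arr D)"

record ('o1, 'm1, 'o2, 'm2) lax =
  Fun :: "('o1, 'm1, 'o2, 'm2) ftr"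
  Str :: "'o1 \<Rightarrow> 'm2"

definition lax_ok ::
  "('o1, 'm1, 'x) tcat_scheme \<Rightarrow> ('o2, 'm2, 'y) tcat_scheme \<Rightarrow>
   ('o1, 'm1, 'o2, 'm2) lax \<Rightarrow> bool" where
  "lax_ok C D M \<longleftrightarrow> lax_tangent_morphism C D (Fun M) (Str M) \<and>
     FO (Fun M) \<in> extensional (Obj C) \<and> FA (Fun M) \<in> extensional (Arr C) \<and>
     Str M \<in> extensional (Obj C)"

definition lax_comp ::
  "('o1, 'm1, 'x) tcat_scheme \<Rightarrow> ('o3, 'm3, 'y) tcat_scheme \<Rightarrow>
   ('o2, 'm2, 'o3, 'm3) lax \<Rightarrow> ('o1, 'm1, 'o2, 'm2) lax \<Rightarrow> ('o1, 'm1, 'o3, 'm3) lax" where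
  "lax_comp C E N M = \<lparr>Fun = ftr_restrict C (Fun N \<odot> Fun M),
     Str = (\<lambda>A\<in>Obj C. Str N (FO (Fun M) A) \<cdot>\<^bsub>E\<^esub> FA (Fun N) (Str M A))\<rparr>"

definition tangent_nat ::
  "('o1, 'm1, 'x) tcat_scheme \<Rightarrow> ('o2, 'm2, 'y) tcat_scheme \<Rightarrow>
   ('o1, 'm1, 'o2, 'm2) lax \<Rightarrow> ('o1, 'm1, 'o2, 'm2) lax \<Rightarrow> ('o1 \<Rightarrow> 'm2) \<Rightarrow> bool" where
  "tangent_nat C D M N \<phi> \<longleftrightarrow> nat_trans C D (Fun M) (Fun N) \<phi> \<and>
     (\<forall>A\<in>Obj C. TA D (\<phi> A) \<cdot>\<^bsub>D\<^esub> Str M A = Str N A \<cdot>\<^bsub>D\<^esub> \<phi> (TO C A))"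

text \<open>The tangent bundle of a lax morphism, and its n-fold pullbacks. The lax structure of the
  latter is induced by the former and the universal property of the n-fold pullback, which the
  tangent bundle functor preserves.\<close>

definition lax_T ::
  "('o1, 'm1, 'x) tcat_scheme \<Rightarrow> ('o2, 'm2, 'y) tcat_scheme \<Rightarrow>
   ('o1, 'm1, 'o2, 'm2) lax \<Rightarrow> ('o1, 'm1, 'o2, 'm2) lax" where
  "lax_T C D M = \<lparr>Fun = ftr_restrict C (Tan D \<odot> Fun M),
     Str = (\<lambda>A\<in>Obj C. cT D (FO (Fun M) A) \<cdot>\<^bsub>D\<^esub> TA D (Str M A))\<rparr>"

definition lax_Tn ::
  "('o1, 'm1, 'x) tcat_scheme \<Rightarrow> ('o2, 'm2, 'y) tcat_scheme \<Rightarrow> nat \<Rightarrow>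
   ('o1, 'm1, 'o2, 'm2) lax \<Rightarrow> ('o1, 'm1, 'o2, 'm2) lax" where
  "lax_Tn C D n M = \<lparr>Fun = ftr_restrict C (TnF D n \<odot> Fun M),
     Str = (\<lambda>A\<in>Obj C. ntuple D n
        (Tn D n (FO (Fun M) (TO C A))) (TO D (Tn D n (FO (Fun M) A)))
        (\<lambda>i. TA D (pr D n i (FO (Fun M) A)))
        (\<lambda>i. cT D (FO (Fun M) A) \<cdot>\<^bsub>D\<^esub> TA D (Str M A) \<cdot>\<^bsub>D\<^esub> pr D n i (FO (Fun M) (TO C A))))\<rparr>"


section \<open>Cartesian tangent categories\<close>

record ('o, 'm) products =
  One :: "'o"
  Prod :: "'o \<Rightarrow> 'o \<Rightarrow> 'o"
  Fst :: "'o \<Rightarrow> 'o \<Rightarrow> 'm"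
  Snd :: "'o \<Rightarrow> 'o \<Rightarrow> 'm"

definition bang :: "('o, 'm, 'x) category_scheme \<Rightarrow> ('o, 'm) products \<Rightarrow> 'o \<Rightarrow> 'm" where
  "bang C P X = (THE u. u \<in> Homs C X (One P))"

definition pair :: "('o, 'm, 'x) category_scheme \<Rightarrow> ('o, 'm) products \<Rightarrow> 'm \<Rightarrow> 'm \<Rightarrow> 'm" where
  "pair C P f g = med2 C (Dom C f) (Prod P (Cod C f) (Cod C g))
     (Fst P (Cod C f) (Cod C g)) (Snd P (Cod C f) (Cod C g)) f g"

definition prodmap :: "('o, 'm, 'x) category_scheme \<Rightarrow> ('o, 'm) products \<Rightarrow> 'm \<Rightarrow> 'm \<Rightarrow> 'm" where
  "prodmap C P f g = pair C P (f \<cdot>\<^bsub>C\<^esub> Fst P (Dom C f) (Dom C g)) (g \<cdot>\<^bsub>C\<^esub> Snd P (Dom C f) (Dom C g))"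

text \<open>The inverse of the comparison from \<open>T (A \<times> B)\<close> to \<open>T A \<times> T B\<close>, precomposed with a pairing.\<close>

definition TPpair ::
  "('o, 'm, 'x) tcat_scheme \<Rightarrow> ('o, 'm) products \<Rightarrow> 'o \<Rightarrow> 'o \<Rightarrow> 'o \<Rightarrow> 'm \<Rightarrow> 'm \<Rightarrow> 'm" where
  "TPpair C P X A B f g = med2 C X (TO C (Prod P A B)) (TA C (Fst P A B)) (TA C (Snd P A B)) f g"

definition cartesian_tangent_category ::
  "('o, 'm, 'x) tcat_scheme \<Rightarrow> ('o, 'm) products \<Rightarrow> bool" where
  "cartesian_tangent_category C P \<longleftrightarrow> tangent_category C \<and>
     is_terminal C (One P) \<and> is_terminal C (TO C (One P)) \<and>
     (\<forall>A\<in>Obj C. \<forall>B\<in>Obj C.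
        is_product C A B (Prod P A B) (Fst P A B) (Snd P A B) \<and>
        is_product C (TO C A) (TO C B) (TO C (Prod P A B)) (TA C (Fst P A B)) (TA C (Snd P A B)))"


section \<open>Differential objects\<close>

record ('o, 'm) dobj =
  do_carrier :: "'o"
  do_zero :: "'m"
  do_sum :: "'m"
  do_hat :: "'m"

definition differential_object ::
  "('o, 'm, 'x) tcat_scheme \<Rightarrow> ('o, 'm) products \<Rightarrow> ('o, 'm) dobj \<Rightarrow> bool" where
  "differential_object C P D \<longleftrightarrow>
     (let A = do_carrier D; \<zeta> = do_zero D; \<sigma> = do_sum D; ph = do_hat D;
          AA = Prod P A A; a = Fst P A A; b = Snd P A A
      in A \<in> Obj C \<and> \<zeta> \<in> Homs C (One P) A \<and> \<sigma> \<in> Homs C AA A \<and> ph \<in> Homs C (TO C A) A \<and>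
         \<sigma> \<cdot>\<^bsub>C\<^esub> pair C P (\<zeta> \<cdot>\<^bsub>C\<^esub> bang C P A) (Id C A) = Id C A \<and>
         \<sigma> \<cdot>\<^bsub>C\<^esub> pair C P b a = \<sigma> \<and>
         \<sigma> \<cdot>\<^bsub>C\<^esub> pair C P (\<sigma> \<cdot>\<^bsub>C\<^esub> Fst P AA A) (Snd P AA A) =
           \<sigma> \<cdot>\<^bsub>C\<^esub> pair C P (a \<cdot>\<^bsub>C\<^esub> Fst P AA A) (\<sigma> \<cdot>\<^bsub>C\<^esub> pair C P (b \<cdot>\<^bsub>C\<^esub> Fst P AA A) (Snd P AA A)) \<and>
         ph \<cdot>\<^bsub>C\<^esub> TA C \<zeta> = \<zeta> \<cdot>\<^bsub>C\<^esub> bang C P (TO C (One P)) \<and>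
         ph \<cdot>\<^bsub>C\<^esub> TA C \<sigma> = \<sigma> \<cdot>\<^bsub>C\<^esub> pair C P (ph \<cdot>\<^bsub>C\<^esub> TA C a) (ph \<cdot>\<^bsub>C\<^esub> TA C b) \<and>
         ph \<cdot>\<^bsub>C\<^esub> zT C A = \<zeta> \<cdot>\<^bsub>C\<^esub> bang C P A \<and>
         ph \<cdot>\<^bsub>C\<^esub> sT C A = \<sigma> \<cdot>\<^bsub>C\<^esub> pair C P (ph \<cdot>\<^bsub>C\<^esub> pr C 2 0 A) (ph \<cdot>\<^bsub>C\<^esub> pr C 2 1 A) \<and>
         ph \<cdot>\<^bsub>C\<^esub> TA C ph \<cdot>\<^bsub>C\<^esub> lT C A = ph \<and>
         is_product C A A (TO C A) (pT C A) ph)"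

text \<open>Arrows between structured objects carry their source and target.\<close>

record ('x, 'm) tagged =
  Src :: "'x"
  Tgt :: "'x"
  Und :: "'m"

abbreviation tag :: "'x \<Rightarrow> 'x \<Rightarrow> 'm \<Rightarrow> ('x, 'm) tagged" where
  "tag D E f \<equiv> \<lparr>Src = D, Tgt = E, Und = f\<rparr>"

definition linear_map ::
  "('o, 'm, 'x) tcat_scheme \<Rightarrow> ('o, 'm) products \<Rightarrow> (('o, 'm) dobj, 'm) tagged \<Rightarrow> bool" where
  "linear_map C P t \<longleftrightarrow>
     differential_object C P (Src t) \<and> differential_object C P (Tgt t) \<and>
     Und t \<in> Homs C (do_carrier (Src t)) (do_carrier (Tgt t)) \<and>
     Und t \<cdot>\<^bsub>C\<^esub> do_hat (Src t) = do_hat (Tgt t) \<cdot>\<^bsub>C\<^esub> TA C (Und t)"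

text \<open>In the zero of the tangent bundle, \<open>zT C (One P)\<close> is the unique arrow \<open>* \<rightarrow> T *\<close>.\<close>

definition do_T ::
  "('o, 'm, 'x) tcat_scheme \<Rightarrow> ('o, 'm) products \<Rightarrow> ('o, 'm) dobj \<Rightarrow> ('o, 'm) dobj" where
  "do_T C P D = (let A = do_carrier D; TX = TO C A in
     \<lparr>do_carrier = TX,
      do_zero = TA C (do_zero D) \<cdot>\<^bsub>C\<^esub> zT C (One P),
      do_sum = TA C (do_sum D) \<cdot>\<^bsub>C\<^esub> TPpair C P (Prod P TX TX) A A (Fst P TX TX) (Snd P TX TX),
      do_hat = TA C (do_hat D) \<cdot>\<^bsub>C\<^esub> cT C A\<rparr>)"

definition do_Tn ::
  "('o, 'm, 'x) tcat_scheme \<Rightarrow> ('o, 'm) products \<Rightarrow> nat \<Rightarrow> ('o, 'm) dobj \<Rightarrow> ('o, 'm) dobj" where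
  "do_Tn C P n D = (let A = do_carrier D; X = Tn C n A; q = (\<lambda>i. pr C n i A); E = do_T C P D in
     \<lparr>do_carrier = X,
      do_zero = ntuple C n (One P) X q (\<lambda>i. do_zero E),
      do_sum = ntuple C n (Prod P X X) X q (\<lambda>i. do_sum E \<cdot>\<^bsub>C\<^esub> prodmap C P (q i) (q i)),
      do_hat = ntuple C n (TO C X) X q (\<lambda>i. do_hat E \<cdot>\<^bsub>C\<^esub> TA C (q i))\<rparr>)"

definition DO_cat ::
  "('o, 'm, 'x) tcat_scheme \<Rightarrow> ('o, 'm) products \<Rightarrow>
   (('o, 'm) dobj, (('o, 'm) dobj, 'm) tagged) tcat" where
  "DO_cat C P =
     \<lparr>Obj = {D. differential_object C P D},
      Arr = {t. linear_map C P t},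
      Dom = Src,
      Cod = Tgt,
      Id = (\<lambda>D. tag D D (Id C (do_carrier D))),
      Comp = (\<lambda>g f. tag (Src f) (Tgt g) (Und g \<cdot>\<^bsub>C\<^esub> Und f)),
      Tan = \<lparr>FO = do_T C P,
             FA = (\<lambda>t. tag (do_T C P (Src t)) (do_T C P (Tgt t)) (TA C (Und t)))\<rparr>,
      pT = (\<lambda>D. tag (do_T C P D) D (pT C (do_carrier D))),
      zT = (\<lambda>D. tag D (do_T C P D) (zT C (do_carrier D))),
      sT = (\<lambda>D. tag (do_Tn C P 2 D) (do_T C P D) (sT C (do_carrier D))),
      lT = (\<lambda>D. tag (do_T C P D) (do_T C P (do_T C P D)) (lT C (do_carrier D))),
      cT = (\<lambda>D. tag (do_T C P (do_T C P D)) (do_T C P (do_T C P D)) (cT C (do_carrier D))),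
      Tn = do_Tn C P,
      pr = (\<lambda>n i D. tag (do_Tn C P n D) (do_T C P D) (pr C n i (do_carrier D)))\<rparr>"

definition do_One :: "('o, 'm, 'x) tcat_scheme \<Rightarrow> ('o, 'm) products \<Rightarrow> ('o, 'm) dobj" where
  "do_One C P =
     \<lparr>do_carrier = One P,
      do_zero = Id C (One P),
      do_sum = bang C P (Prod P (One P) (One P)),
      do_hat = bang C P (TO C (One P))\<rparr>"

definition do_Prod ::
  "('o, 'm, 'x) tcat_scheme \<Rightarrow> ('o, 'm) products \<Rightarrow>
   ('o, 'm) dobj \<Rightarrow> ('o, 'm) dobj \<Rightarrow> ('o, 'm) dobj" where
  "do_Prod C P D E = (let a = Fst P (do_carrier D) (do_carrier E);
                          b = Snd P (do_carrier D) (do_carrier E) in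
     \<lparr>do_carrier = Prod P (do_carrier D) (do_carrier E),
      do_zero = pair C P (do_zero D) (do_zero E),
      do_sum = pair C P (do_sum D \<cdot>\<^bsub>C\<^esub> prodmap C P a a) (do_sum E \<cdot>\<^bsub>C\<^esub> prodmap C P b b),
      do_hat = pair C P (do_hat D \<cdot>\<^bsub>C\<^esub> TA C a) (do_hat E \<cdot>\<^bsub>C\<^esub> TA C b)\<rparr>)"

definition DO_prod ::
  "('o, 'm, 'x) tcat_scheme \<Rightarrow> ('o, 'm) products \<Rightarrow>
   (('o, 'm) dobj, (('o, 'm) dobj, 'm) tagged) products" where
  "DO_prod C P =
     \<lparr>One = do_One C P,
      Prod = do_Prod C P,
      Fst = (\<lambda>D E. tag (do_Prod C P D E) D (Fst P (do_carrier D) (do_carrier E))),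
      Snd = (\<lambda>D E. tag (do_Prod C P D E) E (Snd P (do_carrier D) (do_carrier E)))\<rparr>"


section \<open>Tangent fibrations\<close>

record ('e, 'em, 'b, 'bm) tfib =
  Total :: "('e, 'em) tcat"
  Base :: "('b, 'bm) tcat"
  Proj :: "('e, 'em, 'b, 'bm) ftr"
  Lift :: "'bm \<Rightarrow> 'e \<Rightarrow> 'em"

record ('e, 'em, 'b, 'bm) ctfib = "('e, 'em, 'b, 'bm) tfib" +
  TProd :: "('e, 'em) products"
  BProd :: "('b, 'bm) products"

definition cartesian_arrow :: "('e, 'em, 'b, 'bm, 'x) tfib_scheme \<Rightarrow> 'em \<Rightarrow> bool" where
  "cartesian_arrow \<E> \<phi> \<longleftrightarrow> \<phi> \<in> Arr (Total \<E>) \<and>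
     (\<forall>h\<in>Arr (Total \<E>). \<forall>k\<in>Homs (Base \<E>) (FO (Proj \<E>) (Dom (Total \<E>) h))
                                              (FO (Proj \<E>) (Dom (Total \<E>) \<phi>)).
        Cod (Total \<E>) h = Cod (Total \<E>) \<phi> \<longrightarrow>
        FA (Proj \<E>) h = FA (Proj \<E>) \<phi> \<cdot>\<^bsub>Base \<E>\<^esub> k \<longrightarrow>
        (\<exists>!u. u \<in> Homs (Total \<E>) (Dom (Total \<E>) h) (Dom (Total \<E>) \<phi>) \<and>
              FA (Proj \<E>) u = k \<and> \<phi> \<cdot>\<^bsub>Total \<E>\<^esub> u = h))"

definition cart_fill :: "('e, 'em, 'b, 'bm, 'x) tfib_scheme \<Rightarrow> 'em \<Rightarrow> 'em \<Rightarrow> 'bm \<Rightarrow> 'em" where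
  "cart_fill \<E> \<phi> h k = (THE u. u \<in> Homs (Total \<E>) (Dom (Total \<E>) h) (Dom (Total \<E>) \<phi>) \<and>
     FA (Proj \<E>) u = k \<and> \<phi> \<cdot>\<^bsub>Total \<E>\<^esub> u = h)"

definition cloven_fibration :: "('e, 'em, 'b, 'bm, 'x) tfib_scheme \<Rightarrow> bool" where
  "cloven_fibration \<E> \<longleftrightarrow>
     category (Total \<E>) \<and> category (Base \<E>) \<and> is_functor (Total \<E>) (Base \<E>) (Proj \<E>) \<and>
     (\<forall>f\<in>Arr (Base \<E>). \<forall>E\<in>Obj (Total \<E>). FO (Proj \<E>) E = Cod (Base \<E>) f \<longrightarrow>
        cartesian_arrow \<E> (Lift \<E> f E) \<and> Cod (Total \<E>) (Lift \<E> f E) = E \<and>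
        FA (Proj \<E>) (Lift \<E> f E) = f)"

text \<open>A tangentad in fibrations has n-fold pullbacks which are 1-morphisms of fibrations. So
  strict preservation of the tangent structures includes that of the chosen n-fold pullbacks,
  which does not follow from being a strict morphism of tangent categories.\<close>

definition tangent_fibration :: "('e, 'em, 'b, 'bm, 'x) tfib_scheme \<Rightarrow> bool" where
  "tangent_fibration \<E> \<longleftrightarrow> cloven_fibration \<E> \<and>
     strict_tangent_morphism (Total \<E>) (Base \<E>) (Proj \<E>) \<and>
     (\<forall>n\<ge>1. \<forall>E\<in>Obj (Total \<E>).
        FO (Proj \<E>) (Tn (Total \<E>) n E) = Tn (Base \<E>) n (FO (Proj \<E>) E) \<and>
        (\<forall>i<n. FA (Proj \<E>) (pr (Total \<E>) n i E) = pr (Base \<E>) n i (FO (Proj \<E>) E))) \<and>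
     (\<forall>\<phi>. cartesian_arrow \<E> \<phi> \<longrightarrow> cartesian_arrow \<E> (TA (Total \<E>) \<phi>))"

text \<open>Cartesian tangent fibrations come in two kinds: products of the chosen lifts are either
  required to be some Cartesian lift, or to be the chosen one.\<close>

datatype fib_kind = Plain | Cloven

definition cartesian_tangent_fibration ::
  "fib_kind \<Rightarrow> ('e, 'em, 'b, 'bm, 'x) ctfib_scheme \<Rightarrow> bool" where
  "cartesian_tangent_fibration k \<E> \<longleftrightarrow> tangent_fibration \<E> \<and>
     cartesian_tangent_category (Total \<E>) (TProd \<E>) \<and>
     cartesian_tangent_category (Base \<E>) (BProd \<E>) \<and>
     FO (Proj \<E>) (One (TProd \<E>)) = One (BProd \<E>) \<and>
     (\<forall>E\<in>Obj (Total \<E>). \<forall>F\<in>Obj (Total \<E>).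
        FO (Proj \<E>) (Prod (TProd \<E>) E F) = Prod (BProd \<E>) (FO (Proj \<E>) E) (FO (Proj \<E>) F) \<and>
        FA (Proj \<E>) (Fst (TProd \<E>) E F) = Fst (BProd \<E>) (FO (Proj \<E>) E) (FO (Proj \<E>) F) \<and>
        FA (Proj \<E>) (Snd (TProd \<E>) E F) = Snd (BProd \<E>) (FO (Proj \<E>) E) (FO (Proj \<E>) F)) \<and>
     (\<forall>f\<in>Arr (Base \<E>). \<forall>g\<in>Arr (Base \<E>). \<forall>E\<in>Obj (Total \<E>). \<forall>F\<in>Obj (Total \<E>).
        FO (Proj \<E>) E = Cod (Base \<E>) f \<longrightarrow> FO (Proj \<E>) F = Cod (Base \<E>) g \<longrightarrow>
        (case k of
           Plain \<Rightarrow> cartesian_arrow \<E> (prodmap (Total \<E>) (TProd \<E>) (Lift \<E> f E) (Lift \<E> g F))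
         | Cloven \<Rightarrow> prodmap (Total \<E>) (TProd \<E>) (Lift \<E> f E) (Lift \<E> g F) =
             Lift \<E> (prodmap (Base \<E>) (BProd \<E>) f g) (Prod (TProd \<E>) E F)))"


section \<open>The hom-categories of tangent fibrations\<close>

record ('e1, 'em1, 'b1, 'bm1, 'e2, 'em2, 'b2, 'bm2) fmor =
  mB :: "('b1, 'bm1, 'b2, 'bm2) lax"
  mT :: "('e1, 'em1, 'e2, 'em2) lax"

abbreviation bO :: "('e1, 'em1, 'b1, 'bm1, 'e2, 'em2, 'b2, 'bm2) fmor \<Rightarrow> 'b1 \<Rightarrow> 'b2" where
  "bO M A \<equiv> FO (Fun (mB M)) A"

abbreviation tO :: "('e1, 'em1, 'b1, 'bm1, 'e2, 'em2, 'b2, 'bm2) fmor \<Rightarrow> 'e1 \<Rightarrow> 'e2" where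
  "tO M E \<equiv> FO (Fun (mT M)) E"

definition fib_morphism ::
  "('e1, 'em1, 'b1, 'bm1, 'x) tfib_scheme \<Rightarrow> ('e2, 'em2, 'b2, 'bm2, 'y) tfib_scheme \<Rightarrow>
   ('e1, 'em1, 'b1, 'bm1, 'e2, 'em2, 'b2, 'bm2) fmor \<Rightarrow> bool" where
  "fib_morphism \<E>1 \<E>2 M \<longleftrightarrow>
     lax_ok (Base \<E>1) (Base \<E>2) (mB M) \<and> lax_ok (Total \<E>1) (Total \<E>2) (mT M) \<and>
     (\<forall>E\<in>Obj (Total \<E>1). FO (Proj \<E>2) (tO M E) = bO M (FO (Proj \<E>1) E)) \<and>
     (\<forall>f\<in>Arr (Total \<E>1).
        FA (Proj \<E>2) (FA (Fun (mT M)) f) = FA (Fun (mB M)) (FA (Proj \<E>1) f)) \<and>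
     (\<forall>\<phi>. cartesian_arrow \<E>1 \<phi> \<longrightarrow> cartesian_arrow \<E>2 (FA (Fun (mT M)) \<phi>)) \<and>
     (\<forall>E\<in>Obj (Total \<E>1). FA (Proj \<E>2) (Str (mT M) E) = Str (mB M) (FO (Proj \<E>1) E))"

definition strict_fib_morphism ::
  "('e1, 'em1, 'b1, 'bm1, 'x) tfib_scheme \<Rightarrow> ('e2, 'em2, 'b2, 'bm2, 'y) tfib_scheme \<Rightarrow>
   ('e1, 'em1, 'b1, 'bm1, 'e2, 'em2, 'b2, 'bm2) fmor \<Rightarrow> bool" where
  "strict_fib_morphism \<E>1 \<E>2 M \<longleftrightarrow> fib_morphism \<E>1 \<E>2 M \<and>
     (\<forall>A\<in>Obj (Base \<E>1). Str (mB M) A = Id (Base \<E>2) (bO M (TO (Base \<E>1) A))) \<and>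
     (\<forall>E\<in>Obj (Total \<E>1). Str (mT M) E = Id (Total \<E>2) (tO M (TO (Total \<E>1) E)))"

type_synonym ('e1, 'em1, 'b1, 'bm1, 'e2, 'em2, 'b2, 'bm2) fcell =
  "(('e1, 'em1, 'b1, 'bm1, 'e2, 'em2, 'b2, 'bm2) fmor, ('b1 \<Rightarrow> 'bm2) \<times> ('e1 \<Rightarrow> 'em2)) tagged"

definition fib_cell ::
  "('e1, 'em1, 'b1, 'bm1, 'x) tfib_scheme \<Rightarrow> ('e2, 'em2, 'b2, 'bm2, 'y) tfib_scheme \<Rightarrow>
   ('e1, 'em1, 'b1, 'bm1, 'e2, 'em2, 'b2, 'bm2) fcell \<Rightarrow> bool" where
  "fib_cell \<E>1 \<E>2 t \<longleftrightarrow>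
     fib_morphism \<E>1 \<E>2 (Src t) \<and> fib_morphism \<E>1 \<E>2 (Tgt t) \<and>
     tangent_nat (Base \<E>1) (Base \<E>2) (mB (Src t)) (mB (Tgt t)) (fst (Und t)) \<and>
     tangent_nat (Total \<E>1) (Total \<E>2) (mT (Src t)) (mT (Tgt t)) (snd (Und t)) \<and>
     fst (Und t) \<in> extensional (Obj (Base \<E>1)) \<and>
     snd (Und t) \<in> extensional (Obj (Total \<E>1)) \<and>
     (\<forall>E\<in>Obj (Total \<E>1). FA (Proj \<E>2) (snd (Und t) E) = fst (Und t) (FO (Proj \<E>1) E))"

definition mk_cell ::
  "('e1, 'em1, 'b1, 'bm1, 'x) tfib_scheme \<Rightarrow>
   ('e1, 'em1, 'b1, 'bm1, 'e2, 'em2, 'b2, 'bm2) fmor \<Rightarrow>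
   ('e1, 'em1, 'b1, 'bm1, 'e2, 'em2, 'b2, 'bm2) fmor \<Rightarrow>
   ('b1 \<Rightarrow> 'bm2) \<Rightarrow> ('e1 \<Rightarrow> 'em2) \<Rightarrow>
   ('e1, 'em1, 'b1, 'bm1, 'e2, 'em2, 'b2, 'bm2) fcell" where
  "mk_cell \<E>1 M N \<phi> \<phi>' =
     tag M N (restrict \<phi> (Obj (Base \<E>1)), restrict \<phi>' (Obj (Total \<E>1)))"

definition fmor_T ::
  "('e1, 'em1, 'b1, 'bm1, 'x) tfib_scheme \<Rightarrow> ('e2, 'em2, 'b2, 'bm2, 'y) tfib_scheme \<Rightarrow>
   ('e1, 'em1, 'b1, 'bm1, 'e2, 'em2, 'b2, 'bm2) fmor \<Rightarrow>
   ('e1, 'em1, 'b1, 'bm1, 'e2, 'em2, 'b2, 'bm2) fmor" where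
  "fmor_T \<E>1 \<E>2 M = \<lparr>mB = lax_T (Base \<E>1) (Base \<E>2) (mB M),
                       mT = lax_T (Total \<E>1) (Total \<E>2) (mT M)\<rparr>"

definition fmor_Tn ::
  "('e1, 'em1, 'b1, 'bm1, 'x) tfib_scheme \<Rightarrow> ('e2, 'em2, 'b2, 'bm2, 'y) tfib_scheme \<Rightarrow> nat \<Rightarrow>
   ('e1, 'em1, 'b1, 'bm1, 'e2, 'em2, 'b2, 'bm2) fmor \<Rightarrow>
   ('e1, 'em1, 'b1, 'bm1, 'e2, 'em2, 'b2, 'bm2) fmor" where
  "fmor_Tn \<E>1 \<E>2 n M = \<lparr>mB = lax_Tn (Base \<E>1) (Base \<E>2) n (mB M),
                          mT = lax_Tn (Total \<E>1) (Total \<E>2) n (mT M)\<rparr>"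

definition fmor_comp ::
  "('e1, 'em1, 'b1, 'bm1, 'x) tfib_scheme \<Rightarrow> ('e3, 'em3, 'b3, 'bm3, 'y) tfib_scheme \<Rightarrow>
   ('e2, 'em2, 'b2, 'bm2, 'e3, 'em3, 'b3, 'bm3) fmor \<Rightarrow>
   ('e1, 'em1, 'b1, 'bm1, 'e2, 'em2, 'b2, 'bm2) fmor \<Rightarrow>
   ('e1, 'em1, 'b1, 'bm1, 'e3, 'em3, 'b3, 'bm3) fmor" where
  "fmor_comp \<E>1 \<E>3 N M = \<lparr>mB = lax_comp (Base \<E>1) (Base \<E>3) (mB N) (mB M),
                            mT = lax_comp (Total \<E>1) (Total \<E>3) (mT N) (mT M)\<rparr>"

definition fib_hom ::
  "('e1, 'em1, 'b1, 'bm1, 'x) tfib_scheme \<Rightarrow> ('e2, 'em2, 'b2, 'bm2, 'y) tfib_scheme \<Rightarrow>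
   (('e1, 'em1, 'b1, 'bm1, 'e2, 'em2, 'b2, 'bm2) fmor,
    ('e1, 'em1, 'b1, 'bm1, 'e2, 'em2, 'b2, 'bm2) fcell) tcat" where
  "fib_hom \<E>1 \<E>2 = (let B = Base \<E>2; X = Total \<E>2; T = fmor_T \<E>1 \<E>2 in
     \<lparr>Obj = {M. fib_morphism \<E>1 \<E>2 M},
      Arr = {t. fib_cell \<E>1 \<E>2 t},
      Dom = Src,
      Cod = Tgt,
      Id = (\<lambda>M. mk_cell \<E>1 M M (\<lambda>A. Id B (bO M A)) (\<lambda>E. Id X (tO M E))),
      Comp = (\<lambda>t u. mk_cell \<E>1 (Src u) (Tgt t)
                (\<lambda>A. fst (Und t) A \<cdot>\<^bsub>B\<^esub> fst (Und u) A) (\<lambda>E. snd (Und t) E \<cdot>\<^bsub>X\<^esub> snd (Und u) E)),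
      Tan = \<lparr>FO = T,
             FA = (\<lambda>t. mk_cell \<E>1 (T (Src t)) (T (Tgt t))
                     (\<lambda>A. TA B (fst (Und t) A)) (\<lambda>E. TA X (snd (Und t) E)))\<rparr>,
      pT = (\<lambda>M. mk_cell \<E>1 (T M) M (\<lambda>A. pT B (bO M A)) (\<lambda>E. pT X (tO M E))),
      zT = (\<lambda>M. mk_cell \<E>1 M (T M) (\<lambda>A. zT B (bO M A)) (\<lambda>E. zT X (tO M E))),
      sT = (\<lambda>M. mk_cell \<E>1 (fmor_Tn \<E>1 \<E>2 2 M) (T M) (\<lambda>A. sT B (bO M A)) (\<lambda>E. sT X (tO M E))),
      lT = (\<lambda>M. mk_cell \<E>1 (T M) (T (T M)) (\<lambda>A. lT B (bO M A)) (\<lambda>E. lT X (tO M E))),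
      cT = (\<lambda>M. mk_cell \<E>1 (T (T M)) (T (T M)) (\<lambda>A. cT B (bO M A)) (\<lambda>E. cT X (tO M E))),
      Tn = fmor_Tn \<E>1 \<E>2,
      pr = (\<lambda>n i M. mk_cell \<E>1 (fmor_Tn \<E>1 \<E>2 n M) (T M)
              (\<lambda>A. pr B n i (bO M A)) (\<lambda>E. pr X n i (tO M E)))\<rparr>)"

definition lax_One ::
  "('o1, 'm1, 'x) tcat_scheme \<Rightarrow> ('o2, 'm2, 'y) tcat_scheme \<Rightarrow> ('o2, 'm2) products \<Rightarrow>
   ('o1, 'm1, 'o2, 'm2) lax" where
  "lax_One C D P =
     \<lparr>Fun = ftr_restrict C \<lparr>FO = (\<lambda>A. One P), FA = (\<lambda>f. Id D (One P))\<rparr>,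
      Str = (\<lambda>A\<in>Obj C. zT D (One P))\<rparr>"

definition lax_Prod ::
  "('o1, 'm1, 'x) tcat_scheme \<Rightarrow> ('o2, 'm2, 'y) tcat_scheme \<Rightarrow> ('o2, 'm2) products \<Rightarrow>
   ('o1, 'm1, 'o2, 'm2) lax \<Rightarrow> ('o1, 'm1, 'o2, 'm2) lax \<Rightarrow> ('o1, 'm1, 'o2, 'm2) lax" where
  "lax_Prod C D P M N =
     \<lparr>Fun = ftr_restrict C
        \<lparr>FO = (\<lambda>A. Prod P (FO (Fun M) A) (FO (Fun N) A)),
         FA = (\<lambda>f. prodmap D P (FA (Fun M) f) (FA (Fun N) f))\<rparr>,
      Str = (\<lambda>A\<in>Obj C. let X = FO (Fun M) (TO C A); Y = FO (Fun N) (TO C A) in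
        TPpair D P (Prod P X Y) (FO (Fun M) A) (FO (Fun N) A)
          (Str M A \<cdot>\<^bsub>D\<^esub> Fst P X Y) (Str N A \<cdot>\<^bsub>D\<^esub> Snd P X Y))\<rparr>"

definition fmor_Prod ::
  "('e1, 'em1, 'b1, 'bm1, 'x) tfib_scheme \<Rightarrow> ('e2, 'em2, 'b2, 'bm2, 'y) ctfib_scheme \<Rightarrow>
   ('e1, 'em1, 'b1, 'bm1, 'e2, 'em2, 'b2, 'bm2) fmor \<Rightarrow>
   ('e1, 'em1, 'b1, 'bm1, 'e2, 'em2, 'b2, 'bm2) fmor \<Rightarrow>
   ('e1, 'em1, 'b1, 'bm1, 'e2, 'em2, 'b2, 'bm2) fmor" where
  "fmor_Prod \<E>1 \<E>2 M N =
     \<lparr>mB = lax_Prod (Base \<E>1) (Base \<E>2) (BProd \<E>2) (mB M) (mB N),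
      mT = lax_Prod (Total \<E>1) (Total \<E>2) (TProd \<E>2) (mT M) (mT N)\<rparr>"

definition fib_hom_prod ::
  "('e1, 'em1, 'b1, 'bm1, 'x) tfib_scheme \<Rightarrow> ('e2, 'em2, 'b2, 'bm2, 'y) ctfib_scheme \<Rightarrow>
   (('e1, 'em1, 'b1, 'bm1, 'e2, 'em2, 'b2, 'bm2) fmor,
    ('e1, 'em1, 'b1, 'bm1, 'e2, 'em2, 'b2, 'bm2) fcell) products" where
  "fib_hom_prod \<E>1 \<E>2 =
     \<lparr>One = \<lparr>mB = lax_One (Base \<E>1) (Base \<E>2) (BProd \<E>2),
             mT = lax_One (Total \<E>1) (Total \<E>2) (TProd \<E>2)\<rparr>,
      Prod = fmor_Prod \<E>1 \<E>2,
      Fst = (\<lambda>M N. mk_cell \<E>1 (fmor_Prod \<E>1 \<E>2 M N) M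
               (\<lambda>A. Fst (BProd \<E>2) (bO M A) (bO N A)) (\<lambda>E. Fst (TProd \<E>2) (tO M E) (tO N E))),
      Snd = (\<lambda>M N. mk_cell \<E>1 (fmor_Prod \<E>1 \<E>2 M N) N
               (\<lambda>A. Snd (BProd \<E>2) (bO M A) (bO N A)) (\<lambda>E. Snd (TProd \<E>2) (tO M E) (tO N E)))\<rparr>"


section \<open>The construction of differential objects\<close>

type_synonym ('e1, 'em1, 'b1, 'bm1, 'e2, 'em2, 'b2, 'bm2) fdobj =
  "(('e1, 'em1, 'b1, 'bm1, 'e2, 'em2, 'b2, 'bm2) fmor,
    ('e1, 'em1, 'b1, 'bm1, 'e2, 'em2, 'b2, 'bm2) fcell) dobj"

definition pointwise ::
  "('e1, 'em1, 'b1, 'bm1, 'x) tfib_scheme \<Rightarrow> ('e2, 'em2, 'b2, 'bm2, 'y) ctfib_scheme \<Rightarrow>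
   ('e1, 'em1, 'b1, 'bm1, 'e2, 'em2, 'b2, 'bm2) fdobj \<Rightarrow> bool" where
  "pointwise \<E>1 \<E>2 D \<longleftrightarrow> (let M = do_carrier D in
     (\<forall>A\<in>Obj (Base \<E>1). is_product (Base \<E>2) (bO M A) (bO M A) (TO (Base \<E>2) (bO M A))
        (pT (Base \<E>2) (bO M A)) (fst (Und (do_hat D)) A)) \<and>
     (\<forall>E\<in>Obj (Total \<E>1). is_product (Total \<E>2) (tO M E) (tO M E) (TO (Total \<E>2) (tO M E))
        (pT (Total \<E>2) (tO M E)) (snd (Und (do_hat D)) E)))"

text \<open>The tangent category of pointwise differential objects and linear morphisms of
  \<open>[\<E>1 | \<E>2]\<close>.\<close>

definition pointwise_DO ::
  "('e1, 'em1, 'b1, 'bm1, 'x) tfib_scheme \<Rightarrow> ('e2, 'em2, 'b2, 'bm2, 'y) ctfib_scheme \<Rightarrow>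
   (('e1, 'em1, 'b1, 'bm1, 'e2, 'em2, 'b2, 'bm2) fdobj,
    (('e1, 'em1, 'b1, 'bm1, 'e2, 'em2, 'b2, 'bm2) fdobj,
     ('e1, 'em1, 'b1, 'bm1, 'e2, 'em2, 'b2, 'bm2) fcell) tagged) tcat" where
  "pointwise_DO \<E>1 \<E>2 =
     full_sub (DO_cat (fib_hom \<E>1 \<E>2) (fib_hom_prod \<E>1 \<E>2)) {D. pointwise \<E>1 \<E>2 D}"

definition whisker_source ::
  "('e1, 'em1, 'b1, 'bm1, 'x) tfib_scheme \<Rightarrow> ('e3, 'em3, 'b3, 'bm3, 'y) tfib_scheme \<Rightarrow>
   ('e2, 'em2, 'b2, 'bm2, 'e3, 'em3, 'b3, 'bm3) fcell \<Rightarrow>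
   ('e1, 'em1, 'b1, 'bm1, 'e2, 'em2, 'b2, 'bm2) fmor \<Rightarrow>
   ('e1, 'em1, 'b1, 'bm1, 'e3, 'em3, 'b3, 'bm3) fcell" where
  "whisker_source \<E>1 \<E>3 t H =
     mk_cell \<E>1 (fmor_comp \<E>1 \<E>3 (Src t) H) (fmor_comp \<E>1 \<E>3 (Tgt t) H)
       (\<lambda>A. fst (Und t) (bO H A)) (\<lambda>E. snd (Und t) (tO H E))"

definition whisker_target ::
  "('e1, 'em1, 'b1, 'bm1, 'x) tfib_scheme \<Rightarrow> ('e3, 'em3, 'b3, 'bm3, 'y) tfib_scheme \<Rightarrow>
   ('e2, 'em2, 'b2, 'bm2, 'e3, 'em3, 'b3, 'bm3) fmor \<Rightarrow>
   ('e1, 'em1, 'b1, 'bm1, 'e2, 'em2, 'b2, 'bm2) fcell \<Rightarrow>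
   ('e1, 'em1, 'b1, 'bm1, 'e3, 'em3, 'b3, 'bm3) fcell" where
  "whisker_target \<E>1 \<E>3 N t =
     mk_cell \<E>1 (fmor_comp \<E>1 \<E>3 N (Src t)) (fmor_comp \<E>1 \<E>3 N (Tgt t))
       (\<lambda>A. FA (Fun (mB N)) (fst (Und t) A)) (\<lambda>E. FA (Fun (mT N)) (snd (Und t) E))"

definition pullback_dobj ::
  "('e1, 'em1, 'b1, 'bm1, 'x) tfib_scheme \<Rightarrow> ('e3, 'em3, 'b3, 'bm3, 'y) tfib_scheme \<Rightarrow>
   ('e2, 'em2, 'b2, 'bm2, 'e3, 'em3, 'b3, 'bm3) fdobj \<Rightarrow>
   ('e1, 'em1, 'b1, 'bm1, 'e2, 'em2, 'b2, 'bm2) fmor \<Rightarrow>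
   ('e1, 'em1, 'b1, 'bm1, 'e3, 'em3, 'b3, 'bm3) fdobj" where
  "pullback_dobj \<E>1 \<E>3 U H =
     \<lparr>do_carrier = fmor_comp \<E>1 \<E>3 (do_carrier U) H,
      do_zero = whisker_source \<E>1 \<E>3 (do_zero U) H,
      do_sum = whisker_source \<E>1 \<E>3 (do_sum U) H,
      do_hat = whisker_source \<E>1 \<E>3 (do_hat U) H\<rparr>"

definition DO_comparison ::
  "('e1, 'em1, 'b1, 'bm1, 'x) tfib_scheme \<Rightarrow> ('e3, 'em3, 'b3, 'bm3, 'y) tfib_scheme \<Rightarrow>
   ('e2, 'em2, 'b2, 'bm2, 'e3, 'em3, 'b3, 'bm3) fdobj \<Rightarrow>
   (('e1, 'em1, 'b1, 'bm1, 'e2, 'em2, 'b2, 'bm2) fmor,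
    ('e1, 'em1, 'b1, 'bm1, 'e2, 'em2, 'b2, 'bm2) fcell,
    ('e1, 'em1, 'b1, 'bm1, 'e3, 'em3, 'b3, 'bm3) fdobj,
    (('e1, 'em1, 'b1, 'bm1, 'e3, 'em3, 'b3, 'bm3) fdobj,
     ('e1, 'em1, 'b1, 'bm1, 'e3, 'em3, 'b3, 'bm3) fcell) tagged) ftr" where
  "DO_comparison \<E>1 \<E>3 U =
     \<lparr>FO = pullback_dobj \<E>1 \<E>3 U,
      FA = (\<lambda>t. tag (pullback_dobj \<E>1 \<E>3 U (Src t)) (pullback_dobj \<E>1 \<E>3 U (Tgt t))
              (whisker_target \<E>1 \<E>3 (do_carrier U) t))\<rparr>"

text \<open>\<open>\<Delta>\<close> with the differential object \<open>U\<close> of \<open>[\<Delta> | \<E>]\<close> is the tangentad of differential objects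
  of \<open>\<E>\<close>. A quantifier inside a formula ranges over fixed types only; the types of the test
  fibrations \<open>\<E>0\<close> are therefore a parameter, to be instantiated by type variables.\<close>

definition tangentad_of_differential_objects ::
  "fib_kind \<Rightarrow> ('e, 'em, 'b, 'bm) ctfib \<Rightarrow> ('e1, 'em1, 'b1, 'bm1) ctfib \<Rightarrow>
   ('e1, 'em1, 'b1, 'bm1, 'e, 'em, 'b, 'bm) fdobj \<Rightarrow>
   ('e0, 'em0, 'b0, 'bm0) tfib itself \<Rightarrow> bool" where
  "tangentad_of_differential_objects k \<E> \<Delta> U t0 \<longleftrightarrow>
     cartesian_tangent_fibration k \<Delta> \<and>
     strict_fib_morphism \<Delta> \<E> (do_carrier U) \<and>
     differential_object (fib_hom \<Delta> \<E>) (fib_hom_prod \<Delta> \<E>) U \<and> pointwise \<Delta> \<E> U \<and>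
     (\<forall>\<E>0 :: ('e0, 'em0, 'b0, 'bm0) tfib. tangent_fibration \<E>0 \<longrightarrow>
        tangent_iso (fib_hom \<E>0 \<Delta>) (pointwise_DO \<E>0 \<E>) (DO_comparison \<E>0 \<E> U))"

definition admits_differential_objects ::
  "fib_kind \<Rightarrow> ('e, 'em, 'b, 'bm) ctfib \<Rightarrow> ('e1, 'em1, 'b1, 'bm1) ctfib itself \<Rightarrow>
   ('e0, 'em0, 'b0, 'bm0) tfib itself \<Rightarrow> bool" where
  "admits_differential_objects k \<E> t1 t0 \<longleftrightarrow>
     (\<exists>(\<Delta> :: ('e1, 'em1, 'b1, 'bm1) ctfib) U.
        tangentad_of_differential_objects k \<E> \<Delta> U t0)"


section \<open>The fibration of differential objects\<close>

definition do_map :: "('e, 'em, 'b, 'bm) ftr \<Rightarrow> ('e, 'em) dobj \<Rightarrow> ('b, 'bm) dobj" where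
  "do_map F D = \<lparr>do_carrier = FO F (do_carrier D), do_zero = FA F (do_zero D),
                 do_sum = FA F (do_sum D), do_hat = FA F (do_hat D)\<rparr>"

text \<open>The source of the lift of a linear map: the differential structure on \<open>f\<^sup>*E\<close> is induced by
  the Cartesian property of the chosen lift.\<close>

definition do_reindex ::
  "('e, 'em, 'b, 'bm) ctfib \<Rightarrow> (('b, 'bm) dobj, 'bm) tagged \<Rightarrow> ('e, 'em) dobj \<Rightarrow> ('e, 'em) dobj" where
  "do_reindex \<E> f E = (let X = Total \<E>; \<phi> = Lift \<E> (Und f) (do_carrier E) in
     \<lparr>do_carrier = Dom X \<phi>,
      do_zero = cart_fill \<E> \<phi> (do_zero E) (do_zero (Src f)),
      do_sum = cart_fill \<E> \<phi> (do_sum E \<cdot>\<^bsub>X\<^esub> prodmap X (TProd \<E>) \<phi> \<phi>) (do_sum (Src f)),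
      do_hat = cart_fill \<E> \<phi> (do_hat E \<cdot>\<^bsub>X\<^esub> TA X \<phi>) (do_hat (Src f))\<rparr>)"

definition DO_fib ::
  "('e, 'em, 'b, 'bm) ctfib \<Rightarrow>
   (('e, 'em) dobj, (('e, 'em) dobj, 'em) tagged,
    ('b, 'bm) dobj, (('b, 'bm) dobj, 'bm) tagged) ctfib" where
  "DO_fib \<E> =
     \<lparr>Total = DO_cat (Total \<E>) (TProd \<E>),
      Base = DO_cat (Base \<E>) (BProd \<E>),
      Proj = \<lparr>FO = do_map (Proj \<E>),
              FA = (\<lambda>t. tag (do_map (Proj \<E>) (Src t)) (do_map (Proj \<E>) (Tgt t))
                      (FA (Proj \<E>) (Und t)))\<rparr>,
      Lift = (\<lambda>f E. tag (do_reindex \<E> f E) E (Lift \<E> (Und f) (do_carrier E))),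
      TProd = DO_prod (Total \<E>) (TProd \<E>),
      BProd = DO_prod (Base \<E>) (BProd \<E>)\<rparr>"

definition lax_forget ::
  "('o, 'm, 'x) tcat_scheme \<Rightarrow> ('o, 'm) products \<Rightarrow>
   (('o, 'm) dobj, (('o, 'm) dobj, 'm) tagged, 'o, 'm) lax" where
  "lax_forget C P = \<lparr>Fun = ftr_restrict (DO_cat C P) \<lparr>FO = do_carrier, FA = Und\<rparr>,
     Str = (\<lambda>D\<in>Obj (DO_cat C P). Id C (TO C (do_carrier D)))\<rparr>"

definition DO_forget ::
  "('e, 'em, 'b, 'bm) ctfib \<Rightarrow>
   (('e, 'em) dobj, (('e, 'em) dobj, 'em) tagged, ('b, 'bm) dobj, (('b, 'bm) dobj, 'bm) tagged,
    'e, 'em, 'b, 'bm) fmor" where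
  "DO_forget \<E> = \<lparr>mB = lax_forget (Base \<E>) (BProd \<E>), mT = lax_forget (Total \<E>) (TProd \<E>)\<rparr>"

definition DO_universal ::
  "('e, 'em, 'b, 'bm) ctfib \<Rightarrow>
   (('e, 'em) dobj, (('e, 'em) dobj, 'em) tagged, ('b, 'bm) dobj, (('b, 'bm) dobj, 'bm) tagged,
    'e, 'em, 'b, 'bm) fdobj" where
  "DO_universal \<E> = (let \<Delta> = DO_fib \<E>; U = DO_forget \<E>;
                         P = fib_hom_prod \<Delta> \<E> in
     \<lparr>do_carrier = U,
      do_zero = mk_cell \<Delta> (One P) U do_zero do_zero,
      do_sum = mk_cell \<Delta> (Prod P U U) U do_sum do_sum,
      do_hat = mk_cell \<Delta> (fmor_T \<Delta> \<E> U) U do_hat do_hat\<rparr>)"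

end

theory Submission
  imports Defs
begin

text \<open>The tangentad of differential objects is obtained by applying the construction of differential objects
  to the total and to the base category. Three things make this work.

  Structure is inherited componentwise. The hom-category of two tangent fibrations has evaluations at the objects of
  the base and of the total category; the category of differential objects has its underlying functor.
  In both cases these functors preserve the tangent structure on the nose and are jointly faithful, so
  every equational axiom is inherited from their targets. For the limits among the axioms, a cone has a
  mediating arrow in each component, and what remains is that these arrows form a morphism: they must
  be natural, respect the lax structures, or be linear. All of these are equations that can be checked
  after the legs of the limit cone, or after \<open>T\<close> of the legs, provided that both families are jointly
  monic. For the tangent pullbacks this is an axiom. For the universality of the vertical lift it is
  \<open>vlift_stably_monic\<close>, which uses that the canonical flip turns \<open>T\<close> of the vertical lift square at
  \<open>A\<close> into the square at \<open>T A\<close>. The outcome is \<open>tangent_category_of_evaluations\<close>.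

  The fibration is built by reflecting laws. The equations of a differential object are equations between arrows into its
  carrier, so they are reflected by jointly monic families of structure preserving arrows
  (\<open>dobj_by_projections\<close>). Besides tangent powers and products this covers reindexing: a Cartesian lift
  \<open>\<phi>\<close> of a linear map detects equality of arrows with equal image in the base. The zero, the sum and
  the projection are lifted along \<open>\<phi>\<close>, which is possible since linear maps automatically preserve the
  zero and the sum (\<open>linear_zero\<close>, \<open>linear_sum\<close>); the product diagram is lifted by means of
  \<open>\<phi>\<close> and \<open>T \<phi>\<close> (\<open>cartesian_hat_product\<close>). An arrow of differential objects turns out to be
  Cartesian exactly if its underlying arrow is (\<open>DO_cartesianI\<close>, \<open>DO_cartesianD\<close>), whence \<open>T\<close> and
  products preserve Cartesian arrows.

  For the universal property, evaluations also preserve the chosen products. Hence a differential object of the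
  hom-category is the same as a morphism \<open>M\<close> together with differential structures on all its values
  such that the structure arrows are cells, and it is always pointwise (\<open>pointwise_DO_eq\<close>). That
  the projections form a cell says that \<open>M\<close> sends arrows to linear maps and that its lax structure is
  linear. So \<open>M\<close> factors through the fibration of differential objects (\<open>lift_lax_ok\<close>), and uniquely,
  since the values and the underlying morphism determine the factorisation. Evaluated at an object,
  the comparison functor returns the value of the morphism that it is applied to (\<open>pull_eval\<close>); from
  this it preserves the tangent structure and is bijective on morphisms and on 2-cells.\<close>

text \<open>Index sets such as \<open>{..<2}\<close> are split into the elements \<open>0\<close> and \<open>1\<close>, which must stay literal.\<close>

declare One_nat_def [simp del]

section \<open>Categories, functors and limits\<close>

lemma in_Homs_iff [simp]: "f \<in> Homs C A B \<longleftrightarrow> f \<in> Arr C \<and> Dom C f = A \<and> Cod C f = B"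
  by (simp add: Homs_def)

lemma less_two_iff: "i < (2::nat) \<longleftrightarrow> i = 0 \<or> i = 1"
  by auto

text \<open>Pullbacks and products are treated as cones with legs indexed by \<open>{0, 1}\<close>, to have one notion for
  them and the \<open>n\<close>-fold pullbacks.\<close>

abbreviation two :: "'a \<Rightarrow> 'a \<Rightarrow> nat \<Rightarrow> 'a" where
  "two f g \<equiv> \<lambda>i. if i = 0 then f else g"

lemma all_less_two: "(\<forall>i<(2::nat). Q i) \<longleftrightarrow> Q 0 \<and> Q 1"
  by (auto simp: less_two_iff)

lemma unique_eqI: "\<lbrakk>\<exists>!w. Q w; Q u; Q v\<rbrakk> \<Longrightarrow> u = v"
  by blast

context category
begin

declare Dom_in [simp] Cod_in [simp]

lemma Id_simps [simp]:
  "A \<in> Obj C \<Longrightarrow> Id C A \<in> Arr C"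
  "A \<in> Obj C \<Longrightarrow> Dom C (Id C A) = A"
  "A \<in> Obj C \<Longrightarrow> Cod C (Id C A) = A"
  using Id_in by auto

lemma Comp_simps [simp]:
  "\<lbrakk>f \<in> Arr C; g \<in> Arr C; Cod C f = Dom C g\<rbrakk> \<Longrightarrow> g \<cdot> f \<in> Arr C"
  "\<lbrakk>f \<in> Arr C; g \<in> Arr C; Cod C f = Dom C g\<rbrakk> \<Longrightarrow> Dom C (g \<cdot> f) = Dom C f"
  "\<lbrakk>f \<in> Arr C; g \<in> Arr C; Cod C f = Dom C g\<rbrakk> \<Longrightarrow> Cod C (g \<cdot> f) = Cod C g"
  using Comp_in by auto

lemma Comp_unit_simps [simp]:
  "\<lbrakk>f \<in> Arr C; Dom C f = X\<rbrakk> \<Longrightarrow> f \<cdot> Id C X = f"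
  "\<lbrakk>f \<in> Arr C; Cod C f = X\<rbrakk> \<Longrightarrow> Id C X \<cdot> f = f"
  using Comp_Id Id_Comp by auto

lemma assoc [simp]:
  "\<lbrakk>f \<in> Arr C; g \<in> Arr C; h \<in> Arr C; Cod C f = Dom C g; Cod C g = Dom C h\<rbrakk>
    \<Longrightarrow> (h \<cdot> g) \<cdot> f = h \<cdot> (g \<cdot> f)"
  using Comp_assoc by auto

text \<open>Composites are kept bracketed to the right by \<open>assoc\<close>. A law for \<open>a \<cdot> b\<close> then does not match inside
  a longer composite; \<open>reassoc\<close> provides the variant that does, named with the suffix \<open>_x\<close> below.\<close>

lemma reassoc:
  "\<lbrakk>a \<cdot> b = c; a \<in> Arr C; b \<in> Arr C; Cod C b = Dom C a; x \<in> Arr C; Cod C x = Dom C b\<rbrakk>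
    \<Longrightarrow> a \<cdot> (b \<cdot> x) = c \<cdot> x"
  using assoc[of x b a] by simp

end

lemma functor_simps:
  assumes "is_functor C D F"
  shows "A \<in> Obj C \<Longrightarrow> FO F A \<in> Obj D"
    and "f \<in> Arr C \<Longrightarrow> FA F f \<in> Arr D"
    and "f \<in> Arr C \<Longrightarrow> Dom D (FA F f) = FO F (Dom C f)"
    and "f \<in> Arr C \<Longrightarrow> Cod D (FA F f) = FO F (Cod C f)"
    and "A \<in> Obj C \<Longrightarrow> FA F (Id C A) = Id D (FO F A)"
    and "\<lbrakk>f \<in> Arr C; g \<in> Arr C; Cod C f = Dom C g\<rbrakk> \<Longrightarrow> FA F (g \<cdot>\<^bsub>C\<^esub> f) = FA F g \<cdot>\<^bsub>D\<^esub> FA F f"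
  using assms by (auto simp: is_functor_def)

text \<open>The uniqueness half of a limit property. With \<open>K\<close> empty it is that of a terminal object.\<close>

definition jointly_monic ::
  "('o, 'm, 'x) category_scheme \<Rightarrow> 'o \<Rightarrow> 'k set \<Rightarrow> ('k \<Rightarrow> 'm) \<Rightarrow> bool" where
  "jointly_monic C P K \<pi> \<longleftrightarrow>
     (\<forall>u\<in>Arr C. \<forall>v\<in>Arr C. Dom C u = Dom C v \<longrightarrow> Cod C u = P \<longrightarrow> Cod C v = P \<longrightarrow>
        (\<forall>i\<in>K. \<pi> i \<cdot>\<^bsub>C\<^esub> u = \<pi> i \<cdot>\<^bsub>C\<^esub> v) \<longrightarrow> u = v)"

lemma jointly_monicD:
  "\<lbrakk>jointly_monic C P K \<pi>; u \<in> Arr C; v \<in> Arr C; Dom C u = Dom C v; Cod C u = P; Cod C v = P;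
    \<And>i. i \<in> K \<Longrightarrow> \<pi> i \<cdot>\<^bsub>C\<^esub> u = \<pi> i \<cdot>\<^bsub>C\<^esub> v\<rbrakk> \<Longrightarrow> u = v"
  by (auto simp: jointly_monic_def)

text \<open>What it takes for componentwise mediating arrows to assemble to a morphism: naturality is checked
  after the legs, and compatibility with lax structures, which are arrows into a value of \<open>T\<close>, after
  \<open>T\<close> of the legs.\<close>

definition stably_monic ::
  "('o, 'm, 'x) tcat_scheme \<Rightarrow> 'o \<Rightarrow> 'k set \<Rightarrow> ('k \<Rightarrow> 'm) \<Rightarrow> bool" where
  "stably_monic C P K \<pi> \<longleftrightarrow>
     jointly_monic C P K \<pi> \<and> jointly_monic C (TO C P) K (\<lambda>i. TA C (\<pi> i))"

context category
begin

lemma npullbackD: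
  assumes "is_npullback C n q P \<pi>"
  shows "q \<in> Arr C" "P \<in> Obj C" "i < n \<Longrightarrow> \<pi> i \<in> Arr C" "i < n \<Longrightarrow> Dom C (\<pi> i) = P"
    "i < n \<Longrightarrow> Cod C (\<pi> i) = Dom C q" "i < n \<Longrightarrow> j < n \<Longrightarrow> q \<cdot> \<pi> i = q \<cdot> \<pi> j"
    "\<lbrakk>X \<in> Obj C; \<And>i. i < n \<Longrightarrow> g i \<in> Homs C X (Dom C q);
      \<And>i j. i < n \<Longrightarrow> j < n \<Longrightarrow> q \<cdot> g i = q \<cdot> g j\<rbrakk>
      \<Longrightarrow> \<exists>!u. u \<in> Homs C X P \<and> (\<forall>i<n. \<pi> i \<cdot> u = g i)"
proof -
  have c: "q \<in> Arr C" "P \<in> Obj C" "\<forall>i<n. \<pi> i \<in> Homs C P (Dom C q)"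
    "\<forall>i<n. \<forall>j<n. q \<cdot> \<pi> i = q \<cdot> \<pi> j"
    "\<forall>X\<in>Obj C. \<forall>g. (\<forall>i<n. g i \<in> Homs C X (Dom C q)) \<longrightarrow> (\<forall>i<n. \<forall>j<n. q \<cdot> g i = q \<cdot> g j) \<longrightarrow>
        (\<exists>!u. u \<in> Homs C X P \<and> (\<forall>i<n. \<pi> i \<cdot> u = g i))"
    using assms unfolding is_npullback_def by - (elim conjE, assumption)+
  show "q \<in> Arr C" "P \<in> Obj C" by (fact c)+
  show "i < n \<Longrightarrow> \<pi> i \<in> Arr C" "i < n \<Longrightarrow> Dom C (\<pi> i) = P" "i < n \<Longrightarrow> Cod C (\<pi> i) = Dom C q"
    using c(3) by auto
  show "i < n \<Longrightarrow> j < n \<Longrightarrow> q \<cdot> \<pi> i = q \<cdot> \<pi> j" using c(4) by blast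
  show "\<exists>!u. u \<in> Homs C X P \<and> (\<forall>i<n. \<pi> i \<cdot> u = g i)"
    if "X \<in> Obj C" "\<And>i. i < n \<Longrightarrow> g i \<in> Homs C X (Dom C q)"
      "\<And>i j. i < n \<Longrightarrow> j < n \<Longrightarrow> q \<cdot> g i = q \<cdot> g j"
    by (rule c(5)[rule_format]) (use that in blast)+
qed

lemma npullback_tuple:
  assumes P: "is_npullback C n q P \<pi>" and X: "X \<in> Obj C"
    and g: "\<And>i. i < n \<Longrightarrow> g i \<in> Arr C \<and> Dom C (g i) = X \<and> Cod C (g i) = Dom C q"
    and eq: "\<And>i j. i < n \<Longrightarrow> j < n \<Longrightarrow> q \<cdot> g i = q \<cdot> g j"
  shows "ntuple C n X P \<pi> g \<in> Arr C" "Dom C (ntuple C n X P \<pi> g) = X"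
    "Cod C (ntuple C n X P \<pi> g) = P"
    "i < n \<Longrightarrow> \<pi> i \<cdot> ntuple C n X P \<pi> g = g i"
proof -
  have "\<exists>!u. u \<in> Homs C X P \<and> (\<forall>i<n. \<pi> i \<cdot> u = g i)"
    using g by (intro npullbackD(7)[OF P X] eq) auto
  from theI'[OF this, folded ntuple_def]
  show "ntuple C n X P \<pi> g \<in> Arr C" "Dom C (ntuple C n X P \<pi> g) = X"
    "Cod C (ntuple C n X P \<pi> g) = P"
    "i < n \<Longrightarrow> \<pi> i \<cdot> ntuple C n X P \<pi> g = g i"
    by auto
qed

lemma npullback_monic:
  assumes P: "is_npullback C n q P \<pi>"
  shows "jointly_monic C P {..<n} \<pi>"
  unfolding jointly_monic_def
proof (intro ballI impI)
  fix u v assume uv: "u \<in> Arr C" "v \<in> Arr C" "Dom C u = Dom C v" "Cod C u = P" "Cod C v = P"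
    "\<forall>i\<in>{..<n}. \<pi> i \<cdot> u = \<pi> i \<cdot> v"
  have pi: "\<pi> i \<in> Arr C" "Dom C (\<pi> i) = P" "Cod C (\<pi> i) = Dom C q" if "i < n" for i
    using npullbackD[OF P] that by auto
  have eq: "q \<cdot> (\<pi> i \<cdot> u) = q \<cdot> (\<pi> j \<cdot> u)" if "i < n" "j < n" for i j
  proof -
    show ?thesis using pi that uv npullbackD(1)[OF P]
        reassoc[of q "\<pi> i" "q \<cdot> \<pi> j" u, OF npullbackD(6)[OF P that]] by simp
  qed
  have "\<exists>!w. w \<in> Homs C (Dom C u) P \<and> (\<forall>i<n. \<pi> i \<cdot> w = \<pi> i \<cdot> u)"
    using uv pi by (intro npullbackD(7)[OF P] eq) auto
  then show "u = v" by (rule unique_eqI) (use uv in auto)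
qed

lemma npullback_eqI:
  "\<lbrakk>is_npullback C n q P \<pi>; u \<in> Arr C; v \<in> Arr C; Dom C u = Dom C v; Cod C u = P; Cod C v = P;
    \<And>i. i < n \<Longrightarrow> \<pi> i \<cdot> u = \<pi> i \<cdot> v\<rbrakk> \<Longrightarrow> u = v"
  by (erule jointly_monicD[OF npullback_monic]) simp_all

lemma ntuple_eqI:
  assumes "is_npullback C n q P \<pi>" "u \<in> Arr C" "Dom C u = X" "Cod C u = P"
    "\<And>i. i < n \<Longrightarrow> \<pi> i \<cdot> u = g i"
  shows "ntuple C n X P \<pi> g = u"
  unfolding ntuple_def
proof (rule the_equality)
  fix v assume v: "v \<in> Homs C X P \<and> (\<forall>i<n. \<pi> i \<cdot> v = g i)"
  show "v = u" by (rule npullback_eqI[OF assms(1)]) (use assms v in auto)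
qed (use assms in auto)

lemma product_med2:
  assumes P: "is_product C A B P a b"
    and f: "f \<in> Arr C" "Dom C f = X" "Cod C f = A" and g: "g \<in> Arr C" "Dom C g = X" "Cod C g = B"
  shows "med2 C X P a b f g \<in> Arr C" "Dom C (med2 C X P a b f g) = X"
    "Cod C (med2 C X P a b f g) = P"
    "a \<cdot> med2 C X P a b f g = f" "b \<cdot> med2 C X P a b f g = g"
proof -
  have "\<exists>!u. u \<in> Homs C X P \<and> a \<cdot> u = f \<and> b \<cdot> u = g"
    using P f g by (simp add: is_product_def)
  from theI'[OF this, folded med2_def]
  show "med2 C X P a b f g \<in> Arr C" "Dom C (med2 C X P a b f g) = X"
    "Cod C (med2 C X P a b f g) = P"
    "a \<cdot> med2 C X P a b f g = f" "b \<cdot> med2 C X P a b f g = g"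
    by auto
qed

lemma product_eqI:
  assumes P: "is_product C A B P a b" and uv: "u \<in> Arr C" "v \<in> Arr C" "Dom C u = Dom C v"
    "Cod C u = P" "Cod C v = P" "a \<cdot> u = a \<cdot> v" "b \<cdot> u = b \<cdot> v"
  shows "u = v"
proof -
  have "a \<cdot> u \<in> Homs C (Dom C u) A" "b \<cdot> u \<in> Homs C (Dom C u) B"
    using P uv(1,4) by (auto simp: is_product_def)
  then have "\<exists>!w. w \<in> Homs C (Dom C u) P \<and> a \<cdot> w = a \<cdot> u \<and> b \<cdot> w = b \<cdot> u"
    using P by (auto simp: is_product_def)
  then show ?thesis by (rule unique_eqI) (use uv in auto)
qed

lemma product_med2_eqI:
  assumes "is_product C A B P a b" "u \<in> Arr C" "Dom C u = X" "Cod C u = P" "a \<cdot> u = f" "b \<cdot> u = g"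
  shows "med2 C X P a b f g = u"
  unfolding med2_def
proof (rule the_equality)
  fix v assume v: "v \<in> Homs C X P \<and> a \<cdot> v = f \<and> b \<cdot> v = g"
  show "v = u" by (rule product_eqI[OF assms(1)]) (use assms v in auto)
qed (use assms in auto)

lemma terminal_eqI:
  "\<lbrakk>is_terminal C U; u \<in> Arr C; v \<in> Arr C; Dom C u = Dom C v; Cod C u = U; Cod C v = U\<rbrakk> \<Longrightarrow> u = v"
  unfolding is_terminal_def by (metis Dom_in in_Homs_iff)

lemma pullback_eqI:
  assumes P: "is_pullback C f g P a b" and uv: "u \<in> Arr C" "v \<in> Arr C" "Dom C u = Dom C v"
    "Cod C u = P" "Cod C v = P" "a \<cdot> u = a \<cdot> v" "b \<cdot> u = b \<cdot> v"
  shows "u = v"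
proof -
  have ty: "a \<in> Arr C" "b \<in> Arr C" "Dom C a = P" "Dom C b = P" "Cod C a = Dom C f"
    "Cod C b = Dom C g" "f \<in> Arr C" "g \<in> Arr C" "f \<cdot> a = g \<cdot> b"
    using P by (auto simp: is_pullback_def)
  have "f \<cdot> (a \<cdot> u) = g \<cdot> (b \<cdot> u)"
    using ty uv(1,4) reassoc[of f a "g \<cdot> b" u] by simp
  then have "\<exists>!w. w \<in> Homs C (Dom C u) P \<and> a \<cdot> w = a \<cdot> u \<and> b \<cdot> w = b \<cdot> u"
    using P ty uv(1,4) by (simp add: is_pullback_def)
  then show ?thesis by (rule unique_eqI) (use uv in auto)
qed

end

section \<open>Tangent categories\<close>

text \<open>The part of a tangent category that gives sense to the pairings in the remaining axioms.\<close>

locale pre_tangent_category = category C for C :: "('o, 'm, 'x) tcat_scheme" (structure) +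
  assumes Tan_functor: "is_functor C C (Tan C)"
    and p_natural: "nat_trans C C (Tan C) ftr_id (pT C)"
    and Tan_npullback: "\<lbrakk>A \<in> Obj C; 1 \<le> n\<rbrakk> \<Longrightarrow>
      is_npullback C n (((FA (Tan C)) ^^ m) (pT C A)) (((FO (Tan C)) ^^ m) (Tn C n A))
        (\<lambda>i. ((FA (Tan C)) ^^ m) (pr C n i A))"
begin

lemmas T_simps [simp] = functor_simps[OF Tan_functor]

lemma p_simps [simp]:
  "A \<in> Obj C \<Longrightarrow> pT C A \<in> Arr C" "A \<in> Obj C \<Longrightarrow> Dom C (pT C A) = TO C A"
  "A \<in> Obj C \<Longrightarrow> Cod C (pT C A) = A"
  using p_natural by (auto simp: nat_trans_def ftr_id_def)

lemma npullback_T0: "\<lbrakk>A \<in> Obj C; 1 \<le> n\<rbrakk> \<Longrightarrow> is_npullback C n (pT C A) (Tn C n A) (\<lambda>i. pr C n i A)"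
  using Tan_npullback[of A n 0] by simp

lemma npullback_T1: "\<lbrakk>A \<in> Obj C; 1 \<le> n\<rbrakk> \<Longrightarrow>
  is_npullback C n (TA C (pT C A)) (TO C (Tn C n A)) (\<lambda>i. TA C (pr C n i A))"
  using Tan_npullback[of A n 1] by (simp add: One_nat_def)

lemma npullback_T2: "\<lbrakk>A \<in> Obj C; 1 \<le> n\<rbrakk> \<Longrightarrow>
  is_npullback C n (TA C (TA C (pT C A))) (TO C (TO C (Tn C n A))) (\<lambda>i. TA C (TA C (pr C n i A)))"
  using Tan_npullback[of A n 2] by (simp add: numeral_2_eq_2)

lemma Tn_Obj [simp]: "\<lbrakk>A \<in> Obj C; 1 \<le> n\<rbrakk> \<Longrightarrow> Tn C n A \<in> Obj C"
  using npullbackD[OF npullback_T0[of A n]] by auto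

lemma pr_simps [simp]:
  "\<lbrakk>A \<in> Obj C; i < n\<rbrakk> \<Longrightarrow> pr C n i A \<in> Arr C"
  "\<lbrakk>A \<in> Obj C; i < n\<rbrakk> \<Longrightarrow> Dom C (pr C n i A) = Tn C n A"
  "\<lbrakk>A \<in> Obj C; i < n\<rbrakk> \<Longrightarrow> Cod C (pr C n i A) = TO C A"
  using npullbackD[OF npullback_T0[of A n]] by auto

lemma p_pr: "\<lbrakk>A \<in> Obj C; i < n; j < n\<rbrakk> \<Longrightarrow> pT C A \<cdot> pr C n i A = pT C A \<cdot> pr C n j A"
  by (rule npullbackD(6)[OF npullback_T0]) auto

text \<open>Oriented towards the index \<open>0\<close>, so that rewriting terminates.\<close>

lemma p_pr' [simp]: "\<lbrakk>A \<in> Obj C; 0 < i; i < n\<rbrakk> \<Longrightarrow> pT C A \<cdot> pr C n i A = pT C A \<cdot> pr C n 0 A"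
  by (rule p_pr) auto

lemma Tp_pr [simp]:
  "\<lbrakk>A \<in> Obj C; 0 < i; i < n\<rbrakk> \<Longrightarrow> TA C (pT C A) \<cdot> TA C (pr C n i A) = TA C (pT C A) \<cdot> TA C (pr C n 0 A)"
  by (rule npullbackD(6)[OF npullback_T1]) auto

lemma Tn_eqI:
  "\<lbrakk>u \<in> Arr C; v \<in> Arr C; Dom C u = Dom C v; Cod C u = Tn C n A; Cod C v = Tn C n A; A \<in> Obj C; 1 \<le> n;
    \<And>i. i < n \<Longrightarrow> pr C n i A \<cdot> u = pr C n i A \<cdot> v\<rbrakk> \<Longrightarrow> u = v"
  by (rule npullback_eqI[OF npullback_T0]) auto

lemma TTn_eqI:
  "\<lbrakk>u \<in> Arr C; v \<in> Arr C; Dom C u = Dom C v; Cod C u = TO C (Tn C n A); Cod C v = TO C (Tn C n A);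
    A \<in> Obj C; 1 \<le> n; \<And>i. i < n \<Longrightarrow> TA C (pr C n i A) \<cdot> u = TA C (pr C n i A) \<cdot> v\<rbrakk> \<Longrightarrow> u = v"
  by (rule npullback_eqI[OF npullback_T1]) auto

lemma T2_eqI:
  "\<lbrakk>u \<in> Arr C; v \<in> Arr C; Dom C u = Dom C v; Cod C u = Tn C 2 A; Cod C v = Tn C 2 A; A \<in> Obj C;
    pr C 2 0 A \<cdot> u = pr C 2 0 A \<cdot> v; pr C 2 1 A \<cdot> u = pr C 2 1 A \<cdot> v\<rbrakk> \<Longrightarrow> u = v"
  by (rule npullback_eqI[OF npullback_T0[where n = 2]]) (auto simp: less_two_iff)

lemma TT2_eqI:
  "\<lbrakk>u \<in> Arr C; v \<in> Arr C; Dom C u = Dom C v; Cod C u = TO C (Tn C 2 A); Cod C v = TO C (Tn C 2 A);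
    A \<in> Obj C; TA C (pr C 2 0 A) \<cdot> u = TA C (pr C 2 0 A) \<cdot> v;
    TA C (pr C 2 1 A) \<cdot> u = TA C (pr C 2 1 A) \<cdot> v\<rbrakk> \<Longrightarrow> u = v"
  by (rule npullback_eqI[OF npullback_T1[where n = 2]]) (auto simp: less_two_iff)

lemma T2pair_ntuple: "T2pair C X A f g = ntuple C 2 X (Tn C 2 A) (\<lambda>i. pr C 2 i A) (two f g)"
  unfolding T2pair_def med2_def ntuple_def by (simp add: all_less_two)

lemma TT2pair_ntuple: "TT2pair C X A f g =
  ntuple C 2 X (TO C (Tn C 2 A)) (\<lambda>i. TA C (pr C 2 i A)) (two f g)"
  unfolding TT2pair_def med2_def ntuple_def by (simp add: all_less_two)

lemma T2pair_simps [simp]: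
  assumes "A \<in> Obj C" "f \<in> Arr C" "g \<in> Arr C" "Dom C f = X" "Dom C g = X"
    "Cod C f = TO C A" "Cod C g = TO C A" "pT C A \<cdot> f = pT C A \<cdot> g"
  shows "T2pair C X A f g \<in> Arr C" "Dom C (T2pair C X A f g) = X"
    "Cod C (T2pair C X A f g) = Tn C 2 A"
    "pr C 2 0 A \<cdot> T2pair C X A f g = f" "pr C 2 1 A \<cdot> T2pair C X A f g = g"
proof -
  have X: "X \<in> Obj C" using assms by auto
  have 1: "two f g i \<in> Arr C \<and> Dom C (two f g i) = X \<and>
      Cod C (two f g i) = Dom C (pT C A)" for i :: nat
    using assms by auto
  have 2: "pT C A \<cdot> two f g i = pT C A \<cdot> two f g j" for i j :: nat
    using assms by auto
  have P: "is_npullback C 2 (pT C A) (Tn C 2 A) (\<lambda>i. pr C 2 i A)"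
    using npullback_T0[of A 2] assms(1) by simp
  note n = npullback_tuple(1-3)[OF P X 1 2]
    npullback_tuple(4)[where i = 0, OF P X 1 2] npullback_tuple(4)[where i = 1, OF P X 1 2]
  show "T2pair C X A f g \<in> Arr C" "Dom C (T2pair C X A f g) = X"
    "Cod C (T2pair C X A f g) = Tn C 2 A"
    "pr C 2 0 A \<cdot> T2pair C X A f g = f" "pr C 2 1 A \<cdot> T2pair C X A f g = g"
    unfolding T2pair_ntuple using n by auto
qed

lemma T2pair_x [simp]:
  assumes "A \<in> Obj C" "f \<in> Arr C" "g \<in> Arr C" "Dom C f = X" "Dom C g = X"
    "Cod C f = TO C A" "Cod C g = TO C A" "pT C A \<cdot> f = pT C A \<cdot> g" "x \<in> Arr C" "Cod C x = X"
  shows "pr C 2 0 A \<cdot> (T2pair C X A f g \<cdot> x) = f \<cdot> x" "pr C 2 1 A \<cdot> (T2pair C X A f g \<cdot> x) = g \<cdot> x"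
  using T2pair_simps[OF assms(1-8)] assms by (auto intro!: reassoc)

lemma TT2pair_simps [simp]:
  assumes "A \<in> Obj C" "f \<in> Arr C" "g \<in> Arr C" "Dom C f = X" "Dom C g = X"
    "Cod C f = TO C (TO C A)" "Cod C g = TO C (TO C A)" "TA C (pT C A) \<cdot> f = TA C (pT C A) \<cdot> g"
  shows "TT2pair C X A f g \<in> Arr C" "Dom C (TT2pair C X A f g) = X"
    "Cod C (TT2pair C X A f g) = TO C (Tn C 2 A)"
    "TA C (pr C 2 0 A) \<cdot> TT2pair C X A f g = f" "TA C (pr C 2 1 A) \<cdot> TT2pair C X A f g = g"
proof -
  have X: "X \<in> Obj C" using assms by auto
  have 1: "two f g i \<in> Arr C \<and> Dom C (two f g i) = X \<and>
      Cod C (two f g i) = Dom C (TA C (pT C A))" for i :: nat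
    using assms by auto
  have 2: "TA C (pT C A) \<cdot> two f g i = TA C (pT C A) \<cdot> two f g j" for i j :: nat
    using assms by auto
  have P: "is_npullback C 2 (TA C (pT C A)) (TO C (Tn C 2 A)) (\<lambda>i. TA C (pr C 2 i A))"
    using npullback_T1[of A 2] assms(1) by simp
  note n = npullback_tuple(1-3)[OF P X 1 2]
    npullback_tuple(4)[where i = 0, OF P X 1 2] npullback_tuple(4)[where i = 1, OF P X 1 2]
  show "TT2pair C X A f g \<in> Arr C" "Dom C (TT2pair C X A f g) = X"
    "Cod C (TT2pair C X A f g) = TO C (Tn C 2 A)"
    "TA C (pr C 2 0 A) \<cdot> TT2pair C X A f g = f" "TA C (pr C 2 1 A) \<cdot> TT2pair C X A f g = g"
    unfolding TT2pair_ntuple using n by auto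
qed

lemma T2pair_eqI:
  assumes "u \<in> Arr C" "Dom C u = X" "Cod C u = Tn C 2 A" "A \<in> Obj C"
    "pr C 2 0 A \<cdot> u = f" "pr C 2 1 A \<cdot> u = g"
  shows "T2pair C X A f g = u"
  unfolding T2pair_ntuple using assms
  by (intro ntuple_eqI[OF npullback_T0]) (auto simp: less_two_iff)

lemma TT2pair_eqI:
  assumes "u \<in> Arr C" "Dom C u = X" "Cod C u = TO C (Tn C 2 A)" "A \<in> Obj C"
    "TA C (pr C 2 0 A) \<cdot> u = f" "TA C (pr C 2 1 A) \<cdot> u = g"
  shows "TT2pair C X A f g = u"
  unfolding TT2pair_ntuple using assms
  by (intro ntuple_eqI[OF npullback_T1]) (auto simp: less_two_iff)

end

lemma less_imp_one_le: "i < n \<Longrightarrow> 1 \<le> (n::nat)"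
  by simp

context pre_tangent_category
begin

lemma p_nat_simp:
  "\<lbrakk>f \<in> Arr C; Cod C f = B\<rbrakk> \<Longrightarrow> pT C B \<cdot> TA C f = f \<cdot> pT C (Dom C f)"
  using p_natural by (auto simp: nat_trans_def ftr_id_def)

lemma p_nat_x:
  "\<lbrakk>f \<in> Arr C; Cod C f = B; x \<in> Arr C; Cod C x = TO C (Dom C f)\<rbrakk>
    \<Longrightarrow> pT C B \<cdot> (TA C f \<cdot> x) = f \<cdot> (pT C (Dom C f) \<cdot> x)"
  using reassoc[OF p_nat_simp[of f B]] by auto

lemma TnF_FO [simp]: "FO (TnF C n) A = Tn C n A"
  by (simp add: TnF_def)

lemma TnF_simps [simp]:
  assumes "f \<in> Arr C"
  shows "1 \<le> n \<Longrightarrow> FA (TnF C n) f \<in> Arr C" "1 \<le> n \<Longrightarrow> Dom C (FA (TnF C n) f) = Tn C n (Dom C f)"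
    "1 \<le> n \<Longrightarrow> Cod C (FA (TnF C n) f) = Tn C n (Cod C f)"
    "\<lbrakk>i < n; Cod C f = B\<rbrakk> \<Longrightarrow> pr C n i B \<cdot> FA (TnF C n) f = TA C f \<cdot> pr C n i (Dom C f)"
proof -
  let ?g = "\<lambda>i. TA C f \<cdot> pr C n i (Dom C f)"
  have P: "is_npullback C n (pT C (Cod C f)) (Tn C n (Cod C f)) (\<lambda>i. pr C n i (Cod C f))"
    if "1 \<le> n" using npullback_T0 assms that by simp
  have g: "?g i \<in> Arr C \<and> Dom C (?g i) = Tn C n (Dom C f) \<and> Cod C (?g i) = Dom C (pT C (Cod C f))"
    if "i < n" for i using that assms by simp
  have eq: "pT C (Cod C f) \<cdot> ?g i = pT C (Cod C f) \<cdot> ?g j" if "i < n" "j < n" for i j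
    using that assms p_pr[of "Dom C f" i n j] by (simp add: p_nat_x)
  have X: "Tn C n (Dom C f) \<in> Obj C" if "1 \<le> n" using assms that by simp
  let ?t = "ntuple C n (Tn C n (Dom C f)) (Tn C n (Cod C f)) (\<lambda>i. pr C n i (Cod C f)) ?g"
  have n: "?t \<in> Arr C" "Dom C ?t = Tn C n (Dom C f)" "Cod C ?t = Tn C n (Cod C f)"
    "i < n \<Longrightarrow> pr C n i (Cod C f) \<cdot> ?t = ?g i" if "1 \<le> n" for i
    by (rule npullback_tuple[OF P X g eq]; use that in simp)+
  show "FA (TnF C n) f \<in> Arr C" "Dom C (FA (TnF C n) f) = Tn C n (Dom C f)"
    "Cod C (FA (TnF C n) f) = Tn C n (Cod C f)" if "1 \<le> n"
    using n(1-3)[OF that] by (auto simp: TnF_def)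
  show "\<lbrakk>i < n; Cod C f = B\<rbrakk> \<Longrightarrow> pr C n i B \<cdot> FA (TnF C n) f = TA C f \<cdot> pr C n i (Dom C f)"
    using n(4)[of i] unfolding TnF_def by (auto simp: TnF_def)
qed

lemma TnF_x [simp]:
  "\<lbrakk>f \<in> Arr C; i < n; Cod C f = B; x \<in> Arr C; Cod C x = Tn C n (Dom C f)\<rbrakk>
    \<Longrightarrow> pr C n i B \<cdot> (FA (TnF C n) f \<cdot> x) = TA C f \<cdot> (pr C n i (Dom C f) \<cdot> x)"
  using reassoc[OF TnF_simps(4)[of f i n B], of x] less_imp_one_le[of i n] by auto

lemma TnF_functor: "1 \<le> n \<Longrightarrow> is_functor C C (TnF C n)"
  unfolding is_functor_def
proof (intro conjI ballI impI)
  fix A assume "1 \<le> n" "A \<in> Obj C"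
  then show "FA (TnF C n) (Id C A) = Id C (FO (TnF C n) A)"
    by - (rule Tn_eqI[of _ _ n A], simp_all)
next
  fix f g assume "1 \<le> n" "f \<in> Arr C" "g \<in> Arr C" "Cod C f = Dom C g"
  then show "FA (TnF C n) (g \<cdot> f) = FA (TnF C n) g \<cdot> FA (TnF C n) f"
    by - (rule Tn_eqI[of _ _ n "Cod C g"], simp_all)
qed simp_all

lemma T2pair_comp:
  "\<lbrakk>A \<in> Obj C; f \<in> Arr C; g \<in> Arr C; Dom C f = X; Dom C g = X; Cod C f = TO C A; Cod C g = TO C A;
    pT C A \<cdot> f = pT C A \<cdot> g; h \<in> Arr C; Cod C h = X\<rbrakk>
    \<Longrightarrow> T2pair C X A f g \<cdot> h = T2pair C (Dom C h) A (f \<cdot> h) (g \<cdot> h)"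
  by (rule T2pair_eqI[symmetric]) auto

lemma T2pair_pr [simp]: "A \<in> Obj C \<Longrightarrow> T2pair C (Tn C 2 A) A (pr C 2 0 A) (pr C 2 1 A) = Id C (Tn C 2 A)"
  by (rule T2pair_eqI) auto

lemma TnF_pair:
  assumes "f \<in> Arr C" "Cod C f = B" "Dom C f = A" "u \<in> Arr C" "v \<in> Arr C" "Dom C u = X" "Dom C v = X"
    "Cod C u = TO C A" "Cod C v = TO C A" "pT C A \<cdot> u = pT C A \<cdot> v"
  shows "T2pair C X B (TA C f \<cdot> u) (TA C f \<cdot> v) = FA (TnF C 2) f \<cdot> T2pair C X A u v"
proof -
  have "A \<in> Obj C" "B \<in> Obj C" using assms by auto
  then show ?thesis using assms by (intro T2pair_eqI) simp_all
qed

end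

lemma (in category) pullback_monic:
  "is_pullback C f g P a b \<Longrightarrow> jointly_monic C P {0, 1} (two a b)"
  unfolding jointly_monic_def by (intro ballI impI, rule pullback_eqI) auto

sublocale tangent_category \<subseteq> pre_tangent_category
  using T_functor p_nat T_npullback by unfold_locales

context tangent_category
begin

lemma z_simps [simp]:
  "A \<in> Obj C \<Longrightarrow> zT C A \<in> Arr C" "A \<in> Obj C \<Longrightarrow> Dom C (zT C A) = A"
  "A \<in> Obj C \<Longrightarrow> Cod C (zT C A) = TO C A"
  using z_nat by (auto simp: nat_trans_def ftr_id_def)

lemma s_simps [simp]:
  "A \<in> Obj C \<Longrightarrow> sT C A \<in> Arr C" "A \<in> Obj C \<Longrightarrow> Dom C (sT C A) = Tn C 2 A"
  "A \<in> Obj C \<Longrightarrow> Cod C (sT C A) = TO C A"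
  using s_nat by (auto simp: nat_trans_def)

lemma l_simps [simp]:
  "A \<in> Obj C \<Longrightarrow> lT C A \<in> Arr C" "A \<in> Obj C \<Longrightarrow> Dom C (lT C A) = TO C A"
  "A \<in> Obj C \<Longrightarrow> Cod C (lT C A) = TO C (TO C A)"
  using l_nat by (auto simp: nat_trans_def ftr_comp_def)

lemma c_simps [simp]:
  "A \<in> Obj C \<Longrightarrow> cT C A \<in> Arr C" "A \<in> Obj C \<Longrightarrow> Dom C (cT C A) = TO C (TO C A)"
  "A \<in> Obj C \<Longrightarrow> Cod C (cT C A) = TO C (TO C A)"
  using c_nat by (auto simp: nat_trans_def ftr_comp_def)

lemma z_nat_simp: "\<lbrakk>f \<in> Arr C; Cod C f = B\<rbrakk> \<Longrightarrow> zT C B \<cdot> f = TA C f \<cdot> zT C (Dom C f)"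
  using z_nat by (auto simp: nat_trans_def ftr_id_def)

lemma l_nat_simp: "\<lbrakk>f \<in> Arr C; Cod C f = B\<rbrakk> \<Longrightarrow> lT C B \<cdot> TA C f = TA C (TA C f) \<cdot> lT C (Dom C f)"
  using l_nat by (auto simp: nat_trans_def ftr_comp_def)

lemma c_nat_simp:
  "\<lbrakk>f \<in> Arr C; Cod C f = B\<rbrakk> \<Longrightarrow> cT C B \<cdot> TA C (TA C f) = TA C (TA C f) \<cdot> cT C (Dom C f)"
  using c_nat by (auto simp: nat_trans_def ftr_comp_def)

lemma s_nat_simp: "\<lbrakk>f \<in> Arr C; Cod C f = B\<rbrakk> \<Longrightarrow> sT C B \<cdot> FA (TnF C 2) f = TA C f \<cdot> sT C (Dom C f)"
  using s_nat by (auto simp: nat_trans_def)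

lemma z_nat_x:
  "\<lbrakk>f \<in> Arr C; Cod C f = B; x \<in> Arr C; Cod C x = Dom C f\<rbrakk>
    \<Longrightarrow> zT C B \<cdot> (f \<cdot> x) = TA C f \<cdot> (zT C (Dom C f) \<cdot> x)"
  using reassoc[OF z_nat_simp[of f B]] by auto

lemma l_nat_x:
  "\<lbrakk>f \<in> Arr C; Cod C f = B; x \<in> Arr C; Cod C x = TO C (Dom C f)\<rbrakk>
    \<Longrightarrow> lT C B \<cdot> (TA C f \<cdot> x) = TA C (TA C f) \<cdot> (lT C (Dom C f) \<cdot> x)"
  using reassoc[OF l_nat_simp[of f B]] by auto

lemma c_nat_x:
  "\<lbrakk>f \<in> Arr C; Cod C f = B; x \<in> Arr C; Cod C x = TO C (TO C (Dom C f))\<rbrakk>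
    \<Longrightarrow> cT C B \<cdot> (TA C (TA C f) \<cdot> x) = TA C (TA C f) \<cdot> (cT C (Dom C f) \<cdot> x)"
  using reassoc[OF c_nat_simp[of f B]] by auto

text \<open>Naturality of \<open>s\<close> for pairs, in which form the additions of concrete tangent vectors meet it.\<close>

lemma s_pair:
  assumes "f \<in> Arr C" "Cod C f = B" "Dom C f = A" "u \<in> Arr C" "v \<in> Arr C" "Dom C u = X" "Dom C v = X"
    "Cod C u = TO C A" "Cod C v = TO C A" "pT C A \<cdot> u = pT C A \<cdot> v"
  shows "sT C B \<cdot> T2pair C X B (TA C f \<cdot> u) (TA C f \<cdot> v) = TA C f \<cdot> (sT C A \<cdot> T2pair C X A u v)"
proof -
  have A: "A \<in> Obj C" "B \<in> Obj C" using assms by auto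
  then have "sT C B \<cdot> (FA (TnF C 2) f \<cdot> T2pair C X A u v) = (TA C f \<cdot> sT C A) \<cdot> T2pair C X A u v"
    using assms by (intro reassoc) (simp_all add: s_nat_simp)
  then show ?thesis using A assms by (simp add: TnF_pair[OF assms])
qed

lemma Tp_c: "A \<in> Obj C \<Longrightarrow> TA C (pT C A) \<cdot> cT C A = pT C (TO C A)"
  using reassoc[OF c_p, of A "cT C A"] by (simp add: c_c)

lemma c_zT: "A \<in> Obj C \<Longrightarrow> cT C A \<cdot> zT C (TO C A) = TA C (zT C A)"
  using reassoc[OF c_c, of A "TA C (zT C A)"] by (simp add: c_z)

lemma Tc_Tc: "A \<in> Obj C \<Longrightarrow> TA C (cT C A) \<cdot> TA C (cT C A) = Id C (TO C (TO C (TO C A)))"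
  by (simp add: c_c flip: T_simps(6))

text \<open>The axiom \<open>c\<^sub>T \<circ> T c \<circ> l\<^sub>T = T l \<circ> c\<close>, solved for \<open>l\<^sub>T \<circ> c\<close> by means of \<open>c \<circ> c = id\<close>.\<close>

lemma l_c: "A \<in> Obj C \<Longrightarrow> lT C (TO C A) \<cdot> cT C A = TA C (cT C A) \<cdot> (cT C (TO C A) \<cdot> TA C (lT C A))"
proof -
  assume A: "A \<in> Obj C"
  have *: "TA C (cT C A) \<cdot> (TA C (cT C A) \<cdot> x) = x" if "x \<in> Arr C" "Cod C x = TO C (TO C (TO C A))" for x
    using reassoc[OF Tc_Tc[OF A]] that A by simp
  have **: "cT C (TO C A) \<cdot> (cT C (TO C A) \<cdot> x) = x" if "x \<in> Arr C" "Cod C x = TO C (TO C (TO C A))" for x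
    using reassoc[OF c_c[of "TO C A"]] that A by simp
  have "TA C (lT C A) = cT C (TO C A) \<cdot> (TA C (cT C A) \<cdot> (lT C (TO C A) \<cdot> cT C A))"
  proof -
    have "(cT C (TO C A) \<cdot> (TA C (cT C A) \<cdot> lT C (TO C A))) \<cdot> cT C A = (TA C (lT C A) \<cdot> cT C A) \<cdot> cT C A"
      using c_c_l[OF A] A by simp
    then show ?thesis using A by (simp add: c_c)
  qed
  then show ?thesis using A by (simp add: * **)
qed

lemma p_c_x: "\<lbrakk>A \<in> Obj C; x \<in> Arr C; Cod C x = TO C (TO C A)\<rbrakk> \<Longrightarrow> pT C (TO C A) \<cdot> (cT C A \<cdot> x) = TA C (pT C A) \<cdot> x"
  using reassoc[OF c_p[of A]] by simp

lemma Tp_c_x: "\<lbrakk>A \<in> Obj C; x \<in> Arr C; Cod C x = TO C (TO C A)\<rbrakk> \<Longrightarrow> TA C (pT C A) \<cdot> (cT C A \<cdot> x) = pT C (TO C A) \<cdot> x"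
  using reassoc[OF Tp_c[of A]] by simp

lemma Tp_l_x: "\<lbrakk>A \<in> Obj C; x \<in> Arr C; Cod C x = TO C A\<rbrakk> \<Longrightarrow> TA C (pT C A) \<cdot> (lT C A \<cdot> x) = zT C A \<cdot> (pT C A \<cdot> x)"
  using reassoc[OF l_p[of A]] by simp

lemma c_z_x: "\<lbrakk>A \<in> Obj C; x \<in> Arr C; Cod C x = TO C A\<rbrakk> \<Longrightarrow> cT C A \<cdot> (TA C (zT C A) \<cdot> x) = zT C (TO C A) \<cdot> x"
  using reassoc[OF c_z[of A]] by simp

lemma c_zT_x: "\<lbrakk>A \<in> Obj C; x \<in> Arr C; Cod C x = TO C A\<rbrakk> \<Longrightarrow> cT C A \<cdot> (zT C (TO C A) \<cdot> x) = TA C (zT C A) \<cdot> x"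
  using reassoc[OF c_zT[of A]] by simp

lemma c_c_x: "\<lbrakk>A \<in> Obj C; x \<in> Arr C; Cod C x = TO C (TO C A)\<rbrakk> \<Longrightarrow> cT C A \<cdot> (cT C A \<cdot> x) = x"
  using reassoc[OF c_c[of A]] by simp

lemma l_c_x: "\<lbrakk>A \<in> Obj C; x \<in> Arr C; Cod C x = TO C (TO C A)\<rbrakk> \<Longrightarrow> lT C (TO C A) \<cdot> (cT C A \<cdot> x) = TA C (cT C A) \<cdot> (cT C (TO C A) \<cdot> (TA C (lT C A) \<cdot> x))"
  using reassoc[OF l_c[of A]] by simp

lemmas tangent_x = p_c_x Tp_c_x Tp_l_x c_z_x c_zT_x c_c_x l_c_x
lemmas tangent_laws = p_z c_p Tp_c l_p c_z c_zT c_l c_c l_z l_l l_c Tc_Tc tangent_x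
lemmas nat_laws = p_nat_simp p_nat_x z_nat_simp z_nat_x l_nat_simp l_nat_x c_nat_simp c_nat_x

text \<open>The top arrow of the square whose pullback property is the universality of the vertical lift.\<close>

definition vlift where
  "vlift A = TA C (sT C A) \<cdot> TT2pair C (Tn C 2 A) A (zT C (TO C A) \<cdot> pr C 2 0 A) (lT C A \<cdot> pr C 2 1 A)"

lemma vlift_monic: "A \<in> Obj C \<Longrightarrow> jointly_monic C (Tn C 2 A) {0, 1} (two (pT C A \<cdot> pr C 2 0 A) (vlift A))"
  unfolding vlift_def by (rule pullback_monic[OF l_universal])

lemma lift_compat [simp]:
  "A \<in> Obj C \<Longrightarrow> TA C (pT C A) \<cdot> (zT C (TO C A) \<cdot> pr C 2 0 A) = TA C (pT C A) \<cdot> (lT C A \<cdot> pr C 2 1 A)"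
  by (simp add: tangent_laws nat_laws)

lemma vlift_simps [simp]:
  "A \<in> Obj C \<Longrightarrow> vlift A \<in> Arr C" "A \<in> Obj C \<Longrightarrow> Dom C (vlift A) = Tn C 2 A"
  "A \<in> Obj C \<Longrightarrow> Cod C (vlift A) = TO C (TO C A)"
  by (simp_all add: vlift_def)

text \<open>The square is a pullback at every object, but its image under \<open>T\<close> is not given to be one. Let
  \<open>\<kappa> : T (T\<^sub>2 A) \<rightarrow> T\<^sub>2 (T A)\<close> be the isomorphism with components \<open>c \<circ> T \<pi>\<^sub>i\<close>. Then
  \<open>vlift (T A) \<circ> \<kappa> = T c \<circ> c\<^sub>T \<circ> T (vlift A)\<close>, so arrows that agree after \<open>T\<close> of the legs at \<open>A\<close>
  agree, after \<open>\<kappa>\<close>, on the legs at \<open>T A\<close>, which are jointly monic.\<close>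

lemma vlift_stably_monic:
  assumes A: "A \<in> Obj C"
  shows "stably_monic C (Tn C 2 A) {0, 1} (two (pT C A \<cdot> pr C 2 0 A) (vlift A))"
proof -
  define \<kappa> where "\<kappa> = T2pair C (TO C (Tn C 2 A)) (TO C A)
    (cT C A \<cdot> TA C (pr C 2 0 A)) (cT C A \<cdot> TA C (pr C 2 1 A))"
  define V where "V = (\<lambda>A. TT2pair C (Tn C 2 A) A (zT C (TO C A) \<cdot> pr C 2 0 A) (lT C A \<cdot> pr C 2 1 A))"
  let ?W = "TA C (cT C A) \<cdot> cT C (TO C A)"
  have V: "V B \<in> Arr C" "Dom C (V B) = Tn C 2 B" "Cod C (V B) = TO C (Tn C 2 B)"
    "TA C (pr C 2 0 B) \<cdot> V B = zT C (TO C B) \<cdot> pr C 2 0 B"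
    "TA C (pr C 2 1 B) \<cdot> V B = lT C B \<cdot> pr C 2 1 B"
    "vlift B = TA C (sT C B) \<cdot> V B" if "B \<in> Obj C" for B
    using that by (simp_all add: V_def vlift_def)
  have TV: "TA C (TA C (pr C 2 0 A)) \<cdot> TA C (V A) = TA C (zT C (TO C A)) \<cdot> TA C (pr C 2 0 A)"
    "TA C (TA C (pr C 2 1 A)) \<cdot> TA C (V A) = TA C (lT C A) \<cdot> TA C (pr C 2 1 A)"
    using A V by (simp_all flip: T_simps(6))
  have pk: "pT C (TO C A) \<cdot> (cT C A \<cdot> TA C (pr C 2 0 A)) = pT C (TO C A) \<cdot> (cT C A \<cdot> TA C (pr C 2 1 A))"
    using A by (simp add: tangent_laws)
  have k: "\<kappa> \<in> Arr C" "Dom C \<kappa> = TO C (Tn C 2 A)" "Cod C \<kappa> = Tn C 2 (TO C A)"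
    "pr C 2 0 (TO C A) \<cdot> \<kappa> = cT C A \<cdot> TA C (pr C 2 0 A)"
    "pr C 2 1 (TO C A) \<cdot> \<kappa> = cT C A \<cdot> TA C (pr C 2 1 A)"
    using A pk by (simp_all add: \<kappa>_def)
  have kx: "pr C 2 0 (TO C A) \<cdot> (\<kappa> \<cdot> x) = cT C A \<cdot> (TA C (pr C 2 0 A) \<cdot> x)"
    "pr C 2 1 (TO C A) \<cdot> (\<kappa> \<cdot> x) = cT C A \<cdot> (TA C (pr C 2 1 A) \<cdot> x)"
    if "x \<in> Arr C" "Cod C x = TO C (Tn C 2 A)" for x
    using reassoc[OF k(4), of x] reassoc[OF k(5), of x] that k A by simp_all
  have Tk: "TA C (pr C 2 0 (TO C A)) \<cdot> (TA C \<kappa> \<cdot> x) = TA C (cT C A) \<cdot> (TA C (TA C (pr C 2 0 A)) \<cdot> x)"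
    "TA C (pr C 2 1 (TO C A)) \<cdot> (TA C \<kappa> \<cdot> x) = TA C (cT C A) \<cdot> (TA C (TA C (pr C 2 1 A)) \<cdot> x)"
    if "x \<in> Arr C" "Cod C x = TO C (TO C (Tn C 2 A))" for x
    using arg_cong[OF k(4), of "TA C"] arg_cong[OF k(5), of "TA C"] that k(1-3) A
      reassoc[of "TA C (pr C 2 0 (TO C A))" "TA C \<kappa>" "TA C (cT C A) \<cdot> TA C (TA C (pr C 2 0 A))" x]
      reassoc[of "TA C (pr C 2 1 (TO C A))" "TA C \<kappa>" "TA C (cT C A) \<cdot> TA C (TA C (pr C 2 1 A))" x]
    by simp_all
  have VT: "TA C (pr C 2 0 (TO C A)) \<cdot> (V (TO C A) \<cdot> x) = zT C (TO C (TO C A)) \<cdot> (pr C 2 0 (TO C A) \<cdot> x)"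
    "TA C (pr C 2 1 (TO C A)) \<cdot> (V (TO C A) \<cdot> x) = lT C (TO C A) \<cdot> (pr C 2 1 (TO C A) \<cdot> x)"
    if "x \<in> Arr C" "Cod C x = Tn C 2 (TO C A)" for x
    using reassoc[OF V(4)[of "TO C A"], of x] reassoc[OF V(5)[of "TO C A"], of x] V(1-3)[of "TO C A"] that A
    by simp_all
  have cTV: "TA C (TA C (pr C 2 0 A)) \<cdot> (cT C (Tn C 2 A) \<cdot> TA C (V A)) = zT C (TO C (TO C A)) \<cdot> TA C (pr C 2 0 A)"
    "TA C (TA C (pr C 2 1 A)) \<cdot> (cT C (Tn C 2 A) \<cdot> TA C (V A)) = cT C (TO C A) \<cdot> (TA C (lT C A) \<cdot> TA C (pr C 2 1 A))"
    using A V(1-3)[OF A] TV c_z_x[of "TO C A" "TA C (pr C 2 0 A)"]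
      reassoc[OF c_nat_simp[symmetric, of "pr C 2 0 A" "TO C A"], of "TA C (V A)"]
      reassoc[OF c_nat_simp[symmetric, of "pr C 2 1 A" "TO C A"], of "TA C (V A)"]
    by simp_all
  \<comment> \<open>Up to flips, \<open>\<kappa>\<close> exchanges the pairing \<open>V\<close> at \<open>T A\<close> with \<open>T\<close> of that at \<open>A\<close>; fact \<open>2\<close> says
    the same for the addition \<open>s\<close>.\<close>
  have 1: "V (TO C A) \<cdot> \<kappa> = TA C \<kappa> \<cdot> (cT C (Tn C 2 A) \<cdot> TA C (V A))"
    using A k V(1-3)
    by - (rule TT2_eqI[where A = "TO C A"], simp_all add: Tk VT cTV, simp_all add: tangent_laws nat_laws)
  have 2: "TA C (sT C (TO C A)) \<cdot> TA C \<kappa> = TA C (cT C A) \<cdot> TA C (TA C (sT C A))"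
    using arg_cong[OF c_s[OF A], of "TA C"] A k(1-3) by (simp add: \<kappa>_def[symmetric])
  have "vlift (TO C A) \<cdot> \<kappa> = TA C (sT C (TO C A)) \<cdot> (TA C \<kappa> \<cdot> (cT C (Tn C 2 A) \<cdot> TA C (V A)))"
    using A k(1-3) V(1-3) V(6)[of "TO C A"] by (simp add: 1)
  also have "\<dots> = ?W \<cdot> TA C (vlift A)"
    using A k(1-3) V(1-3)[OF A] V(6)[of A] reassoc[OF 2, of "cT C (Tn C 2 A) \<cdot> TA C (V A)"]
    by (simp add: nat_laws)
  finally have W: "vlift (TO C A) \<cdot> \<kappa> = ?W \<cdot> TA C (vlift A)" .
  have "jointly_monic C (TO C (Tn C 2 A)) {0, 1} (\<lambda>i. TA C (two (pT C A \<cdot> pr C 2 0 A) (vlift A) i))"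
    unfolding jointly_monic_def
  proof (intro ballI impI)
    fix u v assume uv: "u \<in> Arr C" "v \<in> Arr C" "Dom C u = Dom C v" "Cod C u = TO C (Tn C 2 A)"
      "Cod C v = TO C (Tn C 2 A)"
      and eq: "\<forall>i\<in>{0, 1::nat}. TA C (two (pT C A \<cdot> pr C 2 0 A) (vlift A) i) \<cdot> u =
        TA C (two (pT C A \<cdot> pr C 2 0 A) (vlift A) i) \<cdot> v"
    have eq0: "TA C (pT C A) \<cdot> (TA C (pr C 2 0 A) \<cdot> u) = TA C (pT C A) \<cdot> (TA C (pr C 2 0 A) \<cdot> v)"
      using eq A uv by simp
    have eq1: "TA C (vlift A) \<cdot> u = TA C (vlift A) \<cdot> v"
      using eq by simp
    have e1: "vlift (TO C A) \<cdot> (\<kappa> \<cdot> u) = vlift (TO C A) \<cdot> (\<kappa> \<cdot> v)"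
      using reassoc[OF W, of u] reassoc[OF W, of v] uv k(1-3) A eq1 by simp
    have ku: "\<kappa> \<cdot> u = \<kappa> \<cdot> v"
      by (rule jointly_monicD[OF vlift_monic[of "TO C A"]])
        (use uv k A eq0 e1 in \<open>auto simp: kx tangent_laws\<close>)
    have "cT C A \<cdot> (TA C (pr C 2 0 A) \<cdot> u) = cT C A \<cdot> (TA C (pr C 2 0 A) \<cdot> v)"
      "cT C A \<cdot> (TA C (pr C 2 1 A) \<cdot> u) = cT C A \<cdot> (TA C (pr C 2 1 A) \<cdot> v)"
      using kx[of u] kx[of v] uv ku by simp_all
    from arg_cong[OF this(1), of "\<lambda>x. cT C A \<cdot> x"] arg_cong[OF this(2), of "\<lambda>x. cT C A \<cdot> x"]
    show "u = v" using uv A by - (rule TT2_eqI[OF uv(1-5) A], simp_all add: tangent_laws)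
  qed
  then show ?thesis using vlift_monic[OF A] by (simp add: stably_monic_def)
qed

lemma Tn_stably_monic:
  assumes "A \<in> Obj C" "1 \<le> n"
  shows "stably_monic C (((FO (Tan C)) ^^ m) (Tn C n A)) {..<n} (\<lambda>i. ((FA (Tan C)) ^^ m) (pr C n i A))"
  using npullback_monic[OF T_npullback[OF assms, of m]] npullback_monic[OF T_npullback[OF assms, of "Suc m"]]
  by (simp add: stably_monic_def)

end

section \<open>Functors preserving the tangent structure on the nose\<close>

text \<open>The chosen pullbacks and their projections are preserved as well. Therefore pairings are preserved,
  and with them every arrow from which the axioms are built.\<close>

definition tangent_preserving ::
  "('o1, 'm1, 'x) tcat_scheme \<Rightarrow> ('o2, 'm2, 'y) tcat_scheme \<Rightarrow> ('o1, 'm1, 'o2, 'm2) ftr \<Rightarrow> bool" where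
  "tangent_preserving C D F \<longleftrightarrow> is_functor C D F \<and>
     (\<forall>A\<in>Obj C. FO F (TO C A) = TO D (FO F A)) \<and>
     (\<forall>f\<in>Arr C. FA F (TA C f) = TA D (FA F f)) \<and>
     (\<forall>A\<in>Obj C. FA F (pT C A) = pT D (FO F A)) \<and>
     (\<forall>A\<in>Obj C. FA F (zT C A) = zT D (FO F A)) \<and>
     (\<forall>A\<in>Obj C. FA F (sT C A) = sT D (FO F A)) \<and>
     (\<forall>A\<in>Obj C. FA F (lT C A) = lT D (FO F A)) \<and>
     (\<forall>A\<in>Obj C. FA F (cT C A) = cT D (FO F A)) \<and>
     (\<forall>n\<ge>1. \<forall>A\<in>Obj C. FO F (Tn C n A) = Tn D n (FO F A)) \<and>
     (\<forall>n. \<forall>i<n. \<forall>A\<in>Obj C. FA F (pr C n i A) = pr D n i (FO F A))"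

lemma tangent_preserving_functor: "tangent_preserving C D F \<Longrightarrow> is_functor C D F"
  by (simp add: tangent_preserving_def)

lemma tangent_preserving_simps:
  assumes "tangent_preserving C D F"
  shows "A \<in> Obj C \<Longrightarrow> FO F (TO C A) = TO D (FO F A)"
    "f \<in> Arr C \<Longrightarrow> FA F (TA C f) = TA D (FA F f)"
    "A \<in> Obj C \<Longrightarrow> FA F (pT C A) = pT D (FO F A)"
    "A \<in> Obj C \<Longrightarrow> FA F (zT C A) = zT D (FO F A)"
    "A \<in> Obj C \<Longrightarrow> FA F (sT C A) = sT D (FO F A)"
    "A \<in> Obj C \<Longrightarrow> FA F (lT C A) = lT D (FO F A)"
    "A \<in> Obj C \<Longrightarrow> FA F (cT C A) = cT D (FO F A)"
    "\<lbrakk>A \<in> Obj C; 1 \<le> n\<rbrakk> \<Longrightarrow> FO F (Tn C n A) = Tn D n (FO F A)"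
    "\<lbrakk>A \<in> Obj C; i < n\<rbrakk> \<Longrightarrow> FA F (pr C n i A) = pr D n i (FO F A)"
  using assms by (auto simp: tangent_preserving_def)

lemma tangent_preserving_pow_FO:
  assumes "tangent_preserving C D F" "\<And>A. A \<in> Obj C \<Longrightarrow> TO C A \<in> Obj C"
  shows "A \<in> Obj C \<Longrightarrow> ((FO (Tan C)) ^^ m) A \<in> Obj C \<and>
    FO F (((FO (Tan C)) ^^ m) A) = ((FO (Tan D)) ^^ m) (FO F A)"
  by (induction m) (use assms(2) in \<open>auto simp: tangent_preserving_simps[OF assms(1)]\<close>)

lemma tangent_preserving_pow_FA:
  assumes "tangent_preserving C D F" "\<And>f. f \<in> Arr C \<Longrightarrow> TA C f \<in> Arr C"
  shows "f \<in> Arr C \<Longrightarrow> ((FA (Tan C)) ^^ m) f \<in> Arr C \<and>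
    FA F (((FA (Tan C)) ^^ m) f) = ((FA (Tan D)) ^^ m) (FA F f)"
  by (induction m) (use assms(2) in \<open>auto simp: tangent_preserving_simps[OF assms(1)]\<close>)

lemma stably_monic_cong:
  "(\<And>i. i \<in> K \<Longrightarrow> \<pi> i = \<pi>' i) \<Longrightarrow> stably_monic C P K \<pi> \<longleftrightarrow> stably_monic C P K \<pi>'"
  by (simp add: stably_monic_def jointly_monic_def)

lemma is_npullback_cong:
  assumes "\<And>i. i < n \<Longrightarrow> \<pi> i = \<pi>' i"
  shows "is_npullback C n q P \<pi> \<longleftrightarrow> is_npullback C n q P \<pi>'"
proof -
  have 1: "(\<forall>i<n. \<pi> i \<in> Homs C P (Dom C q)) \<longleftrightarrow> (\<forall>i<n. \<pi>' i \<in> Homs C P (Dom C q))"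
    using assms by simp
  have 2: "(\<forall>i<n. \<forall>j<n. q \<cdot>\<^bsub>C\<^esub> \<pi> i = q \<cdot>\<^bsub>C\<^esub> \<pi> j) \<longleftrightarrow> (\<forall>i<n. \<forall>j<n. q \<cdot>\<^bsub>C\<^esub> \<pi>' i = q \<cdot>\<^bsub>C\<^esub> \<pi>' j)"
    using assms by metis
  have 3: "(\<forall>i<n. \<pi> i \<cdot>\<^bsub>C\<^esub> u = g i) \<longleftrightarrow> (\<forall>i<n. \<pi>' i \<cdot>\<^bsub>C\<^esub> u = g i)" for u g
    using assms by simp
  show ?thesis unfolding is_npullback_def 1 2 3 ..
qed

lemma tangent_preserving_T2pair:
  assumes C: "pre_tangent_category C" and D: "pre_tangent_category D" and F: "tangent_preserving C D F"
    and fg: "A \<in> Obj C" "f \<in> Arr C" "g \<in> Arr C" "Dom C f = X" "Dom C g = X"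
  shows "\<lbrakk>Cod C f = TO C A; Cod C g = TO C A; pT C A \<cdot>\<^bsub>C\<^esub> f = pT C A \<cdot>\<^bsub>C\<^esub> g\<rbrakk>
      \<Longrightarrow> FA F (T2pair C X A f g) = T2pair D (FO F X) (FO F A) (FA F f) (FA F g)"
    and "\<lbrakk>Cod C f = TO C (TO C A); Cod C g = TO C (TO C A);
        TA C (pT C A) \<cdot>\<^bsub>C\<^esub> f = TA C (pT C A) \<cdot>\<^bsub>C\<^esub> g\<rbrakk>
      \<Longrightarrow> FA F (TT2pair C X A f g) = TT2pair D (FO F X) (FO F A) (FA F f) (FA F g)"
proof -
  interpret C: pre_tangent_category C by fact
  interpret D: pre_tangent_category D by fact
  note F_simps = functor_simps[OF tangent_preserving_functor[OF F]] tangent_preserving_simps[OF F]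
  {
    assume a: "Cod C f = TO C A" "Cod C g = TO C A" "pT C A \<cdot>\<^bsub>C\<^esub> f = pT C A \<cdot>\<^bsub>C\<^esub> g"
    let ?t = "T2pair C X A f g"
    have "pr D 2 0 (FO F A) \<cdot>\<^bsub>D\<^esub> FA F ?t = FA F (pr C 2 0 A \<cdot>\<^bsub>C\<^esub> ?t)"
      "pr D 2 1 (FO F A) \<cdot>\<^bsub>D\<^esub> FA F ?t = FA F (pr C 2 1 A \<cdot>\<^bsub>C\<^esub> ?t)"
      using fg a by (simp_all add: F_simps del: C.T2pair_simps(4,5))
    then show "FA F ?t = T2pair D (FO F X) (FO F A) (FA F f) (FA F g)"
      using fg a by (intro D.T2pair_eqI[symmetric]) (simp_all add: F_simps)
  }
  {
    assume a: "Cod C f = TO C (TO C A)" "Cod C g = TO C (TO C A)"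
      "TA C (pT C A) \<cdot>\<^bsub>C\<^esub> f = TA C (pT C A) \<cdot>\<^bsub>C\<^esub> g"
    let ?t = "TT2pair C X A f g"
    have "TA D (pr D 2 0 (FO F A)) \<cdot>\<^bsub>D\<^esub> FA F ?t = FA F (TA C (pr C 2 0 A) \<cdot>\<^bsub>C\<^esub> ?t)"
      "TA D (pr D 2 1 (FO F A)) \<cdot>\<^bsub>D\<^esub> FA F ?t = FA F (TA C (pr C 2 1 A) \<cdot>\<^bsub>C\<^esub> ?t)"
      using fg a by (simp_all add: F_simps del: C.TT2pair_simps(4,5))
    then show "FA F ?t = TT2pair D (FO F X) (FO F A) (FA F f) (FA F g)"
      using fg a by (intro D.TT2pair_eqI[symmetric]) (simp_all add: F_simps)
  }
qed

lemma tangent_preserving_TnF: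
  assumes C: "pre_tangent_category C" and D: "pre_tangent_category D" and F: "tangent_preserving C D F"
    and f: "f \<in> Arr C" and n: "1 \<le> n"
  shows "FA F (FA (TnF C n) f) = FA (TnF D n) (FA F f)"
proof -
  interpret C: pre_tangent_category C by fact
  interpret D: pre_tangent_category D by fact
  note F_simps = functor_simps[OF tangent_preserving_functor[OF F]] tangent_preserving_simps[OF F]
  have "pr D n i (FO F (Cod C f)) \<cdot>\<^bsub>D\<^esub> FA F (FA (TnF C n) f) = FA F (TA C f \<cdot>\<^bsub>C\<^esub> pr C n i (Dom C f))"
    if "i < n" for i
    using f n that arg_cong[OF C.TnF_simps(4)[OF f that refl], of "FA F"]
    by (simp add: F_simps del: C.TnF_simps(4))
  then show ?thesis
    using f n by - (rule D.Tn_eqI[where A = "FO F (Cod C f)" and n = n], simp_all add: F_simps)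
qed

section \<open>Tangent structures detected by evaluations\<close>

text \<open>The typing of the data of a tangent category, without any of its laws.\<close>

locale tangent_structure = category C for C :: "('o, 'm, 'x) tcat_scheme" (structure) +
  assumes TO_typ: "A \<in> Obj C \<Longrightarrow> TO C A \<in> Obj C"
    and TA_typ: "f \<in> Arr C \<Longrightarrow> TA C f \<in> Homs C (TO C (Dom C f)) (TO C (Cod C f))"
    and p_typ: "A \<in> Obj C \<Longrightarrow> pT C A \<in> Homs C (TO C A) A"
    and z_typ: "A \<in> Obj C \<Longrightarrow> zT C A \<in> Homs C A (TO C A)"
    and s_typ: "A \<in> Obj C \<Longrightarrow> sT C A \<in> Homs C (Tn C 2 A) (TO C A)"
    and l_typ: "A \<in> Obj C \<Longrightarrow> lT C A \<in> Homs C (TO C A) (TO C (TO C A))"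
    and c_typ: "A \<in> Obj C \<Longrightarrow> cT C A \<in> Homs C (TO C (TO C A)) (TO C (TO C A))"
    and Tn_typ: "\<lbrakk>A \<in> Obj C; 1 \<le> n\<rbrakk> \<Longrightarrow> Tn C n A \<in> Obj C"
    and pr_typ: "\<lbrakk>A \<in> Obj C; i < n\<rbrakk> \<Longrightarrow> pr C n i A \<in> Homs C (Tn C n A) (TO C A)"
begin

lemma typ_simps [simp]:
  "A \<in> Obj C \<Longrightarrow> TO C A \<in> Obj C"
  "f \<in> Arr C \<Longrightarrow> TA C f \<in> Arr C" "f \<in> Arr C \<Longrightarrow> Dom C (TA C f) = TO C (Dom C f)"
  "f \<in> Arr C \<Longrightarrow> Cod C (TA C f) = TO C (Cod C f)"
  "A \<in> Obj C \<Longrightarrow> pT C A \<in> Arr C" "A \<in> Obj C \<Longrightarrow> Dom C (pT C A) = TO C A" "A \<in> Obj C \<Longrightarrow> Cod C (pT C A) = A"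
  "A \<in> Obj C \<Longrightarrow> zT C A \<in> Arr C" "A \<in> Obj C \<Longrightarrow> Dom C (zT C A) = A" "A \<in> Obj C \<Longrightarrow> Cod C (zT C A) = TO C A"
  "A \<in> Obj C \<Longrightarrow> sT C A \<in> Arr C" "A \<in> Obj C \<Longrightarrow> Dom C (sT C A) = Tn C 2 A"
  "A \<in> Obj C \<Longrightarrow> Cod C (sT C A) = TO C A"
  "A \<in> Obj C \<Longrightarrow> lT C A \<in> Arr C" "A \<in> Obj C \<Longrightarrow> Dom C (lT C A) = TO C A"
  "A \<in> Obj C \<Longrightarrow> Cod C (lT C A) = TO C (TO C A)"
  "A \<in> Obj C \<Longrightarrow> cT C A \<in> Arr C" "A \<in> Obj C \<Longrightarrow> Dom C (cT C A) = TO C (TO C A)"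
  "A \<in> Obj C \<Longrightarrow> Cod C (cT C A) = TO C (TO C A)"
  "\<lbrakk>A \<in> Obj C; 1 \<le> n\<rbrakk> \<Longrightarrow> Tn C n A \<in> Obj C"
  "\<lbrakk>A \<in> Obj C; i < n\<rbrakk> \<Longrightarrow> pr C n i A \<in> Arr C"
  "\<lbrakk>A \<in> Obj C; i < n\<rbrakk> \<Longrightarrow> Dom C (pr C n i A) = Tn C n A"
  "\<lbrakk>A \<in> Obj C; i < n\<rbrakk> \<Longrightarrow> Cod C (pr C n i A) = TO C A"
  using TO_typ TA_typ p_typ z_typ s_typ l_typ c_typ Tn_typ pr_typ by auto

lemma pow_TO [simp]: "A \<in> Obj C \<Longrightarrow> ((FO (Tan C)) ^^ m) A \<in> Obj C"
  by (induction m) auto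

lemma pow_TA [simp]:
  "f \<in> Arr C \<Longrightarrow> ((FA (Tan C)) ^^ m) f \<in> Arr C"
  "f \<in> Arr C \<Longrightarrow> Dom C (((FA (Tan C)) ^^ m) f) = ((FO (Tan C)) ^^ m) (Dom C f)"
  "f \<in> Arr C \<Longrightarrow> Cod C (((FA (Tan C)) ^^ m) f) = ((FO (Tan C)) ^^ m) (Cod C f)"
proof -
  have "((FA (Tan C)) ^^ m) f \<in> Arr C \<and> Dom C (((FA (Tan C)) ^^ m) f) = ((FO (Tan C)) ^^ m) (Dom C f) \<and>
    Cod C (((FA (Tan C)) ^^ m) f) = ((FO (Tan C)) ^^ m) (Cod C f)" if "f \<in> Arr C"
    using that by (induction m) auto
  then show "f \<in> Arr C \<Longrightarrow> ((FA (Tan C)) ^^ m) f \<in> Arr C"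
    "f \<in> Arr C \<Longrightarrow> Dom C (((FA (Tan C)) ^^ m) f) = ((FO (Tan C)) ^^ m) (Dom C f)"
    "f \<in> Arr C \<Longrightarrow> Cod C (((FA (Tan C)) ^^ m) f) = ((FO (Tan C)) ^^ m) (Cod C f)" by auto
qed

lemma evaluate_npullback:
  fixes m n :: nat
  assumes D: "tangent_category D" and F: "tangent_preserving C D F" and A: "A \<in> Obj C" and n: "1 \<le> n"
  defines "q \<equiv> ((FA (Tan C)) ^^ m) (pT C A)" and "P \<equiv> ((FO (Tan C)) ^^ m) (Tn C n A)"
    and "\<pi> \<equiv> \<lambda>i. ((FA (Tan C)) ^^ m) (pr C n i A)"
  shows "is_npullback D n (FA F q) (FO F P) (\<lambda>i. FA F (\<pi> i))"
    "stably_monic D (FO F P) {..<n} (\<lambda>i. FA F (\<pi> i))"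
proof -
  interpret D: tangent_category D by fact
  note F_simps = functor_simps[OF tangent_preserving_functor[OF F]] tangent_preserving_simps[OF F]
    tangent_preserving_pow_FO[OF F, of _ m] tangent_preserving_pow_FA[OF F, of _ m]
  have FA: "FO F A \<in> Obj D" using A by (simp add: F_simps)
  have eqs: "FA F q = ((FA (Tan D)) ^^ m) (pT D (FO F A))"
    "FO F P = ((FO (Tan D)) ^^ m) (Tn D n (FO F A))"
    "\<And>i. i < n \<Longrightarrow> FA F (\<pi> i) = ((FA (Tan D)) ^^ m) (pr D n i (FO F A))"
    unfolding q_def P_def \<pi>_def using A n by (simp_all add: F_simps)
  show "is_npullback D n (FA F q) (FO F P) (\<lambda>i. FA F (\<pi> i))"
    unfolding eqs(1,2) by (subst is_npullback_cong[OF eqs(3)], assumption, rule D.T_npullback[OF FA n])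
  show "stably_monic D (FO F P) {..<n} (\<lambda>i. FA F (\<pi> i))"
    unfolding eqs(2) by (subst stably_monic_cong[OF eqs(3)], simp, rule D.Tn_stably_monic[OF FA n])
qed

lemma evaluate_cone:
  fixes m n :: nat
  assumes D: "tangent_category D" and F: "tangent_preserving C D F" and A: "A \<in> Obj C" and n: "1 \<le> n"
  defines "q \<equiv> ((FA (Tan C)) ^^ m) (pT C A)" and "P \<equiv> ((FO (Tan C)) ^^ m) (Tn C n A)"
    and "\<pi> \<equiv> \<lambda>i. ((FA (Tan C)) ^^ m) (pr C n i A)"
  assumes X: "X \<in> Obj C" and g: "\<And>i. i < n \<Longrightarrow> g i \<in> Homs C X (Dom C q)"
    and eq: "\<And>i j. i < n \<Longrightarrow> j < n \<Longrightarrow> q \<cdot> g i = q \<cdot> g j"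
  shows "\<exists>v\<in>Homs D (FO F X) (FO F P). \<forall>i\<in>{..<n}. FA F (\<pi> i) \<cdot>\<^bsub>D\<^esub> v = FA F (g i)"
proof -
  interpret D: tangent_category D by fact
  note F_simps = functor_simps[OF tangent_preserving_functor[OF F]]
  have np: "is_npullback D n (FA F q) (FO F P) (\<lambda>i. FA F (\<pi> i))"
    unfolding q_def P_def \<pi>_def by (rule evaluate_npullback(1)[OF D F A n])
  have q: "q \<in> Arr C" using A by (simp add: q_def)
  have eq': "FA F q \<cdot>\<^bsub>D\<^esub> FA F (g i) = FA F q \<cdot>\<^bsub>D\<^esub> FA F (g j)" if "i < n" "j < n" for i j
    using arg_cong[OF eq[OF that], of "FA F"] g[OF that(1)] g[OF that(2)] q by (simp add: F_simps)
  have "\<exists>!v. v \<in> Homs D (FO F X) (FO F P) \<and> (\<forall>i<n. FA F (\<pi> i) \<cdot>\<^bsub>D\<^esub> v = FA F (g i))"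
  proof (rule D.npullbackD(7)[OF np])
    show "FO F X \<in> Obj D" using X by (simp add: F_simps)
    show "FA F (g i) \<in> Homs D (FO F X) (Dom D (FA F q))" if "i < n" for i
      using g[OF that] q by (simp add: F_simps)
  qed (rule eq')
  then show ?thesis by blast
qed

end

text \<open>The functor \<open>F\<close> takes the vertical lift square to the one at \<open>F A\<close>, which is a pullback with stably
  monic legs.\<close>

lemma evaluate_lift:
  assumes C: "pre_tangent_category C" and str: "tangent_structure C"
    and D: "tangent_category D" and F: "tangent_preserving C D F" and A: "A \<in> Obj C"
    and z: "FA F (zT C A) = zT D (FO F A)"
    and zl: "TA C (pT C A) \<cdot>\<^bsub>C\<^esub> (zT C (TO C A) \<cdot>\<^bsub>C\<^esub> pr C 2 0 A) = TA C (pT C A) \<cdot>\<^bsub>C\<^esub> (lT C A \<cdot>\<^bsub>C\<^esub> pr C 2 1 A)"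
  defines "a \<equiv> pT C A \<cdot>\<^bsub>C\<^esub> pr C 2 0 A"
    and "b \<equiv> TA C (sT C A) \<cdot>\<^bsub>C\<^esub> TT2pair C (Tn C 2 A) A (zT C (TO C A) \<cdot>\<^bsub>C\<^esub> pr C 2 0 A) (lT C A \<cdot>\<^bsub>C\<^esub> pr C 2 1 A)"
  shows "is_pullback D (zT D (FO F A)) (TA D (pT D (FO F A))) (FO F (Tn C 2 A)) (FA F a) (FA F b)"
    "stably_monic D (FO F (Tn C 2 A)) {0, 1} (\<lambda>i. FA F (two a b i))"
proof -
  interpret C: pre_tangent_category C by fact
  interpret C: tangent_structure C by fact
  interpret D: tangent_category D by fact
  note F_simps = functor_simps[OF tangent_preserving_functor[OF F]] tangent_preserving_simps[OF F]
    tangent_preserving_T2pair[OF C D.pre_tangent_category_axioms F]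
  have FA: "FO F A \<in> Obj D" using A by (simp add: F_simps)
  have ab: "FA F a = pT D (FO F A) \<cdot>\<^bsub>D\<^esub> pr D 2 0 (FO F A)" "FA F b = D.vlift (FO F A)"
    unfolding a_def b_def D.vlift_def using A zl by (simp_all add: F_simps)
  show "is_pullback D (zT D (FO F A)) (TA D (pT D (FO F A))) (FO F (Tn C 2 A)) (FA F a) (FA F b)"
    using D.l_universal[OF FA] A unfolding ab D.vlift_def by (simp add: F_simps)
  have "(\<lambda>i. FA F (two a b i)) = two (pT D (FO F A) \<cdot>\<^bsub>D\<^esub> pr D 2 0 (FO F A)) (D.vlift (FO F A))"
    using ab by auto
  then show "stably_monic D (FO F (Tn C 2 A)) {0, 1} (\<lambda>i. FA F (two a b i))"
    using D.vlift_stably_monic[OF FA] A by (simp add: F_simps)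
qed

text \<open>Two families, since the evaluations of a hom-category of fibrations have two targets. The assumption
  \<open>lift\<close> is the only one about limits: a cone \<open>\<gamma>\<close> that factors through \<open>\<pi>\<close> in every component does so
  globally if the components of \<open>\<pi>\<close> are stably monic.\<close>

locale tangent_evaluations = tangent_structure C + D: tangent_category D + E: tangent_category E
  for C :: "('o, 'm, 'x) tcat_scheme" (structure)
    and D :: "('o1, 'm1, 'y) tcat_scheme" and E :: "('o2, 'm2, 'w) tcat_scheme" +
  fixes I :: "('o, 'm, 'o1, 'm1) ftr set" and J :: "('o, 'm, 'o2, 'm2) ftr set"
  assumes I: "F \<in> I \<Longrightarrow> tangent_preserving C D F"
    and J: "G \<in> J \<Longrightarrow> tangent_preserving C E G"
    and faithful: "\<lbrakk>f \<in> Arr C; g \<in> Arr C; Dom C f = Dom C g; Cod C f = Cod C g;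
      \<And>F. F \<in> I \<Longrightarrow> FA F f = FA F g; \<And>G. G \<in> J \<Longrightarrow> FA G f = FA G g\<rbrakk> \<Longrightarrow> f = g"
    and lift: "\<lbrakk>X \<in> Obj C; P \<in> Obj C;
      \<And>i :: nat. i \<in> K \<Longrightarrow> \<pi> i \<in> Arr C \<and> Dom C (\<pi> i) = P;
      \<And>i. i \<in> K \<Longrightarrow> \<gamma> i \<in> Arr C \<and> Dom C (\<gamma> i) = X \<and> Cod C (\<gamma> i) = Cod C (\<pi> i);
      \<And>F. F \<in> I \<Longrightarrow> stably_monic D (FO F P) K (\<lambda>i. FA F (\<pi> i)) \<and>
        (\<exists>v\<in>Homs D (FO F X) (FO F P). \<forall>i\<in>K. FA F (\<pi> i) \<cdot>\<^bsub>D\<^esub> v = FA F (\<gamma> i));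
      \<And>G. G \<in> J \<Longrightarrow> stably_monic E (FO G P) K (\<lambda>i. FA G (\<pi> i)) \<and>
        (\<exists>v\<in>Homs E (FO G X) (FO G P). \<forall>i\<in>K. FA G (\<pi> i) \<cdot>\<^bsub>E\<^esub> v = FA G (\<gamma> i))\<rbrakk>
      \<Longrightarrow> \<exists>u\<in>Homs C X P. \<forall>i\<in>K. \<pi> i \<cdot> u = \<gamma> i"
begin

lemma I_simps [simp]:
  assumes "F \<in> I"
  shows "A \<in> Obj C \<Longrightarrow> FO F A \<in> Obj D"
    "f \<in> Arr C \<Longrightarrow> FA F f \<in> Arr D"
    "f \<in> Arr C \<Longrightarrow> Dom D (FA F f) = FO F (Dom C f)"
    "f \<in> Arr C \<Longrightarrow> Cod D (FA F f) = FO F (Cod C f)"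
    "A \<in> Obj C \<Longrightarrow> FA F (Id C A) = Id D (FO F A)"
    "\<lbrakk>f \<in> Arr C; g \<in> Arr C; Cod C f = Dom C g\<rbrakk> \<Longrightarrow> FA F (g \<cdot>\<^bsub>C\<^esub> f) = FA F g \<cdot>\<^bsub>D\<^esub> FA F f"
    "A \<in> Obj C \<Longrightarrow> FO F (TO C A) = TO D (FO F A)"
    "f \<in> Arr C \<Longrightarrow> FA F (TA C f) = TA D (FA F f)"
    "A \<in> Obj C \<Longrightarrow> FA F (pT C A) = pT D (FO F A)"
    "A \<in> Obj C \<Longrightarrow> FA F (zT C A) = zT D (FO F A)"
    "A \<in> Obj C \<Longrightarrow> FA F (sT C A) = sT D (FO F A)"
    "A \<in> Obj C \<Longrightarrow> FA F (lT C A) = lT D (FO F A)"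
    "A \<in> Obj C \<Longrightarrow> FA F (cT C A) = cT D (FO F A)"
    "\<lbrakk>A \<in> Obj C; 1 \<le> n\<rbrakk> \<Longrightarrow> FO F (Tn C n A) = Tn D n (FO F A)"
    "\<lbrakk>A \<in> Obj C; i < n\<rbrakk> \<Longrightarrow> FA F (pr C n i A) = pr D n i (FO F A)"
  using functor_simps[OF tangent_preserving_functor[OF I[OF assms]]]
    tangent_preserving_simps[OF I[OF assms]] by auto

lemma J_simps [simp]:
  assumes "F \<in> J"
  shows "A \<in> Obj C \<Longrightarrow> FO F A \<in> Obj E"
    "f \<in> Arr C \<Longrightarrow> FA F f \<in> Arr E"
    "f \<in> Arr C \<Longrightarrow> Dom E (FA F f) = FO F (Dom C f)"
    "f \<in> Arr C \<Longrightarrow> Cod E (FA F f) = FO F (Cod C f)"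
    "A \<in> Obj C \<Longrightarrow> FA F (Id C A) = Id E (FO F A)"
    "\<lbrakk>f \<in> Arr C; g \<in> Arr C; Cod C f = Dom C g\<rbrakk> \<Longrightarrow> FA F (g \<cdot>\<^bsub>C\<^esub> f) = FA F g \<cdot>\<^bsub>E\<^esub> FA F f"
    "A \<in> Obj C \<Longrightarrow> FO F (TO C A) = TO E (FO F A)"
    "f \<in> Arr C \<Longrightarrow> FA F (TA C f) = TA E (FA F f)"
    "A \<in> Obj C \<Longrightarrow> FA F (pT C A) = pT E (FO F A)"
    "A \<in> Obj C \<Longrightarrow> FA F (zT C A) = zT E (FO F A)"
    "A \<in> Obj C \<Longrightarrow> FA F (sT C A) = sT E (FO F A)"
    "A \<in> Obj C \<Longrightarrow> FA F (lT C A) = lT E (FO F A)"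
    "A \<in> Obj C \<Longrightarrow> FA F (cT C A) = cT E (FO F A)"
    "\<lbrakk>A \<in> Obj C; 1 \<le> n\<rbrakk> \<Longrightarrow> FO F (Tn C n A) = Tn E n (FO F A)"
    "\<lbrakk>A \<in> Obj C; i < n\<rbrakk> \<Longrightarrow> FA F (pr C n i A) = pr E n i (FO F A)"
  using functor_simps[OF tangent_preserving_functor[OF J[OF assms]]]
    tangent_preserving_simps[OF J[OF assms]] by auto

lemma evaluate_comp_cong:
  "\<lbrakk>F \<in> I; a \<cdot> u = a \<cdot> v; a \<in> Arr C; u \<in> Arr C; v \<in> Arr C; Cod C u = Dom C a; Cod C v = Dom C a\<rbrakk>
    \<Longrightarrow> FA F a \<cdot>\<^bsub>D\<^esub> FA F u = FA F a \<cdot>\<^bsub>D\<^esub> FA F v"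
  "\<lbrakk>G \<in> J; a \<cdot> u = a \<cdot> v; a \<in> Arr C; u \<in> Arr C; v \<in> Arr C; Cod C u = Dom C a; Cod C v = Dom C a\<rbrakk>
    \<Longrightarrow> FA G a \<cdot>\<^bsub>E\<^esub> FA G u = FA G a \<cdot>\<^bsub>E\<^esub> FA G v"
  by (simp_all flip: I_simps(6) J_simps(6))

lemma Tan_is_functor: "is_functor C C (Tan C)"
  unfolding is_functor_def
proof (intro conjI ballI impI)
  fix A assume "A \<in> Obj C"
  then show "TA C (Id C A) = Id C (TO C A)" by - (rule faithful, simp_all)
next
  fix f g assume "f \<in> Arr C" "g \<in> Arr C" "Cod C f = Dom C g"
  then show "TA C (g \<cdot> f) = TA C g \<cdot> TA C f" by - (rule faithful, simp_all)
qed simp_all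

lemma p_is_natural: "nat_trans C C (Tan C) ftr_id (pT C)"
  unfolding nat_trans_def ftr_id_def
proof (intro conjI ballI; simp)
  fix f assume "f \<in> Arr C"
  then show "pT C (Cod C f) \<cdot> TA C f = f \<cdot> pT C (Dom C f)"
    by - (rule faithful, simp_all add: D.p_nat_simp E.p_nat_simp)
qed

text \<open>Existence of the mediating arrow is \<open>lift\<close>, applied to the mediating arrows of the evaluated
  pullbacks; uniqueness is joint faithfulness.\<close>

lemma Tan_is_npullback:
  assumes A: "A \<in> Obj C" and n: "1 \<le> n"
  shows "is_npullback C n (((FA (Tan C)) ^^ m) (pT C A)) (((FO (Tan C)) ^^ m) (Tn C n A))
    (\<lambda>i. ((FA (Tan C)) ^^ m) (pr C n i A))" (is "is_npullback C n ?q ?P ?\<pi>")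
  unfolding is_npullback_def
proof (intro conjI allI impI ballI)
  have ty: "?q \<in> Arr C" "Dom C ?q = ((FO (Tan C)) ^^ m) (TO C A)" "?P \<in> Obj C"
    "\<And>i. i < n \<Longrightarrow> ?\<pi> i \<in> Arr C" "\<And>i. i < n \<Longrightarrow> Dom C (?\<pi> i) = ?P"
    "\<And>i. i < n \<Longrightarrow> Cod C (?\<pi> i) = Dom C ?q"
    using A n by simp_all
  show "?q \<in> Arr C" "?P \<in> Obj C" "\<And>i. i < n \<Longrightarrow> ?\<pi> i \<in> Homs C ?P (Dom C ?q)"
    using ty by simp_all
  note npI = evaluate_npullback(1)[OF D.tangent_category_axioms I A n, of _ m]
  note npJ = evaluate_npullback(1)[OF E.tangent_category_axioms J A n, of _ m]
  show "?q \<cdot> ?\<pi> i = ?q \<cdot> ?\<pi> j" if "i < n" "j < n" for i j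
  proof (rule faithful)
    show "FA F (?q \<cdot> ?\<pi> i) = FA F (?q \<cdot> ?\<pi> j)" if "F \<in> I" for F
      using D.npullbackD(6)[OF npI[OF that] \<open>i < n\<close> \<open>j < n\<close>] ty \<open>i < n\<close> \<open>j < n\<close> that
      by (simp del: pow_TA)
    show "FA F (?q \<cdot> ?\<pi> i) = FA F (?q \<cdot> ?\<pi> j)" if "F \<in> J" for F
      using E.npullbackD(6)[OF npJ[OF that] \<open>i < n\<close> \<open>j < n\<close>] ty \<open>i < n\<close> \<open>j < n\<close> that
      by (simp del: pow_TA)
  qed (use ty that in \<open>simp_all del: pow_TA\<close>)
  fix X g assume X: "X \<in> Obj C" and g: "\<forall>i<n. g i \<in> Homs C X (Dom C ?q)"
    and eq: "\<forall>i<n. \<forall>j<n. ?q \<cdot> g i = ?q \<cdot> g j"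
  have "\<exists>u\<in>Homs C X ?P. \<forall>i\<in>{..<n}. ?\<pi> i \<cdot> u = g i"
  proof (rule lift[OF X ty(3)])
    show "stably_monic D (FO F ?P) {..<n} (\<lambda>i. FA F (?\<pi> i)) \<and>
      (\<exists>v\<in>Homs D (FO F X) (FO F ?P). \<forall>i\<in>{..<n}. FA F (?\<pi> i) \<cdot>\<^bsub>D\<^esub> v = FA F (g i))" if "F \<in> I" for F
      by (intro conjI evaluate_npullback(2)[OF D.tangent_category_axioms I[OF that] A n]
          evaluate_cone[OF D.tangent_category_axioms I[OF that] A n X])
        (use g eq in blast)+
    show "stably_monic E (FO F ?P) {..<n} (\<lambda>i. FA F (?\<pi> i)) \<and>
      (\<exists>v\<in>Homs E (FO F X) (FO F ?P). \<forall>i\<in>{..<n}. FA F (?\<pi> i) \<cdot>\<^bsub>E\<^esub> v = FA F (g i))" if "F \<in> J" for F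
      by (intro conjI evaluate_npullback(2)[OF E.tangent_category_axioms J[OF that] A n]
          evaluate_cone[OF E.tangent_category_axioms J[OF that] A n X])
        (use g eq in blast)+
  qed (use ty g in \<open>simp_all del: pow_TA\<close>)
  then obtain u where u: "u \<in> Homs C X ?P" "\<And>i. i < n \<Longrightarrow> ?\<pi> i \<cdot> u = g i" by auto
  show "\<exists>!u. u \<in> Homs C X ?P \<and> (\<forall>i<n. ?\<pi> i \<cdot> u = g i)"
  proof (rule ex1I[of _ u])
    fix v assume v: "v \<in> Homs C X ?P \<and> (\<forall>i<n. ?\<pi> i \<cdot> v = g i)"
    then have vi: "?\<pi> i \<cdot> v = ?\<pi> i \<cdot> u" if "i < n" for i using u(2)[OF that] that by metis
    show "v = u"
    proof (rule faithful)
      show "FA F v = FA F u" if F: "F \<in> I" for F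
      proof (rule D.npullback_eqI[OF npI[OF F]])
        show "FA F (?\<pi> i) \<cdot>\<^bsub>D\<^esub> FA F v = FA F (?\<pi> i) \<cdot>\<^bsub>D\<^esub> FA F u" if "i < n" for i
          using arg_cong[OF vi[OF that], of "FA F"] v u(1) ty(4-6)[OF that] F by (simp del: pow_TA)
      qed (use v u(1) F in simp_all)
      show "FA F v = FA F u" if F: "F \<in> J" for F
      proof (rule E.npullback_eqI[OF npJ[OF F]])
        show "FA F (?\<pi> i) \<cdot>\<^bsub>E\<^esub> FA F v = FA F (?\<pi> i) \<cdot>\<^bsub>E\<^esub> FA F u" if "i < n" for i
          using arg_cong[OF vi[OF that], of "FA F"] v u(1) ty(4-6)[OF that] F by (simp del: pow_TA)
      qed (use v u(1) F in simp_all)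
    qed (use u v in simp_all)
  qed (use u in auto)
qed

lemma pre_tangent: "pre_tangent_category C"
  using Tan_is_functor p_is_natural Tan_is_npullback by unfold_locales

end

sublocale tangent_evaluations \<subseteq> pre_tangent_category C
  by (rule pre_tangent)

context tangent_evaluations
begin

lemma pairing_simps [simp]:
  assumes "A \<in> Obj C" "f \<in> Arr C" "g \<in> Arr C" "Dom C f = X" "Dom C g = X"
  shows "\<lbrakk>F \<in> I; Cod C f = TO C A; Cod C g = TO C A; pT C A \<cdot> f = pT C A \<cdot> g\<rbrakk>
      \<Longrightarrow> FA F (T2pair C X A f g) = T2pair D (FO F X) (FO F A) (FA F f) (FA F g)"
    "\<lbrakk>F \<in> I; Cod C f = TO C (TO C A); Cod C g = TO C (TO C A); TA C (pT C A) \<cdot> f = TA C (pT C A) \<cdot> g\<rbrakk>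
      \<Longrightarrow> FA F (TT2pair C X A f g) = TT2pair D (FO F X) (FO F A) (FA F f) (FA F g)"
    "\<lbrakk>G \<in> J; Cod C f = TO C A; Cod C g = TO C A; pT C A \<cdot> f = pT C A \<cdot> g\<rbrakk>
      \<Longrightarrow> FA G (T2pair C X A f g) = T2pair E (FO G X) (FO G A) (FA G f) (FA G g)"
    "\<lbrakk>G \<in> J; Cod C f = TO C (TO C A); Cod C g = TO C (TO C A); TA C (pT C A) \<cdot> f = TA C (pT C A) \<cdot> g\<rbrakk>
      \<Longrightarrow> FA G (TT2pair C X A f g) = TT2pair E (FO G X) (FO G A) (FA G f) (FA G g)"
  using assms
  by (simp_all add: tangent_preserving_T2pair[OF pre_tangent D.pre_tangent_category_axioms I]
      tangent_preserving_T2pair[OF pre_tangent E.pre_tangent_category_axioms J])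

lemma TnF_evaluate [simp]:
  "\<lbrakk>F \<in> I; f \<in> Arr C; 1 \<le> n\<rbrakk> \<Longrightarrow> FA F (FA (TnF C n) f) = FA (TnF D n) (FA F f)"
  "\<lbrakk>G \<in> J; f \<in> Arr C; 1 \<le> n\<rbrakk> \<Longrightarrow> FA G (FA (TnF C n) f) = FA (TnF E n) (FA G f)"
  by (simp_all add: tangent_preserving_TnF[OF pre_tangent D.pre_tangent_category_axioms I]
      tangent_preserving_TnF[OF pre_tangent E.pre_tangent_category_axioms J])

text \<open>A pairing is meaningful only if its components agree over the base object. The following laws yield
  this agreement for the pairings in the remaining axioms.\<close>

lemma p_s': "A \<in> Obj C \<Longrightarrow> pT C A \<cdot> sT C A = pT C A \<cdot> pr C 2 0 A"
  by (rule faithful) (simp_all add: D.p_s E.p_s)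

lemma p_s'_x: "\<lbrakk>A \<in> Obj C; x \<in> Arr C; Cod C x = Tn C 2 A\<rbrakk>
  \<Longrightarrow> pT C A \<cdot> (sT C A \<cdot> x) = pT C A \<cdot> (pr C 2 0 A \<cdot> x)"
  using reassoc[OF p_s'[of A]] by simp

lemma p_z': "A \<in> Obj C \<Longrightarrow> pT C A \<cdot> zT C A = Id C A"
  by (rule faithful) (simp_all add: D.p_z E.p_z)

lemma p_z'_x: "\<lbrakk>A \<in> Obj C; x \<in> Arr C; Cod C x = A\<rbrakk> \<Longrightarrow> pT C A \<cdot> (zT C A \<cdot> x) = x"
  using reassoc[OF p_z'[of A]] by simp

lemma Tp_l': "A \<in> Obj C \<Longrightarrow> TA C (pT C A) \<cdot> lT C A = zT C A \<cdot> pT C A"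
  by (rule faithful) (simp_all add: D.l_p E.l_p)

lemma Tp_l'_x: "\<lbrakk>A \<in> Obj C; x \<in> Arr C; Cod C x = TO C A\<rbrakk>
  \<Longrightarrow> TA C (pT C A) \<cdot> (lT C A \<cdot> x) = zT C A \<cdot> (pT C A \<cdot> x)"
  using reassoc[OF Tp_l'[of A]] by simp

lemma p_c': "A \<in> Obj C \<Longrightarrow> pT C (TO C A) \<cdot> cT C A = TA C (pT C A)"
  by (rule faithful) (simp_all add: D.c_p E.c_p)

lemma p_c'_x: "\<lbrakk>A \<in> Obj C; x \<in> Arr C; Cod C x = TO C (TO C A)\<rbrakk>
  \<Longrightarrow> pT C (TO C A) \<cdot> (cT C A \<cdot> x) = TA C (pT C A) \<cdot> x"
  using reassoc[OF p_c'[of A]] by simp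

lemma Tp_z': "A \<in> Obj C \<Longrightarrow> TA C (pT C A) \<cdot> zT C (TO C A) = zT C A \<cdot> pT C A"
  by (rule faithful) (simp_all add: D.z_nat_simp E.z_nat_simp)

lemma Tp_z'_x: "\<lbrakk>A \<in> Obj C; x \<in> Arr C; Cod C x = TO C A\<rbrakk>
  \<Longrightarrow> TA C (pT C A) \<cdot> (zT C (TO C A) \<cdot> x) = zT C A \<cdot> (pT C A \<cdot> x)"
  using reassoc[OF Tp_z'[of A]] by simp

lemmas compat_laws = p_s' p_s'_x p_z' p_z'_x Tp_l' Tp_l'_x p_c' p_c'_x Tp_z' Tp_z'_x

text \<open>As for the tangent pullbacks; the evaluated legs are stably monic by \<open>vlift_stably_monic\<close>.\<close>

lemma l_is_universal:
  assumes A: "A \<in> Obj C"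
  shows "is_pullback C (zT C A) (TA C (pT C A)) (Tn C 2 A)
        (pT C A \<cdot> pr C 2 0 A)
        (TA C (sT C A) \<cdot> TT2pair C (Tn C 2 A) A
            (zT C (TO C A) \<cdot> pr C 2 0 A) (lT C A \<cdot> pr C 2 1 A))" (is "is_pullback C ?f ?g ?P ?a ?b")
  unfolding is_pullback_def
proof (intro conjI allI impI ballI)
  have zl: "TA C (pT C A) \<cdot> (zT C (TO C A) \<cdot> pr C 2 0 A) = TA C (pT C A) \<cdot> (lT C A \<cdot> pr C 2 1 A)"
    using A by (simp add: compat_laws)
  have ty: "?f \<in> Arr C" "?g \<in> Arr C" "Cod C ?f = Cod C ?g" "?a \<in> Arr C" "Dom C ?a = ?P"
    "Cod C ?a = Dom C ?f" "?b \<in> Arr C" "Dom C ?b = ?P" "Cod C ?b = Dom C ?g" "Dom C ?f = A"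
    "Dom C ?g = TO C (TO C A)" "?P \<in> Obj C"
    using A zl by simp_all
  show "?f \<in> Arr C" "?g \<in> Arr C" "Cod C ?f = Cod C ?g" "?a \<in> Homs C ?P (Dom C ?f)"
    "?b \<in> Homs C ?P (Dom C ?g)" using ty by simp_all
  note evI = evaluate_lift[OF pre_tangent tangent_structure_axioms D.tangent_category_axioms I A _ zl]
  note evJ = evaluate_lift[OF pre_tangent tangent_structure_axioms E.tangent_category_axioms J A _ zl]
  show comm: "?f \<cdot> ?a = ?g \<cdot> ?b"
  proof (rule faithful)
    show "FA F (?f \<cdot> ?a) = FA F (?g \<cdot> ?b)" if "F \<in> I" for F
      using evI(1)[OF that] that A ty unfolding is_pullback_def
      by (simp del: pairing_simps TT2pair_simps assoc)
    show "FA F (?f \<cdot> ?a) = FA F (?g \<cdot> ?b)" if "F \<in> J" for F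
      using evJ(1)[OF that] that A ty unfolding is_pullback_def
      by (simp del: pairing_simps TT2pair_simps assoc)
  qed (use ty in simp_all)
  fix X h k assume h: "h \<in> Homs C X (Dom C ?f)" and k: "k \<in> Homs C X (Dom C ?g)"
    and eq: "?f \<cdot> h = ?g \<cdot> k"
  have X: "X \<in> Obj C" using h by auto
  have "\<exists>u\<in>Homs C X ?P. \<forall>i\<in>{0, 1::nat}. two ?a ?b i \<cdot> u = two h k i"
  proof (rule lift[OF X ty(12)])
    show "stably_monic D (FO F ?P) {0, 1::nat} (\<lambda>i. FA F (two ?a ?b i)) \<and>
      (\<exists>v\<in>Homs D (FO F X) (FO F ?P). \<forall>i\<in>{0, 1::nat}. FA F (two ?a ?b i) \<cdot>\<^bsub>D\<^esub> v = FA F (two h k i))"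
      if F: "F \<in> I" for F
    proof
      have "zT D (FO F A) \<cdot>\<^bsub>D\<^esub> FA F h = TA D (pT D (FO F A)) \<cdot>\<^bsub>D\<^esub> FA F k"
        using arg_cong[OF eq, of "FA F"] h k A F by simp
      then have "\<exists>!u. u \<in> Homs D (FO F X) (FO F ?P) \<and> FA F ?a \<cdot>\<^bsub>D\<^esub> u = FA F h \<and> FA F ?b \<cdot>\<^bsub>D\<^esub> u = FA F k"
        using evI(1)[OF F] h k A F unfolding is_pullback_def
        by (simp del: pairing_simps TT2pair_simps assoc I_simps(6))
      then show "\<exists>v\<in>Homs D (FO F X) (FO F ?P). \<forall>i\<in>{0, 1::nat}. FA F (two ?a ?b i) \<cdot>\<^bsub>D\<^esub> v = FA F (two h k i)"
        by (auto simp del: pairing_simps TT2pair_simps assoc I_simps in_Homs_iff)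
    qed (use evI(2)[OF F] F A in simp)
    show "stably_monic E (FO F ?P) {0, 1::nat} (\<lambda>i. FA F (two ?a ?b i)) \<and>
      (\<exists>v\<in>Homs E (FO F X) (FO F ?P). \<forall>i\<in>{0, 1::nat}. FA F (two ?a ?b i) \<cdot>\<^bsub>E\<^esub> v = FA F (two h k i))"
      if F: "F \<in> J" for F
    proof
      have "zT E (FO F A) \<cdot>\<^bsub>E\<^esub> FA F h = TA E (pT E (FO F A)) \<cdot>\<^bsub>E\<^esub> FA F k"
        using arg_cong[OF eq, of "FA F"] h k A F by simp
      then have "\<exists>!u. u \<in> Homs E (FO F X) (FO F ?P) \<and> FA F ?a \<cdot>\<^bsub>E\<^esub> u = FA F h \<and> FA F ?b \<cdot>\<^bsub>E\<^esub> u = FA F k"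
        using evJ(1)[OF F] h k A F unfolding is_pullback_def
        by (simp del: pairing_simps TT2pair_simps assoc J_simps(6))
      then show "\<exists>v\<in>Homs E (FO F X) (FO F ?P). \<forall>i\<in>{0, 1::nat}. FA F (two ?a ?b i) \<cdot>\<^bsub>E\<^esub> v = FA F (two h k i)"
        by (auto simp del: pairing_simps TT2pair_simps assoc J_simps in_Homs_iff)
    qed (use evJ(2)[OF F] F A in simp)
  qed (use ty h k in \<open>auto simp del: TT2pair_simps\<close>)
  then obtain u where u: "u \<in> Homs C X ?P" "?a \<cdot> u = h" "?b \<cdot> u = k"
    by (auto simp del: TT2pair_simps assoc)
  show "\<exists>!u. u \<in> Homs C X ?P \<and> ?a \<cdot> u = h \<and> ?b \<cdot> u = k"
  proof (rule ex1I[of _ u])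
    fix v assume v: "v \<in> Homs C X ?P \<and> ?a \<cdot> v = h \<and> ?b \<cdot> v = k"
    then have vu: "?a \<cdot> v = ?a \<cdot> u" "?b \<cdot> v = ?b \<cdot> u" using u by metis+
    show "v = u"
    proof (rule faithful)
      show "FA F v = FA F u" if F: "F \<in> I" for F
      proof (rule D.pullback_eqI[OF evI(1)[OF F]])
        show "FA F ?a \<cdot>\<^bsub>D\<^esub> FA F v = FA F ?a \<cdot>\<^bsub>D\<^esub> FA F u"
          by (rule evaluate_comp_cong(1)[OF F vu(1) ty(4)]) (use ty v u(1) in simp_all)
        show "FA F ?b \<cdot>\<^bsub>D\<^esub> FA F v = FA F ?b \<cdot>\<^bsub>D\<^esub> FA F u"
          by (rule evaluate_comp_cong(1)[OF F vu(2) ty(7)]) (use ty v u(1) in simp_all)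
      qed (use v u(1) F A in simp_all)
      show "FA F v = FA F u" if F: "F \<in> J" for F
      proof (rule E.pullback_eqI[OF evJ(1)[OF F]])
        show "FA F ?a \<cdot>\<^bsub>E\<^esub> FA F v = FA F ?a \<cdot>\<^bsub>E\<^esub> FA F u"
          by (rule evaluate_comp_cong(2)[OF F vu(1) ty(4)]) (use ty v u(1) in simp_all)
        show "FA F ?b \<cdot>\<^bsub>E\<^esub> FA F v = FA F ?b \<cdot>\<^bsub>E\<^esub> FA F u"
          by (rule evaluate_comp_cong(2)[OF F vu(2) ty(7)]) (use ty v u(1) in simp_all)
      qed (use v u(1) F A in simp_all)
    qed (use u v in simp_all)
  qed (use u in auto)
qed

text \<open>Evaluations preserve both sides of each equational axiom, so faithfulness reduces it to the same
  axiom in the targets.\<close>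

theorem tangent_category_of_evaluations: "tangent_category C"
proof
  show "is_functor C C (Tan C)" by (rule Tan_is_functor)
  show "nat_trans C C (Tan C) ftr_id (pT C)" by (rule p_is_natural)
  show "nat_trans C C ftr_id (Tan C) (zT C)"
    unfolding nat_trans_def ftr_id_def
  proof (intro conjI ballI; simp?)
    fix f assume "f \<in> Arr C"
    then show "zT C (Cod C f) \<cdot> f = TA C f \<cdot> zT C (Dom C f)"
      by - (rule faithful, simp_all add: D.z_nat_simp E.z_nat_simp)
  qed
  show "nat_trans C C (TnF C 2) (Tan C) (sT C)"
    unfolding nat_trans_def
  proof (intro conjI ballI; simp?)
    fix f assume "f \<in> Arr C"
    then show "sT C (Cod C f) \<cdot> FA (TnF C 2) f = TA C f \<cdot> sT C (Dom C f)"
      by - (rule faithful, simp_all add: D.s_nat_simp E.s_nat_simp)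
  qed
  show "nat_trans C C (Tan C) (Tan C \<odot> Tan C) (lT C)"
    unfolding nat_trans_def ftr_comp_def
  proof (intro conjI ballI; simp?)
    fix f assume "f \<in> Arr C"
    then show "lT C (Cod C f) \<cdot> TA C f = TA C (TA C f) \<cdot> lT C (Dom C f)"
      by - (rule faithful, simp_all add: D.l_nat_simp E.l_nat_simp)
  qed
  show "nat_trans C C (Tan C \<odot> Tan C) (Tan C \<odot> Tan C) (cT C)"
    unfolding nat_trans_def ftr_comp_def
  proof (intro conjI ballI; simp?)
    fix f assume "f \<in> Arr C"
    then show "cT C (Cod C f) \<cdot> TA C (TA C f) = TA C (TA C f) \<cdot> cT C (Dom C f)"
      by - (rule faithful, simp_all add: D.c_nat_simp E.c_nat_simp)
  qed
next
  fix A assume A: "A \<in> Obj C"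
  have ev: "\<And>F. F \<in> I \<Longrightarrow> FO F A \<in> Obj D" "\<And>G. G \<in> J \<Longrightarrow> FO G A \<in> Obj E" using A by simp_all
  have zl: "TA C (pT C A) \<cdot> (lT C A \<cdot> pr C 2 0 A) = TA C (pT C A) \<cdot> (lT C A \<cdot> pr C 2 1 A)"
    using A by (simp add: compat_laws)
  have s3: "pT C A \<cdot> (pr C 3 i A \<cdot> x) = pT C A \<cdot> (pr C 3 j A \<cdot> x)"
    if "x \<in> Arr C" "Cod C x = Tn C 3 A" "i < 3" "j < 3" for x i j
    using reassoc[OF p_pr[of A i 3 j], of x] A that by simp
  show "is_npullback C n (((FA (Tan C)) ^^ m) (pT C A)) (((FO (Tan C)) ^^ m) (Tn C n A))
        (\<lambda>i. ((FA (Tan C)) ^^ m) (pr C n i A))" if "1 \<le> n" for n m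
    by (rule Tan_is_npullback[OF A that])
  show "pT C A \<cdot> zT C A = Id C A" using A by (rule p_z')
  show "pT C A \<cdot> sT C A = pT C A \<cdot> pr C 2 0 A" using A by (rule p_s')
  show "sT C A \<cdot> T2pair C (TO C A) A (zT C A \<cdot> pT C A) (Id C (TO C A)) = Id C (TO C A)"
    by (rule faithful) (use A ev D.s_unit E.s_unit in \<open>simp_all add: compat_laws\<close>)
  show "sT C A \<cdot> T2pair C (Tn C 2 A) A (pr C 2 1 A) (pr C 2 0 A) = sT C A"
    by (rule faithful) (use A ev D.s_comm E.s_comm in \<open>simp_all add: compat_laws\<close>)
  show "sT C A \<cdot> T2pair C (Tn C 3 A) A
                 (sT C A \<cdot> T2pair C (Tn C 3 A) A (pr C 3 0 A) (pr C 3 1 A)) (pr C 3 2 A) =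
      sT C A \<cdot> T2pair C (Tn C 3 A) A
                 (pr C 3 0 A) (sT C A \<cdot> T2pair C (Tn C 3 A) A (pr C 3 1 A) (pr C 3 2 A))"
    by (rule faithful) (use A ev D.s_assoc E.s_assoc in \<open>simp_all add: compat_laws\<close>)
  show "TA C (pT C A) \<cdot> lT C A = zT C A \<cdot> pT C A" using A by (rule Tp_l')
  show "lT C A \<cdot> zT C A = TA C (zT C A) \<cdot> zT C A"
    by (rule faithful) (use A ev D.l_z E.l_z in \<open>simp_all\<close>)
  show "lT C A \<cdot> sT C A =
      TA C (sT C A) \<cdot> TT2pair C (Tn C 2 A) A (lT C A \<cdot> pr C 2 0 A) (lT C A \<cdot> pr C 2 1 A)"
    by (rule faithful) (use A ev D.l_s E.l_s zl in \<open>simp_all\<close>)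
  show "pT C (TO C A) \<cdot> cT C A = TA C (pT C A)" using A by (rule p_c')
  show "cT C A \<cdot> TA C (zT C A) = zT C (TO C A)"
    by (rule faithful) (use A ev D.c_z E.c_z in \<open>simp_all\<close>)
  show "cT C A \<cdot> TA C (sT C A) =
      sT C (TO C A) \<cdot> T2pair C (TO C (Tn C 2 A)) (TO C A)
                        (cT C A \<cdot> TA C (pr C 2 0 A)) (cT C A \<cdot> TA C (pr C 2 1 A))"
    by (rule faithful) (use A ev D.c_s E.c_s in \<open>simp_all add: compat_laws\<close>)
  show "TA C (lT C A) \<cdot> lT C A = lT C (TO C A) \<cdot> lT C A"
    by (rule faithful) (use A ev D.l_l E.l_l in \<open>simp_all\<close>)
  show "cT C A \<cdot> lT C A = lT C A"
    by (rule faithful) (use A ev D.c_l E.c_l in \<open>simp_all\<close>)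
  show "cT C (TO C A) \<cdot> TA C (cT C A) \<cdot> lT C (TO C A) = TA C (lT C A) \<cdot> cT C A"
    by (rule faithful) (use A ev D.c_c_l E.c_c_l in \<open>simp_all\<close>)
  show "cT C A \<cdot> cT C A = Id C (TO C (TO C A))"
    by (rule faithful) (use A ev D.c_c E.c_c in \<open>simp_all\<close>)
  show "TA C (cT C A) \<cdot> cT C (TO C A) \<cdot> TA C (cT C A) =
      cT C (TO C A) \<cdot> TA C (cT C A) \<cdot> cT C (TO C A)"
    by (rule faithful) (use A ev D.c_braid E.c_braid in \<open>simp_all\<close>)
  show "is_pullback C (zT C A) (TA C (pT C A)) (Tn C 2 A)
        (pT C A \<cdot> pr C 2 0 A)
        (TA C (sT C A) \<cdot> TT2pair C (Tn C 2 A) A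
            (zT C (TO C A) \<cdot> pr C 2 0 A) (lT C A \<cdot> pr C 2 1 A))"
    using A by (rule l_is_universal)
qed

end

lemma (in category) product_monic2: "is_product C A B P a b \<Longrightarrow> jointly_monic C P {0, 1} (two a b)"
  unfolding jointly_monic_def by (intro ballI impI, rule product_eqI) auto

lemma (in category) terminal_monic: "is_terminal C U \<Longrightarrow> jointly_monic C U {} \<pi>"
  unfolding jointly_monic_def by (auto intro: terminal_eqI)

context tangent_evaluations
begin

text \<open>The product cones must be stably monic to be lifted, and for that \<open>T\<close> must preserve them; hence the
  second conjuncts.\<close>

lemma product_of_evaluations:
  assumes ab: "a \<in> Arr C" "b \<in> Arr C" "Dom C a = P" "Dom C b = P" "Cod C a = A" "Cod C b = B"
    and pI: "\<And>F. F \<in> I \<Longrightarrow> is_product D (FO F A) (FO F B) (FO F P) (FA F a) (FA F b) \<and>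
      is_product D (TO D (FO F A)) (TO D (FO F B)) (TO D (FO F P)) (TA D (FA F a)) (TA D (FA F b))"
    and pJ: "\<And>F. F \<in> J \<Longrightarrow> is_product E (FO F A) (FO F B) (FO F P) (FA F a) (FA F b) \<and>
      is_product E (TO E (FO F A)) (TO E (FO F B)) (TO E (FO F P)) (TA E (FA F a)) (TA E (FA F b))"
  shows "is_product C A B P a b"
  unfolding is_product_def
proof (intro conjI allI ballI)
  show P: "P \<in> Obj C" "a \<in> Homs C P A" "b \<in> Homs C P B" using ab by auto
  fix X f g assume f: "f \<in> Homs C X A" and g: "g \<in> Homs C X B"
  have "\<exists>u\<in>Homs C X P. \<forall>i\<in>{0, 1::nat}. two a b i \<cdot> u = two f g i"
  proof (rule lift)
    fix F assume F: "F \<in> I"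
    have e: "(\<lambda>i. FA F (two a b i)) = two (FA F a) (FA F b)"
      "(\<lambda>i. TA D (two (FA F a) (FA F b) i)) = two (TA D (FA F a)) (TA D (FA F b))"
      by auto
    have "stably_monic D (FO F P) {0, 1::nat} (\<lambda>i. FA F (two a b i))"
      using D.product_monic2[OF conjunct1[OF pI[OF F]]] D.product_monic2[OF conjunct2[OF pI[OF F]]]
      unfolding stably_monic_def e by blast
    moreover
    have "\<exists>!v. v \<in> Homs D (FO F X) (FO F P) \<and> FA F a \<cdot>\<^bsub>D\<^esub> v = FA F f \<and> FA F b \<cdot>\<^bsub>D\<^esub> v = FA F g"
      using pI[OF F] f g F unfolding is_product_def by simp
    then have "\<exists>v\<in>Homs D (FO F X) (FO F P). \<forall>i\<in>{0, 1::nat}. FA F (two a b i) \<cdot>\<^bsub>D\<^esub> v = FA F (two f g i)"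
      by (simp del: in_Homs_iff) blast
    ultimately show "stably_monic D (FO F P) {0, 1::nat} (\<lambda>i. FA F (two a b i)) \<and>
      (\<exists>v\<in>Homs D (FO F X) (FO F P). \<forall>i\<in>{0, 1::nat}. FA F (two a b i) \<cdot>\<^bsub>D\<^esub> v = FA F (two f g i))" ..
  next
    fix F assume F: "F \<in> J"
    have e: "(\<lambda>i. FA F (two a b i)) = two (FA F a) (FA F b)"
      "(\<lambda>i. TA E (two (FA F a) (FA F b) i)) = two (TA E (FA F a)) (TA E (FA F b))"
      by auto
    have "stably_monic E (FO F P) {0, 1::nat} (\<lambda>i. FA F (two a b i))"
      using E.product_monic2[OF conjunct1[OF pJ[OF F]]] E.product_monic2[OF conjunct2[OF pJ[OF F]]]
      unfolding stably_monic_def e by blast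
    moreover
    have "\<exists>!v. v \<in> Homs E (FO F X) (FO F P) \<and> FA F a \<cdot>\<^bsub>E\<^esub> v = FA F f \<and> FA F b \<cdot>\<^bsub>E\<^esub> v = FA F g"
      using pJ[OF F] f g F unfolding is_product_def by simp
    then have "\<exists>v\<in>Homs E (FO F X) (FO F P). \<forall>i\<in>{0, 1::nat}. FA F (two a b i) \<cdot>\<^bsub>E\<^esub> v = FA F (two f g i)"
      by (simp del: in_Homs_iff) blast
    ultimately show "stably_monic E (FO F P) {0, 1::nat} (\<lambda>i. FA F (two a b i)) \<and>
      (\<exists>v\<in>Homs E (FO F X) (FO F P). \<forall>i\<in>{0, 1::nat}. FA F (two a b i) \<cdot>\<^bsub>E\<^esub> v = FA F (two f g i))" ..
  qed (use f g ab P in auto)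
  then obtain u where u: "u \<in> Homs C X P" "a \<cdot> u = f" "b \<cdot> u = g" by auto
  show "\<exists>!u. u \<in> Homs C X P \<and> a \<cdot> u = f \<and> b \<cdot> u = g"
  proof (rule ex1I[of _ u])
    fix v assume v: "v \<in> Homs C X P \<and> a \<cdot> v = f \<and> b \<cdot> v = g"
    then have vu: "a \<cdot> v = a \<cdot> u" "b \<cdot> v = b \<cdot> u" using u by simp_all
    show "v = u"
    proof (rule faithful)
      show "FA F v = FA F u" if F: "F \<in> I" for F
        by (rule D.product_eqI[OF conjunct1[OF pI[OF F]]])
          (use v u F ab in \<open>simp_all add: evaluate_comp_cong(1)[OF F vu(1)] evaluate_comp_cong(1)[OF F vu(2)]\<close>)
      show "FA F v = FA F u" if F: "F \<in> J" for F
        by (rule E.product_eqI[OF conjunct1[OF pJ[OF F]]])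
          (use v u F ab in \<open>simp_all add: evaluate_comp_cong(2)[OF F vu(1)] evaluate_comp_cong(2)[OF F vu(2)]\<close>)
    qed (use u v in simp_all)
  qed (use u in auto)
qed

lemma terminal_of_evaluations:
  assumes U: "U \<in> Obj C"
    and tI: "\<And>F. F \<in> I \<Longrightarrow> is_terminal D (FO F U) \<and> is_terminal D (TO D (FO F U))"
    and tJ: "\<And>F. F \<in> J \<Longrightarrow> is_terminal E (FO F U) \<and> is_terminal E (TO E (FO F U))"
  shows "is_terminal C U"
  unfolding is_terminal_def
proof (intro conjI ballI U)
  fix X assume X: "X \<in> Obj C"
  \<comment> \<open>A terminal object is the vertex of a cone without legs, so any families of arrows will do.\<close>
  have "\<exists>u\<in>Homs C X U. \<forall>i\<in>({}::nat set). undefined i \<cdot> u = undefined i"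
  proof (rule lift[OF X U])
    show "stably_monic D (FO F U) ({}::nat set) (\<lambda>i. FA F (undefined i)) \<and>
      (\<exists>v\<in>Homs D (FO F X) (FO F U). \<forall>i\<in>({}::nat set). FA F (undefined i) \<cdot>\<^bsub>D\<^esub> v = FA F (undefined i))" if F: "F \<in> I" for F
    proof
      show "stably_monic D (FO F U) ({}::nat set) (\<lambda>i. FA F (undefined i))"
        unfolding stably_monic_def
        by (intro conjI D.terminal_monic conjunct1[OF tI[OF F]] conjunct2[OF tI[OF F]])
      have "FO F X \<in> Obj D" using F X by simp
      then have "\<exists>!v. v \<in> Homs D (FO F X) (FO F U)" using conjunct1[OF tI[OF F]] unfolding is_terminal_def by blast
      then show "\<exists>v\<in>Homs D (FO F X) (FO F U). \<forall>i\<in>({}::nat set). FA F (undefined i) \<cdot>\<^bsub>D\<^esub> v = FA F (undefined i)"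
        by blast
    qed
    show "stably_monic E (FO F U) ({}::nat set) (\<lambda>i. FA F (undefined i)) \<and>
      (\<exists>v\<in>Homs E (FO F X) (FO F U). \<forall>i\<in>({}::nat set). FA F (undefined i) \<cdot>\<^bsub>E\<^esub> v = FA F (undefined i))" if F: "F \<in> J" for F
    proof
      show "stably_monic E (FO F U) ({}::nat set) (\<lambda>i. FA F (undefined i))"
        unfolding stably_monic_def
        by (intro conjI E.terminal_monic conjunct1[OF tJ[OF F]] conjunct2[OF tJ[OF F]])
      have "FO F X \<in> Obj E" using F X by simp
      then have "\<exists>!v. v \<in> Homs E (FO F X) (FO F U)" using conjunct1[OF tJ[OF F]] unfolding is_terminal_def by blast
      then show "\<exists>v\<in>Homs E (FO F X) (FO F U). \<forall>i\<in>({}::nat set). FA F (undefined i) \<cdot>\<^bsub>E\<^esub> v = FA F (undefined i)"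
        by blast
    qed
  qed auto
  then obtain u where u: "u \<in> Homs C X U" by auto
  show "\<exists>!u. u \<in> Homs C X U"
  proof (rule ex1I[of _ u])
    fix v assume v: "v \<in> Homs C X U"
    show "v = u"
    proof (rule faithful)
      show "FA F v = FA F u" if F: "F \<in> I" for F
        by (rule D.terminal_eqI[OF conjunct1[OF tI[OF F]]]) (use v u F in simp_all)
      show "FA F v = FA F u" if F: "F \<in> J" for F
        by (rule E.terminal_eqI[OF conjunct1[OF tJ[OF F]]]) (use v u F in simp_all)
    qed (use u v in simp_all)
  qed (use u in auto)
qed

end

section \<open>Lax tangent morphisms\<close>

lemma laxD:
  assumes "lax_tangent_morphism C D F \<alpha>"
  shows "tangent_category C" "tangent_category D" "is_functor C D F"
    "A \<in> Obj C \<Longrightarrow> \<alpha> A \<in> Arr D" "A \<in> Obj C \<Longrightarrow> Dom D (\<alpha> A) = FO F (TO C A)"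
    "A \<in> Obj C \<Longrightarrow> Cod D (\<alpha> A) = TO D (FO F A)"
    "f \<in> Arr C \<Longrightarrow> \<alpha> (Cod C f) \<cdot>\<^bsub>D\<^esub> FA F (TA C f) = TA D (FA F f) \<cdot>\<^bsub>D\<^esub> \<alpha> (Dom C f)"
    "A \<in> Obj C \<Longrightarrow> pT D (FO F A) \<cdot>\<^bsub>D\<^esub> \<alpha> A = FA F (pT C A)"
    "A \<in> Obj C \<Longrightarrow> \<alpha> A \<cdot>\<^bsub>D\<^esub> FA F (zT C A) = zT D (FO F A)"
    "A \<in> Obj C \<Longrightarrow> \<alpha> A \<cdot>\<^bsub>D\<^esub> FA F (sT C A) =
        sT D (FO F A) \<cdot>\<^bsub>D\<^esub> T2pair D (FO F (Tn C 2 A)) (FO F A)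
          (\<alpha> A \<cdot>\<^bsub>D\<^esub> FA F (pr C 2 0 A)) (\<alpha> A \<cdot>\<^bsub>D\<^esub> FA F (pr C 2 1 A))"
    "A \<in> Obj C \<Longrightarrow> lT D (FO F A) \<cdot>\<^bsub>D\<^esub> \<alpha> A =
        TA D (\<alpha> A) \<cdot>\<^bsub>D\<^esub> \<alpha> (TO C A) \<cdot>\<^bsub>D\<^esub> FA F (lT C A)"
    "A \<in> Obj C \<Longrightarrow> cT D (FO F A) \<cdot>\<^bsub>D\<^esub> TA D (\<alpha> A) \<cdot>\<^bsub>D\<^esub> \<alpha> (TO C A) =
        TA D (\<alpha> A) \<cdot>\<^bsub>D\<^esub> \<alpha> (TO C A) \<cdot>\<^bsub>D\<^esub> FA F (cT C A)"
  using assms unfolding lax_tangent_morphism_def nat_trans_def ftr_comp_def by auto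

locale lax_morphism = C: tangent_category C + D: tangent_category D
  for C :: "('o1, 'm1, 'x) tcat_scheme" and D :: "('o2, 'm2, 'y) tcat_scheme" and F \<alpha> +
  assumes lax: "lax_tangent_morphism C D F \<alpha>"
begin

lemmas F_simps [simp] = functor_simps[OF laxD(3)[OF lax]]
lemmas \<alpha>_simps [simp] = laxD(4-6)[OF lax]

lemma F_pr: "A \<in> Obj C \<Longrightarrow> FA F (pT C A) \<cdot>\<^bsub>D\<^esub> FA F (pr C 2 1 A) = FA F (pT C A) \<cdot>\<^bsub>D\<^esub> FA F (pr C 2 0 A)"
  using F_simps(6)[of "pr C 2 1 A" "pT C A"] F_simps(6)[of "pr C 2 0 A" "pT C A"] by simp

lemma \<alpha>_nat: "\<lbrakk>f \<in> Arr C; Cod C f = B\<rbrakk>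
    \<Longrightarrow> \<alpha> B \<cdot>\<^bsub>D\<^esub> FA F (TA C f) = TA D (FA F f) \<cdot>\<^bsub>D\<^esub> \<alpha> (Dom C f)"
  using laxD(7)[OF lax] by auto

lemma \<alpha>_nat_x: "\<lbrakk>f \<in> Arr C; Cod C f = B; x \<in> Arr D; Cod D x = FO F (TO C (Dom C f))\<rbrakk>
    \<Longrightarrow> \<alpha> B \<cdot>\<^bsub>D\<^esub> (FA F (TA C f) \<cdot>\<^bsub>D\<^esub> x) = TA D (FA F f) \<cdot>\<^bsub>D\<^esub> (\<alpha> (Dom C f) \<cdot>\<^bsub>D\<^esub> x)"
  using D.reassoc[OF \<alpha>_nat[of f B]] by auto

lemma p_\<alpha>: "A \<in> Obj C \<Longrightarrow> pT D (FO F A) \<cdot>\<^bsub>D\<^esub> \<alpha> A = FA F (pT C A)"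
  by (rule laxD(8)[OF lax])

lemma p_\<alpha>_x: "\<lbrakk>A \<in> Obj C; x \<in> Arr D; Cod D x = FO F (TO C A)\<rbrakk>
    \<Longrightarrow> pT D (FO F A) \<cdot>\<^bsub>D\<^esub> (\<alpha> A \<cdot>\<^bsub>D\<^esub> x) = FA F (pT C A) \<cdot>\<^bsub>D\<^esub> x"
  using D.reassoc[OF p_\<alpha>[of A]] by simp

lemma \<alpha>_z: "A \<in> Obj C \<Longrightarrow> \<alpha> A \<cdot>\<^bsub>D\<^esub> FA F (zT C A) = zT D (FO F A)"
  by (rule laxD(9)[OF lax])

lemma \<alpha>_z_x: "\<lbrakk>A \<in> Obj C; x \<in> Arr D; Cod D x = FO F A\<rbrakk>
    \<Longrightarrow> \<alpha> A \<cdot>\<^bsub>D\<^esub> (FA F (zT C A) \<cdot>\<^bsub>D\<^esub> x) = zT D (FO F A) \<cdot>\<^bsub>D\<^esub> x"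
  using D.reassoc[OF \<alpha>_z[of A]] by simp

lemma \<alpha>_s: "A \<in> Obj C \<Longrightarrow> \<alpha> A \<cdot>\<^bsub>D\<^esub> FA F (sT C A) =
        sT D (FO F A) \<cdot>\<^bsub>D\<^esub> T2pair D (FO F (Tn C 2 A)) (FO F A)
          (\<alpha> A \<cdot>\<^bsub>D\<^esub> FA F (pr C 2 0 A)) (\<alpha> A \<cdot>\<^bsub>D\<^esub> FA F (pr C 2 1 A))"
  by (rule laxD(10)[OF lax])

lemma \<alpha>_s_x: "\<lbrakk>A \<in> Obj C; x \<in> Arr D; Cod D x = FO F (Tn C 2 A)\<rbrakk> \<Longrightarrow> \<alpha> A \<cdot>\<^bsub>D\<^esub> (FA F (sT C A) \<cdot>\<^bsub>D\<^esub> x) =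
        sT D (FO F A) \<cdot>\<^bsub>D\<^esub> T2pair D (Dom D x) (FO F A)
          (\<alpha> A \<cdot>\<^bsub>D\<^esub> (FA F (pr C 2 0 A) \<cdot>\<^bsub>D\<^esub> x)) (\<alpha> A \<cdot>\<^bsub>D\<^esub> (FA F (pr C 2 1 A) \<cdot>\<^bsub>D\<^esub> x))"
  using D.reassoc[OF \<alpha>_s[of A]] by (simp add: p_\<alpha>_x F_pr D.T2pair_comp)

lemma l_\<alpha>: "A \<in> Obj C \<Longrightarrow> lT D (FO F A) \<cdot>\<^bsub>D\<^esub> \<alpha> A =
        TA D (\<alpha> A) \<cdot>\<^bsub>D\<^esub> (\<alpha> (TO C A) \<cdot>\<^bsub>D\<^esub> FA F (lT C A))"
  using laxD(11)[OF lax] by simp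

lemma l_\<alpha>_x: "\<lbrakk>A \<in> Obj C; x \<in> Arr D; Cod D x = FO F (TO C A)\<rbrakk> \<Longrightarrow> lT D (FO F A) \<cdot>\<^bsub>D\<^esub> (\<alpha> A \<cdot>\<^bsub>D\<^esub> x) =
        TA D (\<alpha> A) \<cdot>\<^bsub>D\<^esub> (\<alpha> (TO C A) \<cdot>\<^bsub>D\<^esub> (FA F (lT C A) \<cdot>\<^bsub>D\<^esub> x))"
  using D.reassoc[OF l_\<alpha>[of A]] by simp

lemma c_\<alpha>: "A \<in> Obj C \<Longrightarrow> cT D (FO F A) \<cdot>\<^bsub>D\<^esub> (TA D (\<alpha> A) \<cdot>\<^bsub>D\<^esub> \<alpha> (TO C A)) =
        TA D (\<alpha> A) \<cdot>\<^bsub>D\<^esub> (\<alpha> (TO C A) \<cdot>\<^bsub>D\<^esub> FA F (cT C A))"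
  using laxD(12)[OF lax] by simp

lemma c_\<alpha>_x: "\<lbrakk>A \<in> Obj C; x \<in> Arr D; Cod D x = FO F (TO C (TO C A))\<rbrakk>
  \<Longrightarrow> cT D (FO F A) \<cdot>\<^bsub>D\<^esub> (TA D (\<alpha> A) \<cdot>\<^bsub>D\<^esub> (\<alpha> (TO C A) \<cdot>\<^bsub>D\<^esub> x)) =
        TA D (\<alpha> A) \<cdot>\<^bsub>D\<^esub> (\<alpha> (TO C A) \<cdot>\<^bsub>D\<^esub> (FA F (cT C A) \<cdot>\<^bsub>D\<^esub> x))"
  using D.reassoc[OF c_\<alpha>[of A], of x] by simp

lemmas lax_laws = p_\<alpha> p_\<alpha>_x \<alpha>_z \<alpha>_z_x \<alpha>_s \<alpha>_s_x l_\<alpha> l_\<alpha>_x c_\<alpha> c_\<alpha>_x F_pr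

end

lemma lax_morphismI: "lax_tangent_morphism C D F \<alpha> \<Longrightarrow> lax_morphism C D F \<alpha>"
  using laxD(1,2) by (auto simp: lax_morphism_def lax_morphism_axioms_def)

lemma laxI:
  assumes "tangent_category C" "tangent_category D" "is_functor C D F"
    "\<And>A. A \<in> Obj C \<Longrightarrow> \<alpha> A \<in> Homs D (FO F (TO C A)) (TO D (FO F A))"
    "\<And>f. f \<in> Arr C \<Longrightarrow> \<alpha> (Cod C f) \<cdot>\<^bsub>D\<^esub> FA F (TA C f) = TA D (FA F f) \<cdot>\<^bsub>D\<^esub> \<alpha> (Dom C f)"
    "\<And>A. A \<in> Obj C \<Longrightarrow> pT D (FO F A) \<cdot>\<^bsub>D\<^esub> \<alpha> A = FA F (pT C A)"
    "\<And>A. A \<in> Obj C \<Longrightarrow> \<alpha> A \<cdot>\<^bsub>D\<^esub> FA F (zT C A) = zT D (FO F A)"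
    "\<And>A. A \<in> Obj C \<Longrightarrow> \<alpha> A \<cdot>\<^bsub>D\<^esub> FA F (sT C A) =
        sT D (FO F A) \<cdot>\<^bsub>D\<^esub> T2pair D (FO F (Tn C 2 A)) (FO F A)
          (\<alpha> A \<cdot>\<^bsub>D\<^esub> FA F (pr C 2 0 A)) (\<alpha> A \<cdot>\<^bsub>D\<^esub> FA F (pr C 2 1 A))"
    "\<And>A. A \<in> Obj C \<Longrightarrow> lT D (FO F A) \<cdot>\<^bsub>D\<^esub> \<alpha> A =
        TA D (\<alpha> A) \<cdot>\<^bsub>D\<^esub> (\<alpha> (TO C A) \<cdot>\<^bsub>D\<^esub> FA F (lT C A))"
    "\<And>A. A \<in> Obj C \<Longrightarrow> cT D (FO F A) \<cdot>\<^bsub>D\<^esub> (TA D (\<alpha> A) \<cdot>\<^bsub>D\<^esub> \<alpha> (TO C A)) =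
        TA D (\<alpha> A) \<cdot>\<^bsub>D\<^esub> (\<alpha> (TO C A) \<cdot>\<^bsub>D\<^esub> FA F (cT C A))"
  shows "lax_tangent_morphism C D F \<alpha>"
proof -
  interpret C: tangent_category C by fact
  interpret D: tangent_category D by fact
  note [simp] = functor_simps[OF assms(3)]
  have [simp]: "\<alpha> A \<in> Arr D" "Dom D (\<alpha> A) = FO F (TO C A)" "Cod D (\<alpha> A) = TO D (FO F A)"
    if "A \<in> Obj C" for A using assms(4)[OF that] by auto
  show ?thesis
    unfolding lax_tangent_morphism_def nat_trans_def ftr_comp_def
    using assms by simp
qed

lemma functor_cong:
  assumes "is_functor C D F" "category C" "\<And>A. A \<in> Obj C \<Longrightarrow> FO F' A = FO F A"
    "\<And>f. f \<in> Arr C \<Longrightarrow> FA F' f = FA F f"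
  shows "is_functor C D F'"
proof -
  interpret category C by fact
  show ?thesis using assms(1) unfolding is_functor_def by (simp add: assms(3,4))
qed

text \<open>Functors and structure arrows are stored as extensional functions, so that a composite agrees with
  the expected one only on the objects and arrows of its source; the laws look at nothing else.\<close>

lemma lax_cong:
  assumes lax: "lax_tangent_morphism C D F \<alpha>" and FO: "\<And>A. A \<in> Obj C \<Longrightarrow> FO F' A = FO F A"
    and FA: "\<And>f. f \<in> Arr C \<Longrightarrow> FA F' f = FA F f" and \<alpha>: "\<And>A. A \<in> Obj C \<Longrightarrow> \<alpha>' A = \<alpha> A"
  shows "lax_tangent_morphism C D F' \<alpha>'"
proof -
  interpret lax_morphism C D F \<alpha> by (rule lax_morphismI[OF lax])
  show ?thesis
  proof (rule laxI)
    show "is_functor C D F'"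
      using functor_cong[OF laxD(3)[OF lax] C.category_axioms] FO FA by blast
  qed (simp_all add: FO FA \<alpha> \<alpha>_nat lax_laws C.tangent_category_axioms D.tangent_category_axioms)
qed

lemma functor_comp:
  assumes "is_functor C D F" "is_functor D E G"
  shows "is_functor C E (G \<odot> F)"
  unfolding is_functor_def ftr_comp_def
  using functor_simps[OF assms(1)] functor_simps[OF assms(2)] by simp

lemma lax_composite:
  assumes F: "lax_tangent_morphism C D F \<alpha>" and G: "lax_tangent_morphism D E G \<beta>"
  shows "lax_tangent_morphism C E (G \<odot> F) (\<lambda>A. \<beta> (FO F A) \<cdot>\<^bsub>E\<^esub> FA G (\<alpha> A))"
proof -
  interpret F: lax_morphism C D F \<alpha> by (rule lax_morphismI[OF F])
  interpret G: lax_morphism D E G \<beta> by (rule lax_morphismI[OF G])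
  have push: "FA G a \<cdot>\<^bsub>E\<^esub> FA G b = FA G (a \<cdot>\<^bsub>D\<^esub> b)" if "a \<in> Arr D" "b \<in> Arr D" "Cod D b = Dom D a" for a b
    using that by simp
  \<comment> \<open>The laws of \<open>F\<close> under \<open>G\<close>, with \<open>G\<close> distributed over composites as the simplifier does.\<close>
  have G\<alpha>: "FA G (pT D (FO F A)) \<cdot>\<^bsub>E\<^esub> FA G (\<alpha> A) = FA G (FA F (pT C A))"
    "FA G (\<alpha> A) \<cdot>\<^bsub>E\<^esub> FA G (FA F (zT C A)) = FA G (zT D (FO F A))"
    "FA G (\<alpha> A) \<cdot>\<^bsub>E\<^esub> FA G (FA F (sT C A)) = FA G (sT D (FO F A) \<cdot>\<^bsub>D\<^esub> T2pair D (FO F (Tn C 2 A)) (FO F A)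
          (\<alpha> A \<cdot>\<^bsub>D\<^esub> FA F (pr C 2 0 A)) (\<alpha> A \<cdot>\<^bsub>D\<^esub> FA F (pr C 2 1 A)))"
    "FA G (lT D (FO F A)) \<cdot>\<^bsub>E\<^esub> FA G (\<alpha> A) =
        FA G (TA D (\<alpha> A)) \<cdot>\<^bsub>E\<^esub> (FA G (\<alpha> (TO C A)) \<cdot>\<^bsub>E\<^esub> FA G (FA F (lT C A)))"
    "FA G (cT D (FO F A)) \<cdot>\<^bsub>E\<^esub> (FA G (TA D (\<alpha> A)) \<cdot>\<^bsub>E\<^esub> FA G (\<alpha> (TO C A))) =
        FA G (TA D (\<alpha> A)) \<cdot>\<^bsub>E\<^esub> (FA G (\<alpha> (TO C A)) \<cdot>\<^bsub>E\<^esub> FA G (FA F (cT C A)))"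
    "\<And>x. \<lbrakk>x \<in> Arr E; Cod E x = FO G (FO F (TO C A))\<rbrakk>
      \<Longrightarrow> FA G (pT D (FO F A)) \<cdot>\<^bsub>E\<^esub> (FA G (\<alpha> A) \<cdot>\<^bsub>E\<^esub> x) = FA G (FA F (pT C A)) \<cdot>\<^bsub>E\<^esub> x"
    if "A \<in> Obj C" for A
  proof -
    show 1: "FA G (pT D (FO F A)) \<cdot>\<^bsub>E\<^esub> FA G (\<alpha> A) = FA G (FA F (pT C A))"
      using that push[of "pT D (FO F A)" "\<alpha> A"] by (simp add: F.lax_laws del: G.F_simps(6))
    show "FA G (\<alpha> A) \<cdot>\<^bsub>E\<^esub> FA G (FA F (zT C A)) = FA G (zT D (FO F A))"
      using that push[of "\<alpha> A" "FA F (zT C A)"] by (simp add: F.lax_laws del: G.F_simps(6))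
    show "FA G (\<alpha> A) \<cdot>\<^bsub>E\<^esub> FA G (FA F (sT C A)) = FA G (sT D (FO F A) \<cdot>\<^bsub>D\<^esub> T2pair D (FO F (Tn C 2 A)) (FO F A)
          (\<alpha> A \<cdot>\<^bsub>D\<^esub> FA F (pr C 2 0 A)) (\<alpha> A \<cdot>\<^bsub>D\<^esub> FA F (pr C 2 1 A)))"
      using that push[of "\<alpha> A" "FA F (sT C A)"] by (simp add: F.lax_laws del: G.F_simps(6))
    show "FA G (lT D (FO F A)) \<cdot>\<^bsub>E\<^esub> FA G (\<alpha> A) =
        FA G (TA D (\<alpha> A)) \<cdot>\<^bsub>E\<^esub> (FA G (\<alpha> (TO C A)) \<cdot>\<^bsub>E\<^esub> FA G (FA F (lT C A)))"
      using that by (simp add: push F.lax_laws del: G.F_simps(6))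
    show "FA G (cT D (FO F A)) \<cdot>\<^bsub>E\<^esub> (FA G (TA D (\<alpha> A)) \<cdot>\<^bsub>E\<^esub> FA G (\<alpha> (TO C A))) =
        FA G (TA D (\<alpha> A)) \<cdot>\<^bsub>E\<^esub> (FA G (\<alpha> (TO C A)) \<cdot>\<^bsub>E\<^esub> FA G (FA F (cT C A)))"
      using that by (simp add: push F.lax_laws del: G.F_simps(6))
    show "\<lbrakk>x \<in> Arr E; Cod E x = FO G (FO F (TO C A))\<rbrakk>
      \<Longrightarrow> FA G (pT D (FO F A)) \<cdot>\<^bsub>E\<^esub> (FA G (\<alpha> A) \<cdot>\<^bsub>E\<^esub> x) = FA G (FA F (pT C A)) \<cdot>\<^bsub>E\<^esub> x" for x
      using that G.D.reassoc[OF 1, of x] by simp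
  qed
  have GF_pr: "FA G (FA F (pT C A)) \<cdot>\<^bsub>E\<^esub> FA G (FA F (pr C 2 1 A)) =
      FA G (FA F (pT C A)) \<cdot>\<^bsub>E\<^esub> FA G (FA F (pr C 2 0 A))" if "A \<in> Obj C" for A
    using that by (simp add: push F.lax_laws del: G.F_simps(6))
  let ?\<gamma> = "\<lambda>A. \<beta> (FO F A) \<cdot>\<^bsub>E\<^esub> FA G (\<alpha> A)"
  show ?thesis
  proof (rule laxI)
    fix A assume A: "A \<in> Obj C"
    have pp: "pT D (FO F A) \<cdot>\<^bsub>D\<^esub> (\<alpha> A \<cdot>\<^bsub>D\<^esub> FA F (pr C 2 0 A)) = pT D (FO F A) \<cdot>\<^bsub>D\<^esub> (\<alpha> A \<cdot>\<^bsub>D\<^esub> FA F (pr C 2 1 A))"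
      using A by (simp add: F.lax_laws)
    have r: "TA E (FA G (\<alpha> A)) \<cdot>\<^bsub>E\<^esub> (\<beta> (FO F (TO C A)) \<cdot>\<^bsub>E\<^esub> x) = \<beta> (TO D (FO F A)) \<cdot>\<^bsub>E\<^esub> (FA G (TA D (\<alpha> A)) \<cdot>\<^bsub>E\<^esub> x)"
      if "x \<in> Arr E" "Cod E x = FO G (TO D (FO F (TO C A)))" for x
      using A that G.\<alpha>_nat_x[of "\<alpha> A" "TO D (FO F A)" x] by simp
    let ?t = "T2pair D (FO F (Tn C 2 A)) (FO F A)
          (\<alpha> A \<cdot>\<^bsub>D\<^esub> FA F (pr C 2 0 A)) (\<alpha> A \<cdot>\<^bsub>D\<^esub> FA F (pr C 2 1 A))"
    have t: "?t \<in> Arr D" "Dom D ?t = FO F (Tn C 2 A)" "Cod D ?t = Tn D 2 (FO F A)"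
      "FA G (pr D 2 0 (FO F A)) \<cdot>\<^bsub>E\<^esub> FA G ?t = FA G (\<alpha> A) \<cdot>\<^bsub>E\<^esub> FA G (FA F (pr C 2 0 A))"
      "FA G (pr D 2 1 (FO F A)) \<cdot>\<^bsub>E\<^esub> FA G ?t = FA G (\<alpha> A) \<cdot>\<^bsub>E\<^esub> FA G (FA F (pr C 2 1 A))"
      using A pp by (simp_all add: push del: G.F_simps(6))
    show "?\<gamma> A \<cdot>\<^bsub>E\<^esub> FA (G \<odot> F) (sT C A) =
      sT E (FO (G \<odot> F) A) \<cdot>\<^bsub>E\<^esub> T2pair E (FO (G \<odot> F) (Tn C 2 A)) (FO (G \<odot> F) A)
        (?\<gamma> A \<cdot>\<^bsub>E\<^esub> FA (G \<odot> F) (pr C 2 0 A)) (?\<gamma> A \<cdot>\<^bsub>E\<^esub> FA (G \<odot> F) (pr C 2 1 A))"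
      using A t by (simp add: ftr_comp_def G\<alpha>(3) G.lax_laws del: F.D.T2pair_simps)
    show "lT E (FO (G \<odot> F) A) \<cdot>\<^bsub>E\<^esub> ?\<gamma> A =
        TA E (?\<gamma> A) \<cdot>\<^bsub>E\<^esub> (?\<gamma> (TO C A) \<cdot>\<^bsub>E\<^esub> FA (G \<odot> F) (lT C A))"
      using A by (simp add: ftr_comp_def G.lax_laws G\<alpha> r)
    show "cT E (FO (G \<odot> F) A) \<cdot>\<^bsub>E\<^esub> (TA E (?\<gamma> A) \<cdot>\<^bsub>E\<^esub> ?\<gamma> (TO C A)) =
        TA E (?\<gamma> A) \<cdot>\<^bsub>E\<^esub> (?\<gamma> (TO C A) \<cdot>\<^bsub>E\<^esub> FA (G \<odot> F) (cT C A))"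
      using A by (simp add: ftr_comp_def G.lax_laws G\<alpha> r)
  next
    fix f assume f: "f \<in> Arr C"
    have "FA G (\<alpha> (Cod C f)) \<cdot>\<^bsub>E\<^esub> FA G (FA F (TA C f)) = FA G (TA D (FA F f)) \<cdot>\<^bsub>E\<^esub> FA G (\<alpha> (Dom C f))"
      using f by (simp add: push F.\<alpha>_nat del: G.F_simps(6))
    then show "?\<gamma> (Cod C f) \<cdot>\<^bsub>E\<^esub> FA (G \<odot> F) (TA C f) = TA E (FA (G \<odot> F) f) \<cdot>\<^bsub>E\<^esub> ?\<gamma> (Dom C f)"
      using f by (simp add: ftr_comp_def G.\<alpha>_nat_x)
  qed (simp_all add: G\<alpha> G.lax_laws ftr_comp_def F.C.tangent_category_axioms G.D.tangent_category_axioms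
      functor_comp[OF laxD(3)[OF F] laxD(3)[OF G], unfolded ftr_comp_def])
qed

lemma (in tangent_category) lax_Tan: "lax_tangent_morphism C C (Tan C) (cT C)"
proof (rule laxI)
  fix A assume A: "A \<in> Obj C"
  show "cT C (TO C A) \<cdot> (TA C (cT C A) \<cdot> cT C (TO C A)) = TA C (cT C A) \<cdot> (cT C (TO C A) \<cdot> TA C (cT C A))"
    using c_braid[OF A] A by simp
qed (simp_all add: tangent_category_axioms Tan_functor c_nat_simp c_p c_z c_s l_c)

text \<open>The laws for \<open>\<alpha>\<close> are equations between arrows into \<open>F A\<close>, \<open>T (F A)\<close> and \<open>T (T (F A))\<close>. They
  follow from those for the \<open>\<beta> i\<close> if the \<open>\<pi> i\<close> are jointly monic after zero, one and two applications
  of \<open>T\<close>. Tangent powers and products of lax morphisms have such projections.\<close>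

lemma lax_by_projections:
  assumes C: "tangent_category C" and D: "tangent_category D" and F: "is_functor C D F"
    and \<alpha>: "\<And>A. A \<in> Obj C \<Longrightarrow> \<alpha> A \<in> Homs D (FO F (TO C A)) (TO D (FO F A))"
    and G: "\<And>i. i \<in> K \<Longrightarrow> lax_tangent_morphism C D (G i) (\<beta> i)"
    and \<pi>: "\<And>i A. \<lbrakk>i \<in> K; A \<in> Obj C\<rbrakk> \<Longrightarrow> \<pi> i A \<in> Homs D (FO F A) (FO (G i) A)"
    and \<pi>_nat: "\<And>i f. \<lbrakk>i \<in> K; f \<in> Arr C\<rbrakk>
      \<Longrightarrow> \<pi> i (Cod C f) \<cdot>\<^bsub>D\<^esub> FA F f = FA (G i) f \<cdot>\<^bsub>D\<^esub> \<pi> i (Dom C f)"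
    and \<pi>\<alpha>: "\<And>i A. \<lbrakk>i \<in> K; A \<in> Obj C\<rbrakk> \<Longrightarrow> TA D (\<pi> i A) \<cdot>\<^bsub>D\<^esub> \<alpha> A = \<beta> i A \<cdot>\<^bsub>D\<^esub> \<pi> i (TO C A)"
    and m0: "\<And>A. A \<in> Obj C \<Longrightarrow> jointly_monic D (FO F A) K (\<lambda>i. \<pi> i A)"
    and m1: "\<And>A. A \<in> Obj C \<Longrightarrow> jointly_monic D (TO D (FO F A)) K (\<lambda>i. TA D (\<pi> i A))"
    and m2: "\<And>A. A \<in> Obj C \<Longrightarrow> jointly_monic D (TO D (TO D (FO F A))) K (\<lambda>i. TA D (TA D (\<pi> i A)))"
  shows "lax_tangent_morphism C D F \<alpha>"
proof -
  interpret C: tangent_category C by fact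
  interpret D: tangent_category D by fact
  note [simp] = functor_simps[OF F]
  have [simp]: "\<alpha> A \<in> Arr D" "Dom D (\<alpha> A) = FO F (TO C A)" "Cod D (\<alpha> A) = TO D (FO F A)"
    if "A \<in> Obj C" for A using \<alpha>[OF that] by auto
  have p_simps [simp]: "\<pi> i A \<in> Arr D" "Dom D (\<pi> i A) = FO F A" "Cod D (\<pi> i A) = FO (G i) A"
    if "A \<in> Obj C" "i \<in> K" for i A using \<pi>[OF that(2,1)] by auto
  have G_Obj [simp]: "FO (G i) A \<in> Obj D" if "A \<in> Obj C" "i \<in> K" for i A
    using functor_simps(1)[OF laxD(3)[OF G[OF that(2)]]] that(1) .
  have pr1: "FA F (pT C A) \<cdot>\<^bsub>D\<^esub> FA F (pr C 2 1 A) = FA F (pT C A) \<cdot>\<^bsub>D\<^esub> FA F (pr C 2 0 A)"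
    if "A \<in> Obj C" for A
    using that functor_simps(6)[OF F, of "pr C 2 1 A" "pT C A"] functor_simps(6)[OF F, of "pr C 2 0 A" "pT C A"]
    by simp
  have 1: "\<pi> i B \<cdot>\<^bsub>D\<^esub> (FA F f \<cdot>\<^bsub>D\<^esub> x) = FA (G i) f \<cdot>\<^bsub>D\<^esub> (\<pi> i (Dom C f) \<cdot>\<^bsub>D\<^esub> x)"
    if "i \<in> K" "f \<in> Arr C" "B = Cod C f" "x \<in> Arr D" "Cod D x = FO F (Dom C f)" for i f B x
    using D.reassoc[OF \<pi>_nat[OF that(1,2)], of x] functor_simps[OF laxD(3)[OF G[OF that(1)]]] that by simp
  have 2: "TA D (\<pi> i A) \<cdot>\<^bsub>D\<^esub> (\<alpha> A \<cdot>\<^bsub>D\<^esub> x) = \<beta> i A \<cdot>\<^bsub>D\<^esub> (\<pi> i (TO C A) \<cdot>\<^bsub>D\<^esub> x)"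
    if "i \<in> K" "A \<in> Obj C" "x \<in> Arr D" "Cod D x = FO F (TO C A)" for i A x
    using D.reassoc[OF \<pi>\<alpha>[OF that(1,2)], of x] laxD(4-6)[OF G[OF that(1)]] that by simp
  have 3: "TA D (TA D (\<pi> i A)) \<cdot>\<^bsub>D\<^esub> (TA D (\<alpha> A) \<cdot>\<^bsub>D\<^esub> x) = TA D (\<beta> i A) \<cdot>\<^bsub>D\<^esub> (TA D (\<pi> i (TO C A)) \<cdot>\<^bsub>D\<^esub> x)"
    if "i \<in> K" "A \<in> Obj C" "x \<in> Arr D" "Cod D x = TO D (FO F (TO C A))" for i A x
    using D.reassoc[of "TA D (TA D (\<pi> i A))" "TA D (\<alpha> A)" "TA D (\<beta> i A) \<cdot>\<^bsub>D\<^esub> TA D (\<pi> i (TO C A))" x]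
      arg_cong[OF \<pi>\<alpha>[OF that(1,2)], of "TA D"] laxD(4-6)[OF G[OF that(1)]] that by simp
  have 4: "\<pi> i A \<cdot>\<^bsub>D\<^esub> (pT D (FO F A) \<cdot>\<^bsub>D\<^esub> x) = pT D (FO (G i) A) \<cdot>\<^bsub>D\<^esub> (TA D (\<pi> i A) \<cdot>\<^bsub>D\<^esub> x)"
    if "i \<in> K" "A \<in> Obj C" "x \<in> Arr D" "Cod D x = TO D (FO F A)" for i A x
    using that by (simp add: D.p_nat_x)
  have 5: "TA D (\<pi> i A) \<cdot>\<^bsub>D\<^esub> zT D (FO F A) = zT D (FO (G i) A) \<cdot>\<^bsub>D\<^esub> \<pi> i A"
    if "i \<in> K" "A \<in> Obj C" for i A
    using that by (simp add: D.z_nat_simp)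
  have 6: "TA D (\<pi> i A) \<cdot>\<^bsub>D\<^esub> (sT D (FO F A) \<cdot>\<^bsub>D\<^esub> T2pair D X (FO F A) u v) =
      sT D (FO (G i) A) \<cdot>\<^bsub>D\<^esub> T2pair D X (FO (G i) A) (TA D (\<pi> i A) \<cdot>\<^bsub>D\<^esub> u) (TA D (\<pi> i A) \<cdot>\<^bsub>D\<^esub> v)"
    if "i \<in> K" "A \<in> Obj C" "u \<in> Arr D" "v \<in> Arr D" "Dom D u = X" "Dom D v = X"
    "Cod D u = TO D (FO F A)" "Cod D v = TO D (FO F A)"
    "pT D (FO F A) \<cdot>\<^bsub>D\<^esub> u = pT D (FO F A) \<cdot>\<^bsub>D\<^esub> v" for i A u v X
    by (rule D.s_pair[symmetric]) (use that in simp_all)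
  have 7: "TA D (TA D (\<pi> i A)) \<cdot>\<^bsub>D\<^esub> (lT D (FO F A) \<cdot>\<^bsub>D\<^esub> x) = lT D (FO (G i) A) \<cdot>\<^bsub>D\<^esub> (TA D (\<pi> i A) \<cdot>\<^bsub>D\<^esub> x)"
    if "i \<in> K" "A \<in> Obj C" "x \<in> Arr D" "Cod D x = TO D (FO F A)" for i A x
    using that by (simp add: D.l_nat_x)
  have 8: "TA D (TA D (\<pi> i A)) \<cdot>\<^bsub>D\<^esub> (cT D (FO F A) \<cdot>\<^bsub>D\<^esub> x) = cT D (FO (G i) A) \<cdot>\<^bsub>D\<^esub> (TA D (TA D (\<pi> i A)) \<cdot>\<^bsub>D\<^esub> x)"
    if "i \<in> K" "A \<in> Obj C" "x \<in> Arr D" "Cod D x = TO D (TO D (FO F A))" for i A x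
    using that by (simp add: D.c_nat_x)
  have 9: "TA D (\<pi> i (Cod C f)) \<cdot>\<^bsub>D\<^esub> (TA D (FA F f) \<cdot>\<^bsub>D\<^esub> x) = TA D (FA (G i) f) \<cdot>\<^bsub>D\<^esub> (TA D (\<pi> i (Dom C f)) \<cdot>\<^bsub>D\<^esub> x)"
    if "i \<in> K" "f \<in> Arr C" "x \<in> Arr D" "Cod D x = TO D (FO F (Dom C f))" for i f x
    using D.reassoc[of "TA D (\<pi> i (Cod C f))" "TA D (FA F f)" "TA D (FA (G i) f) \<cdot>\<^bsub>D\<^esub> TA D (\<pi> i (Dom C f))" x]
      arg_cong[OF \<pi>_nat[OF that(1,2)], of "TA D"] functor_simps[OF laxD(3)[OF G[OF that(1)]]] that by simp
  have p\<alpha>: "pT D (FO F A) \<cdot>\<^bsub>D\<^esub> \<alpha> A = FA F (pT C A)" if A: "A \<in> Obj C" for A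
  proof (rule jointly_monicD[OF m0[OF A]])
    fix i assume i: "i \<in> K"
    interpret G: lax_morphism C D "G i" "\<beta> i" by (rule lax_morphismI[OF G[OF i]])
    show "\<pi> i A \<cdot>\<^bsub>D\<^esub> (pT D (FO F A) \<cdot>\<^bsub>D\<^esub> \<alpha> A) = \<pi> i A \<cdot>\<^bsub>D\<^esub> FA F (pT C A)"
      using A i \<pi>_nat[OF i, of "pT C A"] by (simp add: 4 \<pi>\<alpha> G.lax_laws)
  qed (use A in simp_all)
  have p\<alpha>_x: "pT D (FO F A) \<cdot>\<^bsub>D\<^esub> (\<alpha> A \<cdot>\<^bsub>D\<^esub> x) = FA F (pT C A) \<cdot>\<^bsub>D\<^esub> x"
    if A: "A \<in> Obj C" "x \<in> Arr D" "Cod D x = FO F (TO C A)" for A x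
    using D.reassoc[OF p\<alpha>[OF A(1)], of x] that by simp
  show ?thesis
  proof (rule laxI[OF C D F \<alpha> _ p\<alpha>])
    fix f assume f: "f \<in> Arr C"
    show "\<alpha> (Cod C f) \<cdot>\<^bsub>D\<^esub> FA F (TA C f) = TA D (FA F f) \<cdot>\<^bsub>D\<^esub> \<alpha> (Dom C f)"
    proof (rule jointly_monicD[OF m1[of "Cod C f"]])
      fix i assume i: "i \<in> K"
      interpret G: lax_morphism C D "G i" "\<beta> i" by (rule lax_morphismI[OF G[OF i]])
      show "TA D (\<pi> i (Cod C f)) \<cdot>\<^bsub>D\<^esub> (\<alpha> (Cod C f) \<cdot>\<^bsub>D\<^esub> FA F (TA C f)) =
        TA D (\<pi> i (Cod C f)) \<cdot>\<^bsub>D\<^esub> (TA D (FA F f) \<cdot>\<^bsub>D\<^esub> \<alpha> (Dom C f))"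
        using f i \<pi>_nat[OF i, of "TA C f"] by (simp add: 2 9 \<pi>\<alpha> G.\<alpha>_nat_x)
    qed (use f in simp_all)
  next
    fix A assume A: "A \<in> Obj C"
    show "\<alpha> A \<cdot>\<^bsub>D\<^esub> FA F (zT C A) = zT D (FO F A)"
    proof (rule jointly_monicD[OF m1[OF A]])
      fix i assume i: "i \<in> K"
      interpret G: lax_morphism C D "G i" "\<beta> i" by (rule lax_morphismI[OF G[OF i]])
      show "TA D (\<pi> i A) \<cdot>\<^bsub>D\<^esub> (\<alpha> A \<cdot>\<^bsub>D\<^esub> FA F (zT C A)) = TA D (\<pi> i A) \<cdot>\<^bsub>D\<^esub> zT D (FO F A)"
        using A i \<pi>_nat[OF i, of "zT C A"] by (simp add: 2 5 \<pi>\<alpha> G.lax_laws)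
    qed (use A in simp_all)
    show "\<alpha> A \<cdot>\<^bsub>D\<^esub> FA F (sT C A) =
        sT D (FO F A) \<cdot>\<^bsub>D\<^esub> T2pair D (FO F (Tn C 2 A)) (FO F A)
          (\<alpha> A \<cdot>\<^bsub>D\<^esub> FA F (pr C 2 0 A)) (\<alpha> A \<cdot>\<^bsub>D\<^esub> FA F (pr C 2 1 A))"
    proof (rule jointly_monicD[OF m1[OF A]])
      fix i assume i: "i \<in> K"
      interpret G: lax_morphism C D "G i" "\<beta> i" by (rule lax_morphismI[OF G[OF i]])
      show "TA D (\<pi> i A) \<cdot>\<^bsub>D\<^esub> (\<alpha> A \<cdot>\<^bsub>D\<^esub> FA F (sT C A)) =
        TA D (\<pi> i A) \<cdot>\<^bsub>D\<^esub> (sT D (FO F A) \<cdot>\<^bsub>D\<^esub> T2pair D (FO F (Tn C 2 A)) (FO F A)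
          (\<alpha> A \<cdot>\<^bsub>D\<^esub> FA F (pr C 2 0 A)) (\<alpha> A \<cdot>\<^bsub>D\<^esub> FA F (pr C 2 1 A)))"
        using A i \<pi>_nat[OF i, of "sT C A"] \<pi>_nat[OF i, of "pr C 2 0 A"] \<pi>_nat[OF i, of "pr C 2 1 A"]
        by (simp add: 2 6 \<pi>\<alpha> p\<alpha>_x pr1 G.lax_laws)
    qed (use A in \<open>simp_all add: p\<alpha>_x pr1\<close>)
    show "lT D (FO F A) \<cdot>\<^bsub>D\<^esub> \<alpha> A = TA D (\<alpha> A) \<cdot>\<^bsub>D\<^esub> (\<alpha> (TO C A) \<cdot>\<^bsub>D\<^esub> FA F (lT C A))"
    proof (rule jointly_monicD[OF m2[OF A]])
      fix i assume i: "i \<in> K"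
      interpret G: lax_morphism C D "G i" "\<beta> i" by (rule lax_morphismI[OF G[OF i]])
      show "TA D (TA D (\<pi> i A)) \<cdot>\<^bsub>D\<^esub> (lT D (FO F A) \<cdot>\<^bsub>D\<^esub> \<alpha> A) =
        TA D (TA D (\<pi> i A)) \<cdot>\<^bsub>D\<^esub> (TA D (\<alpha> A) \<cdot>\<^bsub>D\<^esub> (\<alpha> (TO C A) \<cdot>\<^bsub>D\<^esub> FA F (lT C A)))"
        using A i \<pi>_nat[OF i, of "lT C A"] by (simp add: 2 3 7 \<pi>\<alpha> G.lax_laws)
    qed (use A in simp_all)
    show "cT D (FO F A) \<cdot>\<^bsub>D\<^esub> (TA D (\<alpha> A) \<cdot>\<^bsub>D\<^esub> \<alpha> (TO C A)) =
        TA D (\<alpha> A) \<cdot>\<^bsub>D\<^esub> (\<alpha> (TO C A) \<cdot>\<^bsub>D\<^esub> FA F (cT C A))"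
    proof (rule jointly_monicD[OF m2[OF A]])
      fix i assume i: "i \<in> K"
      interpret G: lax_morphism C D "G i" "\<beta> i" by (rule lax_morphismI[OF G[OF i]])
      show "TA D (TA D (\<pi> i A)) \<cdot>\<^bsub>D\<^esub> (cT D (FO F A) \<cdot>\<^bsub>D\<^esub> (TA D (\<alpha> A) \<cdot>\<^bsub>D\<^esub> \<alpha> (TO C A))) =
        TA D (TA D (\<pi> i A)) \<cdot>\<^bsub>D\<^esub> (TA D (\<alpha> A) \<cdot>\<^bsub>D\<^esub> (\<alpha> (TO C A) \<cdot>\<^bsub>D\<^esub> FA F (cT C A)))"
        using A i \<pi>_nat[OF i, of "cT C A"] by (simp add: 2 3 8 \<pi>\<alpha> G.lax_laws)
    qed (use A in simp_all)
  qed
qed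

section \<open>Tangent natural transformations\<close>

lemma tangent_natD:
  assumes "tangent_nat C D M N \<phi>"
  shows "A \<in> Obj C \<Longrightarrow> \<phi> A \<in> Arr D" "A \<in> Obj C \<Longrightarrow> Dom D (\<phi> A) = FO (Fun M) A"
    "A \<in> Obj C \<Longrightarrow> Cod D (\<phi> A) = FO (Fun N) A"
    "f \<in> Arr C \<Longrightarrow> \<phi> (Cod C f) \<cdot>\<^bsub>D\<^esub> FA (Fun M) f = FA (Fun N) f \<cdot>\<^bsub>D\<^esub> \<phi> (Dom C f)"
    "A \<in> Obj C \<Longrightarrow> TA D (\<phi> A) \<cdot>\<^bsub>D\<^esub> Str M A = Str N A \<cdot>\<^bsub>D\<^esub> \<phi> (TO C A)"
  using assms by (auto simp: tangent_nat_def nat_trans_def)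

lemma tangent_natI:
  assumes "\<And>A. A \<in> Obj C \<Longrightarrow> \<phi> A \<in> Homs D (FO (Fun M) A) (FO (Fun N) A)"
    "\<And>f. f \<in> Arr C \<Longrightarrow> \<phi> (Cod C f) \<cdot>\<^bsub>D\<^esub> FA (Fun M) f = FA (Fun N) f \<cdot>\<^bsub>D\<^esub> \<phi> (Dom C f)"
    "\<And>A. A \<in> Obj C \<Longrightarrow> TA D (\<phi> A) \<cdot>\<^bsub>D\<^esub> Str M A = Str N A \<cdot>\<^bsub>D\<^esub> \<phi> (TO C A)"
  shows "tangent_nat C D M N \<phi>"
  using assms by (simp add: tangent_nat_def nat_trans_def)

lemma lax_okD: "lax_ok C D M \<Longrightarrow> lax_tangent_morphism C D (Fun M) (Str M)"
  by (simp add: lax_ok_def)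

lemma lax_ok_ext:
  "lax_ok C D M \<Longrightarrow> FO (Fun M) \<in> extensional (Obj C)" "lax_ok C D M \<Longrightarrow> FA (Fun M) \<in> extensional (Arr C)"
  "lax_ok C D M \<Longrightarrow> Str M \<in> extensional (Obj C)"
  by (simp_all add: lax_ok_def)

lemma lax_ok_restrict:
  assumes "lax_tangent_morphism C D F \<alpha>"
  shows "lax_ok C D \<lparr>Fun = ftr_restrict C F, Str = restrict \<alpha> (Obj C)\<rparr>"
  unfolding lax_ok_def
  using lax_cong[OF assms, of "ftr_restrict C F" "restrict \<alpha> (Obj C)"] by (simp add: ftr_restrict_def)

lemma lax_T_simps [simp]:
  "A \<in> Obj C \<Longrightarrow> FO (Fun (lax_T C D M)) A = TO D (FO (Fun M) A)"
  "f \<in> Arr C \<Longrightarrow> FA (Fun (lax_T C D M)) f = TA D (FA (Fun M) f)"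
  "A \<in> Obj C \<Longrightarrow> Str (lax_T C D M) A = cT D (FO (Fun M) A) \<cdot>\<^bsub>D\<^esub> TA D (Str M A)"
  by (simp_all add: lax_T_def ftr_restrict_def ftr_comp_def)

lemma lax_comp_simps [simp]:
  "A \<in> Obj C \<Longrightarrow> FO (Fun (lax_comp C E N M)) A = FO (Fun N) (FO (Fun M) A)"
  "f \<in> Arr C \<Longrightarrow> FA (Fun (lax_comp C E N M)) f = FA (Fun N) (FA (Fun M) f)"
  "A \<in> Obj C \<Longrightarrow> Str (lax_comp C E N M) A = Str N (FO (Fun M) A) \<cdot>\<^bsub>E\<^esub> FA (Fun N) (Str M A)"
  by (simp_all add: lax_comp_def ftr_restrict_def ftr_comp_def)

lemma lax_comp_ok:
  assumes "lax_ok C D M" "lax_ok D E N"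
  shows "lax_ok C E (lax_comp C E N M)"
  unfolding lax_comp_def
  by (rule lax_ok_restrict, rule lax_composite[OF lax_okD[OF assms(1)] lax_okD[OF assms(2)]])

lemma lax_T_ok:
  assumes "lax_ok C D M"
  shows "lax_ok C D (lax_T C D M)"
  unfolding lax_T_def
  by (rule lax_ok_restrict, rule lax_composite[OF lax_okD[OF assms]
      tangent_category.lax_Tan[OF laxD(2)[OF lax_okD[OF assms]]]])

locale lax_object = lax_morphism C D "Fun M" "Str M"
  for C :: "('o1, 'm1, 'x) tcat_scheme" and D :: "('o2, 'm2, 'y) tcat_scheme" and M +
  assumes ok: "lax_ok C D M"
begin

abbreviation mO where "mO \<equiv> FO (Fun M)"
abbreviation mA where "mA \<equiv> FA (Fun M)"

lemma lax_Tn_FO [simp]: "A \<in> Obj C \<Longrightarrow> FO (Fun (lax_Tn C D n M)) A = Tn D n (mO A)"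
  by (simp add: lax_Tn_def ftr_restrict_def ftr_comp_def)

lemma lax_Tn_FA [simp]: "f \<in> Arr C \<Longrightarrow> FA (Fun (lax_Tn C D n M)) f = FA (TnF D n) (mA f)"
  by (simp add: lax_Tn_def ftr_restrict_def ftr_comp_def)

lemma lax_Tn_Str:
  assumes A: "A \<in> Obj C"
  shows "1 \<le> n \<Longrightarrow> Str (lax_Tn C D n M) A \<in> Arr D"
    "1 \<le> n \<Longrightarrow> Dom D (Str (lax_Tn C D n M) A) = Tn D n (mO (TO C A))"
    "1 \<le> n \<Longrightarrow> Cod D (Str (lax_Tn C D n M) A) = TO D (Tn D n (mO A))"
    "i < n \<Longrightarrow> TA D (pr D n i (mO A)) \<cdot>\<^bsub>D\<^esub> Str (lax_Tn C D n M) A =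
      cT D (mO A) \<cdot>\<^bsub>D\<^esub> (TA D (Str M A) \<cdot>\<^bsub>D\<^esub> pr D n i (mO (TO C A)))"
proof -
  let ?g = "\<lambda>i. cT D (mO A) \<cdot>\<^bsub>D\<^esub> TA D (Str M A) \<cdot>\<^bsub>D\<^esub> pr D n i (mO (TO C A))"
  have P: "is_npullback D n (TA D (pT D (mO A))) (TO D (Tn D n (mO A))) (\<lambda>i. TA D (pr D n i (mO A)))"
    if "1 \<le> n" using A that by (intro D.npullback_T1) simp_all
  have g: "?g i \<in> Arr D \<and> Dom D (?g i) = Tn D n (mO (TO C A)) \<and> Cod D (?g i) = Dom D (TA D (pT D (mO A)))"
    if "i < n" for i using A that by simp
  have eq: "TA D (pT D (mO A)) \<cdot>\<^bsub>D\<^esub> ?g i = TA D (pT D (mO A)) \<cdot>\<^bsub>D\<^esub> ?g j" if "i < n" "j < n" for i j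
    using A that D.p_pr[of "mO (TO C A)" i n j] by (simp add: D.tangent_laws D.nat_laws)
  have X: "Tn D n (mO (TO C A)) \<in> Obj D" if "1 \<le> n" using A that by simp
  let ?t = "Str (lax_Tn C D n M) A"
  have t: "?t = ntuple D n (Tn D n (mO (TO C A))) (TO D (Tn D n (mO A))) (\<lambda>i. TA D (pr D n i (mO A))) ?g"
    using A by (simp add: lax_Tn_def)
  show "1 \<le> n \<Longrightarrow> ?t \<in> Arr D" unfolding t by (rule D.npullback_tuple(1)[OF P X g eq])
  show "1 \<le> n \<Longrightarrow> Dom D ?t = Tn D n (mO (TO C A))" unfolding t by (rule D.npullback_tuple(2)[OF P X g eq])
  show "1 \<le> n \<Longrightarrow> Cod D ?t = TO D (Tn D n (mO A))" unfolding t by (rule D.npullback_tuple(3)[OF P X g eq])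
  have "TA D (pr D n i (mO A)) \<cdot>\<^bsub>D\<^esub> ?t = ?g i" if "i < n"
    unfolding t by (rule D.npullback_tuple(4)[OF P X g eq]; use that in simp)
  then show "i < n \<Longrightarrow> TA D (pr D n i (mO A)) \<cdot>\<^bsub>D\<^esub> ?t =
      cT D (mO A) \<cdot>\<^bsub>D\<^esub> (TA D (Str M A) \<cdot>\<^bsub>D\<^esub> pr D n i (mO (TO C A)))"
    using A by simp
qed

lemma lax_Tn_ok:
  assumes n: "1 \<le> n"
  shows "lax_ok C D (lax_Tn C D n M)"
proof -
  have "lax_tangent_morphism C D (Fun (lax_Tn C D n M)) (Str (lax_Tn C D n M))"
  proof (rule lax_by_projections[where K = "{..<n}" and G = "\<lambda>_. Fun (lax_T C D M)"
        and \<beta> = "\<lambda>_. Str (lax_T C D M)" and \<pi> = "\<lambda>i A. pr D n i (mO A)"])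
    show "is_functor C D (Fun (lax_Tn C D n M))"
      by (rule functor_cong[OF functor_comp[OF laxD(3)[OF lax] D.TnF_functor[OF n]] C.category_axioms])
        (simp_all add: ftr_comp_def)
    show "lax_tangent_morphism C D (Fun (lax_T C D M)) (Str (lax_T C D M))" for i
      by (rule lax_okD[OF lax_T_ok[OF ok]])
    fix A assume A: "A \<in> Obj C"
    show "jointly_monic D (FO (Fun (lax_Tn C D n M)) A) {..<n} (\<lambda>i. pr D n i (mO A))"
      using D.npullback_monic[OF D.npullback_T0[of "mO A" n]] A n by simp
    show "jointly_monic D (TO D (FO (Fun (lax_Tn C D n M)) A)) {..<n} (\<lambda>i. TA D (pr D n i (mO A)))"
      using D.npullback_monic[OF D.npullback_T1[of "mO A" n]] A n by simp
    show "jointly_monic D (TO D (TO D (FO (Fun (lax_Tn C D n M)) A))) {..<n} (\<lambda>i. TA D (TA D (pr D n i (mO A))))"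
      using D.npullback_monic[OF D.npullback_T2[of "mO A" n]] A n by simp
  qed (use n in \<open>simp_all add: lax_Tn_Str C.tangent_category_axioms D.tangent_category_axioms\<close>)
  then show ?thesis
    unfolding lax_ok_def by (simp add: lax_Tn_def ftr_restrict_def)
qed

lemma tangent_nat_Id: "tangent_nat C D M M (\<lambda>A. Id D (mO A))"
  by (rule tangent_natI) simp_all

lemma tangent_nat_p: "tangent_nat C D (lax_T C D M) M (\<lambda>A. pT D (mO A))"
  by (rule tangent_natI) (simp_all add: D.tangent_laws D.nat_laws)

lemma tangent_nat_z: "tangent_nat C D M (lax_T C D M) (\<lambda>A. zT D (mO A))"
proof (rule tangent_natI)
  fix A assume A: "A \<in> Obj C"
  show "TA D (zT D (mO A)) \<cdot>\<^bsub>D\<^esub> Str M A = Str (lax_T C D M) A \<cdot>\<^bsub>D\<^esub> zT D (mO (TO C A))"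
    using A D.z_nat_simp[of "Str M A" "TO D (mO A)"] D.c_zT_x[of "mO A" "Str M A"] by simp
qed (simp_all add: D.z_nat_simp)

lemma tangent_nat_l: "tangent_nat C D (lax_T C D M) (lax_T C D (lax_T C D M)) (\<lambda>A. lT D (mO A))"
proof (rule tangent_natI)
  fix A assume A: "A \<in> Obj C"
  have "cT D (TO D (mO A)) \<cdot>\<^bsub>D\<^esub> (TA D (cT D (mO A)) \<cdot>\<^bsub>D\<^esub> (lT D (TO D (mO A)) \<cdot>\<^bsub>D\<^esub> TA D (Str M A))) =
    TA D (lT D (mO A)) \<cdot>\<^bsub>D\<^esub> (cT D (mO A) \<cdot>\<^bsub>D\<^esub> TA D (Str M A))"
    using D.reassoc[OF D.c_c_l[of "mO A"], of "TA D (Str M A)"] A by simp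
  then show "TA D (lT D (mO A)) \<cdot>\<^bsub>D\<^esub> Str (lax_T C D M) A =
      Str (lax_T C D (lax_T C D M)) A \<cdot>\<^bsub>D\<^esub> lT D (mO (TO C A))"
    using A D.l_nat_simp[of "Str M A" "TO D (mO A)"] by simp
qed (simp_all add: D.nat_laws)

lemma tangent_nat_c: "tangent_nat C D (lax_T C D (lax_T C D M)) (lax_T C D (lax_T C D M)) (\<lambda>A. cT D (mO A))"
proof (rule tangent_natI)
  fix A assume A: "A \<in> Obj C"
  have "TA D (cT D (mO A)) \<cdot>\<^bsub>D\<^esub> (cT D (TO D (mO A)) \<cdot>\<^bsub>D\<^esub> (TA D (cT D (mO A)) \<cdot>\<^bsub>D\<^esub> TA D (TA D (Str M A)))) =
    cT D (TO D (mO A)) \<cdot>\<^bsub>D\<^esub> (TA D (cT D (mO A)) \<cdot>\<^bsub>D\<^esub> (cT D (TO D (mO A)) \<cdot>\<^bsub>D\<^esub> TA D (TA D (Str M A))))"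
    using D.reassoc[OF D.c_braid[of "mO A"], of "TA D (TA D (Str M A))"] A by simp
  then show "TA D (cT D (mO A)) \<cdot>\<^bsub>D\<^esub> Str (lax_T C D (lax_T C D M)) A =
      Str (lax_T C D (lax_T C D M)) A \<cdot>\<^bsub>D\<^esub> cT D (mO (TO C A))"
    using A D.c_nat_simp[of "Str M A" "TO D (mO A)"] by simp
qed (simp_all add: D.nat_laws)

lemma tangent_nat_pr:
  "i < n \<Longrightarrow> tangent_nat C D (lax_Tn C D n M) (lax_T C D M) (\<lambda>A. pr D n i (mO A))"
  by (rule tangent_natI) (simp_all add: lax_Tn_Str)

lemma tangent_nat_s: "tangent_nat C D (lax_Tn C D 2 M) (lax_T C D M) (\<lambda>A. sT D (mO A))"
proof (rule tangent_natI)
  fix A assume A: "A \<in> Obj C"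
  let ?t = "Str (lax_Tn C D 2 M) A" and ?u = "Str M A"
  have t: "?t \<in> Arr D" "Dom D ?t = Tn D 2 (mO (TO C A))" "Cod D ?t = TO D (Tn D 2 (mO A))"
    "TA D (pr D 2 0 (mO A)) \<cdot>\<^bsub>D\<^esub> ?t = cT D (mO A) \<cdot>\<^bsub>D\<^esub> (TA D ?u \<cdot>\<^bsub>D\<^esub> pr D 2 0 (mO (TO C A)))"
    "TA D (pr D 2 1 (mO A)) \<cdot>\<^bsub>D\<^esub> ?t = cT D (mO A) \<cdot>\<^bsub>D\<^esub> (TA D ?u \<cdot>\<^bsub>D\<^esub> pr D 2 1 (mO (TO C A)))"
    using lax_Tn_Str[OF A] by simp_all
  have "sT D (TO D (mO A)) \<cdot>\<^bsub>D\<^esub> FA (TnF D 2) ?u = TA D ?u \<cdot>\<^bsub>D\<^esub> sT D (mO (TO C A))"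
    using A by (simp add: D.s_nat_simp)
  moreover have "FA (TnF D 2) ?u = T2pair D (Tn D 2 (mO (TO C A))) (TO D (mO A))
      (TA D ?u \<cdot>\<^bsub>D\<^esub> pr D 2 0 (mO (TO C A))) (TA D ?u \<cdot>\<^bsub>D\<^esub> pr D 2 1 (mO (TO C A)))"
    using A by (intro D.T2pair_eqI[symmetric]) simp_all
  moreover have "cT D (mO A) \<cdot>\<^bsub>D\<^esub> (TA D (sT D (mO A)) \<cdot>\<^bsub>D\<^esub> ?t) =
      sT D (TO D (mO A)) \<cdot>\<^bsub>D\<^esub> T2pair D (Tn D 2 (mO (TO C A))) (TO D (mO A))
      (TA D ?u \<cdot>\<^bsub>D\<^esub> pr D 2 0 (mO (TO C A))) (TA D ?u \<cdot>\<^bsub>D\<^esub> pr D 2 1 (mO (TO C A)))"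
    using D.reassoc[OF D.c_s[of "mO A"], of ?t] A t
    by (simp add: D.T2pair_comp D.tangent_laws)
  ultimately have "cT D (mO A) \<cdot>\<^bsub>D\<^esub> (TA D (sT D (mO A)) \<cdot>\<^bsub>D\<^esub> ?t) = TA D ?u \<cdot>\<^bsub>D\<^esub> sT D (mO (TO C A))"
    by simp
  then have "cT D (mO A) \<cdot>\<^bsub>D\<^esub> (cT D (mO A) \<cdot>\<^bsub>D\<^esub> (TA D (sT D (mO A)) \<cdot>\<^bsub>D\<^esub> ?t)) =
      cT D (mO A) \<cdot>\<^bsub>D\<^esub> (TA D ?u \<cdot>\<^bsub>D\<^esub> sT D (mO (TO C A)))" by simp
  then show "TA D (sT D (mO A)) \<cdot>\<^bsub>D\<^esub> ?t = Str (lax_T C D M) A \<cdot>\<^bsub>D\<^esub> sT D (mO (TO C A))"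
    using A t by (simp add: D.tangent_laws)
qed (simp_all add: D.s_nat_simp)

end

lemma lax_objectI: "lax_ok C D M \<Longrightarrow> lax_object C D M"
  by (simp add: lax_object_def lax_object_axioms_def lax_morphismI lax_okD)

lemma tangent_nat_comp:
  assumes "lax_ok C D M" "lax_ok C D N" "lax_ok C D L" "tangent_nat C D M N \<phi>" "tangent_nat C D N L \<psi>"
  shows "tangent_nat C D M L (\<lambda>A. \<psi> A \<cdot>\<^bsub>D\<^esub> \<phi> A)"
proof -
  interpret M: lax_object C D M by (rule lax_objectI[OF assms(1)])
  interpret N: lax_object C D N by (rule lax_objectI[OF assms(2)])
  interpret L: lax_object C D L by (rule lax_objectI[OF assms(3)])
  note t = tangent_natD[OF assms(4)] and u = tangent_natD[OF assms(5)]
  show ?thesis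
  proof (rule tangent_natI)
    fix f assume f: "f \<in> Arr C"
    show "(\<psi> (Cod C f) \<cdot>\<^bsub>D\<^esub> \<phi> (Cod C f)) \<cdot>\<^bsub>D\<^esub> FA (Fun M) f = FA (Fun L) f \<cdot>\<^bsub>D\<^esub> (\<psi> (Dom C f) \<cdot>\<^bsub>D\<^esub> \<phi> (Dom C f))"
      using f t(1-3) u(1-3) t(4)[OF f] M.D.reassoc[OF u(4)[OF f], of "\<phi> (Dom C f)"] by simp
  next
    fix A assume A: "A \<in> Obj C"
    show "TA D (\<psi> A \<cdot>\<^bsub>D\<^esub> \<phi> A) \<cdot>\<^bsub>D\<^esub> Str M A = Str L A \<cdot>\<^bsub>D\<^esub> (\<psi> (TO C A) \<cdot>\<^bsub>D\<^esub> \<phi> (TO C A))"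
      using A t(1-3) u(1-3) t(5)[OF A] M.D.reassoc[OF u(5)[OF A], of "\<phi> (TO C A)"] by simp
  qed (use t(1-3) u(1-3) in simp_all)
qed

lemma tangent_nat_T:
  assumes "lax_ok C D M" "lax_ok C D N" "tangent_nat C D M N \<phi>"
  shows "tangent_nat C D (lax_T C D M) (lax_T C D N) (\<lambda>A. TA D (\<phi> A))"
proof -
  interpret M: lax_object C D M by (rule lax_objectI[OF assms(1)])
  interpret N: lax_object C D N by (rule lax_objectI[OF assms(2)])
  note t = tangent_natD[OF assms(3)]
  show ?thesis
  proof (rule tangent_natI)
    fix f assume f: "f \<in> Arr C"
    show "TA D (\<phi> (Cod C f)) \<cdot>\<^bsub>D\<^esub> FA (Fun (lax_T C D M)) f = FA (Fun (lax_T C D N)) f \<cdot>\<^bsub>D\<^esub> TA D (\<phi> (Dom C f))"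
      using f t(1-3) arg_cong[OF t(4)[OF f], of "TA D"] by simp
  next
    fix A assume A: "A \<in> Obj C"
    show "TA D (TA D (\<phi> A)) \<cdot>\<^bsub>D\<^esub> Str (lax_T C D M) A = Str (lax_T C D N) A \<cdot>\<^bsub>D\<^esub> TA D (\<phi> (TO C A))"
      using A t(1-3) arg_cong[OF t(5)[OF A], of "TA D"] M.D.c_nat_x[of "\<phi> A" "FO (Fun N) A" "TA D (Str M A)"]
      by simp
  qed (use t(1-3) in simp_all)
qed

text \<open>The two sides of naturality agree after the legs \<open>\<pi> i\<close>, those of compatibility with the lax
  structures after \<open>T (\<pi> i)\<close>.\<close>

lemma tangent_nat_lift:
  assumes X: "lax_ok C D X" and P: "lax_ok C D P" and G: "\<And>i. i \<in> K \<Longrightarrow> lax_ok C D (G i)"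
    and \<pi>: "\<And>i. i \<in> K \<Longrightarrow> tangent_nat C D P (G i) (\<pi> i)"
    and g: "\<And>i. i \<in> K \<Longrightarrow> tangent_nat C D X (G i) (g i)"
    and u: "\<And>A. A \<in> Obj C \<Longrightarrow> u A \<in> Homs D (FO (Fun X) A) (FO (Fun P) A)"
    and \<pi>u: "\<And>i A. \<lbrakk>i \<in> K; A \<in> Obj C\<rbrakk> \<Longrightarrow> \<pi> i A \<cdot>\<^bsub>D\<^esub> u A = g i A"
    and m: "\<And>A. A \<in> Obj C \<Longrightarrow> stably_monic D (FO (Fun P) A) K (\<lambda>i. \<pi> i A)"
  shows "tangent_nat C D X P u"
proof -
  interpret X: lax_object C D X by (rule lax_objectI[OF X])
  interpret P: lax_object C D P by (rule lax_objectI[OF P])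
  have [simp]: "u A \<in> Arr D" "Dom D (u A) = FO (Fun X) A" "Cod D (u A) = FO (Fun P) A" if "A \<in> Obj C" for A
    using u[OF that] by simp_all
  show ?thesis
  proof (rule tangent_natI[OF u])
    fix f assume f: "f \<in> Arr C"
    show "u (Cod C f) \<cdot>\<^bsub>D\<^esub> FA (Fun X) f = FA (Fun P) f \<cdot>\<^bsub>D\<^esub> u (Dom C f)"
    proof (rule jointly_monicD[OF m[unfolded stably_monic_def, THEN conjunct1]])
      fix i assume i: "i \<in> K"
      interpret G: lax_object C D "G i" by (rule lax_objectI[OF G[OF i]])
      note p = tangent_natD[OF \<pi>[OF i]] and q = tangent_natD[OF g[OF i]]
      show "\<pi> i (Cod C f) \<cdot>\<^bsub>D\<^esub> (u (Cod C f) \<cdot>\<^bsub>D\<^esub> FA (Fun X) f) = \<pi> i (Cod C f) \<cdot>\<^bsub>D\<^esub> (FA (Fun P) f \<cdot>\<^bsub>D\<^esub> u (Dom C f))"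
        using f p(1-3) q(1-3) q(4)[OF f] X.D.reassoc[OF \<pi>u[OF i, of "Cod C f"], of "FA (Fun X) f"]
          X.D.reassoc[OF p(4)[OF f], of "u (Dom C f)"] by (simp add: \<pi>u i)
    qed (use f in simp_all)
  next
    fix A assume A: "A \<in> Obj C"
    show "TA D (u A) \<cdot>\<^bsub>D\<^esub> Str X A = Str P A \<cdot>\<^bsub>D\<^esub> u (TO C A)"
    proof (rule jointly_monicD[OF m[unfolded stably_monic_def, THEN conjunct2]])
      fix i assume i: "i \<in> K"
      interpret G: lax_object C D "G i" by (rule lax_objectI[OF G[OF i]])
      note p = tangent_natD[OF \<pi>[OF i]] and q = tangent_natD[OF g[OF i]]
      have T\<pi>u: "TA D (\<pi> i A) \<cdot>\<^bsub>D\<^esub> TA D (u A) = TA D (g i A)"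
        using arg_cong[OF \<pi>u[OF i A], of "TA D"] A p(1-3) i by simp
      show "TA D (\<pi> i A) \<cdot>\<^bsub>D\<^esub> (TA D (u A) \<cdot>\<^bsub>D\<^esub> Str X A) = TA D (\<pi> i A) \<cdot>\<^bsub>D\<^esub> (Str P A \<cdot>\<^bsub>D\<^esub> u (TO C A))"
        using A p(1-3) q(1-3) q(5)[OF A] X.D.reassoc[OF T\<pi>u, of "Str X A"]
          X.D.reassoc[OF p(5)[OF A], of "u (TO C A)"] by (simp add: \<pi>u i)
    qed (use A in simp_all)
  qed simp
qed

lemma tangent_nat_restrict:
  assumes "category C" "\<And>A. A \<in> Obj C \<Longrightarrow> TO C A \<in> Obj C"
  shows "tangent_nat C D M N (restrict \<phi> (Obj C)) \<longleftrightarrow> tangent_nat C D M N \<phi>"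
proof -
  interpret category C by fact
  show ?thesis unfolding tangent_nat_def nat_trans_def using assms(2) by simp
qed

section \<open>Tangent fibrations\<close>

lemma tangent_fibration_preserving:
  assumes "tangent_fibration \<E>"
  shows "tangent_preserving (Total \<E>) (Base \<E>) (Proj \<E>)"
proof -
  have l: "lax_tangent_morphism (Total \<E>) (Base \<E>) (Proj \<E>) (\<lambda>A. Id (Base \<E>) (FO (Proj \<E>) (TO (Total \<E>) A)))"
    using assms by (simp add: tangent_fibration_def strict_tangent_morphism_def)
  interpret lax_morphism "Total \<E>" "Base \<E>" "Proj \<E>" "\<lambda>A. Id (Base \<E>) (FO (Proj \<E>) (TO (Total \<E>) A))"
    by (rule lax_morphismI[OF l])
  have T: "FO (Proj \<E>) (TO (Total \<E>) A) = TO (Base \<E>) (FO (Proj \<E>) A)" if "A \<in> Obj (Total \<E>)" for A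
    using \<alpha>_simps(3)[OF that] that by simp
  have Tn: "FO (Proj \<E>) (Tn (Total \<E>) n E) = Tn (Base \<E>) n (FO (Proj \<E>) E)"
    "\<And>i. i < n \<Longrightarrow> FA (Proj \<E>) (pr (Total \<E>) n i E) = pr (Base \<E>) n i (FO (Proj \<E>) E)"
    if "1 \<le> n" "E \<in> Obj (Total \<E>)" for n E
    using assms that by (simp_all add: tangent_fibration_def)
  have pr2: "FA (Proj \<E>) (pr (Total \<E>) 2 0 E) = pr (Base \<E>) 2 0 (FO (Proj \<E>) E)"
    "FA (Proj \<E>) (pr (Total \<E>) 2 1 E) = pr (Base \<E>) 2 1 (FO (Proj \<E>) E)" if "E \<in> Obj (Total \<E>)" for E
    using Tn(2)[of 2 E] that by simp_all
  have TA: "FA (Proj \<E>) (TA (Total \<E>) f) = TA (Base \<E>) (FA (Proj \<E>) f)" if "f \<in> Arr (Total \<E>)" for f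
    using \<alpha>_nat[OF that refl] that by (simp add: T)
  show ?thesis
    unfolding tangent_preserving_def
  proof (intro conjI ballI allI impI)
    show "is_functor (Total \<E>) (Base \<E>) (Proj \<E>)" by (rule laxD(3)[OF l])
    fix A assume A: "A \<in> Obj (Total \<E>)"
    show "FO (Proj \<E>) (TO (Total \<E>) A) = TO (Base \<E>) (FO (Proj \<E>) A)" using A by (rule T)
    show "FA (Proj \<E>) (pT (Total \<E>) A) = pT (Base \<E>) (FO (Proj \<E>) A)" using p_\<alpha>[OF A] A by (simp add: T)
    show "FA (Proj \<E>) (zT (Total \<E>) A) = zT (Base \<E>) (FO (Proj \<E>) A)" using \<alpha>_z[OF A] A by (simp add: T)
    show "FA (Proj \<E>) (sT (Total \<E>) A) = sT (Base \<E>) (FO (Proj \<E>) A)"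
      using \<alpha>_s[OF A] A by (simp add: T pr2 Tn)
    show "FA (Proj \<E>) (lT (Total \<E>) A) = lT (Base \<E>) (FO (Proj \<E>) A)" using l_\<alpha>[OF A] A by (simp add: T)
    show "FA (Proj \<E>) (cT (Total \<E>) A) = cT (Base \<E>) (FO (Proj \<E>) A)" using c_\<alpha>[OF A] A by (simp add: T)
  qed (use TA Tn in auto)
qed

lemma tangent_preserving_lax:
  assumes C: "tangent_category C" and D: "tangent_category D" and F: "tangent_preserving C D F"
  shows "strict_tangent_morphism C D F"
proof -
  interpret C: tangent_category C by fact
  interpret D: tangent_category D by fact
  note [simp] = functor_simps[OF tangent_preserving_functor[OF F]] tangent_preserving_simps[OF F]
  show ?thesis
    unfolding strict_tangent_morphism_def
    by (rule laxI[OF C D tangent_preserving_functor[OF F]]) simp_all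
qed

locale tangent_fib =
  fixes \<E> :: "('e, 'em, 'b, 'bm, 'x) tfib_scheme"
  assumes tangent_fibration: "tangent_fibration \<E>"
begin

abbreviation "XX \<equiv> Total \<E>"
abbreviation "BB \<equiv> Base \<E>"
abbreviation \<Pi>O where "\<Pi>O \<equiv> FO (Proj \<E>)"
abbreviation \<Pi>A where "\<Pi>A \<equiv> FA (Proj \<E>)"

lemma preserving: "tangent_preserving XX BB (Proj \<E>)"
  by (rule tangent_fibration_preserving[OF tangent_fibration])

end

sublocale tangent_fib \<subseteq> X: tangent_category XX
  using tangent_fibration
  by (simp add: tangent_fibration_def strict_tangent_morphism_def lax_tangent_morphism_def)

sublocale tangent_fib \<subseteq> B: tangent_category BB
  using tangent_fibration
  by (simp add: tangent_fibration_def strict_tangent_morphism_def lax_tangent_morphism_def)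

context tangent_fib
begin

lemmas \<Pi>_functor [simp] = functor_simps[OF tangent_preserving_functor[OF preserving]]
lemmas \<Pi>_simps [simp] = tangent_preserving_simps[OF preserving]
lemmas \<Pi>_T2pair = tangent_preserving_T2pair[OF X.pre_tangent_category_axioms B.pre_tangent_category_axioms preserving]
lemmas \<Pi>_TnF [simp] = tangent_preserving_TnF[OF X.pre_tangent_category_axioms B.pre_tangent_category_axioms preserving]

lemma cartesian_Arr [simp]: "cartesian_arrow \<E> \<phi> \<Longrightarrow> \<phi> \<in> Arr XX"
  by (simp add: cartesian_arrow_def)

lemma cartesian_fill:
  assumes "cartesian_arrow \<E> \<phi>" "h \<in> Arr XX" "Cod XX h = Cod XX \<phi>" "k \<in> Arr BB" "Dom BB k = \<Pi>O (Dom XX h)"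
    "Cod BB k = \<Pi>O (Dom XX \<phi>)" "\<Pi>A h = \<Pi>A \<phi> \<cdot>\<^bsub>BB\<^esub> k"
  shows "\<exists>!u. u \<in> Homs XX (Dom XX h) (Dom XX \<phi>) \<and> \<Pi>A u = k \<and> \<phi> \<cdot>\<^bsub>XX\<^esub> u = h"
  using assms unfolding cartesian_arrow_def by simp

lemma cart_fill_simps:
  assumes "cartesian_arrow \<E> \<phi>" "h \<in> Arr XX" "Cod XX h = Cod XX \<phi>" "k \<in> Arr BB" "Dom BB k = \<Pi>O (Dom XX h)"
    "Cod BB k = \<Pi>O (Dom XX \<phi>)" "\<Pi>A h = \<Pi>A \<phi> \<cdot>\<^bsub>BB\<^esub> k"
  shows "cart_fill \<E> \<phi> h k \<in> Arr XX" "Dom XX (cart_fill \<E> \<phi> h k) = Dom XX h"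
    "Cod XX (cart_fill \<E> \<phi> h k) = Dom XX \<phi>" "\<Pi>A (cart_fill \<E> \<phi> h k) = k"
    "\<phi> \<cdot>\<^bsub>XX\<^esub> cart_fill \<E> \<phi> h k = h"
  using theI'[OF cartesian_fill[OF assms], folded cart_fill_def] by auto

lemma cartesian_eqI:
  assumes \<phi>: "cartesian_arrow \<E> \<phi>" and uv: "u \<in> Arr XX" "v \<in> Arr XX" "Dom XX u = Dom XX v" "Cod XX u = Dom XX \<phi>"
    "Cod XX v = Dom XX \<phi>" "\<phi> \<cdot>\<^bsub>XX\<^esub> u = \<phi> \<cdot>\<^bsub>XX\<^esub> v" "\<Pi>A u = \<Pi>A v"
  shows "u = v"
proof -
  have "\<exists>!w. w \<in> Homs XX (Dom XX (\<phi> \<cdot>\<^bsub>XX\<^esub> u)) (Dom XX \<phi>) \<and> \<Pi>A w = \<Pi>A u \<and> \<phi> \<cdot>\<^bsub>XX\<^esub> w = \<phi> \<cdot>\<^bsub>XX\<^esub> u"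
    by (rule cartesian_fill[OF \<phi>]) (use \<phi> uv(1,4) in simp_all)
  then show ?thesis by (rule unique_eqI) (use \<phi> uv in simp_all)
qed

lemma cart_fill_eqI:
  assumes "cartesian_arrow \<E> \<phi>" "u \<in> Arr XX" "Cod XX u = Dom XX \<phi>" "\<phi> \<cdot>\<^bsub>XX\<^esub> u = h" "\<Pi>A u = k"
  shows "cart_fill \<E> \<phi> h k = u"
  unfolding cart_fill_def
proof (rule the_equality)
  fix v assume v: "v \<in> Homs XX (Dom XX h) (Dom XX \<phi>) \<and> \<Pi>A v = k \<and> \<phi> \<cdot>\<^bsub>XX\<^esub> v = h"
  show "v = u" by (rule cartesian_eqI[OF assms(1)]) (use assms v in auto)
qed (use assms in auto)

lemma cartesianI:
  assumes "\<phi> \<in> Arr XX"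
    and "\<And>h k. \<lbrakk>h \<in> Arr XX; Cod XX h = Cod XX \<phi>; k \<in> Arr BB; Dom BB k = \<Pi>O (Dom XX h);
      Cod BB k = \<Pi>O (Dom XX \<phi>); \<Pi>A h = \<Pi>A \<phi> \<cdot>\<^bsub>BB\<^esub> k\<rbrakk>
      \<Longrightarrow> \<exists>u\<in>Arr XX. Dom XX u = Dom XX h \<and> Cod XX u = Dom XX \<phi> \<and> \<Pi>A u = k \<and> \<phi> \<cdot>\<^bsub>XX\<^esub> u = h"
    and "\<And>u v. \<lbrakk>u \<in> Arr XX; v \<in> Arr XX; Dom XX u = Dom XX v; Cod XX u = Dom XX \<phi>; Cod XX v = Dom XX \<phi>;
      \<phi> \<cdot>\<^bsub>XX\<^esub> u = \<phi> \<cdot>\<^bsub>XX\<^esub> v; \<Pi>A u = \<Pi>A v\<rbrakk> \<Longrightarrow> u = v"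
  shows "cartesian_arrow \<E> \<phi>"
  unfolding cartesian_arrow_def
proof (intro conjI ballI impI assms(1))
  fix h k assume hk: "h \<in> Arr XX" "k \<in> Homs BB (\<Pi>O (Dom XX h)) (\<Pi>O (Dom XX \<phi>))" "Cod XX h = Cod XX \<phi>"
    "\<Pi>A h = \<Pi>A \<phi> \<cdot>\<^bsub>BB\<^esub> k"
  then obtain u where u: "u \<in> Arr XX" "Dom XX u = Dom XX h" "Cod XX u = Dom XX \<phi>" "\<Pi>A u = k" "\<phi> \<cdot>\<^bsub>XX\<^esub> u = h"
    using assms(2)[of h k] by auto
  show "\<exists>!u. u \<in> Homs XX (Dom XX h) (Dom XX \<phi>) \<and> \<Pi>A u = k \<and> \<phi> \<cdot>\<^bsub>XX\<^esub> u = h"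
  proof (rule ex1I[of _ u])
    fix v assume v: "v \<in> Homs XX (Dom XX h) (Dom XX \<phi>) \<and> \<Pi>A v = k \<and> \<phi> \<cdot>\<^bsub>XX\<^esub> v = h"
    show "v = u" by (rule assms(3)) (use u v in auto)
  qed (use u in simp)
qed

lemma cartesian_T: "cartesian_arrow \<E> \<phi> \<Longrightarrow> cartesian_arrow \<E> (TA XX \<phi>)"
  using tangent_fibration by (simp add: tangent_fibration_def)

text \<open>A filler for \<open>T\<^sub>n \<phi>\<close> is a tuple of fillers for \<open>T \<phi>\<close>. Its entries agree over the source of \<open>\<phi>\<close>
  because they do so after \<open>\<phi>\<close> and in the base, and \<open>\<phi>\<close> is Cartesian.\<close>

lemma cartesian_TnF:
  assumes \<phi>: "cartesian_arrow \<E> \<phi>" and n: "1 \<le> n"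
  shows "cartesian_arrow \<E> (FA (TnF XX n) \<phi>)"
proof (rule cartesianI)
  have T\<phi>: "cartesian_arrow \<E> (TA XX \<phi>)" by (rule cartesian_T[OF \<phi>])
  have ty [simp]: "\<phi> \<in> Arr XX" using \<phi> by simp
  show "FA (TnF XX n) \<phi> \<in> Arr XX" using n by simp
  fix h k assume h: "h \<in> Arr XX" "Cod XX h = Cod XX (FA (TnF XX n) \<phi>)" and k: "k \<in> Arr BB"
    "Dom BB k = \<Pi>O (Dom XX h)" "Cod BB k = \<Pi>O (Dom XX (FA (TnF XX n) \<phi>))"
    and eq: "\<Pi>A h = \<Pi>A (FA (TnF XX n) \<phi>) \<cdot>\<^bsub>BB\<^esub> k"
  define u where "u i = cart_fill \<E> (TA XX \<phi>) (pr XX n i (Cod XX \<phi>) \<cdot>\<^bsub>XX\<^esub> h)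
    (pr BB n i (\<Pi>O (Dom XX \<phi>)) \<cdot>\<^bsub>BB\<^esub> k)" for i
  have u: "u i \<in> Arr XX" "Dom XX (u i) = Dom XX h" "Cod XX (u i) = TO XX (Dom XX \<phi>)"
    "\<Pi>A (u i) = pr BB n i (\<Pi>O (Dom XX \<phi>)) \<cdot>\<^bsub>BB\<^esub> k"
    "TA XX \<phi> \<cdot>\<^bsub>XX\<^esub> u i = pr XX n i (Cod XX \<phi>) \<cdot>\<^bsub>XX\<^esub> h" if i: "i < n" for i
  proof -
    have "\<Pi>A (pr XX n i (Cod XX \<phi>) \<cdot>\<^bsub>XX\<^esub> h) = \<Pi>A (TA XX \<phi>) \<cdot>\<^bsub>BB\<^esub> (pr BB n i (\<Pi>O (Dom XX \<phi>)) \<cdot>\<^bsub>BB\<^esub> k)"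
      using h k eq n i by simp
    note c = cart_fill_simps[OF T\<phi> _ _ _ _ _ this, folded u_def]
    show "u i \<in> Arr XX" "Dom XX (u i) = Dom XX h" "Cod XX (u i) = TO XX (Dom XX \<phi>)"
      "\<Pi>A (u i) = pr BB n i (\<Pi>O (Dom XX \<phi>)) \<cdot>\<^bsub>BB\<^esub> k"
      "TA XX \<phi> \<cdot>\<^bsub>XX\<^esub> u i = pr XX n i (Cod XX \<phi>) \<cdot>\<^bsub>XX\<^esub> h"
      using c h k n i by simp_all
  qed
  have pu: "pT XX (Dom XX \<phi>) \<cdot>\<^bsub>XX\<^esub> u i = pT XX (Dom XX \<phi>) \<cdot>\<^bsub>XX\<^esub> u j" if i: "i < n" and j: "j < n" for i j
  proof (rule cartesian_eqI[OF \<phi>])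
    have e: "\<phi> \<cdot>\<^bsub>XX\<^esub> (pT XX (Dom XX \<phi>) \<cdot>\<^bsub>XX\<^esub> u i) = pT XX (Cod XX \<phi>) \<cdot>\<^bsub>XX\<^esub> (pr XX n i (Cod XX \<phi>) \<cdot>\<^bsub>XX\<^esub> h)"
      if "i < n" for i
      using X.p_nat_x[of \<phi> "Cod XX \<phi>" "u i"] u[OF that] by simp
    show "\<phi> \<cdot>\<^bsub>XX\<^esub> (pT XX (Dom XX \<phi>) \<cdot>\<^bsub>XX\<^esub> u i) = \<phi> \<cdot>\<^bsub>XX\<^esub> (pT XX (Dom XX \<phi>) \<cdot>\<^bsub>XX\<^esub> u j)"
      using X.reassoc[OF X.p_pr[of "Cod XX \<phi>" i n j], of h] e[OF i] e[OF j] i j h n by simp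
    show "\<Pi>A (pT XX (Dom XX \<phi>) \<cdot>\<^bsub>XX\<^esub> u i) = \<Pi>A (pT XX (Dom XX \<phi>) \<cdot>\<^bsub>XX\<^esub> u j)"
      using B.reassoc[OF B.p_pr[of "\<Pi>O (Dom XX \<phi>)" i n j], of k] u[OF i] u[OF j] i j k n by simp
  qed (use u i j in simp_all)
  have np: "is_npullback XX n (pT XX (Dom XX \<phi>)) (Tn XX n (Dom XX \<phi>)) (\<lambda>i. pr XX n i (Dom XX \<phi>))"
    using X.npullback_T0 n by simp
  have "\<exists>!w. w \<in> Homs XX (Dom XX h) (Tn XX n (Dom XX \<phi>)) \<and> (\<forall>i<n. pr XX n i (Dom XX \<phi>) \<cdot>\<^bsub>XX\<^esub> w = u i)"
  proof (rule X.npullbackD(7)[OF np])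
    show "Dom XX h \<in> Obj XX" using h by simp
    show "u i \<in> Homs XX (Dom XX h) (Dom XX (pT XX (Dom XX \<phi>)))" if "i < n" for i using u[OF that] by simp
  qed (rule pu)
  then obtain w where w: "w \<in> Arr XX" "Dom XX w = Dom XX h" "Cod XX w = Tn XX n (Dom XX \<phi>)"
    "\<And>i. i < n \<Longrightarrow> pr XX n i (Dom XX \<phi>) \<cdot>\<^bsub>XX\<^esub> w = u i" by auto
  have "FA (TnF XX n) \<phi> \<cdot>\<^bsub>XX\<^esub> w = h"
  proof (rule X.Tn_eqI[where n = n and A = "Cod XX \<phi>"])
    show "pr XX n i (Cod XX \<phi>) \<cdot>\<^bsub>XX\<^esub> (FA (TnF XX n) \<phi> \<cdot>\<^bsub>XX\<^esub> w) = pr XX n i (Cod XX \<phi>) \<cdot>\<^bsub>XX\<^esub> h" if "i < n" for i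
      using that w u[OF that] by simp
  qed (use w h n in simp_all)
  moreover have "\<Pi>A w = k"
  proof (rule B.Tn_eqI[where n = n and A = "\<Pi>O (Dom XX \<phi>)"])
    show "pr BB n i (\<Pi>O (Dom XX \<phi>)) \<cdot>\<^bsub>BB\<^esub> \<Pi>A w = pr BB n i (\<Pi>O (Dom XX \<phi>)) \<cdot>\<^bsub>BB\<^esub> k" if "i < n" for i
      using that w(1-3) u[OF that] arg_cong[OF w(4)[OF that], of \<Pi>A] by simp
  qed (use w h k n in simp_all)
  ultimately show "\<exists>u\<in>Arr XX. Dom XX u = Dom XX h \<and> Cod XX u = Dom XX (FA (TnF XX n) \<phi>) \<and> \<Pi>A u = k \<and>
      FA (TnF XX n) \<phi> \<cdot>\<^bsub>XX\<^esub> u = h"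
    using w n by auto
next
  fix u v assume uv: "u \<in> Arr XX" "v \<in> Arr XX" "Dom XX u = Dom XX v" "Cod XX u = Dom XX (FA (TnF XX n) \<phi>)"
    "Cod XX v = Dom XX (FA (TnF XX n) \<phi>)" "FA (TnF XX n) \<phi> \<cdot>\<^bsub>XX\<^esub> u = FA (TnF XX n) \<phi> \<cdot>\<^bsub>XX\<^esub> v" "\<Pi>A u = \<Pi>A v"
  have ty [simp]: "\<phi> \<in> Arr XX" using \<phi> by simp
  have co: "Cod XX u = Tn XX n (Dom XX \<phi>)" "Cod XX v = Tn XX n (Dom XX \<phi>)" using uv n by simp_all
  show "u = v"
  proof (rule X.Tn_eqI[where n = n and A = "Dom XX \<phi>"])
    fix i assume i: "i < n"
    show "pr XX n i (Dom XX \<phi>) \<cdot>\<^bsub>XX\<^esub> u = pr XX n i (Dom XX \<phi>) \<cdot>\<^bsub>XX\<^esub> v"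
    proof (rule cartesian_eqI[OF cartesian_T[OF \<phi>]])
      show "TA XX \<phi> \<cdot>\<^bsub>XX\<^esub> (pr XX n i (Dom XX \<phi>) \<cdot>\<^bsub>XX\<^esub> u) = TA XX \<phi> \<cdot>\<^bsub>XX\<^esub> (pr XX n i (Dom XX \<phi>) \<cdot>\<^bsub>XX\<^esub> v)"
        using X.TnF_x[of \<phi> i n "Cod XX \<phi>" u] X.TnF_x[of \<phi> i n "Cod XX \<phi>" v] uv co i by simp
    qed (use uv co i in simp_all)
  qed (use uv co n in simp_all)
qed

end

section \<open>The hom-category of two tangent fibrations\<close>

locale tangent_fibrations = E1: tangent_fib \<E>1 + E2: tangent_fib \<E>2
  for \<E>1 :: "('e1, 'em1, 'b1, 'bm1, 'x) tfib_scheme" and \<E>2 :: "('e2, 'em2, 'b2, 'bm2, 'y) tfib_scheme"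
begin

lemma morB: "fib_morphism \<E>1 \<E>2 M \<Longrightarrow> lax_object (Base \<E>1) (Base \<E>2) (mB M)"
  and morT: "fib_morphism \<E>1 \<E>2 M \<Longrightarrow> lax_object (Total \<E>1) (Total \<E>2) (mT M)"
  by (simp_all add: fib_morphism_def lax_objectI)

lemma mor_ok:
  assumes "fib_morphism \<E>1 \<E>2 M"
  shows "lax_ok (Base \<E>1) (Base \<E>2) (mB M)" "lax_ok (Total \<E>1) (Total \<E>2) (mT M)"
  using assms by (simp_all add: fib_morphism_def)

lemma mor_simps [simp]:
  assumes "fib_morphism \<E>1 \<E>2 M"
  shows "A \<in> Obj (Base \<E>1) \<Longrightarrow> bO M A \<in> Obj (Base \<E>2)" "E \<in> Obj (Total \<E>1) \<Longrightarrow> tO M E \<in> Obj (Total \<E>2)"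
    "E \<in> Obj (Total \<E>1) \<Longrightarrow> FO (Proj \<E>2) (tO M E) = bO M (FO (Proj \<E>1) E)"
    "f \<in> Arr (Total \<E>1) \<Longrightarrow> FA (Proj \<E>2) (FA (Fun (mT M)) f) = FA (Fun (mB M)) (FA (Proj \<E>1) f)"
    "cartesian_arrow \<E>1 \<phi> \<Longrightarrow> cartesian_arrow \<E>2 (FA (Fun (mT M)) \<phi>)"
    "E \<in> Obj (Total \<E>1) \<Longrightarrow> FA (Proj \<E>2) (Str (mT M) E) = Str (mB M) (FO (Proj \<E>1) E)"
proof -
  interpret b: lax_object "Base \<E>1" "Base \<E>2" "mB M" by (rule morB[OF assms])
  interpret t: lax_object "Total \<E>1" "Total \<E>2" "mT M" by (rule morT[OF assms])
  show "A \<in> Obj (Base \<E>1) \<Longrightarrow> bO M A \<in> Obj (Base \<E>2)" by simp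
  show "E \<in> Obj (Total \<E>1) \<Longrightarrow> tO M E \<in> Obj (Total \<E>2)" by simp
qed (use assms in \<open>simp_all add: fib_morphism_def\<close>)

lemma cell_simps [simp]:
  assumes "fib_cell \<E>1 \<E>2 t"
  shows "fib_morphism \<E>1 \<E>2 (Src t)" "fib_morphism \<E>1 \<E>2 (Tgt t)"
    "A \<in> Obj (Base \<E>1) \<Longrightarrow> fst (Und t) A \<in> Arr (Base \<E>2)"
    "A \<in> Obj (Base \<E>1) \<Longrightarrow> Dom (Base \<E>2) (fst (Und t) A) = bO (Src t) A"
    "A \<in> Obj (Base \<E>1) \<Longrightarrow> Cod (Base \<E>2) (fst (Und t) A) = bO (Tgt t) A"
    "E \<in> Obj (Total \<E>1) \<Longrightarrow> snd (Und t) E \<in> Arr (Total \<E>2)"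
    "E \<in> Obj (Total \<E>1) \<Longrightarrow> Dom (Total \<E>2) (snd (Und t) E) = tO (Src t) E"
    "E \<in> Obj (Total \<E>1) \<Longrightarrow> Cod (Total \<E>2) (snd (Und t) E) = tO (Tgt t) E"
    "E \<in> Obj (Total \<E>1) \<Longrightarrow> FA (Proj \<E>2) (snd (Und t) E) = fst (Und t) (FO (Proj \<E>1) E)"
  using assms unfolding fib_cell_def by (auto dest: tangent_natD)

lemma cell_nat:
  assumes "fib_cell \<E>1 \<E>2 t"
  shows "tangent_nat (Base \<E>1) (Base \<E>2) (mB (Src t)) (mB (Tgt t)) (fst (Und t))"
    "tangent_nat (Total \<E>1) (Total \<E>2) (mT (Src t)) (mT (Tgt t)) (snd (Und t))"
  using assms unfolding fib_cell_def by blast+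

lemma cell_ext:
  assumes "fib_cell \<E>1 \<E>2 t"
  shows "fst (Und t) \<in> extensional (Obj (Base \<E>1))" "snd (Und t) \<in> extensional (Obj (Total \<E>1))"
  using assms unfolding fib_cell_def by blast+

lemma cell_eqI:
  assumes "fib_cell \<E>1 \<E>2 t" "fib_cell \<E>1 \<E>2 u" "Src t = Src u" "Tgt t = Tgt u"
    "\<And>A. A \<in> Obj (Base \<E>1) \<Longrightarrow> fst (Und t) A = fst (Und u) A"
    "\<And>E. E \<in> Obj (Total \<E>1) \<Longrightarrow> snd (Und t) E = snd (Und u) E"
  shows "t = u"
proof -
  have "fst (Und t) = fst (Und u)"
    by (rule extensionalityI[OF cell_ext(1)[OF assms(1)] cell_ext(1)[OF assms(2)] assms(5)])
  moreover have "snd (Und t) = snd (Und u)"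
    by (rule extensionalityI[OF cell_ext(2)[OF assms(1)] cell_ext(2)[OF assms(2)] assms(6)])
  ultimately show ?thesis using assms(3,4) by (cases t; cases u) (auto simp: prod_eq_iff)
qed

lemma mk_cell_simps [simp]:
  "Src (mk_cell \<E>1 M N \<phi> \<psi>) = M" "Tgt (mk_cell \<E>1 M N \<phi> \<psi>) = N"
  "A \<in> Obj (Base \<E>1) \<Longrightarrow> fst (Und (mk_cell \<E>1 M N \<phi> \<psi>)) A = \<phi> A"
  "E \<in> Obj (Total \<E>1) \<Longrightarrow> snd (Und (mk_cell \<E>1 M N \<phi> \<psi>)) E = \<psi> E"
  by (simp_all add: mk_cell_def)

lemma mk_cell_cell:
  assumes "fib_morphism \<E>1 \<E>2 M" "fib_morphism \<E>1 \<E>2 N"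
    "tangent_nat (Base \<E>1) (Base \<E>2) (mB M) (mB N) \<phi>" "tangent_nat (Total \<E>1) (Total \<E>2) (mT M) (mT N) \<psi>"
    "\<And>E. E \<in> Obj (Total \<E>1) \<Longrightarrow> FA (Proj \<E>2) (\<psi> E) = \<phi> (FO (Proj \<E>1) E)"
  shows "fib_cell \<E>1 \<E>2 (mk_cell \<E>1 M N \<phi> \<psi>)"
  unfolding fib_cell_def
proof (intro conjI)
  show "tangent_nat (Base \<E>1) (Base \<E>2) (mB (Src (mk_cell \<E>1 M N \<phi> \<psi>))) (mB (Tgt (mk_cell \<E>1 M N \<phi> \<psi>)))
    (fst (Und (mk_cell \<E>1 M N \<phi> \<psi>)))"
    using assms(3) by (simp add: mk_cell_def tangent_nat_restrict E1.B.category_axioms)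
  show "tangent_nat (Total \<E>1) (Total \<E>2) (mT (Src (mk_cell \<E>1 M N \<phi> \<psi>))) (mT (Tgt (mk_cell \<E>1 M N \<phi> \<psi>)))
    (snd (Und (mk_cell \<E>1 M N \<phi> \<psi>)))"
    using assms(4) by (simp add: mk_cell_def tangent_nat_restrict E1.X.category_axioms)
  show "\<forall>E\<in>Obj (Total \<E>1). FA (Proj \<E>2) (snd (Und (mk_cell \<E>1 M N \<phi> \<psi>)) E) =
      fst (Und (mk_cell \<E>1 M N \<phi> \<psi>)) (FO (Proj \<E>1) E)"
    using assms(5) by simp
qed (use assms in \<open>simp_all add: mk_cell_def\<close>)

lemma fmor_T_sel [simp]: "mB (fmor_T \<E>1 \<E>2 M) = lax_T (Base \<E>1) (Base \<E>2) (mB M)"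
  "mT (fmor_T \<E>1 \<E>2 M) = lax_T (Total \<E>1) (Total \<E>2) (mT M)"
  by (simp_all add: fmor_T_def)

lemma fmor_Tn_sel [simp]: "mB (fmor_Tn \<E>1 \<E>2 n M) = lax_Tn (Base \<E>1) (Base \<E>2) n (mB M)"
  "mT (fmor_Tn \<E>1 \<E>2 n M) = lax_Tn (Total \<E>1) (Total \<E>2) n (mT M)"
  by (simp_all add: fmor_Tn_def)

lemma fmor_T_mor [simp]:
  assumes M: "fib_morphism \<E>1 \<E>2 M"
  shows "fib_morphism \<E>1 \<E>2 (fmor_T \<E>1 \<E>2 M)"
proof -
  interpret b: lax_object "Base \<E>1" "Base \<E>2" "mB M" by (rule morB[OF M])
  interpret t: lax_object "Total \<E>1" "Total \<E>2" "mT M" by (rule morT[OF M])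
  show ?thesis
    unfolding fib_morphism_def
  proof (intro conjI allI impI ballI)
    fix \<phi> assume \<phi>: "cartesian_arrow \<E>1 \<phi>"
    then have "cartesian_arrow \<E>2 (TA (Total \<E>2) (FA (Fun (mT M)) \<phi>))"
      using E2.cartesian_T M by simp
    then show "cartesian_arrow \<E>2 (FA (Fun (mT (fmor_T \<E>1 \<E>2 M))) \<phi>)" using \<phi> by simp
  qed (use M in \<open>simp_all add: lax_T_ok mor_ok\<close>)
qed

lemma fmor_Tn_mor [simp]:
  assumes M: "fib_morphism \<E>1 \<E>2 M" and n: "1 \<le> n"
  shows "fib_morphism \<E>1 \<E>2 (fmor_Tn \<E>1 \<E>2 n M)"
proof -
  interpret b: lax_object "Base \<E>1" "Base \<E>2" "mB M" by (rule morB[OF M])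
  interpret t: lax_object "Total \<E>1" "Total \<E>2" "mT M" by (rule morT[OF M])
  show ?thesis
    unfolding fib_morphism_def
  proof (intro conjI allI impI ballI)
    fix \<phi> assume \<phi>: "cartesian_arrow \<E>1 \<phi>"
    then have "cartesian_arrow \<E>2 (FA (TnF (Total \<E>2) n) (FA (Fun (mT M)) \<phi>))"
      using E2.cartesian_TnF M n by simp
    then show "cartesian_arrow \<E>2 (FA (Fun (mT (fmor_Tn \<E>1 \<E>2 n M))) \<phi>)" using \<phi> by simp
  next
    fix E assume E: "E \<in> Obj (Total \<E>1)"
    note s = t.lax_Tn_Str[OF E] and sb = b.lax_Tn_Str[of "FO (Proj \<E>1) E"]
    show "FA (Proj \<E>2) (Str (mT (fmor_Tn \<E>1 \<E>2 n M)) E) = Str (mB (fmor_Tn \<E>1 \<E>2 n M)) (FO (Proj \<E>1) E)"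
    proof (rule E2.B.TTn_eqI[where n = n and A = "bO M (FO (Proj \<E>1) E)"])
      fix i assume i: "i < n"
      show "TA (Base \<E>2) (pr (Base \<E>2) n i (bO M (FO (Proj \<E>1) E))) \<cdot>\<^bsub>Base \<E>2\<^esub>
          FA (Proj \<E>2) (Str (mT (fmor_Tn \<E>1 \<E>2 n M)) E) =
        TA (Base \<E>2) (pr (Base \<E>2) n i (bO M (FO (Proj \<E>1) E))) \<cdot>\<^bsub>Base \<E>2\<^esub>
          Str (mB (fmor_Tn \<E>1 \<E>2 n M)) (FO (Proj \<E>1) E)"
        using arg_cong[OF s(4)[OF i], of "FA (Proj \<E>2)"] s(1-3)[OF n] sb(4)[OF _ i] E M i by simp
    qed (use s(1-3)[OF n] sb(1-3)[OF _ n] E M n in simp_all)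
  qed (use M n in \<open>simp_all add: b.lax_Tn_ok t.lax_Tn_ok\<close>)
qed

end

definition eval_base ::
  "'b1 \<Rightarrow> (('e1, 'em1, 'b1, 'bm1, 'e2, 'em2, 'b2, 'bm2) fmor,
    ('e1, 'em1, 'b1, 'bm1, 'e2, 'em2, 'b2, 'bm2) fcell, 'b2, 'bm2) ftr" where
  "eval_base A = \<lparr>FO = (\<lambda>M. bO M A), FA = (\<lambda>t. fst (Und t) A)\<rparr>"

definition eval_total ::
  "'e1 \<Rightarrow> (('e1, 'em1, 'b1, 'bm1, 'e2, 'em2, 'b2, 'bm2) fmor,
    ('e1, 'em1, 'b1, 'bm1, 'e2, 'em2, 'b2, 'bm2) fcell, 'e2, 'em2) ftr" where
  "eval_total E = \<lparr>FO = (\<lambda>M. tO M E), FA = (\<lambda>t. snd (Und t) E)\<rparr>"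

lemma eval_sel [simp]:
  "FO (eval_base A) M = bO M A" "FA (eval_base A) t = fst (Und t) A"
  "FO (eval_total E) M = tO M E" "FA (eval_total E) t = snd (Und t) E"
  by (simp_all add: eval_base_def eval_total_def)

lemma fib_hom_sel [simp]:
  "M \<in> Obj (fib_hom \<E>1 \<E>2) \<longleftrightarrow> fib_morphism \<E>1 \<E>2 M"
  "t \<in> Arr (fib_hom \<E>1 \<E>2) \<longleftrightarrow> fib_cell \<E>1 \<E>2 t"
  "Dom (fib_hom \<E>1 \<E>2) = Src" "Cod (fib_hom \<E>1 \<E>2) = Tgt"
  "Id (fib_hom \<E>1 \<E>2) M = mk_cell \<E>1 M M (\<lambda>A. Id (Base \<E>2) (bO M A)) (\<lambda>E. Id (Total \<E>2) (tO M E))"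
  "t \<cdot>\<^bsub>fib_hom \<E>1 \<E>2\<^esub> u = mk_cell \<E>1 (Src u) (Tgt t)
    (\<lambda>A. fst (Und t) A \<cdot>\<^bsub>Base \<E>2\<^esub> fst (Und u) A) (\<lambda>E. snd (Und t) E \<cdot>\<^bsub>Total \<E>2\<^esub> snd (Und u) E)"
  "TO (fib_hom \<E>1 \<E>2) M = fmor_T \<E>1 \<E>2 M"
  "TA (fib_hom \<E>1 \<E>2) t = mk_cell \<E>1 (fmor_T \<E>1 \<E>2 (Src t)) (fmor_T \<E>1 \<E>2 (Tgt t))
    (\<lambda>A. TA (Base \<E>2) (fst (Und t) A)) (\<lambda>E. TA (Total \<E>2) (snd (Und t) E))"
  "pT (fib_hom \<E>1 \<E>2) M = mk_cell \<E>1 (fmor_T \<E>1 \<E>2 M) M (\<lambda>A. pT (Base \<E>2) (bO M A)) (\<lambda>E. pT (Total \<E>2) (tO M E))"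
  "zT (fib_hom \<E>1 \<E>2) M = mk_cell \<E>1 M (fmor_T \<E>1 \<E>2 M) (\<lambda>A. zT (Base \<E>2) (bO M A)) (\<lambda>E. zT (Total \<E>2) (tO M E))"
  "sT (fib_hom \<E>1 \<E>2) M = mk_cell \<E>1 (fmor_Tn \<E>1 \<E>2 2 M) (fmor_T \<E>1 \<E>2 M)
    (\<lambda>A. sT (Base \<E>2) (bO M A)) (\<lambda>E. sT (Total \<E>2) (tO M E))"
  "lT (fib_hom \<E>1 \<E>2) M = mk_cell \<E>1 (fmor_T \<E>1 \<E>2 M) (fmor_T \<E>1 \<E>2 (fmor_T \<E>1 \<E>2 M))
    (\<lambda>A. lT (Base \<E>2) (bO M A)) (\<lambda>E. lT (Total \<E>2) (tO M E))"
  "cT (fib_hom \<E>1 \<E>2) M = mk_cell \<E>1 (fmor_T \<E>1 \<E>2 (fmor_T \<E>1 \<E>2 M)) (fmor_T \<E>1 \<E>2 (fmor_T \<E>1 \<E>2 M))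
    (\<lambda>A. cT (Base \<E>2) (bO M A)) (\<lambda>E. cT (Total \<E>2) (tO M E))"
  "Tn (fib_hom \<E>1 \<E>2) n M = fmor_Tn \<E>1 \<E>2 n M"
  "pr (fib_hom \<E>1 \<E>2) n i M = mk_cell \<E>1 (fmor_Tn \<E>1 \<E>2 n M) (fmor_T \<E>1 \<E>2 M)
    (\<lambda>A. pr (Base \<E>2) n i (bO M A)) (\<lambda>E. pr (Total \<E>2) n i (tO M E))"
  by (simp_all add: fib_hom_def Let_def)

context tangent_fibrations
begin

lemma Id_cell [simp]:
  assumes M: "fib_morphism \<E>1 \<E>2 M"
  shows "fib_cell \<E>1 \<E>2 (mk_cell \<E>1 M M (\<lambda>A. Id (Base \<E>2) (bO M A)) (\<lambda>E. Id (Total \<E>2) (tO M E)))"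
  by (rule mk_cell_cell[OF M M lax_object.tangent_nat_Id[OF morB[OF M]] lax_object.tangent_nat_Id[OF morT[OF M]]])
    (use M in simp)

lemma Comp_cell [simp]:
  assumes t: "fib_cell \<E>1 \<E>2 t" and u: "fib_cell \<E>1 \<E>2 u" and tu: "Tgt u = Src t"
  shows "fib_cell \<E>1 \<E>2 (mk_cell \<E>1 (Src u) (Tgt t)
    (\<lambda>A. fst (Und t) A \<cdot>\<^bsub>Base \<E>2\<^esub> fst (Und u) A) (\<lambda>E. snd (Und t) E \<cdot>\<^bsub>Total \<E>2\<^esub> snd (Und u) E))"
proof (rule mk_cell_cell)
  have m: "fib_morphism \<E>1 \<E>2 (Src u)" "fib_morphism \<E>1 \<E>2 (Src t)" "fib_morphism \<E>1 \<E>2 (Tgt t)"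
    using t u by simp_all
  show "tangent_nat (Base \<E>1) (Base \<E>2) (mB (Src u)) (mB (Tgt t)) (\<lambda>A. fst (Und t) A \<cdot>\<^bsub>Base \<E>2\<^esub> fst (Und u) A)"
    by (rule tangent_nat_comp[OF mor_ok(1)[OF m(1)] mor_ok(1)[OF m(2)] mor_ok(1)[OF m(3)]])
      (use cell_nat(1)[OF t] cell_nat(1)[OF u] tu in simp_all)
  show "tangent_nat (Total \<E>1) (Total \<E>2) (mT (Src u)) (mT (Tgt t)) (\<lambda>A. snd (Und t) A \<cdot>\<^bsub>Total \<E>2\<^esub> snd (Und u) A)"
    by (rule tangent_nat_comp[OF mor_ok(2)[OF m(1)] mor_ok(2)[OF m(2)] mor_ok(2)[OF m(3)]])
      (use cell_nat(2)[OF t] cell_nat(2)[OF u] tu in simp_all)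
qed (use t u tu in simp_all)

text \<open>The endpoints are variables so that the rule still matches after they have been rewritten.\<close>

lemma Comp_cell' [simp]:
  "\<lbrakk>fib_cell \<E>1 \<E>2 t; fib_cell \<E>1 \<E>2 u; Tgt u = Src t; M = Src u; N = Tgt t\<rbrakk>
    \<Longrightarrow> fib_cell \<E>1 \<E>2 (mk_cell \<E>1 M N
    (\<lambda>A. fst (Und t) A \<cdot>\<^bsub>Base \<E>2\<^esub> fst (Und u) A) (\<lambda>E. snd (Und t) E \<cdot>\<^bsub>Total \<E>2\<^esub> snd (Und u) E))"
  by simp

lemma T_cell [simp]:
  assumes t: "fib_cell \<E>1 \<E>2 t"
  shows "fib_cell \<E>1 \<E>2 (mk_cell \<E>1 (fmor_T \<E>1 \<E>2 (Src t)) (fmor_T \<E>1 \<E>2 (Tgt t))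
    (\<lambda>A. TA (Base \<E>2) (fst (Und t) A)) (\<lambda>E. TA (Total \<E>2) (snd (Und t) E)))"
  by (rule mk_cell_cell)
    (use t in \<open>simp_all add: tangent_nat_T[OF mor_ok(1) mor_ok(1) cell_nat(1)] tangent_nat_T[OF mor_ok(2) mor_ok(2) cell_nat(2)]\<close>)

lemma structure_cells [simp]:
  assumes M: "fib_morphism \<E>1 \<E>2 M"
  shows "fib_cell \<E>1 \<E>2 (mk_cell \<E>1 (fmor_T \<E>1 \<E>2 M) M (\<lambda>A. pT (Base \<E>2) (bO M A)) (\<lambda>E. pT (Total \<E>2) (tO M E)))"
    "fib_cell \<E>1 \<E>2 (mk_cell \<E>1 M (fmor_T \<E>1 \<E>2 M) (\<lambda>A. zT (Base \<E>2) (bO M A)) (\<lambda>E. zT (Total \<E>2) (tO M E)))"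
    "fib_cell \<E>1 \<E>2 (mk_cell \<E>1 (fmor_Tn \<E>1 \<E>2 2 M) (fmor_T \<E>1 \<E>2 M)
      (\<lambda>A. sT (Base \<E>2) (bO M A)) (\<lambda>E. sT (Total \<E>2) (tO M E)))"
    "fib_cell \<E>1 \<E>2 (mk_cell \<E>1 (fmor_T \<E>1 \<E>2 M) (fmor_T \<E>1 \<E>2 (fmor_T \<E>1 \<E>2 M))
      (\<lambda>A. lT (Base \<E>2) (bO M A)) (\<lambda>E. lT (Total \<E>2) (tO M E)))"
    "fib_cell \<E>1 \<E>2 (mk_cell \<E>1 (fmor_T \<E>1 \<E>2 (fmor_T \<E>1 \<E>2 M)) (fmor_T \<E>1 \<E>2 (fmor_T \<E>1 \<E>2 M))
      (\<lambda>A. cT (Base \<E>2) (bO M A)) (\<lambda>E. cT (Total \<E>2) (tO M E)))"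
    "i < n \<Longrightarrow> fib_cell \<E>1 \<E>2 (mk_cell \<E>1 (fmor_Tn \<E>1 \<E>2 n M) (fmor_T \<E>1 \<E>2 M)
      (\<lambda>A. pr (Base \<E>2) n i (bO M A)) (\<lambda>E. pr (Total \<E>2) n i (tO M E)))"
proof -
  interpret b: lax_object "Base \<E>1" "Base \<E>2" "mB M" by (rule morB[OF M])
  interpret t: lax_object "Total \<E>1" "Total \<E>2" "mT M" by (rule morT[OF M])
  note cell = mk_cell_cell
  show "fib_cell \<E>1 \<E>2 (mk_cell \<E>1 (fmor_T \<E>1 \<E>2 M) M (\<lambda>A. pT (Base \<E>2) (bO M A)) (\<lambda>E. pT (Total \<E>2) (tO M E)))"
    by (rule cell) (use M in \<open>simp_all add: b.tangent_nat_p t.tangent_nat_p\<close>)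
  show "fib_cell \<E>1 \<E>2 (mk_cell \<E>1 M (fmor_T \<E>1 \<E>2 M) (\<lambda>A. zT (Base \<E>2) (bO M A)) (\<lambda>E. zT (Total \<E>2) (tO M E)))"
    by (rule cell) (use M in \<open>simp_all add: b.tangent_nat_z t.tangent_nat_z\<close>)
  show "fib_cell \<E>1 \<E>2 (mk_cell \<E>1 (fmor_Tn \<E>1 \<E>2 2 M) (fmor_T \<E>1 \<E>2 M)
      (\<lambda>A. sT (Base \<E>2) (bO M A)) (\<lambda>E. sT (Total \<E>2) (tO M E)))"
    by (rule cell) (use M in \<open>simp_all add: b.tangent_nat_s t.tangent_nat_s\<close>)
  show "fib_cell \<E>1 \<E>2 (mk_cell \<E>1 (fmor_T \<E>1 \<E>2 M) (fmor_T \<E>1 \<E>2 (fmor_T \<E>1 \<E>2 M))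
      (\<lambda>A. lT (Base \<E>2) (bO M A)) (\<lambda>E. lT (Total \<E>2) (tO M E)))"
    by (rule cell) (use M in \<open>simp_all add: b.tangent_nat_l t.tangent_nat_l\<close>)
  show "fib_cell \<E>1 \<E>2 (mk_cell \<E>1 (fmor_T \<E>1 \<E>2 (fmor_T \<E>1 \<E>2 M)) (fmor_T \<E>1 \<E>2 (fmor_T \<E>1 \<E>2 M))
      (\<lambda>A. cT (Base \<E>2) (bO M A)) (\<lambda>E. cT (Total \<E>2) (tO M E)))"
    by (rule cell) (use M in \<open>simp_all add: b.tangent_nat_c t.tangent_nat_c\<close>)
  show "fib_cell \<E>1 \<E>2 (mk_cell \<E>1 (fmor_Tn \<E>1 \<E>2 n M) (fmor_T \<E>1 \<E>2 M)
      (\<lambda>A. pr (Base \<E>2) n i (bO M A)) (\<lambda>E. pr (Total \<E>2) n i (tO M E)))" if "i < n"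
    by (rule cell) (use M that less_imp_one_le[OF that] in \<open>simp_all add: b.tangent_nat_pr t.tangent_nat_pr\<close>)
qed

lemma fib_hom_category: "category (fib_hom \<E>1 \<E>2)"
proof
  fix f g h :: "('e1, 'em1, 'b1, 'bm1, 'e2, 'em2, 'b2, 'bm2) fcell"
    and W X Y Z :: "('e1, 'em1, 'b1, 'bm1, 'e2, 'em2, 'b2, 'bm2) fmor"
  show "f \<cdot>\<^bsub>fib_hom \<E>1 \<E>2\<^esub> Id (fib_hom \<E>1 \<E>2) X = f" if "f \<in> Homs (fib_hom \<E>1 \<E>2) X Y"
    by (rule cell_eqI) (use that in auto)
  show "Id (fib_hom \<E>1 \<E>2) Y \<cdot>\<^bsub>fib_hom \<E>1 \<E>2\<^esub> f = f" if "f \<in> Homs (fib_hom \<E>1 \<E>2) X Y"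
    by (rule cell_eqI) (use that in auto)
  show "(h \<cdot>\<^bsub>fib_hom \<E>1 \<E>2\<^esub> g) \<cdot>\<^bsub>fib_hom \<E>1 \<E>2\<^esub> f = h \<cdot>\<^bsub>fib_hom \<E>1 \<E>2\<^esub> (g \<cdot>\<^bsub>fib_hom \<E>1 \<E>2\<^esub> f)"
    if "f \<in> Homs (fib_hom \<E>1 \<E>2) W X" "g \<in> Homs (fib_hom \<E>1 \<E>2) X Y" "h \<in> Homs (fib_hom \<E>1 \<E>2) Y Z"
    by (rule cell_eqI) (use that in auto)
qed auto

lemma fib_hom_structure: "tangent_structure (fib_hom \<E>1 \<E>2)"
proof -
  interpret category "fib_hom \<E>1 \<E>2" by (rule fib_hom_category)
  show ?thesis by unfold_locales simp_all
qed

lemma eval_base_preserving: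
  assumes A: "A \<in> Obj (Base \<E>1)"
  shows "tangent_preserving (fib_hom \<E>1 \<E>2) (Base \<E>2) (eval_base A)"
  unfolding tangent_preserving_def is_functor_def
  using A lax_object.lax_Tn_FO[OF morB] by auto

lemma eval_total_preserving:
  assumes E: "E \<in> Obj (Total \<E>1)"
  shows "tangent_preserving (fib_hom \<E>1 \<E>2) (Total \<E>2) (eval_total E)"
  unfolding tangent_preserving_def is_functor_def
  using E lax_object.lax_Tn_FO[OF morT] by auto

text \<open>Each half of the mediating cell comes from \<open>tangent_nat_lift\<close>. The total half lies over the base half
  because the base components of the cone are jointly monic.\<close>

lemma cell_lift:
  fixes K :: "nat set"
  assumes X: "fib_morphism \<E>1 \<E>2 X" and P: "fib_morphism \<E>1 \<E>2 P"
    and \<pi>: "\<And>i. i \<in> K \<Longrightarrow> fib_cell \<E>1 \<E>2 (\<pi> i) \<and> Src (\<pi> i) = P"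
    and g: "\<And>i. i \<in> K \<Longrightarrow> fib_cell \<E>1 \<E>2 (g i) \<and> Src (g i) = X \<and> Tgt (g i) = Tgt (\<pi> i)"
    and b: "\<And>A. A \<in> Obj (Base \<E>1) \<Longrightarrow> stably_monic (Base \<E>2) (bO P A) K (\<lambda>i. fst (Und (\<pi> i)) A) \<and>
      (\<exists>v\<in>Homs (Base \<E>2) (bO X A) (bO P A). \<forall>i\<in>K. fst (Und (\<pi> i)) A \<cdot>\<^bsub>Base \<E>2\<^esub> v = fst (Und (g i)) A)"
    and t: "\<And>E. E \<in> Obj (Total \<E>1) \<Longrightarrow> stably_monic (Total \<E>2) (tO P E) K (\<lambda>i. snd (Und (\<pi> i)) E) \<and>
      (\<exists>v\<in>Homs (Total \<E>2) (tO X E) (tO P E). \<forall>i\<in>K. snd (Und (\<pi> i)) E \<cdot>\<^bsub>Total \<E>2\<^esub> v = snd (Und (g i)) E)"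
  shows "\<exists>u\<in>Homs (fib_hom \<E>1 \<E>2) X P. \<forall>i\<in>K. \<pi> i \<cdot>\<^bsub>fib_hom \<E>1 \<E>2\<^esub> u = g i"
proof -
  obtain u where u: "\<And>A. A \<in> Obj (Base \<E>1) \<Longrightarrow> u A \<in> Homs (Base \<E>2) (bO X A) (bO P A)"
    "\<And>A i. A \<in> Obj (Base \<E>1) \<Longrightarrow> i \<in> K \<Longrightarrow> fst (Und (\<pi> i)) A \<cdot>\<^bsub>Base \<E>2\<^esub> u A = fst (Und (g i)) A"
    using b by metis
  obtain w where w: "\<And>E. E \<in> Obj (Total \<E>1) \<Longrightarrow> w E \<in> Homs (Total \<E>2) (tO X E) (tO P E)"
    "\<And>E i. E \<in> Obj (Total \<E>1) \<Longrightarrow> i \<in> K \<Longrightarrow> snd (Und (\<pi> i)) E \<cdot>\<^bsub>Total \<E>2\<^esub> w E = snd (Und (g i)) E"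
    using t by metis
  have mor: "fib_morphism \<E>1 \<E>2 (Tgt (\<pi> i))" if "i \<in> K" for i using \<pi>[OF that] by simp
  have tu: "tangent_nat (Base \<E>1) (Base \<E>2) (mB X) (mB P) u"
  proof (rule tangent_nat_lift[where K = K and G = "\<lambda>i. mB (Tgt (\<pi> i))" and \<pi> = "\<lambda>i. fst (Und (\<pi> i))"
        and g = "\<lambda>i. fst (Und (g i))"])
    show "tangent_nat (Base \<E>1) (Base \<E>2) (mB P) (mB (Tgt (\<pi> i))) (fst (Und (\<pi> i)))" if "i \<in> K" for i
      using cell_nat(1)[of "\<pi> i"] \<pi>[OF that] by simp
    show "tangent_nat (Base \<E>1) (Base \<E>2) (mB X) (mB (Tgt (\<pi> i))) (fst (Und (g i)))" if "i \<in> K" for i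
      using cell_nat(1)[of "g i"] g[OF that] by simp
  qed (use X P u b mor in \<open>simp_all add: mor_ok\<close>)
  have tw: "tangent_nat (Total \<E>1) (Total \<E>2) (mT X) (mT P) w"
  proof (rule tangent_nat_lift[where K = K and G = "\<lambda>i. mT (Tgt (\<pi> i))" and \<pi> = "\<lambda>i. snd (Und (\<pi> i))"
        and g = "\<lambda>i. snd (Und (g i))"])
    show "tangent_nat (Total \<E>1) (Total \<E>2) (mT P) (mT (Tgt (\<pi> i))) (snd (Und (\<pi> i)))" if "i \<in> K" for i
      using cell_nat(2)[of "\<pi> i"] \<pi>[OF that] by simp
    show "tangent_nat (Total \<E>1) (Total \<E>2) (mT X) (mT (Tgt (\<pi> i))) (snd (Und (g i)))" if "i \<in> K" for i
      using cell_nat(2)[of "g i"] g[OF that] by simp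
  qed (use X P w t mor in \<open>simp_all add: mor_ok\<close>)
  have wu: "FA (Proj \<E>2) (w E) = u (FO (Proj \<E>1) E)" if E: "E \<in> Obj (Total \<E>1)" for E
  proof -
    have A: "FO (Proj \<E>1) E \<in> Obj (Base \<E>1)" using E by simp
    have m: "jointly_monic (Base \<E>2) (bO P (FO (Proj \<E>1) E)) K (\<lambda>i. fst (Und (\<pi> i)) (FO (Proj \<E>1) E))"
      using b[OF A] by (simp add: stably_monic_def)
    show ?thesis
    proof (rule jointly_monicD[OF m])
      fix i assume i: "i \<in> K"
      show "fst (Und (\<pi> i)) (FO (Proj \<E>1) E) \<cdot>\<^bsub>Base \<E>2\<^esub> FA (Proj \<E>2) (w E) =
        fst (Und (\<pi> i)) (FO (Proj \<E>1) E) \<cdot>\<^bsub>Base \<E>2\<^esub> u (FO (Proj \<E>1) E)"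
        using arg_cong[OF w(2)[OF E i], of "FA (Proj \<E>2)"] w(1)[OF E] u(2)[OF A i] \<pi>[OF i] g[OF i] E by simp
    qed (use w(1)[OF E] u(1)[OF A] X P E in simp_all)
  qed
  define c where "c = mk_cell \<E>1 X P u w"
  have c: "fib_cell \<E>1 \<E>2 c" unfolding c_def by (rule mk_cell_cell[OF X P tu tw wu])
  have "\<pi> i \<cdot>\<^bsub>fib_hom \<E>1 \<E>2\<^esub> c = g i" if i: "i \<in> K" for i
    by (rule cell_eqI) (use c \<pi>[OF i] g[OF i] u(2) w(2) i in \<open>auto simp: c_def\<close>)
  then show ?thesis using c by (intro bexI[of _ c]) (auto simp: c_def)
qed

lemma fib_hom_evaluations:
  "tangent_evaluations (fib_hom \<E>1 \<E>2) (Base \<E>2) (Total \<E>2) (eval_base ` Obj (Base \<E>1)) (eval_total ` Obj (Total \<E>1))"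
proof -
  interpret tangent_structure "fib_hom \<E>1 \<E>2" by (rule fib_hom_structure)
  show ?thesis
  proof unfold_locales
    show "f = g" if "f \<in> Arr (fib_hom \<E>1 \<E>2)" "g \<in> Arr (fib_hom \<E>1 \<E>2)"
      "Dom (fib_hom \<E>1 \<E>2) f = Dom (fib_hom \<E>1 \<E>2) g" "Cod (fib_hom \<E>1 \<E>2) f = Cod (fib_hom \<E>1 \<E>2) g"
      "\<And>F. F \<in> eval_base ` Obj (Base \<E>1) \<Longrightarrow> FA F f = FA F g"
      "\<And>F. F \<in> eval_total ` Obj (Total \<E>1) \<Longrightarrow> FA F f = FA F g" for f g
      by (rule cell_eqI) (use that(1-4) that(5)[OF imageI] that(6)[OF imageI] in simp_all)
    show "\<exists>u\<in>Homs (fib_hom \<E>1 \<E>2) X P. \<forall>i\<in>K. \<pi> i \<cdot>\<^bsub>fib_hom \<E>1 \<E>2\<^esub> u = g i"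
      if "X \<in> Obj (fib_hom \<E>1 \<E>2)" "P \<in> Obj (fib_hom \<E>1 \<E>2)"
        "\<And>i. i \<in> K \<Longrightarrow> \<pi> i \<in> Arr (fib_hom \<E>1 \<E>2) \<and> Dom (fib_hom \<E>1 \<E>2) (\<pi> i) = P"
        "\<And>i. i \<in> K \<Longrightarrow> g i \<in> Arr (fib_hom \<E>1 \<E>2) \<and> Dom (fib_hom \<E>1 \<E>2) (g i) = X \<and>
          Cod (fib_hom \<E>1 \<E>2) (g i) = Cod (fib_hom \<E>1 \<E>2) (\<pi> i)"
        "\<And>F. F \<in> eval_base ` Obj (Base \<E>1) \<Longrightarrow> stably_monic (Base \<E>2) (FO F P) K (\<lambda>i. FA F (\<pi> i)) \<and>
          (\<exists>v\<in>Homs (Base \<E>2) (FO F X) (FO F P). \<forall>i\<in>K. FA F (\<pi> i) \<cdot>\<^bsub>Base \<E>2\<^esub> v = FA F (g i))"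
        "\<And>F. F \<in> eval_total ` Obj (Total \<E>1) \<Longrightarrow> stably_monic (Total \<E>2) (FO F P) K (\<lambda>i. FA F (\<pi> i)) \<and>
          (\<exists>v\<in>Homs (Total \<E>2) (FO F X) (FO F P). \<forall>i\<in>K. FA F (\<pi> i) \<cdot>\<^bsub>Total \<E>2\<^esub> v = FA F (g i))"
      for X P and K :: "nat set" and \<pi> g
      by (rule cell_lift) (use that(1-4) that(5)[OF imageI] that(6)[OF imageI] in \<open>simp_all del: in_Homs_iff\<close>)
  qed (auto simp: eval_base_preserving eval_total_preserving)
qed

theorem fib_hom_tangent_category: "tangent_category (fib_hom \<E>1 \<E>2)"
  by (rule tangent_evaluations.tangent_category_of_evaluations[OF fib_hom_evaluations])

end

section \<open>Cartesian tangent categories\<close>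

text \<open>Any two products of \<open>A\<close> and \<open>B\<close> are isomorphic, so it is enough to preserve one of them. This makes
  \<open>T\<close> preserve the product diagram of a differential object, which is not a chosen product.\<close>

lemma functor_preserves_products:
  assumes C: "category C" and D: "category D" and F: "is_functor C D F"
    and R: "is_product C A B R r s" and FR: "is_product D (FO F A) (FO F B) (FO F R) (FA F r) (FA F s)"
    and Q: "is_product C A B Q a b"
  shows "is_product D (FO F A) (FO F B) (FO F Q) (FA F a) (FA F b)"
proof -
  interpret C: category C by fact
  interpret D: category D by fact
  note [simp] = functor_simps[OF F]
  have ty [simp]: "a \<in> Arr C" "b \<in> Arr C" "Dom C a = Q" "Dom C b = Q" "Cod C a = A" "Cod C b = B" "Q \<in> Obj C"
    "r \<in> Arr C" "s \<in> Arr C" "Dom C r = R" "Dom C s = R" "Cod C r = A" "Cod C s = B" "R \<in> Obj C"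
    using R Q by (auto simp: is_product_def)
  obtain u where u: "u \<in> Arr C" "Dom C u = Q" "Cod C u = R" "r \<cdot>\<^bsub>C\<^esub> u = a" "s \<cdot>\<^bsub>C\<^esub> u = b"
    using C.product_med2[OF R, of a Q b] by auto
  obtain v where v: "v \<in> Arr C" "Dom C v = R" "Cod C v = Q" "a \<cdot>\<^bsub>C\<^esub> v = r" "b \<cdot>\<^bsub>C\<^esub> v = s"
    using C.product_med2[OF Q, of r R s] by auto
  have vu: "v \<cdot>\<^bsub>C\<^esub> u = Id C Q"
    by (rule C.product_eqI[OF Q]) (use u v C.reassoc[OF v(4), of u] C.reassoc[OF v(5), of u] in simp_all)
  have Fu: "FA F r \<cdot>\<^bsub>D\<^esub> FA F u = FA F a" "FA F s \<cdot>\<^bsub>D\<^esub> FA F u = FA F b"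
    "FA F a \<cdot>\<^bsub>D\<^esub> FA F v = FA F r" "FA F b \<cdot>\<^bsub>D\<^esub> FA F v = FA F s" "FA F v \<cdot>\<^bsub>D\<^esub> FA F u = Id D (FO F Q)"
    using u v vu functor_simps(6)[OF F, of u r] functor_simps(6)[OF F, of u s] functor_simps(6)[OF F, of v a]
      functor_simps(6)[OF F, of v b] functor_simps(6)[OF F, of u v] by simp_all
  show ?thesis
    unfolding is_product_def
  proof (intro conjI allI ballI)
    fix X f g assume f: "f \<in> Homs D X (FO F A)" and g: "g \<in> Homs D X (FO F B)"
    obtain w where w: "w \<in> Arr D" "Dom D w = X" "Cod D w = FO F R" "FA F r \<cdot>\<^bsub>D\<^esub> w = f" "FA F s \<cdot>\<^bsub>D\<^esub> w = g"
      using D.product_med2[OF FR, of f X g] f g by auto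
    show "\<exists>!h. h \<in> Homs D X (FO F Q) \<and> FA F a \<cdot>\<^bsub>D\<^esub> h = f \<and> FA F b \<cdot>\<^bsub>D\<^esub> h = g"
    proof (rule ex1I[of _ "FA F v \<cdot>\<^bsub>D\<^esub> w"])
      show "FA F v \<cdot>\<^bsub>D\<^esub> w \<in> Homs D X (FO F Q) \<and> FA F a \<cdot>\<^bsub>D\<^esub> (FA F v \<cdot>\<^bsub>D\<^esub> w) = f \<and> FA F b \<cdot>\<^bsub>D\<^esub> (FA F v \<cdot>\<^bsub>D\<^esub> w) = g"
        using w v D.reassoc[OF Fu(3), of w] D.reassoc[OF Fu(4), of w] by simp
      fix h assume h: "h \<in> Homs D X (FO F Q) \<and> FA F a \<cdot>\<^bsub>D\<^esub> h = f \<and> FA F b \<cdot>\<^bsub>D\<^esub> h = g"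
      have "FA F u \<cdot>\<^bsub>D\<^esub> h = w"
        by (rule D.product_eqI[OF FR])
          (use h w u D.reassoc[OF Fu(1), of h] D.reassoc[OF Fu(2), of h] in simp_all)
      then have "FA F v \<cdot>\<^bsub>D\<^esub> (FA F u \<cdot>\<^bsub>D\<^esub> h) = FA F v \<cdot>\<^bsub>D\<^esub> w" by simp
      then show "h = FA F v \<cdot>\<^bsub>D\<^esub> w" using h u v D.reassoc[OF Fu(5), of h] by simp
    qed
  qed simp_all
qed

locale cartesian_tangent = tangent_category C for C :: "('o, 'm, 'x) tcat_scheme" (structure) +
  fixes P :: "('o, 'm) products"
  assumes cartesian: "cartesian_tangent_category C P"
begin

lemma terminal: "is_terminal C (One P)" "is_terminal C (TO C (One P))"
  using cartesian by (simp_all add: cartesian_tangent_category_def)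

lemma products:
  "\<lbrakk>A \<in> Obj C; B \<in> Obj C\<rbrakk> \<Longrightarrow> is_product C A B (Prod P A B) (Fst P A B) (Snd P A B)"
  "\<lbrakk>A \<in> Obj C; B \<in> Obj C\<rbrakk>
    \<Longrightarrow> is_product C (TO C A) (TO C B) (TO C (Prod P A B)) (TA C (Fst P A B)) (TA C (Snd P A B))"
  using cartesian by (simp_all add: cartesian_tangent_category_def)

lemma T_products:
  assumes "is_product C A B Q a b"
  shows "is_product C (TO C A) (TO C B) (TO C Q) (TA C a) (TA C b)"
proof -
  have "A \<in> Obj C" "B \<in> Obj C" using assms by (auto simp: is_product_def)
  then show ?thesis
    by (intro functor_preserves_products[OF category_axioms category_axioms Tan_functor products(1) products(2) assms])
qed

lemma One_simps [simp]: "One P \<in> Obj C"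
  using terminal by (simp add: is_terminal_def)

lemma bang_simps [simp]:
  assumes "X \<in> Obj C"
  shows "bang C P X \<in> Arr C" "Dom C (bang C P X) = X" "Cod C (bang C P X) = One P"
proof -
  have "\<exists>!u. u \<in> Homs C X (One P)" using assms terminal(1) by (simp add: is_terminal_def)
  from theI'[OF this, folded bang_def]
  show "bang C P X \<in> Arr C" "Dom C (bang C P X) = X" "Cod C (bang C P X) = One P" by auto
qed

lemma One_eqI: "\<lbrakk>u \<in> Arr C; v \<in> Arr C; Dom C u = Dom C v; Cod C u = One P; Cod C v = One P\<rbrakk> \<Longrightarrow> u = v"
  by (rule terminal_eqI[OF terminal(1)])

lemma TOne_eqI: "\<lbrakk>u \<in> Arr C; v \<in> Arr C; Dom C u = Dom C v; Cod C u = TO C (One P); Cod C v = TO C (One P)\<rbrakk> \<Longrightarrow> u = v"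
  by (rule terminal_eqI[OF terminal(2)])

lemma bang_comp [simp]: "\<lbrakk>x \<in> Arr C; Cod C x = X\<rbrakk> \<Longrightarrow> bang C P X \<cdot> x = bang C P (Dom C x)"
  by (rule One_eqI) auto

lemma T_bang: "X \<in> Obj C \<Longrightarrow> TA C (bang C P X) = zT C (One P) \<cdot> bang C P (TO C X)"
  by (rule TOne_eqI) simp_all

lemma Prod_simps [simp]:
  assumes "A \<in> Obj C" "B \<in> Obj C"
  shows "Prod P A B \<in> Obj C" "Fst P A B \<in> Arr C" "Dom C (Fst P A B) = Prod P A B" "Cod C (Fst P A B) = A"
    "Snd P A B \<in> Arr C" "Dom C (Snd P A B) = Prod P A B" "Cod C (Snd P A B) = B"
  using products(1)[OF assms] by (simp_all add: is_product_def)

lemma pair_simps [simp]: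
  assumes "f \<in> Arr C" "g \<in> Arr C" "Dom C f = Dom C g"
  shows "pair C P f g \<in> Arr C" "Dom C (pair C P f g) = Dom C f"
    "Cod C (pair C P f g) = Prod P (Cod C f) (Cod C g)"
    "\<lbrakk>Cod C f = A; Cod C g = B\<rbrakk> \<Longrightarrow> Fst P A B \<cdot> pair C P f g = f"
    "\<lbrakk>Cod C f = A; Cod C g = B\<rbrakk> \<Longrightarrow> Snd P A B \<cdot> pair C P f g = g"
proof -
  have pr: "is_product C (Cod C f) (Cod C g) (Prod P (Cod C f) (Cod C g)) (Fst P (Cod C f) (Cod C g))
      (Snd P (Cod C f) (Cod C g))"
    using assms by (intro products(1)) simp_all
  note m = product_med2[OF pr assms(1) refl refl assms(2) assms(3)[symmetric] refl, folded pair_def]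
  show "pair C P f g \<in> Arr C" "Dom C (pair C P f g) = Dom C f"
    "Cod C (pair C P f g) = Prod P (Cod C f) (Cod C g)" by (fact m)+
  show "\<lbrakk>Cod C f = A; Cod C g = B\<rbrakk> \<Longrightarrow> Fst P A B \<cdot> pair C P f g = f"
    "\<lbrakk>Cod C f = A; Cod C g = B\<rbrakk> \<Longrightarrow> Snd P A B \<cdot> pair C P f g = g" using m(4,5) by blast+
qed

lemma pair_x [simp]:
  assumes "f \<in> Arr C" "g \<in> Arr C" "Dom C f = Dom C g" "x \<in> Arr C" "Cod C x = Dom C g" "Cod C f = A" "Cod C g = B"
  shows "Fst P A B \<cdot> (pair C P f g \<cdot> x) = f \<cdot> x" "Snd P A B \<cdot> (pair C P f g \<cdot> x) = g \<cdot> x"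
proof -
  have "A \<in> Obj C" "B \<in> Obj C" using assms by auto
  then show "Fst P A B \<cdot> (pair C P f g \<cdot> x) = f \<cdot> x" "Snd P A B \<cdot> (pair C P f g \<cdot> x) = g \<cdot> x"
    using assms by (auto intro!: reassoc)
qed

lemma Prod_eqI:
  "\<lbrakk>u \<in> Arr C; v \<in> Arr C; Dom C u = Dom C v; Cod C u = Prod P A B; Cod C v = Prod P A B; A \<in> Obj C; B \<in> Obj C;
    Fst P A B \<cdot> u = Fst P A B \<cdot> v; Snd P A B \<cdot> u = Snd P A B \<cdot> v\<rbrakk> \<Longrightarrow> u = v"
  by (rule product_eqI[OF products(1)])

lemma pair_comp [simp]:
  assumes "f \<in> Arr C" "g \<in> Arr C" "Dom C f = Dom C g" "x \<in> Arr C" "Cod C x = Dom C g"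
  shows "pair C P f g \<cdot> x = pair C P (f \<cdot> x) (g \<cdot> x)"
  by (rule Prod_eqI[where A = "Cod C f" and B = "Cod C g"]) (use assms in simp_all)

lemma pair_Fst_Snd [simp]: "\<lbrakk>A \<in> Obj C; B \<in> Obj C\<rbrakk> \<Longrightarrow> pair C P (Fst P A B) (Snd P A B) = Id C (Prod P A B)"
  by (rule Prod_eqI[where A = A and B = B]) auto

lemma pair_eta [simp]:
  assumes "x \<in> Arr C" "Cod C x = Prod P A B" "A \<in> Obj C" "B \<in> Obj C"
  shows "pair C P (Fst P A B \<cdot> x) (Snd P A B \<cdot> x) = x"
  by (rule Prod_eqI[where A = A and B = B]) (use assms in simp_all)

lemma prodmap_simps [simp]:
  assumes "f \<in> Arr C" "g \<in> Arr C"
  shows "prodmap C P f g \<in> Arr C" "Dom C (prodmap C P f g) = Prod P (Dom C f) (Dom C g)"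
    "Cod C (prodmap C P f g) = Prod P (Cod C f) (Cod C g)"
    "\<lbrakk>Cod C f = A; Cod C g = B\<rbrakk> \<Longrightarrow> Fst P A B \<cdot> prodmap C P f g = f \<cdot> Fst P (Dom C f) (Dom C g)"
    "\<lbrakk>Cod C f = A; Cod C g = B\<rbrakk> \<Longrightarrow> Snd P A B \<cdot> prodmap C P f g = g \<cdot> Snd P (Dom C f) (Dom C g)"
  unfolding prodmap_def using assms by simp_all

lemma prodmap_comp [simp]:
  assumes "f \<in> Arr C" "g \<in> Arr C" "x \<in> Arr C" "Cod C x = Prod P (Dom C f) (Dom C g)"
  shows "prodmap C P f g \<cdot> x = pair C P (f \<cdot> (Fst P (Dom C f) (Dom C g) \<cdot> x)) (g \<cdot> (Snd P (Dom C f) (Dom C g) \<cdot> x))"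
  unfolding prodmap_def using assms by simp

lemma TPpair_simps [simp]:
  assumes "f \<in> Arr C" "g \<in> Arr C" "Dom C f = X" "Dom C g = X" "Cod C f = TO C A" "Cod C g = TO C B"
    "A \<in> Obj C" "B \<in> Obj C"
  shows "TPpair C P X A B f g \<in> Arr C" "Dom C (TPpair C P X A B f g) = X"
    "Cod C (TPpair C P X A B f g) = TO C (Prod P A B)"
    "TA C (Fst P A B) \<cdot> TPpair C P X A B f g = f"
    "TA C (Snd P A B) \<cdot> TPpair C P X A B f g = g"
  unfolding TPpair_def using product_med2[OF products(2)[OF assms(7,8)], of f X g] assms by simp_all

lemma TPpair_x [simp]:
  assumes "f \<in> Arr C" "g \<in> Arr C" "Dom C f = X" "Dom C g = X" "Cod C f = TO C A" "Cod C g = TO C B"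
    "A \<in> Obj C" "B \<in> Obj C" "x \<in> Arr C" "Cod C x = X"
  shows "TA C (Fst P A B) \<cdot> (TPpair C P X A B f g \<cdot> x) = f \<cdot> x"
    "TA C (Snd P A B) \<cdot> (TPpair C P X A B f g \<cdot> x) = g \<cdot> x"
  using TPpair_simps[OF assms(1-8)] assms(7-10) by (auto intro!: reassoc)

lemma TPpair_eqI:
  assumes "u \<in> Arr C" "Dom C u = X" "Cod C u = TO C (Prod P A B)" "A \<in> Obj C" "B \<in> Obj C"
    "TA C (Fst P A B) \<cdot> u = f" "TA C (Snd P A B) \<cdot> u = g"
  shows "TPpair C P X A B f g = u"
  unfolding TPpair_def using assms by (intro product_med2_eqI[OF products(2)])

lemma TPpair_comp [simp]:
  assumes "f \<in> Arr C" "g \<in> Arr C" "Dom C f = X" "Dom C g = X" "Cod C f = TO C A" "Cod C g = TO C B"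
    "A \<in> Obj C" "B \<in> Obj C" "x \<in> Arr C" "Cod C x = X"
  shows "TPpair C P X A B f g \<cdot> x = TPpair C P (Dom C x) A B (f \<cdot> x) (g \<cdot> x)"
  by (rule TPpair_eqI[symmetric]) (use assms in simp_all)

lemma T_Fst_pair [simp]:
  assumes "f \<in> Arr C" "g \<in> Arr C" "Dom C f = Dom C g" "Cod C f = A" "Cod C g = B"
  shows "TA C (Fst P A B) \<cdot> TA C (pair C P f g) = TA C f" "TA C (Snd P A B) \<cdot> TA C (pair C P f g) = TA C g"
proof -
  have "A \<in> Obj C" "B \<in> Obj C" using assms by auto
  then show "TA C (Fst P A B) \<cdot> TA C (pair C P f g) = TA C f" "TA C (Snd P A B) \<cdot> TA C (pair C P f g) = TA C g"
    using assms T_simps(6)[of "pair C P f g" "Fst P A B"] T_simps(6)[of "pair C P f g" "Snd P A B"] by simp_all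
qed

lemma T_pair:
  assumes "f \<in> Arr C" "g \<in> Arr C" "Dom C f = Dom C g"
  shows "TA C (pair C P f g) = TPpair C P (TO C (Dom C g)) (Cod C f) (Cod C g) (TA C f) (TA C g)"
  by (rule TPpair_eqI[symmetric]) (use assms in simp_all)

lemma T_pair_x:
  assumes "f \<in> Arr C" "g \<in> Arr C" "Dom C f = Dom C g" "x \<in> Arr C" "Cod C x = TO C (Dom C g)"
  shows "TA C (pair C P f g) \<cdot> x = TPpair C P (Dom C x) (Cod C f) (Cod C g) (TA C f \<cdot> x) (TA C g \<cdot> x)"
  using assms by (simp add: T_pair)

end

section \<open>Differential objects\<close>

locale dobj = cartesian_tangent C P for C :: "('o, 'm, 'x) tcat_scheme" (structure) and P +
  fixes D :: "('o, 'm) dobj"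
  assumes dobj: "differential_object C P D"
begin

abbreviation "A \<equiv> do_carrier D"
abbreviation "\<zeta> \<equiv> do_zero D"
abbreviation "\<sigma> \<equiv> do_sum D"
abbreviation "ph \<equiv> do_hat D"

lemma dobj_typ [simp]:
  "A \<in> Obj C" "\<zeta> \<in> Arr C" "Dom C \<zeta> = One P" "Cod C \<zeta> = A" "\<sigma> \<in> Arr C" "Dom C \<sigma> = Prod P A A" "Cod C \<sigma> = A"
  "ph \<in> Arr C" "Dom C ph = TO C A" "Cod C ph = A"
  using dobj by (simp_all add: differential_object_def Let_def)

lemma dobj_raw:
  "\<sigma> \<cdot> pair C P (\<zeta> \<cdot> bang C P A) (Id C A) = Id C A"
  "\<sigma> \<cdot> pair C P (Snd P A A) (Fst P A A) = \<sigma>"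
  "\<sigma> \<cdot> pair C P (\<sigma> \<cdot> Fst P (Prod P A A) A) (Snd P (Prod P A A) A) =
    \<sigma> \<cdot> pair C P (Fst P A A \<cdot> Fst P (Prod P A A) A)
      (\<sigma> \<cdot> pair C P (Snd P A A \<cdot> Fst P (Prod P A A) A) (Snd P (Prod P A A) A))"
  "ph \<cdot> TA C \<zeta> = \<zeta> \<cdot> bang C P (TO C (One P))"
  "ph \<cdot> TA C \<sigma> = \<sigma> \<cdot> pair C P (ph \<cdot> TA C (Fst P A A)) (ph \<cdot> TA C (Snd P A A))"
  "ph \<cdot> zT C A = \<zeta> \<cdot> bang C P A"
  "ph \<cdot> sT C A = \<sigma> \<cdot> pair C P (ph \<cdot> pr C 2 0 A) (ph \<cdot> pr C 2 1 A)"
  "ph \<cdot> (TA C ph \<cdot> lT C A) = ph"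
  and hat_product: "is_product C A A (TO C A) (pT C A) ph"
  using dobj assoc[of "lT C A" "TA C ph" ph] by (simp_all add: differential_object_def Let_def)

lemma unit_x: "\<lbrakk>x \<in> Arr C; Cod C x = A; X = Dom C x\<rbrakk> \<Longrightarrow> \<sigma> \<cdot> pair C P (\<zeta> \<cdot> bang C P X) x = x"
  using reassoc[OF dobj_raw(1), of x] by simp

lemma comm_x: "\<lbrakk>x \<in> Arr C; y \<in> Arr C; Cod C x = A; Cod C y = A; Dom C x = Dom C y\<rbrakk>
    \<Longrightarrow> \<sigma> \<cdot> pair C P x y = \<sigma> \<cdot> pair C P y x"
  using reassoc[OF dobj_raw(2), of "pair C P y x"] by simp

lemma assoc_x:
  assumes "x \<in> Arr C" "y \<in> Arr C" "w \<in> Arr C" "Cod C x = A" "Cod C y = A" "Cod C w = A"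
    "Dom C x = Dom C w" "Dom C y = Dom C w"
  shows "\<sigma> \<cdot> pair C P (\<sigma> \<cdot> pair C P x y) w = \<sigma> \<cdot> pair C P x (\<sigma> \<cdot> pair C P y w)"
  using reassoc[OF dobj_raw(3), of "pair C P (pair C P x y) w"] assms by simp

lemma hat_sum_x: "\<lbrakk>x \<in> Arr C; Cod C x = TO C (Prod P A A)\<rbrakk> \<Longrightarrow>
    ph \<cdot> (TA C \<sigma> \<cdot> x) = \<sigma> \<cdot> pair C P (ph \<cdot> (TA C (Fst P A A) \<cdot> x)) (ph \<cdot> (TA C (Snd P A A) \<cdot> x))"
  using reassoc[OF dobj_raw(5), of x] by simp

lemma hat_z_x: "\<lbrakk>x \<in> Arr C; Cod C x = A\<rbrakk> \<Longrightarrow> ph \<cdot> (zT C A \<cdot> x) = \<zeta> \<cdot> bang C P (Dom C x)"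
  using reassoc[OF dobj_raw(6), of x] by simp

lemma hat_s_x: "\<lbrakk>x \<in> Arr C; Cod C x = Tn C 2 A\<rbrakk> \<Longrightarrow>
    ph \<cdot> (sT C A \<cdot> x) = \<sigma> \<cdot> pair C P (ph \<cdot> (pr C 2 0 A \<cdot> x)) (ph \<cdot> (pr C 2 1 A \<cdot> x))"
  using reassoc[OF dobj_raw(7), of x] by simp

lemma hat_l_x: "\<lbrakk>x \<in> Arr C; Cod C x = TO C A\<rbrakk> \<Longrightarrow> ph \<cdot> (TA C ph \<cdot> (lT C A \<cdot> x)) = ph \<cdot> x"
  using reassoc[of ph "TA C ph \<cdot> lT C A" ph x] dobj_raw(8) by simp

lemma hat_eqI:
  "\<lbrakk>u \<in> Arr C; v \<in> Arr C; Dom C u = Dom C v; Cod C u = TO C A; Cod C v = TO C A;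
    pT C A \<cdot> u = pT C A \<cdot> v; ph \<cdot> u = ph \<cdot> v\<rbrakk> \<Longrightarrow> u = v"
  by (rule product_eqI[OF hat_product])

end

context cartesian_tangent
begin

lemma dobjI:
  fixes D :: "('o, 'm) dobj"
  defines "A \<equiv> do_carrier D" and "\<zeta> \<equiv> do_zero D" and "\<sigma> \<equiv> do_sum D" and "ph \<equiv> do_hat D"
  assumes "A \<in> Obj C" "\<zeta> \<in> Homs C (One P) A" "\<sigma> \<in> Homs C (Prod P A A) A" "ph \<in> Homs C (TO C A) A"
    "\<sigma> \<cdot> pair C P (\<zeta> \<cdot> bang C P A) (Id C A) = Id C A"
    "\<sigma> \<cdot> pair C P (Snd P A A) (Fst P A A) = \<sigma>"
    "\<sigma> \<cdot> pair C P (\<sigma> \<cdot> Fst P (Prod P A A) A) (Snd P (Prod P A A) A) =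
      \<sigma> \<cdot> pair C P (Fst P A A \<cdot> Fst P (Prod P A A) A)
        (\<sigma> \<cdot> pair C P (Snd P A A \<cdot> Fst P (Prod P A A) A) (Snd P (Prod P A A) A))"
    "ph \<cdot> TA C \<zeta> = \<zeta> \<cdot> bang C P (TO C (One P))"
    "ph \<cdot> TA C \<sigma> = \<sigma> \<cdot> pair C P (ph \<cdot> TA C (Fst P A A)) (ph \<cdot> TA C (Snd P A A))"
    "ph \<cdot> zT C A = \<zeta> \<cdot> bang C P A"
    "ph \<cdot> sT C A = \<sigma> \<cdot> pair C P (ph \<cdot> pr C 2 0 A) (ph \<cdot> pr C 2 1 A)"
    "ph \<cdot> (TA C ph \<cdot> lT C A) = ph"
    "is_product C A A (TO C A) (pT C A) ph"
  shows "differential_object C P D"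
proof -
  have e: "ph \<cdot> TA C ph \<cdot> lT C A = ph" using assms(5,8,16) by simp
  show ?thesis
    unfolding differential_object_def Let_def A_def[symmetric] \<zeta>_def[symmetric] \<sigma>_def[symmetric] ph_def[symmetric]
    by (intro conjI assms(5-15) assms(17) e)
qed

end

context dobj
begin

abbreviation "TD \<equiv> do_T C P D"

lemma do_T_sel [simp]: "do_carrier TD = TO C A" "do_zero TD = TA C \<zeta> \<cdot> zT C (One P)"
  "do_sum TD = TA C \<sigma> \<cdot> TPpair C P (Prod P (TO C A) (TO C A)) A A (Fst P (TO C A) (TO C A)) (Snd P (TO C A) (TO C A))"
  "do_hat TD = TA C ph \<cdot> cT C A"
  by (simp_all add: do_T_def Let_def)

lemma T_law:
  "f \<cdot> g = h \<Longrightarrow> f \<in> Arr C \<Longrightarrow> g \<in> Arr C \<Longrightarrow> Cod C g = Dom C f \<Longrightarrow> TA C f \<cdot> TA C g = TA C h"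
  by (metis T_simps(6))

text \<open>\<open>T\<close> preserves the product diagram of \<open>D\<close>, and the flip exchanges \<open>T p\<close> with \<open>p\<^sub>T\<close>.\<close>

lemma do_T_product: "is_product C (TO C A) (TO C A) (TO C (TO C A)) (pT C (TO C A)) (TA C ph \<cdot> cT C A)"
  unfolding is_product_def
proof (intro conjI allI ballI)
  note Tp = T_products[OF hat_product]
  fix X f g assume f: "f \<in> Homs C X (TO C A)" and g: "g \<in> Homs C X (TO C A)"
  let ?w = "med2 C X (TO C (TO C A)) (TA C (pT C A)) (TA C ph) f g"
  have w: "?w \<in> Arr C" "Dom C ?w = X" "Cod C ?w = TO C (TO C A)" "TA C (pT C A) \<cdot> ?w = f" "TA C ph \<cdot> ?w = g"
    using product_med2[OF Tp, of f X g] f g by simp_all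
  show "\<exists>!u. u \<in> Homs C X (TO C (TO C A)) \<and> pT C (TO C A) \<cdot> u = f \<and> (TA C ph \<cdot> cT C A) \<cdot> u = g"
  proof (rule ex1I[of _ "cT C A \<cdot> ?w"])
    show "cT C A \<cdot> ?w \<in> Homs C X (TO C (TO C A)) \<and> pT C (TO C A) \<cdot> (cT C A \<cdot> ?w) = f \<and>
      (TA C ph \<cdot> cT C A) \<cdot> (cT C A \<cdot> ?w) = g"
      using w by (simp add: tangent_laws)
    fix u assume u: "u \<in> Homs C X (TO C (TO C A)) \<and> pT C (TO C A) \<cdot> u = f \<and> (TA C ph \<cdot> cT C A) \<cdot> u = g"
    have "cT C A \<cdot> u = ?w"
      by (rule product_eqI[OF Tp]) (use u w in \<open>auto simp: tangent_laws\<close>)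
    then have "cT C A \<cdot> (cT C A \<cdot> u) = cT C A \<cdot> ?w" by simp
    then show "u = cT C A \<cdot> ?w" using u by (simp add: tangent_laws)
  qed
qed simp_all

text \<open>Every law is \<open>T\<close> of the corresponding law of \<open>D\<close>, transported along the flip and along the isomorphism
  of \<open>T (A \<times> A)\<close> with \<open>T A \<times> T A\<close>.\<close>

lemma do_T_dobj: "differential_object C P TD"
proof (rule dobjI)
  let ?TX = "TO C A"
  let ?m = "TPpair C P (Prod P ?TX ?TX) A A (Fst P ?TX ?TX) (Snd P ?TX ?TX)"
  show "do_carrier TD \<in> Obj C" "do_zero TD \<in> Homs C (One P) (do_carrier TD)"
    "do_sum TD \<in> Homs C (Prod P (do_carrier TD) (do_carrier TD)) (do_carrier TD)"
    "do_hat TD \<in> Homs C (TO C (do_carrier TD)) (do_carrier TD)" by simp_all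
  show "is_product C (do_carrier TD) (do_carrier TD) (TO C (do_carrier TD)) (pT C (do_carrier TD)) (do_hat TD)"
    using do_T_product by simp
  show "do_sum TD \<cdot> pair C P (do_zero TD \<cdot> bang C P (do_carrier TD)) (Id C (do_carrier TD)) = Id C (do_carrier TD)"
    using arg_cong[OF dobj_raw(1), of "TA C"] by (simp add: T_pair T_bang)
  show "do_sum TD \<cdot> pair C P (Snd P (do_carrier TD) (do_carrier TD)) (Fst P (do_carrier TD) (do_carrier TD)) = do_sum TD"
    using reassoc[OF T_law[OF dobj_raw(2)], of ?m] by (simp add: T_pair_x)
  let ?Y = "Prod P (Prod P ?TX ?TX) ?TX"
  let ?x = "Fst P ?TX ?TX \<cdot> Fst P (Prod P ?TX ?TX) ?TX" and ?y = "Snd P ?TX ?TX \<cdot> Fst P (Prod P ?TX ?TX) ?TX"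
    and ?w = "Snd P (Prod P ?TX ?TX) ?TX"
  let ?W = "TPpair C P ?Y (Prod P A A) A (TPpair C P ?Y A A ?x ?y) ?w"
  show "do_sum TD \<cdot> pair C P (do_sum TD \<cdot> Fst P (Prod P (do_carrier TD) (do_carrier TD)) (do_carrier TD))
      (Snd P (Prod P (do_carrier TD) (do_carrier TD)) (do_carrier TD)) =
    do_sum TD \<cdot> pair C P (Fst P (do_carrier TD) (do_carrier TD) \<cdot> Fst P (Prod P (do_carrier TD) (do_carrier TD)) (do_carrier TD))
      (do_sum TD \<cdot> pair C P (Snd P (do_carrier TD) (do_carrier TD) \<cdot> Fst P (Prod P (do_carrier TD) (do_carrier TD)) (do_carrier TD))
        (Snd P (Prod P (do_carrier TD) (do_carrier TD)) (do_carrier TD)))"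
    using arg_cong[OF arg_cong[OF dobj_raw(3), of "TA C"], of "\<lambda>h. h \<cdot> ?W"] by (simp add: T_pair)
  show "do_hat TD \<cdot> TA C (do_zero TD) = do_zero TD \<cdot> bang C P (TO C (One P))"
  proof -
    have "do_hat TD \<cdot> TA C (do_zero TD) = TA C ph \<cdot> (TA C (TA C \<zeta>) \<cdot> (cT C (One P) \<cdot> TA C (zT C (One P))))"
      by (simp add: nat_laws)
    also have "\<dots> = TA C \<zeta> \<cdot> (TA C (bang C P (TO C (One P))) \<cdot> (cT C (One P) \<cdot> TA C (zT C (One P))))"
      using reassoc[OF T_law[OF dobj_raw(4)], of "cT C (One P) \<cdot> TA C (zT C (One P))"] by simp
    also have "TA C (bang C P (TO C (One P))) \<cdot> (cT C (One P) \<cdot> TA C (zT C (One P))) = zT C (One P) \<cdot> bang C P (TO C (One P))"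
      by (rule TOne_eqI) simp_all
    finally show ?thesis by simp
  qed
  show "do_hat TD \<cdot> TA C (do_sum TD) = do_sum TD \<cdot> pair C P (do_hat TD \<cdot> TA C (Fst P (do_carrier TD) (do_carrier TD)))
      (do_hat TD \<cdot> TA C (Snd P (do_carrier TD) (do_carrier TD)))"
  proof -
    have Tm: "TA C (TA C (Fst P A A)) \<cdot> TA C ?m = TA C (Fst P ?TX ?TX)" "TA C (TA C (Snd P A A)) \<cdot> TA C ?m = TA C (Snd P ?TX ?TX)"
      by (simp_all flip: T_simps(6))
    have c1: "TA C (TA C (Fst P A A)) \<cdot> (cT C (Prod P A A) \<cdot> TA C ?m) = cT C A \<cdot> TA C (Fst P ?TX ?TX)"
      "TA C (TA C (Snd P A A)) \<cdot> (cT C (Prod P A A) \<cdot> TA C ?m) = cT C A \<cdot> TA C (Snd P ?TX ?TX)"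
      using c_nat_x[of "Fst P A A" A "TA C ?m"] c_nat_x[of "Snd P A A" A "TA C ?m"] Tm by simp_all
    have "do_hat TD \<cdot> TA C (do_sum TD) = TA C ph \<cdot> (TA C (TA C \<sigma>) \<cdot> (cT C (Prod P A A) \<cdot> TA C ?m))"
      by (simp add: nat_laws)
    also have "\<dots> = TA C \<sigma> \<cdot> TPpair C P (TO C (Prod P ?TX ?TX)) A A (TA C ph \<cdot> (cT C A \<cdot> TA C (Fst P ?TX ?TX)))
        (TA C ph \<cdot> (cT C A \<cdot> TA C (Snd P ?TX ?TX)))"
      using reassoc[OF T_law[OF dobj_raw(5)], of "cT C (Prod P A A) \<cdot> TA C ?m"] by (simp add: T_pair_x c1)
    finally show ?thesis by simp
  qed
  show "do_hat TD \<cdot> zT C (do_carrier TD) = do_zero TD \<cdot> bang C P (do_carrier TD)"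
    using T_law[OF dobj_raw(6)] by (simp add: tangent_laws T_bang)
  show "do_hat TD \<cdot> sT C (do_carrier TD) = do_sum TD \<cdot> pair C P (do_hat TD \<cdot> pr C 2 0 (do_carrier TD))
      (do_hat TD \<cdot> pr C 2 1 (do_carrier TD))"
  proof -
    let ?c0 = "cT C A \<cdot> pr C 2 0 ?TX" and ?c1 = "cT C A \<cdot> pr C 2 1 ?TX"
    let ?t = "TT2pair C (Tn C 2 ?TX) A ?c0 ?c1"
    have pc: "TA C (pT C A) \<cdot> ?c0 = TA C (pT C A) \<cdot> ?c1" by (simp add: tangent_laws)
    \<comment> \<open>The flip exchanges the addition \<open>s\<^sub>T\<close> with \<open>T s\<close>; the pair \<open>?t\<close> regards a pair of vectors over
      \<open>p\<^sub>T\<close> as one over \<open>T p\<close>.\<close>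
    have "cT C A \<cdot> (TA C (sT C A) \<cdot> ?t) = sT C ?TX \<cdot> (T2pair C (TO C (Tn C 2 A)) ?TX
        (cT C A \<cdot> TA C (pr C 2 0 A)) (cT C A \<cdot> TA C (pr C 2 1 A)) \<cdot> ?t)"
      using reassoc[OF c_s[of A], of ?t] pc by (simp add: tangent_laws)
    also have "T2pair C (TO C (Tn C 2 A)) ?TX (cT C A \<cdot> TA C (pr C 2 0 A)) (cT C A \<cdot> TA C (pr C 2 1 A)) \<cdot> ?t = Id C (Tn C 2 ?TX)"
      using pc by (simp add: T2pair_comp tangent_laws)
    finally have "cT C A \<cdot> (cT C A \<cdot> (TA C (sT C A) \<cdot> ?t)) = cT C A \<cdot> sT C ?TX" using pc by simp
    then have cs: "TA C (sT C A) \<cdot> ?t = cT C A \<cdot> sT C ?TX" using pc by (simp add: tangent_laws)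
    have "do_hat TD \<cdot> sT C ?TX = TA C ph \<cdot> (TA C (sT C A) \<cdot> ?t)" by (simp add: cs)
    also have "\<dots> = TA C \<sigma> \<cdot> TPpair C P (Tn C 2 ?TX) A A (TA C ph \<cdot> ?c0) (TA C ph \<cdot> ?c1)"
      using reassoc[OF T_law[OF dobj_raw(7)], of ?t] pc by (simp add: T_pair_x)
    finally show ?thesis by simp
  qed
  show "do_hat TD \<cdot> (TA C (do_hat TD) \<cdot> lT C (do_carrier TD)) = do_hat TD"
  proof -
    have "do_hat TD \<cdot> (TA C (do_hat TD) \<cdot> lT C ?TX) = TA C ph \<cdot> (TA C (TA C ph) \<cdot> (cT C ?TX \<cdot> (TA C (cT C A) \<cdot> lT C ?TX)))"
      by (simp add: nat_laws)
    also have "cT C ?TX \<cdot> (TA C (cT C A) \<cdot> lT C ?TX) = TA C (lT C A) \<cdot> cT C A"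
      using c_c_l[of A] by simp
    also have "TA C ph \<cdot> (TA C (TA C ph) \<cdot> (TA C (lT C A) \<cdot> cT C A)) = TA C ph \<cdot> cT C A"
      using reassoc[OF T_law[OF dobj_raw(8)], of "cT C A"] by simp
    finally show ?thesis by simp
  qed
qed

end

lemma (in cartesian_tangent) dobj_axiom: "differential_object C P D \<Longrightarrow> dobj C P D"
  by unfold_locales

text \<open>All equations of a differential object are between arrows into \<open>A\<close>, hence reflected by a jointly
  monic family of structure preserving arrows \<open>\<pi> i\<close> to differential objects. Monicity may be relative to
  a relation \<open>R\<close> that the two sides of each equation satisfy: if \<open>\<pi>\<close> is a single Cartesian arrow, \<open>R\<close> is
  equality of the images in the base. The product diagram is no equation and has to be given.\<close>

lemma (in cartesian_tangent) dobj_by_projections: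
  fixes D :: "('o, 'm) dobj" and G :: "'k \<Rightarrow> ('o, 'm) dobj"
  defines "A \<equiv> do_carrier D" and "\<zeta> \<equiv> do_zero D" and "\<sigma> \<equiv> do_sum D" and "ph \<equiv> do_hat D"
  assumes A: "A \<in> Obj C" and \<zeta>: "\<zeta> \<in> Homs C (One P) A" and \<sigma>: "\<sigma> \<in> Homs C (Prod P A A) A"
    and ph: "ph \<in> Homs C (TO C A) A"
    and G: "\<And>i. i \<in> K \<Longrightarrow> differential_object C P (G i)"
    and \<pi>: "\<And>i. i \<in> K \<Longrightarrow> \<pi> i \<in> Homs C A (do_carrier (G i))"
    and \<pi>\<zeta>: "\<And>i. i \<in> K \<Longrightarrow> \<pi> i \<cdot> \<zeta> = do_zero (G i)"
    and \<pi>\<sigma>: "\<And>i. i \<in> K \<Longrightarrow> \<pi> i \<cdot> \<sigma> = do_sum (G i) \<cdot> prodmap C P (\<pi> i) (\<pi> i)"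
    and \<pi>ph: "\<And>i. i \<in> K \<Longrightarrow> \<pi> i \<cdot> ph = do_hat (G i) \<cdot> TA C (\<pi> i)"
    and monic: "\<And>u v. \<lbrakk>u \<in> Arr C; v \<in> Arr C; Dom C u = Dom C v; Cod C u = A; Cod C v = A;
      \<And>i. i \<in> K \<Longrightarrow> \<pi> i \<cdot> u = \<pi> i \<cdot> v; R u v\<rbrakk> \<Longrightarrow> u = v"
    and R: "R (\<sigma> \<cdot> pair C P (\<zeta> \<cdot> bang C P A) (Id C A)) (Id C A)"
      "R (\<sigma> \<cdot> pair C P (Snd P A A) (Fst P A A)) \<sigma>"
      "R (\<sigma> \<cdot> pair C P (\<sigma> \<cdot> Fst P (Prod P A A) A) (Snd P (Prod P A A) A))
        (\<sigma> \<cdot> pair C P (Fst P A A \<cdot> Fst P (Prod P A A) A)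
        (\<sigma> \<cdot> pair C P (Snd P A A \<cdot> Fst P (Prod P A A) A) (Snd P (Prod P A A) A)))"
      "R (ph \<cdot> TA C \<zeta>) (\<zeta> \<cdot> bang C P (TO C (One P)))"
      "R (ph \<cdot> TA C \<sigma>) (\<sigma> \<cdot> pair C P (ph \<cdot> TA C (Fst P A A)) (ph \<cdot> TA C (Snd P A A)))"
      "R (ph \<cdot> zT C A) (\<zeta> \<cdot> bang C P A)"
      "R (ph \<cdot> sT C A) (\<sigma> \<cdot> pair C P (ph \<cdot> pr C 2 0 A) (ph \<cdot> pr C 2 1 A))"
      "R (ph \<cdot> (TA C ph \<cdot> lT C A)) ph"
    and prod: "is_product C A A (TO C A) (pT C A) ph"
  shows "differential_object C P D"
proof -
  have [simp]: "A \<in> Obj C" "\<zeta> \<in> Arr C" "Dom C \<zeta> = One P" "Cod C \<zeta> = A" "\<sigma> \<in> Arr C" "Dom C \<sigma> = Prod P A A"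
    "Cod C \<sigma> = A" "ph \<in> Arr C" "Dom C ph = TO C A" "Cod C ph = A"
    using A \<zeta> \<sigma> ph by simp_all
  have [simp]: "\<pi> i \<in> Arr C" "Dom C (\<pi> i) = A" "Cod C (\<pi> i) = do_carrier (G i)" if "i \<in> K" for i
    using \<pi>[OF that] by simp_all
  have Z: "\<pi> i \<cdot> (\<zeta> \<cdot> x) = do_zero (G i) \<cdot> x" if "i \<in> K" "x \<in> Arr C" "Cod C x = One P" for i x
    using reassoc[OF \<pi>\<zeta>[OF that(1)], of x] that by simp
  have S: "\<pi> i \<cdot> \<sigma> = do_sum (G i) \<cdot> pair C P (\<pi> i \<cdot> Fst P A A) (\<pi> i \<cdot> Snd P A A)" if "i \<in> K" for i
    using \<pi>\<sigma>[OF that] that by (simp add: prodmap_def)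
  have Sx: "\<pi> i \<cdot> (\<sigma> \<cdot> pair C P f g) = do_sum (G i) \<cdot> pair C P (\<pi> i \<cdot> f) (\<pi> i \<cdot> g)"
    if "i \<in> K" "f \<in> Arr C" "g \<in> Arr C" "Dom C f = Dom C g" "Cod C f = A" "Cod C g = A" for i f g
  proof -
    interpret G: dobj C P "G i" by (rule dobj_axiom[OF G[OF that(1)]])
    show ?thesis using reassoc[OF \<pi>\<sigma>[OF that(1)], of "pair C P f g"] that by simp
  qed
  have H: "\<pi> i \<cdot> (ph \<cdot> x) = do_hat (G i) \<cdot> (TA C (\<pi> i) \<cdot> x)" if "i \<in> K" "x \<in> Arr C" "Cod C x = TO C A" for i x
  proof -
    interpret G: dobj C P "G i" by (rule dobj_axiom[OF G[OF that(1)]])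
    show ?thesis using reassoc[OF \<pi>ph[OF that(1)], of x] that by simp
  qed
  show ?thesis
  proof (rule dobjI; fold A_def \<zeta>_def \<sigma>_def ph_def)
    show "\<sigma> \<cdot> pair C P (\<zeta> \<cdot> bang C P A) (Id C A) = Id C A"
    proof (rule monic[OF _ _ _ _ _ _ R(1)])
      fix i assume i: "i \<in> K"
      interpret G: dobj C P "G i" by (rule dobj_axiom[OF G[OF i]])
      show "\<pi> i \<cdot> (\<sigma> \<cdot> pair C P (\<zeta> \<cdot> bang C P A) (Id C A)) = \<pi> i \<cdot> Id C A"
        using i by (simp add: Sx Z G.unit_x)
    qed simp_all
    show "\<sigma> \<cdot> pair C P (Snd P A A) (Fst P A A) = \<sigma>"
    proof (rule monic[OF _ _ _ _ _ _ R(2)])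
      fix i assume i: "i \<in> K"
      interpret G: dobj C P "G i" by (rule dobj_axiom[OF G[OF i]])
      show "\<pi> i \<cdot> (\<sigma> \<cdot> pair C P (Snd P A A) (Fst P A A)) = \<pi> i \<cdot> \<sigma>"
        using i G.comm_x[of "\<pi> i \<cdot> Snd P A A" "\<pi> i \<cdot> Fst P A A"] by (simp add: Sx S)
    qed simp_all
    show "\<sigma> \<cdot> pair C P (\<sigma> \<cdot> Fst P (Prod P A A) A) (Snd P (Prod P A A) A) =
        \<sigma> \<cdot> pair C P (Fst P A A \<cdot> Fst P (Prod P A A) A)
        (\<sigma> \<cdot> pair C P (Snd P A A \<cdot> Fst P (Prod P A A) A) (Snd P (Prod P A A) A))"
    proof (rule monic[OF _ _ _ _ _ _ R(3)])
      fix i assume i: "i \<in> K"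
      interpret G: dobj C P "G i" by (rule dobj_axiom[OF G[OF i]])
      have "\<pi> i \<cdot> (\<sigma> \<cdot> Fst P (Prod P A A) A) = do_sum (G i) \<cdot> pair C P (\<pi> i \<cdot> (Fst P A A \<cdot> Fst P (Prod P A A) A))
          (\<pi> i \<cdot> (Snd P A A \<cdot> Fst P (Prod P A A) A))"
        using reassoc[OF S[OF i], of "Fst P (Prod P A A) A"] i by simp
      then show "\<pi> i \<cdot> (\<sigma> \<cdot> pair C P (\<sigma> \<cdot> Fst P (Prod P A A) A) (Snd P (Prod P A A) A)) =
        \<pi> i \<cdot> (\<sigma> \<cdot> pair C P (Fst P A A \<cdot> Fst P (Prod P A A) A)
        (\<sigma> \<cdot> pair C P (Snd P A A \<cdot> Fst P (Prod P A A) A) (Snd P (Prod P A A) A)))"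
        using i by (simp add: Sx G.assoc_x)
    qed simp_all
    show "ph \<cdot> TA C \<zeta> = \<zeta> \<cdot> bang C P (TO C (One P))"
    proof (rule monic[OF _ _ _ _ _ _ R(4)])
      fix i assume i: "i \<in> K"
      interpret G: dobj C P "G i" by (rule dobj_axiom[OF G[OF i]])
      have "TA C (\<pi> i) \<cdot> TA C \<zeta> = TA C (do_zero (G i))" using G.T_law[OF \<pi>\<zeta>[OF i]] i by simp
      then show "\<pi> i \<cdot> (ph \<cdot> TA C \<zeta>) = \<pi> i \<cdot> (\<zeta> \<cdot> bang C P (TO C (One P)))"
        using i by (simp add: H Z G.dobj_raw)
    qed simp_all
    show "ph \<cdot> TA C \<sigma> = \<sigma> \<cdot> pair C P (ph \<cdot> TA C (Fst P A A)) (ph \<cdot> TA C (Snd P A A))"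
    proof (rule monic[OF _ _ _ _ _ _ R(5)])
      fix i assume i: "i \<in> K"
      interpret G: dobj C P "G i" by (rule dobj_axiom[OF G[OF i]])
      have "TA C (\<pi> i) \<cdot> TA C \<sigma> = TA C (do_sum (G i)) \<cdot> TA C (pair C P (\<pi> i \<cdot> Fst P A A) (\<pi> i \<cdot> Snd P A A))"
        using G.T_law[OF S[OF i]] i by simp
      then show "\<pi> i \<cdot> (ph \<cdot> TA C \<sigma>) = \<pi> i \<cdot> (\<sigma> \<cdot> pair C P (ph \<cdot> TA C (Fst P A A)) (ph \<cdot> TA C (Snd P A A)))"
        using i by (simp add: H Sx G.hat_sum_x)
    qed simp_all
    show "ph \<cdot> zT C A = \<zeta> \<cdot> bang C P A"
    proof (rule monic[OF _ _ _ _ _ _ R(6)])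
      fix i assume i: "i \<in> K"
      interpret G: dobj C P "G i" by (rule dobj_axiom[OF G[OF i]])
      show "\<pi> i \<cdot> (ph \<cdot> zT C A) = \<pi> i \<cdot> (\<zeta> \<cdot> bang C P A)"
        using i z_nat_simp[of "\<pi> i" "do_carrier (G i)"] G.hat_z_x[of "\<pi> i"] by (simp add: H Z)
    qed simp_all
    show "ph \<cdot> sT C A = \<sigma> \<cdot> pair C P (ph \<cdot> pr C 2 0 A) (ph \<cdot> pr C 2 1 A)"
    proof (rule monic[OF _ _ _ _ _ _ R(7)])
      fix i assume i: "i \<in> K"
      interpret G: dobj C P "G i" by (rule dobj_axiom[OF G[OF i]])
      show "\<pi> i \<cdot> (ph \<cdot> sT C A) = \<pi> i \<cdot> (\<sigma> \<cdot> pair C P (ph \<cdot> pr C 2 0 A) (ph \<cdot> pr C 2 1 A))"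
        using i s_nat_simp[of "\<pi> i" "do_carrier (G i)"] G.hat_s_x[of "FA (TnF C 2) (\<pi> i)"] by (simp add: H Sx)
    qed simp_all
    show "ph \<cdot> (TA C ph \<cdot> lT C A) = ph"
    proof (rule monic[OF _ _ _ _ _ _ R(8)])
      fix i assume i: "i \<in> K"
      interpret G: dobj C P "G i" by (rule dobj_axiom[OF G[OF i]])
      have "TA C (\<pi> i) \<cdot> TA C ph = TA C (do_hat (G i)) \<cdot> TA C (TA C (\<pi> i))"
        using G.T_law[OF \<pi>ph[OF i]] i by simp
      then show "\<pi> i \<cdot> (ph \<cdot> (TA C ph \<cdot> lT C A)) = \<pi> i \<cdot> ph"
        using i l_nat_simp[of "\<pi> i" "do_carrier (G i)"] G.hat_l_x[of "TA C (\<pi> i)"] \<pi>ph[OF i]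
          reassoc[of "TA C (\<pi> i)" "TA C ph" "TA C (do_hat (G i)) \<cdot> TA C (TA C (\<pi> i))" "lT C A"] by (simp add: H)
    qed simp_all
  qed (use A \<zeta> \<sigma> ph prod in simp_all)
qed

context dobj
begin

text \<open>Sums in \<open>T A\<close> lie over sums in \<open>A\<close>. Hence the componentwise sum of two tuples of vectors with a
  common base point has a common base point, and defines an addition on \<open>T\<^sub>n A\<close>.\<close>

lemma pTD_sum:
  assumes "x \<in> Arr C" "y \<in> Arr C" "Dom C x = Dom C y" "Cod C x = TO C A" "Cod C y = TO C A"
  shows "pT C A \<cdot> (do_sum TD \<cdot> pair C P x y) = \<sigma> \<cdot> pair C P (pT C A \<cdot> x) (pT C A \<cdot> y)"
proof -
  have "pT C (Prod P A A) \<cdot> TPpair C P (Dom C y) A A x y = pair C P (pT C A \<cdot> x) (pT C A \<cdot> y)"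
  proof (rule Prod_eqI[where A = A and B = A])
    show "Fst P A A \<cdot> (pT C (Prod P A A) \<cdot> TPpair C P (Dom C y) A A x y) = Fst P A A \<cdot> pair C P (pT C A \<cdot> x) (pT C A \<cdot> y)"
      using p_nat_x[of "Fst P A A" A "TPpair C P (Dom C y) A A x y"] assms by simp
    show "Snd P A A \<cdot> (pT C (Prod P A A) \<cdot> TPpair C P (Dom C y) A A x y) = Snd P A A \<cdot> pair C P (pT C A \<cdot> x) (pT C A \<cdot> y)"
      using p_nat_x[of "Snd P A A" A "TPpair C P (Dom C y) A A x y"] assms by simp
  qed (use assms in simp_all)
  then show ?thesis using assms by (simp add: p_nat_x)
qed

abbreviation "TDn n \<equiv> do_Tn C P n D"

lemma do_Tn_carrier [simp]: "do_carrier (TDn n) = Tn C n A"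
  by (simp add: do_Tn_def Let_def)

lemma do_Tn_simps:
  assumes n: "1 \<le> n"
  shows "do_zero (TDn n) \<in> Homs C (One P) (Tn C n A)" "do_sum (TDn n) \<in> Homs C (Prod P (Tn C n A) (Tn C n A)) (Tn C n A)"
    "do_hat (TDn n) \<in> Homs C (TO C (Tn C n A)) (Tn C n A)"
    "\<And>i. i < n \<Longrightarrow> pr C n i A \<cdot> do_zero (TDn n) = do_zero TD"
    "\<And>i. i < n \<Longrightarrow> pr C n i A \<cdot> do_sum (TDn n) = do_sum TD \<cdot> prodmap C P (pr C n i A) (pr C n i A)"
    "\<And>i. i < n \<Longrightarrow> pr C n i A \<cdot> do_hat (TDn n) = do_hat TD \<cdot> TA C (pr C n i A)"
proof -
  have np: "is_npullback C n (pT C A) (Tn C n A) (\<lambda>i. pr C n i A)" using npullback_T0[of A n] n by simp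
  let ?X = "Tn C n A"
  have X: "?X \<in> Obj C" using n by simp
  have z: "do_zero (TDn n) = ntuple C n (One P) ?X (\<lambda>i. pr C n i A) (\<lambda>i. do_zero TD)"
    and s: "do_sum (TDn n) = ntuple C n (Prod P ?X ?X) ?X (\<lambda>i. pr C n i A)
      (\<lambda>i. do_sum TD \<cdot> prodmap C P (pr C n i A) (pr C n i A))"
    and h: "do_hat (TDn n) = ntuple C n (TO C ?X) ?X (\<lambda>i. pr C n i A) (\<lambda>i. do_hat TD \<cdot> TA C (pr C n i A))"
    by (simp_all add: do_Tn_def Let_def)
  note zz = npullback_tuple[OF np, where g = "\<lambda>i. do_zero TD" and X = "One P", folded z]
  show "do_zero (TDn n) \<in> Homs C (One P) ?X" unfolding in_Homs_iff
    by (intro conjI zz(1-3)) simp_all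
  show "pr C n i A \<cdot> do_zero (TDn n) = do_zero TD" if "i < n" for i
    by (rule zz(4)) (use that in simp_all)
  have typs: "do_sum TD \<cdot> prodmap C P (pr C n i A) (pr C n i A) \<in> Arr C \<and>
    Dom C (do_sum TD \<cdot> prodmap C P (pr C n i A) (pr C n i A)) = Prod P ?X ?X \<and>
    Cod C (do_sum TD \<cdot> prodmap C P (pr C n i A) (pr C n i A)) = Dom C (pT C A)" if "i < n" for i
    using that X by (simp add: prodmap_def)
  have eqs: "pT C A \<cdot> (do_sum TD \<cdot> prodmap C P (pr C n i A) (pr C n i A)) =
    pT C A \<cdot> (do_sum TD \<cdot> prodmap C P (pr C n j A) (pr C n j A))" if "i < n" "j < n" for i j
  proof -
    have *: "pT C A \<cdot> (do_sum TD \<cdot> prodmap C P (pr C n i A) (pr C n i A)) =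
      \<sigma> \<cdot> pair C P ((pT C A \<cdot> pr C n i A) \<cdot> Fst P ?X ?X) ((pT C A \<cdot> pr C n i A) \<cdot> Snd P ?X ?X)" if "i < n" for i
      unfolding prodmap_def using that X by (subst pTD_sum) simp_all
    show ?thesis unfolding *[OF that(1)] *[OF that(2)] p_pr[OF dobj_typ(1) that] ..
  qed
  have XX: "Prod P ?X ?X \<in> Obj C" using X by simp
  have ss: "do_sum (TDn n) \<in> Arr C" "Dom C (do_sum (TDn n)) = Prod P ?X ?X" "Cod C (do_sum (TDn n)) = ?X"
    "i < n \<Longrightarrow> pr C n i A \<cdot> do_sum (TDn n) = do_sum TD \<cdot> prodmap C P (pr C n i A) (pr C n i A)" for i
    unfolding s by (rule npullback_tuple[OF np XX typs eqs]; assumption)+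
  show "do_sum (TDn n) \<in> Homs C (Prod P ?X ?X) ?X" using ss by simp
  show "pr C n i A \<cdot> do_sum (TDn n) = do_sum TD \<cdot> prodmap C P (pr C n i A) (pr C n i A)" if "i < n" for i
    by (rule ss(4)[OF that])
  have typh: "do_hat TD \<cdot> TA C (pr C n i A) \<in> Arr C \<and> Dom C (do_hat TD \<cdot> TA C (pr C n i A)) = TO C ?X \<and>
    Cod C (do_hat TD \<cdot> TA C (pr C n i A)) = Dom C (pT C A)" if "i < n" for i
    using that X by simp
  have eqh: "pT C A \<cdot> (do_hat TD \<cdot> TA C (pr C n i A)) = pT C A \<cdot> (do_hat TD \<cdot> TA C (pr C n j A))"
    if "i < n" "j < n" for i j
  proof -
    have *: "pT C A \<cdot> (do_hat TD \<cdot> TA C (pr C n i A)) = ph \<cdot> (TA C (pT C A) \<cdot> TA C (pr C n i A))" if "i < n" for i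
      using that by (simp add: p_nat_x tangent_laws)
    show ?thesis unfolding *[OF that(1)] *[OF that(2)] npullbackD(6)[OF npullback_T1[OF dobj_typ(1) n] that] ..
  qed
  have TX: "TO C ?X \<in> Obj C" using X by simp
  have hh: "do_hat (TDn n) \<in> Arr C" "Dom C (do_hat (TDn n)) = TO C ?X" "Cod C (do_hat (TDn n)) = ?X"
    "i < n \<Longrightarrow> pr C n i A \<cdot> do_hat (TDn n) = do_hat TD \<cdot> TA C (pr C n i A)" for i
    unfolding h by (rule npullback_tuple[OF np TX typh eqh]; assumption)+
  show "do_hat (TDn n) \<in> Homs C (TO C ?X) ?X" using hh by simp
  show "pr C n i A \<cdot> do_hat (TDn n) = do_hat TD \<cdot> TA C (pr C n i A)" if "i < n" for i
    by (rule hh(4)[OF that])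
qed

text \<open>The mediating arrow is a tuple of mediating arrows for \<open>T A\<close>, formed in \<open>T (T\<^sub>n A)\<close> because \<open>T\<close>
  preserves tangent pullbacks. By the product property of \<open>T A\<close>, its entries agree under \<open>T p\<close>.\<close>

lemma do_Tn_product:
  assumes n: "1 \<le> n"
  shows "is_product C (Tn C n A) (Tn C n A) (TO C (Tn C n A)) (pT C (Tn C n A)) (do_hat (TDn n))"
  unfolding is_product_def
proof (intro conjI allI ballI)
  note d = do_Tn_simps[OF n]
  show "TO C (Tn C n A) \<in> Obj C" "pT C (Tn C n A) \<in> Homs C (TO C (Tn C n A)) (Tn C n A)"
    "do_hat (TDn n) \<in> Homs C (TO C (Tn C n A)) (Tn C n A)" using n d by simp_all
  have hat: "pr C n i A \<cdot> (do_hat (TDn n) \<cdot> x) = TA C ph \<cdot> (cT C A \<cdot> (TA C (pr C n i A) \<cdot> x))"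
    if "i < n" "x \<in> Arr C" "Cod C x = TO C (Tn C n A)" for i x
    using reassoc[OF d(6)[OF that(1)], of x] d(3) that by simp
  fix X f g assume f: "f \<in> Homs C X (Tn C n A)" and g: "g \<in> Homs C X (Tn C n A)"
  define u where "u i = med2 C X (TO C (TO C A)) (pT C (TO C A)) (TA C ph \<cdot> cT C A) (pr C n i A \<cdot> f) (pr C n i A \<cdot> g)" for i
  have u: "u i \<in> Arr C" "Dom C (u i) = X" "Cod C (u i) = TO C (TO C A)" "pT C (TO C A) \<cdot> u i = pr C n i A \<cdot> f"
    "TA C ph \<cdot> (cT C A \<cdot> u i) = pr C n i A \<cdot> g" if "i < n" for i
    using product_med2[OF do_T_product, of "pr C n i A \<cdot> f" X "pr C n i A \<cdot> g"] f g that
    by (simp_all add: u_def)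
  have pu: "TA C (pT C A) \<cdot> u i = TA C (pT C A) \<cdot> u j" if i: "i < n" and j: "j < n" for i j
  proof (rule hat_eqI)
    have e: "pT C A \<cdot> (TA C (pT C A) \<cdot> u i) = (pT C A \<cdot> pr C n i A) \<cdot> f"
      "ph \<cdot> (TA C (pT C A) \<cdot> u i) = (pT C A \<cdot> pr C n i A) \<cdot> g" if "i < n" for i
    proof -
      show "pT C A \<cdot> (TA C (pT C A) \<cdot> u i) = (pT C A \<cdot> pr C n i A) \<cdot> f"
        using u[OF that] f that by (simp add: p_nat_x)
      have "ph \<cdot> (TA C (pT C A) \<cdot> u i) = pT C A \<cdot> (TA C ph \<cdot> (cT C A \<cdot> u i))"
        using u(1-3)[OF that] f that by (simp add: p_nat_x tangent_laws)
      then show "ph \<cdot> (TA C (pT C A) \<cdot> u i) = (pT C A \<cdot> pr C n i A) \<cdot> g"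
        using u[OF that] g that by simp
    qed
    show "pT C A \<cdot> (TA C (pT C A) \<cdot> u i) = pT C A \<cdot> (TA C (pT C A) \<cdot> u j)"
      "ph \<cdot> (TA C (pT C A) \<cdot> u i) = ph \<cdot> (TA C (pT C A) \<cdot> u j)"
      unfolding e[OF i] e[OF j] p_pr[OF dobj_typ(1) i j] by (rule refl)+
  qed (use u i j in simp_all)
  have "\<exists>!w. w \<in> Homs C X (TO C (Tn C n A)) \<and> (\<forall>i<n. TA C (pr C n i A) \<cdot> w = u i)"
  proof (rule npullbackD(7)[OF npullback_T1[OF dobj_typ(1) n]])
    show "X \<in> Obj C" using f by auto
    show "u i \<in> Homs C X (Dom C (TA C (pT C A)))" if "i < n" for i using u[OF that] by simp
  qed (rule pu)
  then obtain w where w: "w \<in> Arr C" "Dom C w = X" "Cod C w = TO C (Tn C n A)"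
    "\<And>i. i < n \<Longrightarrow> TA C (pr C n i A) \<cdot> w = u i" by auto
  show "\<exists>!h. h \<in> Homs C X (TO C (Tn C n A)) \<and> pT C (Tn C n A) \<cdot> h = f \<and> do_hat (TDn n) \<cdot> h = g"
  proof (rule ex1I[of _ w])
    have "pT C (Tn C n A) \<cdot> w = f"
    proof (rule Tn_eqI[where n = n and A = A])
      show "pr C n i A \<cdot> (pT C (Tn C n A) \<cdot> w) = pr C n i A \<cdot> f" if "i < n" for i
        using p_nat_x[of "pr C n i A" "TO C A" w] w u[OF that] that n by simp
    qed (use w f n in simp_all)
    moreover have "do_hat (TDn n) \<cdot> w = g"
    proof (rule Tn_eqI[where n = n and A = A])
      show "pr C n i A \<cdot> (do_hat (TDn n) \<cdot> w) = pr C n i A \<cdot> g" if "i < n" for i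
        using w u[OF that] that n by (simp add: hat)
    qed (use w g n d in simp_all)
    ultimately show "w \<in> Homs C X (TO C (Tn C n A)) \<and> pT C (Tn C n A) \<cdot> w = f \<and> do_hat (TDn n) \<cdot> w = g"
      using w by simp
    fix h assume h: "h \<in> Homs C X (TO C (Tn C n A)) \<and> pT C (Tn C n A) \<cdot> h = f \<and> do_hat (TDn n) \<cdot> h = g"
    show "h = w"
    proof (rule TTn_eqI[where n = n and A = A])
      fix i assume i: "i < n"
      show "TA C (pr C n i A) \<cdot> h = TA C (pr C n i A) \<cdot> w" unfolding w(4)[OF i]
        by (rule product_eqI[OF do_T_product])
          (use h i u[OF i] hat[OF i, of h] p_nat_x[of "pr C n i A" "TO C A" h] n in auto)
    qed (use w h n in simp_all)
  qed
qed

lemma do_Tn_dobj: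
  assumes n: "1 \<le> n"
  shows "differential_object C P (TDn n)"
  by (rule dobj_by_projections[where K = "{..<n}" and G = "\<lambda>_. TD" and \<pi> = "\<lambda>i. pr C n i A" and R = "\<lambda>_ _. True"])
    (use do_Tn_simps[OF n] do_Tn_product[OF n] do_T_dobj n in \<open>auto intro: Tn_eqI[where n = n and A = A] simp del: do_T_sel(2-4)\<close>)

end

section \<open>Products detected by evaluations\<close>

definition preserves_products ::
  "('o1, 'm1, 'x) tcat_scheme \<Rightarrow> ('o1, 'm1) products \<Rightarrow> ('o2, 'm2) products \<Rightarrow> ('o1, 'm1, 'o2, 'm2) ftr \<Rightarrow> bool" where
  "preserves_products C P Q F \<longleftrightarrow> FO F (One P) = One Q \<and>
     (\<forall>A\<in>Obj C. \<forall>B\<in>Obj C. FO F (Prod P A B) = Prod Q (FO F A) (FO F B) \<and>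
        FA F (Fst P A B) = Fst Q (FO F A) (FO F B) \<and> FA F (Snd P A B) = Snd Q (FO F A) (FO F B))"

text \<open>As \<open>T 1\<close> is terminal, \<open>z\<close> and \<open>p\<close> at \<open>1\<close> are mutually inverse, and so are their images under \<open>T\<close>.\<close>

lemma (in cartesian_tangent) TTOne_terminal: "is_terminal C (TO C (TO C (One P)))"
  unfolding is_terminal_def
proof (intro conjI ballI)
  fix X assume X: "X \<in> Obj C"
  show "\<exists>!u. u \<in> Homs C X (TO C (TO C (One P)))"
  proof (rule ex1I[of _ "zT C (TO C (One P)) \<cdot> (zT C (One P) \<cdot> bang C P X)"])
    fix u assume u: "u \<in> Homs C X (TO C (TO C (One P)))"
    have i: "zT C (One P) \<cdot> pT C (One P) = Id C (TO C (One P))" by (rule TOne_eqI) simp_all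
    have "TA C (zT C (One P)) \<cdot> TA C (pT C (One P)) = Id C (TO C (TO C (One P)))"
      using arg_cong[OF i, of "TA C"] by simp
    from reassoc[OF this, of u] u have "TA C (zT C (One P)) \<cdot> (TA C (pT C (One P)) \<cdot> u) = u" by simp
    moreover have "TA C (pT C (One P)) \<cdot> u = zT C (One P) \<cdot> bang C P X"
      by (rule TOne_eqI) (use u X in simp_all)
    ultimately show "u = zT C (TO C (One P)) \<cdot> (zT C (One P) \<cdot> bang C P X)"
      using X z_nat_x[of "zT C (One P)" "TO C (One P)" "bang C P X"] by simp
  qed (use X in simp)
qed simp

lemma (in tangent_evaluations) cartesian_of_evaluations:
  assumes D: "cartesian_tangent_category D PD" and E: "cartesian_tangent_category E PE"
    and One: "One P \<in> Obj C"
    and Prod: "\<And>A B. \<lbrakk>A \<in> Obj C; B \<in> Obj C\<rbrakk> \<Longrightarrow> Fst P A B \<in> Homs C (Prod P A B) A \<and> Snd P A B \<in> Homs C (Prod P A B) B"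
    and pI: "\<And>F. F \<in> I \<Longrightarrow> preserves_products C P PD F" and pJ: "\<And>G. G \<in> J \<Longrightarrow> preserves_products C P PE G"
  shows "cartesian_tangent_category C P"
proof -
  interpret D: cartesian_tangent D PD using D by (unfold_locales)
  interpret E: cartesian_tangent E PE using E by (unfold_locales)
  have tI: "FO F (One P) = One PD" and prI: "\<And>A B. \<lbrakk>A \<in> Obj C; B \<in> Obj C\<rbrakk> \<Longrightarrow> FO F (Prod P A B) = Prod PD (FO F A) (FO F B) \<and>
        FA F (Fst P A B) = Fst PD (FO F A) (FO F B) \<and> FA F (Snd P A B) = Snd PD (FO F A) (FO F B)" if "F \<in> I" for F
    using pI[OF that] by (simp_all add: preserves_products_def)
  have tJ: "FO F (One P) = One PE" and prJ: "\<And>A B. \<lbrakk>A \<in> Obj C; B \<in> Obj C\<rbrakk> \<Longrightarrow> FO F (Prod P A B) = Prod PE (FO F A) (FO F B) \<and>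
        FA F (Fst P A B) = Fst PE (FO F A) (FO F B) \<and> FA F (Snd P A B) = Snd PE (FO F A) (FO F B)" if "F \<in> J" for F
    using pJ[OF that] by (simp_all add: preserves_products_def)
  show ?thesis
    unfolding cartesian_tangent_category_def
  proof (intro conjI ballI)
    show "tangent_category C" by (rule tangent_category_of_evaluations)
    show "is_terminal C (One P)"
      by (rule terminal_of_evaluations[OF One]) (simp_all add: tI tJ D.terminal E.terminal)
    show "is_terminal C (TO C (One P))"
      by (rule terminal_of_evaluations)
        (simp_all add: One tI tJ D.terminal E.terminal D.TTOne_terminal E.TTOne_terminal)
    fix A B assume A: "A \<in> Obj C" and B: "B \<in> Obj C"
    note [simp] = Prod[OF A B, unfolded in_Homs_iff, THEN conjunct1, THEN conjunct1]
      Prod[OF A B, unfolded in_Homs_iff, THEN conjunct1, THEN conjunct2, THEN conjunct1]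
      Prod[OF A B, unfolded in_Homs_iff, THEN conjunct1, THEN conjunct2, THEN conjunct2]
      Prod[OF A B, unfolded in_Homs_iff, THEN conjunct2, THEN conjunct1]
      Prod[OF A B, unfolded in_Homs_iff, THEN conjunct2, THEN conjunct2, THEN conjunct1]
      Prod[OF A B, unfolded in_Homs_iff, THEN conjunct2, THEN conjunct2, THEN conjunct2]
    have [simp]: "Prod P A B \<in> Obj C" using Dom_in[of "Fst P A B"] by simp
    have qI: "is_product D (FO F A) (FO F B) (FO F (Prod P A B)) (FA F (Fst P A B)) (FA F (Snd P A B))" if "F \<in> I" for F
      using prI[OF that A B] D.products(1)[of "FO F A" "FO F B"] A B that by simp
    have qJ: "is_product E (FO F A) (FO F B) (FO F (Prod P A B)) (FA F (Fst P A B)) (FA F (Snd P A B))" if "F \<in> J" for F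
      using prJ[OF that A B] E.products(1)[of "FO F A" "FO F B"] A B that by simp
    show "is_product C A B (Prod P A B) (Fst P A B) (Snd P A B)"
      by (rule product_of_evaluations) (simp_all add: qI qJ D.T_products E.T_products)
    show "is_product C (TO C A) (TO C B) (TO C (Prod P A B)) (TA C (Fst P A B)) (TA C (Snd P A B))"
      by (rule product_of_evaluations) (simp_all add: A B qI qJ D.T_products E.T_products)
  qed
qed

section \<open>Differential objects and linear maps\<close>

lemma tagged_eqI: "\<lbrakk>Src t = Src u; Tgt t = Tgt u; Und t = Und u\<rbrakk> \<Longrightarrow> t = (u :: ('x, 'm) tagged)"
  by (cases t; cases u) simp

lemma dobj_eqI:
  "\<lbrakk>do_carrier D = do_carrier E; do_zero D = do_zero E; do_sum D = do_sum E; do_hat D = do_hat E\<rbrakk>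
    \<Longrightarrow> D = (E :: ('o, 'm) dobj)"
  by (cases D; cases E) simp

context cartesian_tangent
begin

lemma linear_simps [simp]:
  assumes "linear_map C P t"
  shows "differential_object C P (Src t)" "differential_object C P (Tgt t)" "Und t \<in> Arr C"
    "Dom C (Und t) = do_carrier (Src t)" "Cod C (Und t) = do_carrier (Tgt t)"
  using assms by (auto simp: linear_map_def)

lemma linear_hat:
  "linear_map C P t \<Longrightarrow> Und t \<cdot> do_hat (Src t) = do_hat (Tgt t) \<cdot> TA C (Und t)"
  unfolding linear_map_def by blast

lemma linear_mapI:
  "\<lbrakk>differential_object C P D; differential_object C P E; f \<in> Arr C; Dom C f = do_carrier D; Cod C f = do_carrier E;
    f \<cdot> do_hat D = do_hat E \<cdot> TA C f\<rbrakk> \<Longrightarrow> linear_map C P (tag D E f)"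
  by (simp add: linear_map_def)

lemma dobj_simps [simp]:
  assumes "differential_object C P D"
  shows "do_carrier D \<in> Obj C" "do_zero D \<in> Arr C" "Dom C (do_zero D) = One P" "Cod C (do_zero D) = do_carrier D"
    "do_sum D \<in> Arr C" "Dom C (do_sum D) = Prod P (do_carrier D) (do_carrier D)" "Cod C (do_sum D) = do_carrier D"
    "do_hat D \<in> Arr C" "Dom C (do_hat D) = TO C (do_carrier D)" "Cod C (do_hat D) = do_carrier D"
    "differential_object C P (do_T C P D)" "1 \<le> n \<Longrightarrow> differential_object C P (do_Tn C P n D)"
    "do_carrier (do_T C P D) = TO C (do_carrier D)" "do_carrier (do_Tn C P n D) = Tn C n (do_carrier D)"
    "do_hat (do_T C P D) = TA C (do_hat D) \<cdot> cT C (do_carrier D)"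
    "i < n \<Longrightarrow> pr C n i (do_carrier D) \<cdot> do_hat (do_Tn C P n D) =
      do_hat (do_T C P D) \<cdot> TA C (pr C n i (do_carrier D))"
proof -
  interpret dobj C P D by (rule dobj_axiom[OF assms])
  show "do_carrier D \<in> Obj C" "do_zero D \<in> Arr C" "Dom C (do_zero D) = One P" "Cod C (do_zero D) = do_carrier D"
    "do_sum D \<in> Arr C" "Dom C (do_sum D) = Prod P (do_carrier D) (do_carrier D)" "Cod C (do_sum D) = do_carrier D"
    "do_hat D \<in> Arr C" "Dom C (do_hat D) = TO C (do_carrier D)" "Cod C (do_hat D) = do_carrier D"
    "differential_object C P (do_T C P D)" "1 \<le> n \<Longrightarrow> differential_object C P (do_Tn C P n D)"
    "do_carrier (do_T C P D) = TO C (do_carrier D)" "do_carrier (do_Tn C P n D) = Tn C n (do_carrier D)"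
    "do_hat (do_T C P D) = TA C (do_hat D) \<cdot> cT C (do_carrier D)"
    by (simp_all add: do_T_dobj do_Tn_dobj)
  show "i < n \<Longrightarrow> pr C n i (do_carrier D) \<cdot> do_hat (do_Tn C P n D) =
      do_hat (do_T C P D) \<cdot> TA C (pr C n i (do_carrier D))"
    using do_Tn_simps(6)[of n i] less_imp_one_le[of i n] by simp
qed

text \<open>The zero is determined by the projection: \<open>ph \<circ> z = \<zeta> \<circ> !\<close>, and \<open>z\<close> is natural.\<close>

lemma linear_zero:
  assumes "linear_map C P t"
  shows "Und t \<cdot> do_zero (Src t) = do_zero (Tgt t)"
proof -
  interpret D: dobj C P "Src t" by (rule dobj_axiom) (simp add: assms)
  interpret E: dobj C P "Tgt t" by (rule dobj_axiom) (simp add: assms)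
  have "Und t \<cdot> (do_zero (Src t) \<cdot> bang C P D.A) = do_zero (Tgt t) \<cdot> bang C P D.A"
    using reassoc[OF linear_hat[OF assms], of "zT C D.A"] assms z_nat_simp[of "Und t" E.A] E.hat_z_x[of "Und t"]
    by (simp add: D.dobj_raw)
  then have "(Und t \<cdot> (do_zero (Src t) \<cdot> bang C P D.A)) \<cdot> do_zero (Src t) = (do_zero (Tgt t) \<cdot> bang C P D.A) \<cdot> do_zero (Src t)"
    by simp
  moreover have "bang C P (One P) = Id C (One P)" by (rule One_eqI) simp_all
  ultimately show ?thesis using assms by simp
qed

text \<open>The sum is determined by the projection as well: the product diagram turns \<open>x\<close> and \<open>y\<close> into tangent
  vectors at the point \<open>\<zeta>\<close>, and \<open>ph\<close> sends the sum of these vectors to \<open>\<sigma> \<circ> (x, y)\<close>. The addition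
  of tangent vectors is natural.\<close>

lemma linear_sum:
  assumes "linear_map C P t"
  shows "Und t \<cdot> do_sum (Src t) = do_sum (Tgt t) \<cdot> prodmap C P (Und t) (Und t)"
proof -
  interpret D: dobj C P "Src t" by (rule dobj_axiom) (simp add: assms)
  interpret E: dobj C P "Tgt t" by (rule dobj_axiom) (simp add: assms)
  let ?A = D.A and ?AA = "Prod P D.A D.A" and ?f = "Und t"
  \<comment> \<open>The tangent vector at \<open>\<zeta>\<close> whose projection is \<open>x\<close>.\<close>
  define e where "e x = med2 C ?AA (TO C ?A) (pT C ?A) D.ph (D.\<zeta> \<cdot> bang C P ?AA) x" for x
  have e: "e x \<in> Arr C" "Dom C (e x) = ?AA" "Cod C (e x) = TO C ?A" "pT C ?A \<cdot> e x = D.\<zeta> \<cdot> bang C P ?AA" "D.ph \<cdot> e x = x"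
    if "x \<in> Arr C" "Dom C x = ?AA" "Cod C x = ?A" for x
    using product_med2[OF D.hat_product, of "D.\<zeta> \<cdot> bang C P ?AA" ?AA x] that by (simp_all add: e_def)
  let ?e0 = "e (Fst P ?A ?A)" and ?e1 = "e (Snd P ?A ?A)"
  let ?r = "T2pair C ?AA ?A ?e0 ?e1"
  have r: "?r \<in> Arr C" "Dom C ?r = ?AA" "Cod C ?r = Tn C 2 ?A" "pr C 2 0 ?A \<cdot> ?r = ?e0" "pr C 2 1 ?A \<cdot> ?r = ?e1"
    using e by simp_all
  have f: "?f \<in> Arr C" "Dom C ?f = ?A" "Cod C ?f = E.A" using assms by simp_all
  have hx: "E.ph \<cdot> (TA C ?f \<cdot> x) = ?f \<cdot> (D.ph \<cdot> x)" if "x \<in> Arr C" "Cod C x = TO C ?A" for x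
    using reassoc[OF linear_hat[OF assms], of x] f that by simp
  have "?f \<cdot> (D.ph \<cdot> (sT C ?A \<cdot> ?r)) = ?f \<cdot> D.\<sigma>"
    using r e by (simp add: D.hat_s_x)
  moreover have "?f \<cdot> (D.ph \<cdot> (sT C ?A \<cdot> ?r)) = E.ph \<cdot> (sT C E.A \<cdot> (FA (TnF C 2) ?f \<cdot> ?r))"
    using f r(1-3) reassoc[OF s_nat_simp[of ?f E.A], of ?r] by (simp add: hx)
  moreover have "E.ph \<cdot> (sT C E.A \<cdot> (FA (TnF C 2) ?f \<cdot> ?r)) = E.\<sigma> \<cdot> pair C P (?f \<cdot> Fst P ?A ?A) (?f \<cdot> Snd P ?A ?A)"
    using f r e by (simp add: E.hat_s_x hx)
  ultimately show ?thesis using f by (simp add: prodmap_def)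
qed

lemma do_One_sel [simp]: "do_carrier (do_One C P) = One P" "do_zero (do_One C P) = Id C (One P)"
  "do_sum (do_One C P) = bang C P (Prod P (One P) (One P))" "do_hat (do_One C P) = bang C P (TO C (One P))"
  by (simp_all add: do_One_def)

text \<open>The empty family of arrows out of a terminal object is jointly monic.\<close>

lemma do_One_dobj [simp]: "differential_object C P (do_One C P)"
proof (rule dobj_by_projections[where K = "{} :: nat set" and R = "\<lambda>_ _. True"])
  show "is_product C (do_carrier (do_One C P)) (do_carrier (do_One C P)) (TO C (do_carrier (do_One C P)))
    (pT C (do_carrier (do_One C P))) (do_hat (do_One C P))"
    unfolding is_product_def
  proof (intro conjI allI ballI)
    fix X f g assume f: "f \<in> Homs C X (do_carrier (do_One C P))" and g: "g \<in> Homs C X (do_carrier (do_One C P))"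
    show "\<exists>!u. u \<in> Homs C X (TO C (do_carrier (do_One C P))) \<and> pT C (do_carrier (do_One C P)) \<cdot> u = f \<and>
        do_hat (do_One C P) \<cdot> u = g"
      by (rule ex1I[of _ "zT C (One P) \<cdot> bang C P X"]) (use f g in \<open>auto intro: One_eqI TOne_eqI\<close>)
  qed simp_all
qed (auto intro: One_eqI)

lemma do_Prod_sel [simp]:
  "do_carrier (do_Prod C P D E) = Prod P (do_carrier D) (do_carrier E)"
  by (simp add: do_Prod_def Let_def)

lemma do_Prod_simps:
  assumes "differential_object C P D" "differential_object C P E"
  defines "a \<equiv> Fst P (do_carrier D) (do_carrier E)" and "b \<equiv> Snd P (do_carrier D) (do_carrier E)"
  shows "do_zero (do_Prod C P D E) \<in> Homs C (One P) (Prod P (do_carrier D) (do_carrier E))"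
    "do_sum (do_Prod C P D E) \<in> Homs C (Prod P (Prod P (do_carrier D) (do_carrier E)) (Prod P (do_carrier D) (do_carrier E)))
      (Prod P (do_carrier D) (do_carrier E))"
    "do_hat (do_Prod C P D E) \<in> Homs C (TO C (Prod P (do_carrier D) (do_carrier E))) (Prod P (do_carrier D) (do_carrier E))"
    "a \<cdot> do_zero (do_Prod C P D E) = do_zero D" "b \<cdot> do_zero (do_Prod C P D E) = do_zero E"
    "a \<cdot> do_sum (do_Prod C P D E) = do_sum D \<cdot> prodmap C P a a" "b \<cdot> do_sum (do_Prod C P D E) = do_sum E \<cdot> prodmap C P b b"
    "a \<cdot> do_hat (do_Prod C P D E) = do_hat D \<cdot> TA C a" "b \<cdot> do_hat (do_Prod C P D E) = do_hat E \<cdot> TA C b"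
  using assms(1,2) unfolding a_def b_def by (simp_all add: do_Prod_def Let_def prodmap_def)

lemma do_Prod_dobj [simp]:
  assumes D: "differential_object C P D" and E: "differential_object C P E"
  shows "differential_object C P (do_Prod C P D E)"
proof -
  interpret D: dobj C P D by (rule dobj_axiom[OF D])
  interpret E: dobj C P E by (rule dobj_axiom[OF E])
  note s = do_Prod_simps[OF D E]
  let ?a = "Fst P D.A E.A" and ?b = "Snd P D.A E.A" and ?A = "Prod P D.A E.A"
  let ?h = "do_hat (do_Prod C P D E)"
  have hx: "?a \<cdot> (?h \<cdot> x) = D.ph \<cdot> (TA C ?a \<cdot> x)" "?b \<cdot> (?h \<cdot> x) = E.ph \<cdot> (TA C ?b \<cdot> x)"
    if "x \<in> Arr C" "Cod C x = TO C ?A" for x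
    using reassoc[OF s(8), of x] reassoc[OF s(9), of x] s(3) that by simp_all
  show ?thesis
  proof (rule dobj_by_projections[where K = "{0, 1::nat}" and G = "two D E" and \<pi> = "two ?a ?b" and R = "\<lambda>_ _. True"])
    show "u = v" if "u \<in> Arr C" "v \<in> Arr C" "Dom C u = Dom C v" "Cod C u = do_carrier (do_Prod C P D E)"
      "Cod C v = do_carrier (do_Prod C P D E)" "\<And>i. i \<in> {0, 1::nat} \<Longrightarrow> two ?a ?b i \<cdot> u = two ?a ?b i \<cdot> v" for u v
      by (rule Prod_eqI[where A = D.A and B = E.A]) (use that(1-5) that(6)[of 0] that(6)[of 1] in simp_all)
    show "is_product C (do_carrier (do_Prod C P D E)) (do_carrier (do_Prod C P D E)) (TO C (do_carrier (do_Prod C P D E)))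
      (pT C (do_carrier (do_Prod C P D E))) ?h"
      unfolding is_product_def
    proof (intro conjI allI ballI)
      fix X f g assume f: "f \<in> Homs C X (do_carrier (do_Prod C P D E))" and g: "g \<in> Homs C X (do_carrier (do_Prod C P D E))"
      let ?u = "med2 C X (TO C D.A) (pT C D.A) D.ph (?a \<cdot> f) (?a \<cdot> g)"
      let ?v = "med2 C X (TO C E.A) (pT C E.A) E.ph (?b \<cdot> f) (?b \<cdot> g)"
      have u: "?u \<in> Arr C" "Dom C ?u = X" "Cod C ?u = TO C D.A" "pT C D.A \<cdot> ?u = ?a \<cdot> f" "D.ph \<cdot> ?u = ?a \<cdot> g"
        using product_med2[OF D.hat_product, of "?a \<cdot> f" X "?a \<cdot> g"] f g by simp_all
      have v: "?v \<in> Arr C" "Dom C ?v = X" "Cod C ?v = TO C E.A" "pT C E.A \<cdot> ?v = ?b \<cdot> f" "E.ph \<cdot> ?v = ?b \<cdot> g"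
        using product_med2[OF E.hat_product, of "?b \<cdot> f" X "?b \<cdot> g"] f g by simp_all
      let ?w = "TPpair C P X D.A E.A ?u ?v"
      have px: "?a \<cdot> (pT C ?A \<cdot> x) = pT C D.A \<cdot> (TA C ?a \<cdot> x)" "?b \<cdot> (pT C ?A \<cdot> x) = pT C E.A \<cdot> (TA C ?b \<cdot> x)"
        if "x \<in> Arr C" "Cod C x = TO C ?A" for x
        using p_nat_x[of ?a D.A x] p_nat_x[of ?b E.A x] that by simp_all
      show "\<exists>!w. w \<in> Homs C X (TO C (do_carrier (do_Prod C P D E))) \<and> pT C (do_carrier (do_Prod C P D E)) \<cdot> w = f \<and> ?h \<cdot> w = g"
      proof (rule ex1I[of _ ?w])
        have "pT C ?A \<cdot> ?w = f" by (rule Prod_eqI[where A = D.A and B = E.A]) (use u v f in \<open>simp_all add: px\<close>)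
        moreover have "?h \<cdot> ?w = g" by (rule Prod_eqI[where A = D.A and B = E.A]) (use u v g s(3) in \<open>simp_all add: hx\<close>)
        ultimately show "?w \<in> Homs C X (TO C (do_carrier (do_Prod C P D E))) \<and> pT C (do_carrier (do_Prod C P D E)) \<cdot> ?w = f \<and> ?h \<cdot> ?w = g"
          using u v by simp
        fix w assume w: "w \<in> Homs C X (TO C (do_carrier (do_Prod C P D E))) \<and> pT C (do_carrier (do_Prod C P D E)) \<cdot> w = f \<and> ?h \<cdot> w = g"
        have "TA C ?a \<cdot> w = ?u" by (rule D.hat_eqI) (use w u px[of w] hx[of w] in auto)
        moreover have "TA C ?b \<cdot> w = ?v" by (rule E.hat_eqI) (use w v px[of w] hx[of w] in auto)
        ultimately show "w = ?w" by (intro TPpair_eqI[symmetric]) (use w in auto)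
      qed
    qed (use s in simp_all)
  qed (use s D E in \<open>auto split: if_splits\<close>)
qed

section \<open>The tangent category of differential objects\<close>

lemma structure_linear [simp]:
  assumes D: "differential_object C P D"
  shows "linear_map C P (tag D D (Id C (do_carrier D)))"
    "linear_map C P (tag (do_T C P D) D (pT C (do_carrier D)))"
    "linear_map C P (tag D (do_T C P D) (zT C (do_carrier D)))"
    "linear_map C P (tag (do_Tn C P 2 D) (do_T C P D) (sT C (do_carrier D)))"
    "linear_map C P (tag (do_T C P D) (do_T C P (do_T C P D)) (lT C (do_carrier D)))"
    "linear_map C P (tag (do_T C P (do_T C P D)) (do_T C P (do_T C P D)) (cT C (do_carrier D)))"
    "i < n \<Longrightarrow> linear_map C P (tag (do_Tn C P n D) (do_T C P D) (pr C n i (do_carrier D)))"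
proof -
  interpret dobj C P D by (rule dobj_axiom[OF D])
  show "linear_map C P (tag D D (Id C A))" by (rule linear_mapI) (simp_all add: D)
  show "linear_map C P (tag (do_T C P D) D (pT C A))"
    by (rule linear_mapI) (simp_all add: D p_nat_x tangent_laws)
  show "linear_map C P (tag D (do_T C P D) (zT C A))"
    by (rule linear_mapI) (simp_all add: D tangent_laws z_nat_simp)
  show "linear_map C P (tag (do_T C P D) (do_T C P (do_T C P D)) (lT C A))"
    by (rule linear_mapI) (simp_all add: D tangent_laws nat_laws)
  show "linear_map C P (tag (do_T C P (do_T C P D)) (do_T C P (do_T C P D)) (cT C A))"
    by (rule linear_mapI) (use c_braid[of A] in \<open>simp_all add: D nat_laws\<close>)
  show "linear_map C P (tag (do_Tn C P n D) (do_T C P D) (pr C n i A))" if "i < n"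
    by (rule linear_mapI) (use that less_imp_one_le[OF that] in \<open>simp_all add: D\<close>)
  let ?h = "do_hat (TDn 2)"
  have h: "?h \<in> Arr C" "Dom C ?h = TO C (Tn C 2 A)" "Cod C ?h = Tn C 2 A"
    "pr C 2 0 A \<cdot> ?h = TA C ph \<cdot> (cT C A \<cdot> TA C (pr C 2 0 A))" "pr C 2 1 A \<cdot> ?h = TA C ph \<cdot> (cT C A \<cdot> TA C (pr C 2 1 A))"
    using do_Tn_simps[of 2] by simp_all
  let ?\<kappa> = "T2pair C (TO C (Tn C 2 A)) (TO C A) (cT C A \<cdot> TA C (pr C 2 0 A)) (cT C A \<cdot> TA C (pr C 2 1 A))"
  have k: "?\<kappa> \<in> Arr C" "Dom C ?\<kappa> = TO C (Tn C 2 A)" "Cod C ?\<kappa> = Tn C 2 (TO C A)"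
    "pr C 2 0 (TO C A) \<cdot> ?\<kappa> = cT C A \<cdot> TA C (pr C 2 0 A)" "pr C 2 1 (TO C A) \<cdot> ?\<kappa> = cT C A \<cdot> TA C (pr C 2 1 A)"
    by (simp_all add: tangent_laws)
  have hk: "?h = FA (TnF C 2) ph \<cdot> ?\<kappa>"
    by (rule T2_eqI[where A = A]) (use h k in \<open>simp_all del: T2pair_simps\<close>)
  have "sT C A \<cdot> ?h = TA C ph \<cdot> (sT C (TO C A) \<cdot> ?\<kappa>)"
    unfolding hk using reassoc[OF s_nat_simp[of ph A], of ?\<kappa>] k(1-3) by simp
  also have "\<dots> = TA C ph \<cdot> (cT C A \<cdot> TA C (sT C A))" using c_s[of A] by simp
  finally show "linear_map C P (tag (TDn 2) TD (sT C A))"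
    by (intro linear_mapI) (simp_all add: D)
qed

lemma T_linear [simp]:
  assumes "linear_map C P t"
  shows "linear_map C P (tag (do_T C P (Src t)) (do_T C P (Tgt t)) (TA C (Und t)))"
proof (rule linear_mapI)
  have "TA C (Und t) \<cdot> TA C (do_hat (Src t)) = TA C (do_hat (Tgt t)) \<cdot> TA C (TA C (Und t))"
    using arg_cong[OF linear_hat[OF assms], of "TA C"] assms by simp
  then show "TA C (Und t) \<cdot> do_hat (do_T C P (Src t)) = do_hat (do_T C P (Tgt t)) \<cdot> TA C (TA C (Und t))"
    using assms reassoc[of "TA C (Und t)" "TA C (do_hat (Src t))" _ "cT C (do_carrier (Src t))"]
    by (simp add: c_nat_simp)
qed (use assms in simp_all)

lemma Comp_linear [simp]:
  assumes "linear_map C P t" "linear_map C P u" "Tgt u = Src t"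
  shows "linear_map C P (tag (Src u) (Tgt t) (Und t \<cdot> Und u))"
proof (rule linear_mapI)
  show "(Und t \<cdot> Und u) \<cdot> do_hat (Src u) = do_hat (Tgt t) \<cdot> TA C (Und t \<cdot> Und u)"
    using assms linear_hat[OF assms(1)] linear_hat[OF assms(2)]
      reassoc[OF linear_hat[OF assms(1)], of "TA C (Und u)"] by simp
qed (use assms in simp_all)

end

lemma DO_cat_sel [simp]:
  "D \<in> Obj (DO_cat C P) \<longleftrightarrow> differential_object C P D"
  "t \<in> Arr (DO_cat C P) \<longleftrightarrow> linear_map C P t"
  "Dom (DO_cat C P) = Src" "Cod (DO_cat C P) = Tgt"
  "Id (DO_cat C P) D = tag D D (Id C (do_carrier D))"
  "t \<cdot>\<^bsub>DO_cat C P\<^esub> u = tag (Src u) (Tgt t) (Und t \<cdot>\<^bsub>C\<^esub> Und u)"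
  "TO (DO_cat C P) D = do_T C P D"
  "TA (DO_cat C P) t = tag (do_T C P (Src t)) (do_T C P (Tgt t)) (TA C (Und t))"
  "pT (DO_cat C P) D = tag (do_T C P D) D (pT C (do_carrier D))"
  "zT (DO_cat C P) D = tag D (do_T C P D) (zT C (do_carrier D))"
  "sT (DO_cat C P) D = tag (do_Tn C P 2 D) (do_T C P D) (sT C (do_carrier D))"
  "lT (DO_cat C P) D = tag (do_T C P D) (do_T C P (do_T C P D)) (lT C (do_carrier D))"
  "cT (DO_cat C P) D = tag (do_T C P (do_T C P D)) (do_T C P (do_T C P D)) (cT C (do_carrier D))"
  "Tn (DO_cat C P) n D = do_Tn C P n D"
  "pr (DO_cat C P) n i D = tag (do_Tn C P n D) (do_T C P D) (pr C n i (do_carrier D))"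
  by (simp_all add: DO_cat_def)

lemma DO_prod_sel [simp]:
  "One (DO_prod C P) = do_One C P" "Prod (DO_prod C P) D E = do_Prod C P D E"
  "Fst (DO_prod C P) D E = tag (do_Prod C P D E) D (Fst P (do_carrier D) (do_carrier E))"
  "Snd (DO_prod C P) D E = tag (do_Prod C P D E) E (Snd P (do_carrier D) (do_carrier E))"
  by (simp_all add: DO_prod_def)

definition und :: "(('o, 'm) dobj, (('o, 'm) dobj, 'm) tagged, 'o, 'm) ftr" where
  "und = \<lparr>FO = do_carrier, FA = Und\<rparr>"

lemma und_sel [simp]: "FO und = do_carrier" "FA und = Und"
  by (simp_all add: und_def)

context cartesian_tangent
begin

lemma DO_category: "category (DO_cat C P)"
  by unfold_locales (auto intro: tagged_eqI)

lemma DO_structure: "tangent_structure (DO_cat C P)"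
proof -
  interpret DO: category "DO_cat C P" by (rule DO_category)
  show ?thesis by unfold_locales simp_all
qed

lemma und_preserving: "tangent_preserving (DO_cat C P) C und"
  unfolding tangent_preserving_def is_functor_def by simp

text \<open>The linearity equation is between arrows into the carrier of \<open>Q\<close>, so the linear legs reflect it.\<close>

lemma linear_lift:
  assumes "X \<in> Obj (DO_cat C P)" "Q \<in> Obj (DO_cat C P)"
    and \<pi>: "\<And>i. i \<in> K \<Longrightarrow> linear_map C P (\<pi> i) \<and> Src (\<pi> i) = Q"
    and g: "\<And>i. i \<in> K \<Longrightarrow> linear_map C P (g i) \<and> Src (g i) = X \<and> Tgt (g i) = Tgt (\<pi> i)"
    and m: "jointly_monic C (do_carrier Q) K (\<lambda>i. Und (\<pi> i))"
    and v: "v \<in> Homs C (do_carrier X) (do_carrier Q)" "\<And>i. i \<in> K \<Longrightarrow> Und (\<pi> i) \<cdot> v = Und (g i)"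
  shows "linear_map C P (tag X Q v)"
proof (rule linear_mapI)
  show "v \<cdot> do_hat X = do_hat Q \<cdot> TA C v"
  proof (rule jointly_monicD[OF m])
    fix i assume i: "i \<in> K"
    have T: "TA C (Und (\<pi> i)) \<cdot> TA C v = TA C (Und (g i))"
      using arg_cong[OF v(2)[OF i], of "TA C"] \<pi>[OF i] g[OF i] v(1) by simp
    show "Und (\<pi> i) \<cdot> (v \<cdot> do_hat X) = Und (\<pi> i) \<cdot> (do_hat Q \<cdot> TA C v)"
      using \<pi>[OF i] g[OF i] v(1) assms(1,2) reassoc[OF v(2)[OF i], of "do_hat X"] T
        reassoc[OF linear_hat, of "\<pi> i" "TA C v"] linear_hat[of "g i"] by simp
  qed (use assms(1,2) v in simp_all)
qed (use assms in simp_all)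

lemma DO_evaluations: "tangent_evaluations (DO_cat C P) C C {und} {}"
proof -
  interpret DO: tangent_structure "DO_cat C P" by (rule DO_structure)
  show ?thesis
  proof unfold_locales
    show "\<exists>u\<in>Homs (DO_cat C P) X Q. \<forall>i\<in>K. \<pi> i \<cdot>\<^bsub>DO_cat C P\<^esub> u = g i"
      if X: "X \<in> Obj (DO_cat C P)" and Q: "Q \<in> Obj (DO_cat C P)"
        and \<pi>: "\<And>i. i \<in> K \<Longrightarrow> \<pi> i \<in> Arr (DO_cat C P) \<and> Dom (DO_cat C P) (\<pi> i) = Q"
        and g: "\<And>i. i \<in> K \<Longrightarrow> g i \<in> Arr (DO_cat C P) \<and> Dom (DO_cat C P) (g i) = X \<and>
          Cod (DO_cat C P) (g i) = Cod (DO_cat C P) (\<pi> i)"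
        and F: "\<And>F. F \<in> {und} \<Longrightarrow> stably_monic C (FO F Q) K (\<lambda>i. FA F (\<pi> i)) \<and>
          (\<exists>v\<in>Homs C (FO F X) (FO F Q). \<forall>i\<in>K. FA F (\<pi> i) \<cdot> v = FA F (g i))"
      for X Q and K :: "nat set" and \<pi> g
    proof -
      obtain v where v: "v \<in> Homs C (do_carrier X) (do_carrier Q)" "\<And>i. i \<in> K \<Longrightarrow> Und (\<pi> i) \<cdot> v = Und (g i)"
        using F[of und] by auto
      have "linear_map C P (tag X Q v)"
        by (rule linear_lift[OF X Q _ _ _ v]) (use \<pi> g F[of und] in \<open>simp_all add: stably_monic_def\<close>)
      then show ?thesis
        by (intro bexI[of _ "tag X Q v"]) (use v g \<pi> in \<open>auto intro!: tagged_eqI\<close>)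
    qed
  qed (auto intro: tagged_eqI und_preserving)
qed

lemma DO_tangent_category: "tangent_category (DO_cat C P)"
  by (rule tangent_evaluations.tangent_category_of_evaluations[OF DO_evaluations])

lemma DO_cartesian: "cartesian_tangent_category (DO_cat C P) (DO_prod C P)"
  by (rule tangent_evaluations.cartesian_of_evaluations[OF DO_evaluations cartesian cartesian])
    (auto simp: preserves_products_def do_Prod_simps intro!: linear_mapI)

end

section \<open>Functors preserving tangent structure and products\<close>

locale cartesian_functor = C: cartesian_tangent C P + D: cartesian_tangent D Q
  for C :: "('o1, 'm1, 'x) tcat_scheme" and P and D :: "('o2, 'm2, 'y) tcat_scheme" and Q +
  fixes F
  assumes tan: "tangent_preserving C D F" and prods: "preserves_products C P Q F"
begin

lemmas F_simps [simp] = functor_simps[OF tangent_preserving_functor[OF tan]] tangent_preserving_simps[OF tan]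
lemmas F_pairing [simp] = tangent_preserving_T2pair[OF C.pre_tangent_category_axioms D.pre_tangent_category_axioms tan]

lemma F_prods [simp]:
  "FO F (One P) = One Q"
  "\<lbrakk>A \<in> Obj C; B \<in> Obj C\<rbrakk> \<Longrightarrow> FO F (Prod P A B) = Prod Q (FO F A) (FO F B)"
  "\<lbrakk>A \<in> Obj C; B \<in> Obj C\<rbrakk> \<Longrightarrow> FA F (Fst P A B) = Fst Q (FO F A) (FO F B)"
  "\<lbrakk>A \<in> Obj C; B \<in> Obj C\<rbrakk> \<Longrightarrow> FA F (Snd P A B) = Snd Q (FO F A) (FO F B)"
  using prods by (simp_all add: preserves_products_def)

lemma F_bang [simp]: "X \<in> Obj C \<Longrightarrow> FA F (bang C P X) = bang D Q (FO F X)"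
  by (rule D.One_eqI) simp_all

lemma F_pair [simp]:
  assumes "f \<in> Arr C" "g \<in> Arr C" "Dom C f = Dom C g"
  shows "FA F (pair C P f g) = pair D Q (FA F f) (FA F g)"
proof (rule D.Prod_eqI[where A = "FO F (Cod C f)" and B = "FO F (Cod C g)"])
  have 1: "FA F (Fst P (Cod C f) (Cod C g)) \<cdot>\<^bsub>D\<^esub> FA F (pair C P f g) = FA F f"
    using assms F_simps(6)[of "pair C P f g" "Fst P (Cod C f) (Cod C g)"] by (simp del: F_prods)
  have 2: "FA F (Snd P (Cod C f) (Cod C g)) \<cdot>\<^bsub>D\<^esub> FA F (pair C P f g) = FA F g"
    using assms F_simps(6)[of "pair C P f g" "Snd P (Cod C f) (Cod C g)"] by (simp del: F_prods)
  show "Fst Q (FO F (Cod C f)) (FO F (Cod C g)) \<cdot>\<^bsub>D\<^esub> FA F (pair C P f g) =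
    Fst Q (FO F (Cod C f)) (FO F (Cod C g)) \<cdot>\<^bsub>D\<^esub> pair D Q (FA F f) (FA F g)"
    using 1 assms by simp
  show "Snd Q (FO F (Cod C f)) (FO F (Cod C g)) \<cdot>\<^bsub>D\<^esub> FA F (pair C P f g) =
    Snd Q (FO F (Cod C f)) (FO F (Cod C g)) \<cdot>\<^bsub>D\<^esub> pair D Q (FA F f) (FA F g)"
    using 2 assms by simp
qed (use assms in simp_all)

lemma F_prodmap [simp]:
  "\<lbrakk>f \<in> Arr C; g \<in> Arr C\<rbrakk> \<Longrightarrow> FA F (prodmap C P f g) = prodmap D Q (FA F f) (FA F g)"
  by (simp add: prodmap_def)

lemma F_TPpair [simp]:
  assumes "f \<in> Arr C" "g \<in> Arr C" "Dom C f = X" "Dom C g = X" "Cod C f = TO C A" "Cod C g = TO C B"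
    "A \<in> Obj C" "B \<in> Obj C"
  shows "FA F (TPpair C P X A B f g) = TPpair D Q (FO F X) (FO F A) (FO F B) (FA F f) (FA F g)"
proof (rule D.TPpair_eqI[symmetric])
  have 1: "FA F (TA C (Fst P A B)) \<cdot>\<^bsub>D\<^esub> FA F (TPpair C P X A B f g) = FA F f"
    using assms F_simps(6)[of "TPpair C P X A B f g" "TA C (Fst P A B)"] by (simp del: F_prods F_simps(8))
  have 2: "FA F (TA C (Snd P A B)) \<cdot>\<^bsub>D\<^esub> FA F (TPpair C P X A B f g) = FA F g"
    using assms F_simps(6)[of "TPpair C P X A B f g" "TA C (Snd P A B)"] by (simp del: F_prods F_simps(8))
  show "TA D (Fst Q (FO F A) (FO F B)) \<cdot>\<^bsub>D\<^esub> FA F (TPpair C P X A B f g) = FA F f"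
    using 1 assms by simp
  show "TA D (Snd Q (FO F A) (FO F B)) \<cdot>\<^bsub>D\<^esub> FA F (TPpair C P X A B f g) = FA F g"
    using 2 assms by simp
qed (use assms in simp_all)

lemma do_map_sel [simp]:
  "do_carrier (do_map F X) = FO F (do_carrier X)" "do_zero (do_map F X) = FA F (do_zero X)"
  "do_sum (do_map F X) = FA F (do_sum X)" "do_hat (do_map F X) = FA F (do_hat X)"
  by (simp_all add: do_map_def)

lemma do_map_dobj [simp]:
  assumes X: "differential_object C P X"
  shows "differential_object D Q (do_map F X)"
proof -
  interpret X: dobj C P X by (rule C.dobj_axiom[OF X])
  show ?thesis
  proof (rule D.dobjI)
    have "is_product D (FO F X.A) (FO F X.A) (FO F (TO C X.A)) (FA F (pT C X.A)) (FA F X.ph)"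
      by (rule functor_preserves_products[OF C.category_axioms D.category_axioms
            tangent_preserving_functor[OF tan] C.products(1) _ X.hat_product])
        (simp_all add: D.products)
    then show "is_product D (do_carrier (do_map F X)) (do_carrier (do_map F X)) (TO D (do_carrier (do_map F X)))
      (pT D (do_carrier (do_map F X))) (do_hat (do_map F X))" by simp
  qed (use X.dobj_raw[THEN arg_cong, of "FA F"] in simp_all)
qed

lemma do_map_T [simp]:
  assumes X: "differential_object C P X"
  shows "do_map F (do_T C P X) = do_T D Q (do_map F X)"
proof -
  interpret X: dobj C P X by (rule C.dobj_axiom[OF X])
  interpret FX: dobj D Q "do_map F X" by (rule D.dobj_axiom) (simp add: X)
  show ?thesis by (rule dobj_eqI) simp_all
qed

lemma do_map_Tn [simp]:
  assumes X: "differential_object C P X" and n: "1 \<le> n"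
  shows "do_map F (do_Tn C P n X) = do_Tn D Q n (do_map F X)"
proof -
  interpret X: dobj C P X by (rule C.dobj_axiom[OF X])
  interpret FX: dobj D Q "do_map F X" by (rule D.dobj_axiom) (simp add: X)
  note s = X.do_Tn_simps[OF n] and t = FX.do_Tn_simps[OF n]
  have T: "FA F (do_zero X.TD) = do_zero FX.TD" "FA F (do_sum X.TD) = do_sum FX.TD" "FA F (do_hat X.TD) = do_hat FX.TD"
    using do_map_T[OF X] by (metis do_map_sel)+
  have e: "pr D n i (FO F X.A) \<cdot>\<^bsub>D\<^esub> FA F (do_zero (X.TDn n)) = do_zero FX.TD"
    "pr D n i (FO F X.A) \<cdot>\<^bsub>D\<^esub> FA F (do_sum (X.TDn n)) = do_sum FX.TD \<cdot>\<^bsub>D\<^esub> prodmap D Q (pr D n i (FO F X.A)) (pr D n i (FO F X.A))"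
    "pr D n i (FO F X.A) \<cdot>\<^bsub>D\<^esub> FA F (do_hat (X.TDn n)) = do_hat FX.TD \<cdot>\<^bsub>D\<^esub> TA D (pr D n i (FO F X.A))" if i: "i < n" for i
    using arg_cong[OF s(4)[OF i], of "FA F"] arg_cong[OF s(5)[OF i], of "FA F"] arg_cong[OF s(6)[OF i], of "FA F"]
      s(1-3) i n T C.dobj_simps[OF C.dobj_simps(11)[OF X]] by (simp_all del: X.do_T_sel(2-4) FX.do_T_sel(2-4) C.dobj_simps(15) C.prodmap_comp D.prodmap_comp)
  show ?thesis
  proof (rule dobj_eqI)
    show "do_zero (do_map F (X.TDn n)) = do_zero (FX.TDn n)"
      by (rule D.Tn_eqI[where n = n and A = "FO F X.A"]) (use s(1-3) t e n in \<open>simp_all del: FX.do_T_sel(2-4)\<close>)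
    show "do_sum (do_map F (X.TDn n)) = do_sum (FX.TDn n)"
      by (rule D.Tn_eqI[where n = n and A = "FO F X.A"]) (use s(1-3) t e n in \<open>simp_all del: FX.do_T_sel(2-4)\<close>)
    show "do_hat (do_map F (X.TDn n)) = do_hat (FX.TDn n)"
      by (rule D.Tn_eqI[where n = n and A = "FO F X.A"]) (use s(1-3) t e n in \<open>simp_all del: FX.do_T_sel(2-4)\<close>)
  qed (use n in simp)
qed

lemma do_map_linear [simp]:
  assumes t: "linear_map C P t"
  shows "linear_map D Q (tag (do_map F (Src t)) (do_map F (Tgt t)) (FA F (Und t)))"
  by (rule D.linear_mapI) (use t arg_cong[OF C.linear_hat[OF t], of "FA F"] in simp_all)

lemma do_map_One [simp]: "do_map F (do_One C P) = do_One D Q"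
  by (rule dobj_eqI) simp_all

lemma do_map_Prod [simp]:
  assumes X: "differential_object C P X" and Y: "differential_object C P Y"
  shows "do_map F (do_Prod C P X Y) = do_Prod D Q (do_map F X) (do_map F Y)"
  by (rule dobj_eqI) (use X Y in \<open>simp_all add: do_Prod_def Let_def prodmap_def\<close>)

definition do_ftr where
  "do_ftr = \<lparr>FO = do_map F, FA = (\<lambda>t. tag (do_map F (Src t)) (do_map F (Tgt t)) (FA F (Und t)))\<rparr>"

lemma do_ftr_sel [simp]: "FO do_ftr = do_map F"
  "FA do_ftr t = tag (do_map F (Src t)) (do_map F (Tgt t)) (FA F (Und t))"
  by (simp_all add: do_ftr_def)

lemma do_ftr_preserving: "tangent_preserving (DO_cat C P) (DO_cat D Q) do_ftr"
  unfolding tangent_preserving_def is_functor_def by simp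

lemma do_ftr_products: "preserves_products (DO_cat C P) (DO_prod C P) (DO_prod D Q) do_ftr"
  unfolding preserves_products_def by simp

end

section \<open>Products of lax morphisms\<close>

locale to_cartesian = C: tangent_category C + D: cartesian_tangent D Q
  for C :: "('o1, 'm1, 'x) tcat_scheme" and D :: "('o2, 'm2, 'y) tcat_scheme" and Q
begin

lemma lax_One_sel [simp]:
  "A \<in> Obj C \<Longrightarrow> FO (Fun (lax_One C D Q)) A = One Q" "f \<in> Arr C \<Longrightarrow> FA (Fun (lax_One C D Q)) f = Id D (One Q)"
  "A \<in> Obj C \<Longrightarrow> Str (lax_One C D Q) A = zT D (One Q)"
  by (simp_all add: lax_One_def ftr_restrict_def)

lemma lax_One_ok [simp]: "lax_ok C D (lax_One C D Q)"
proof -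
  have "lax_tangent_morphism C D (Fun (lax_One C D Q)) (Str (lax_One C D Q))"
  proof (rule lax_by_projections[where K = "{} :: nat set"])
    show "is_functor C D (Fun (lax_One C D Q))" by (simp add: is_functor_def)
    show "jointly_monic D (FO (Fun (lax_One C D Q)) A) ({} :: nat set) (\<lambda>i. undefined i A)" if "A \<in> Obj C" for A
      using D.terminal_monic[OF D.terminal(1)] that by simp
    show "jointly_monic D (TO D (FO (Fun (lax_One C D Q)) A)) ({} :: nat set) (\<lambda>i. TA D (undefined i A))" if "A \<in> Obj C" for A
      using D.terminal_monic[OF D.terminal(2)] that by simp
    show "jointly_monic D (TO D (TO D (FO (Fun (lax_One C D Q)) A))) ({} :: nat set) (\<lambda>i. TA D (TA D (undefined i A)))" if "A \<in> Obj C" for A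
      using D.terminal_monic[OF D.TTOne_terminal] that by simp
  qed (simp_all add: C.tangent_category_axioms D.tangent_category_axioms)
  then show ?thesis by (simp add: lax_ok_def) (simp add: lax_One_def ftr_restrict_def)
qed

lemma lax_Prod_sel [simp]:
  "A \<in> Obj C \<Longrightarrow> FO (Fun (lax_Prod C D Q M N)) A = Prod Q (FO (Fun M) A) (FO (Fun N) A)"
  "f \<in> Arr C \<Longrightarrow> FA (Fun (lax_Prod C D Q M N)) f = prodmap D Q (FA (Fun M) f) (FA (Fun N) f)"
  by (simp_all add: lax_Prod_def ftr_restrict_def)

lemma lax_Prod_Str:
  assumes M: "lax_ok C D M" and N: "lax_ok C D N" and A: "A \<in> Obj C"
  defines "X \<equiv> FO (Fun M) (TO C A)" and "Y \<equiv> FO (Fun N) (TO C A)" and "S \<equiv> Str (lax_Prod C D Q M N) A"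
  shows "S \<in> Arr D" "Dom D S = Prod Q X Y" "Cod D S = TO D (Prod Q (FO (Fun M) A) (FO (Fun N) A))"
    "TA D (Fst Q (FO (Fun M) A) (FO (Fun N) A)) \<cdot>\<^bsub>D\<^esub> S = Str M A \<cdot>\<^bsub>D\<^esub> Fst Q X Y"
    "TA D (Snd Q (FO (Fun M) A) (FO (Fun N) A)) \<cdot>\<^bsub>D\<^esub> S = Str N A \<cdot>\<^bsub>D\<^esub> Snd Q X Y"
proof -
  interpret M: lax_object C D M by (rule lax_objectI[OF M])
  interpret N: lax_object C D N by (rule lax_objectI[OF N])
  show "S \<in> Arr D" "Dom D S = Prod Q X Y" "Cod D S = TO D (Prod Q (FO (Fun M) A) (FO (Fun N) A))"
    "TA D (Fst Q (FO (Fun M) A) (FO (Fun N) A)) \<cdot>\<^bsub>D\<^esub> S = Str M A \<cdot>\<^bsub>D\<^esub> Fst Q X Y"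
    "TA D (Snd Q (FO (Fun M) A) (FO (Fun N) A)) \<cdot>\<^bsub>D\<^esub> S = Str N A \<cdot>\<^bsub>D\<^esub> Snd Q X Y"
    unfolding S_def X_def Y_def using A by (simp_all add: lax_Prod_def Let_def)
qed

lemma lax_Prod_ok [simp]:
  assumes M: "lax_ok C D M" and N: "lax_ok C D N"
  shows "lax_ok C D (lax_Prod C D Q M N)"
proof -
  interpret M: lax_object C D M by (rule lax_objectI[OF M])
  interpret N: lax_object C D N by (rule lax_objectI[OF N])
  let ?L = "lax_Prod C D Q M N"
  have "lax_tangent_morphism C D (Fun ?L) (Str ?L)"
  proof (rule lax_by_projections[where K = "{0, 1::nat}" and G = "\<lambda>i. Fun (two M N i)" and \<beta> = "\<lambda>i. Str (two M N i)"
        and \<pi> = "\<lambda>i A. two (Fst Q (M.mO A) (N.mO A)) (Snd Q (M.mO A) (N.mO A)) i"])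
    show "is_functor C D (Fun ?L)"
      unfolding is_functor_def by (simp add: prodmap_def)
    fix A assume A: "A \<in> Obj C"
    have e: "(\<lambda>i. TA D (two a b i)) = two (TA D a) (TA D b)" for a b by auto
    have e2: "(\<lambda>i. TA D (TA D (two a b i))) = two (TA D (TA D a)) (TA D (TA D b))" for a b by auto
    note p = D.products(1)[of "M.mO A" "N.mO A"]
    show "jointly_monic D (FO (Fun ?L) A) {0, 1} (\<lambda>i. two (Fst Q (M.mO A) (N.mO A)) (Snd Q (M.mO A) (N.mO A)) i)"
      using D.product_monic2[OF p] A by simp
    show "jointly_monic D (TO D (FO (Fun ?L) A)) {0, 1} (\<lambda>i. TA D (two (Fst Q (M.mO A) (N.mO A)) (Snd Q (M.mO A) (N.mO A)) i))"
      unfolding e using D.product_monic2[OF D.T_products[OF p]] A by simp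
    show "jointly_monic D (TO D (TO D (FO (Fun ?L) A))) {0, 1}
      (\<lambda>i. TA D (TA D (two (Fst Q (M.mO A) (N.mO A)) (Snd Q (M.mO A) (N.mO A)) i)))"
      unfolding e2 using D.product_monic2[OF D.T_products[OF D.T_products[OF p]]] A by simp
  qed (use lax_Prod_Str[OF M N] lax_okD[OF M] lax_okD[OF N] in
      \<open>auto simp: C.tangent_category_axioms D.tangent_category_axioms split: if_splits\<close>)
  then show ?thesis by (simp add: lax_ok_def) (simp add: lax_Prod_def ftr_restrict_def)
qed

lemma lax_Prod_projections:
  assumes M: "lax_ok C D M" and N: "lax_ok C D N"
  shows "tangent_nat C D (lax_Prod C D Q M N) M (\<lambda>A. Fst Q (FO (Fun M) A) (FO (Fun N) A))"
    "tangent_nat C D (lax_Prod C D Q M N) N (\<lambda>A. Snd Q (FO (Fun M) A) (FO (Fun N) A))"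
proof -
  interpret M: lax_object C D M by (rule lax_objectI[OF M])
  interpret N: lax_object C D N by (rule lax_objectI[OF N])
  show "tangent_nat C D (lax_Prod C D Q M N) M (\<lambda>A. Fst Q (FO (Fun M) A) (FO (Fun N) A))"
    "tangent_nat C D (lax_Prod C D Q M N) N (\<lambda>A. Snd Q (FO (Fun M) A) (FO (Fun N) A))"
    using lax_Prod_Str[OF M N] by (intro tangent_natI; simp)+
qed

end

section \<open>Cartesian tangent fibrations\<close>

locale cartesian_fib = tangent_fib \<E> for \<E> :: "('e, 'em, 'b, 'bm) ctfib" +
  fixes k :: fib_kind
  assumes ctf: "cartesian_tangent_fibration k \<E>"

sublocale cartesian_fib \<subseteq> Pi: cartesian_functor XX "TProd \<E>" BB "BProd \<E>" "Proj \<E>"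
proof unfold_locales
  show "preserves_products XX (TProd \<E>) (BProd \<E>) (Proj \<E>)"
    using ctf by (simp add: cartesian_tangent_fibration_def preserves_products_def)
qed (use ctf preserving in \<open>simp_all add: cartesian_tangent_fibration_def\<close>)

context cartesian_fib
begin

text \<open>A filler for \<open>\<phi> \<times> \<psi>\<close> is a pair of fillers, and lies over the right arrow since \<open>\<Pi>\<close> preserves products.
  So products of arbitrary Cartesian arrows are Cartesian, not only products of chosen lifts; this is
  what makes the product of two morphisms of fibrations a morphism.\<close>

lemma prodmap_cartesian:
  assumes \<phi>: "cartesian_arrow \<E> \<phi>" and \<psi>: "cartesian_arrow \<E> \<psi>"
  shows "cartesian_arrow \<E> (prodmap XX (TProd \<E>) \<phi> \<psi>)"
proof (rule cartesianI)
  let ?p = "prodmap XX (TProd \<E>) \<phi> \<psi>" and ?X = "Dom XX \<phi>" and ?Y = "Dom XX \<psi>"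
  have [simp]: "\<phi> \<in> Arr XX" "\<psi> \<in> Arr XX" using \<phi> \<psi> by simp_all
  show "?p \<in> Arr XX" by simp
  have px: "Fst (TProd \<E>) (Cod XX \<phi>) (Cod XX \<psi>) \<cdot>\<^bsub>XX\<^esub> (?p \<cdot>\<^bsub>XX\<^esub> x) = \<phi> \<cdot>\<^bsub>XX\<^esub> (Fst (TProd \<E>) ?X ?Y \<cdot>\<^bsub>XX\<^esub> x)"
    "Snd (TProd \<E>) (Cod XX \<phi>) (Cod XX \<psi>) \<cdot>\<^bsub>XX\<^esub> (?p \<cdot>\<^bsub>XX\<^esub> x) = \<psi> \<cdot>\<^bsub>XX\<^esub> (Snd (TProd \<E>) ?X ?Y \<cdot>\<^bsub>XX\<^esub> x)"
    if "x \<in> Arr XX" "Cod XX x = Prod (TProd \<E>) ?X ?Y" for x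
    using that by simp_all
  {
    fix h k assume h: "h \<in> Arr XX" "Cod XX h = Cod XX ?p" and k: "k \<in> Arr BB" "Dom BB k = \<Pi>O (Dom XX h)"
      "Cod BB k = \<Pi>O (Dom XX ?p)" and eq: "\<Pi>A h = \<Pi>A ?p \<cdot>\<^bsub>BB\<^esub> k"
    let ?h1 = "Fst (TProd \<E>) (Cod XX \<phi>) (Cod XX \<psi>) \<cdot>\<^bsub>XX\<^esub> h" and ?h2 = "Snd (TProd \<E>) (Cod XX \<phi>) (Cod XX \<psi>) \<cdot>\<^bsub>XX\<^esub> h"
    let ?k1 = "Fst (BProd \<E>) (\<Pi>O ?X) (\<Pi>O ?Y) \<cdot>\<^bsub>BB\<^esub> k" and ?k2 = "Snd (BProd \<E>) (\<Pi>O ?X) (\<Pi>O ?Y) \<cdot>\<^bsub>BB\<^esub> k"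
    have e1: "\<Pi>A ?h1 = \<Pi>A \<phi> \<cdot>\<^bsub>BB\<^esub> ?k1" and e2: "\<Pi>A ?h2 = \<Pi>A \<psi> \<cdot>\<^bsub>BB\<^esub> ?k2" using h k eq by simp_all
    note u = cart_fill_simps[OF \<phi> _ _ _ _ _ e1] and v = cart_fill_simps[OF \<psi> _ _ _ _ _ e2]
    let ?w = "pair XX (TProd \<E>) (cart_fill \<E> \<phi> ?h1 ?k1) (cart_fill \<E> \<psi> ?h2 ?k2)"
    have uv: "cart_fill \<E> \<phi> ?h1 ?k1 \<in> Arr XX" "Dom XX (cart_fill \<E> \<phi> ?h1 ?k1) = Dom XX h"
      "Cod XX (cart_fill \<E> \<phi> ?h1 ?k1) = ?X" "\<Pi>A (cart_fill \<E> \<phi> ?h1 ?k1) = ?k1" "\<phi> \<cdot>\<^bsub>XX\<^esub> cart_fill \<E> \<phi> ?h1 ?k1 = ?h1"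
      "cart_fill \<E> \<psi> ?h2 ?k2 \<in> Arr XX" "Dom XX (cart_fill \<E> \<psi> ?h2 ?k2) = Dom XX h"
      "Cod XX (cart_fill \<E> \<psi> ?h2 ?k2) = ?Y" "\<Pi>A (cart_fill \<E> \<psi> ?h2 ?k2) = ?k2" "\<psi> \<cdot>\<^bsub>XX\<^esub> cart_fill \<E> \<psi> ?h2 ?k2 = ?h2"
      using u v h k by simp_all
    have "?p \<cdot>\<^bsub>XX\<^esub> ?w = h" using uv h by simp
    moreover have "\<Pi>A ?w = k" using uv k by simp
    ultimately show "\<exists>u\<in>Arr XX. Dom XX u = Dom XX h \<and> Cod XX u = Dom XX ?p \<and> \<Pi>A u = k \<and> ?p \<cdot>\<^bsub>XX\<^esub> u = h"
      using uv by (intro bexI[of _ ?w]) simp_all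
  }
  fix u v assume uv: "u \<in> Arr XX" "v \<in> Arr XX" "Dom XX u = Dom XX v" "Cod XX u = Dom XX ?p"
    "Cod XX v = Dom XX ?p" "?p \<cdot>\<^bsub>XX\<^esub> u = ?p \<cdot>\<^bsub>XX\<^esub> v" "\<Pi>A u = \<Pi>A v"
  have co: "Cod XX u = Prod (TProd \<E>) ?X ?Y" "Cod XX v = Prod (TProd \<E>) ?X ?Y" using uv by simp_all
  show "u = v"
  proof (rule Pi.C.Prod_eqI[OF uv(1-3) co])
    show "Fst (TProd \<E>) ?X ?Y \<cdot>\<^bsub>XX\<^esub> u = Fst (TProd \<E>) ?X ?Y \<cdot>\<^bsub>XX\<^esub> v"
    proof (rule cartesian_eqI[OF \<phi>])
      show "\<phi> \<cdot>\<^bsub>XX\<^esub> (Fst (TProd \<E>) ?X ?Y \<cdot>\<^bsub>XX\<^esub> u) = \<phi> \<cdot>\<^bsub>XX\<^esub> (Fst (TProd \<E>) ?X ?Y \<cdot>\<^bsub>XX\<^esub> v)"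
        unfolding px(1)[OF uv(1) co(1), symmetric] px(1)[OF uv(2) co(2), symmetric] uv(6) ..
    qed (use uv(1-3,7) co in simp_all)
    show "Snd (TProd \<E>) ?X ?Y \<cdot>\<^bsub>XX\<^esub> u = Snd (TProd \<E>) ?X ?Y \<cdot>\<^bsub>XX\<^esub> v"
    proof (rule cartesian_eqI[OF \<psi>])
      show "\<psi> \<cdot>\<^bsub>XX\<^esub> (Snd (TProd \<E>) ?X ?Y \<cdot>\<^bsub>XX\<^esub> u) = \<psi> \<cdot>\<^bsub>XX\<^esub> (Snd (TProd \<E>) ?X ?Y \<cdot>\<^bsub>XX\<^esub> v)"
        unfolding px(2)[OF uv(1) co(1), symmetric] px(2)[OF uv(2) co(2), symmetric] uv(6) ..
    qed (use uv(1-3,7) co in simp_all)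
  qed simp_all
qed

lemma Id_cartesian: "A \<in> Obj XX \<Longrightarrow> cartesian_arrow \<E> (Id XX A)"
  by (rule cartesianI) auto

end

locale to_cartesian_fib = tangent_fibrations \<E>1 \<E>2 + E2: cartesian_fib \<E>2 k
  for \<E>1 :: "('e1, 'em1, 'b1, 'bm1, 'x) tfib_scheme" and \<E>2 :: "('e2, 'em2, 'b2, 'bm2) ctfib" and k

sublocale to_cartesian_fib \<subseteq> T: to_cartesian "Total \<E>1" "Total \<E>2" "TProd \<E>2" ..
sublocale to_cartesian_fib \<subseteq> B: to_cartesian "Base \<E>1" "Base \<E>2" "BProd \<E>2" ..

context to_cartesian_fib
begin

lemma fib_hom_prod_sel [simp]:
  "mB (One (fib_hom_prod \<E>1 \<E>2)) = lax_One (Base \<E>1) (Base \<E>2) (BProd \<E>2)"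
  "mT (One (fib_hom_prod \<E>1 \<E>2)) = lax_One (Total \<E>1) (Total \<E>2) (TProd \<E>2)"
  "Prod (fib_hom_prod \<E>1 \<E>2) M N = fmor_Prod \<E>1 \<E>2 M N"
  "Fst (fib_hom_prod \<E>1 \<E>2) M N = mk_cell \<E>1 (fmor_Prod \<E>1 \<E>2 M N) M
     (\<lambda>A. Fst (BProd \<E>2) (bO M A) (bO N A)) (\<lambda>E. Fst (TProd \<E>2) (tO M E) (tO N E))"
  "Snd (fib_hom_prod \<E>1 \<E>2) M N = mk_cell \<E>1 (fmor_Prod \<E>1 \<E>2 M N) N
     (\<lambda>A. Snd (BProd \<E>2) (bO M A) (bO N A)) (\<lambda>E. Snd (TProd \<E>2) (tO M E) (tO N E))"
  by (simp_all add: fib_hom_prod_def)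

lemma fmor_Prod_sel [simp]:
  "mB (fmor_Prod \<E>1 \<E>2 M N) = lax_Prod (Base \<E>1) (Base \<E>2) (BProd \<E>2) (mB M) (mB N)"
  "mT (fmor_Prod \<E>1 \<E>2 M N) = lax_Prod (Total \<E>1) (Total \<E>2) (TProd \<E>2) (mT M) (mT N)"
  by (simp_all add: fmor_Prod_def)

lemma One_mor [simp]: "fib_morphism \<E>1 \<E>2 (One (fib_hom_prod \<E>1 \<E>2))"
  unfolding fib_morphism_def by (simp add: E2.Id_cartesian)

lemma Prod_mor [simp]:
  assumes M: "fib_morphism \<E>1 \<E>2 M" and N: "fib_morphism \<E>1 \<E>2 N"
  shows "fib_morphism \<E>1 \<E>2 (fmor_Prod \<E>1 \<E>2 M N)"
proof -
  interpret Mb: lax_object "Base \<E>1" "Base \<E>2" "mB M" by (rule morB[OF M])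
  interpret Mt: lax_object "Total \<E>1" "Total \<E>2" "mT M" by (rule morT[OF M])
  interpret Nb: lax_object "Base \<E>1" "Base \<E>2" "mB N" by (rule morB[OF N])
  interpret Nt: lax_object "Total \<E>1" "Total \<E>2" "mT N" by (rule morT[OF N])
  show ?thesis
    unfolding fib_morphism_def
  proof (intro conjI allI impI ballI)
    fix \<phi> assume \<phi>: "cartesian_arrow \<E>1 \<phi>"
    then show "cartesian_arrow \<E>2 (FA (Fun (mT (fmor_Prod \<E>1 \<E>2 M N))) \<phi>)"
      using M N E2.prodmap_cartesian by simp
  next
    fix E assume E: "E \<in> Obj (Total \<E>1)"
    show "FA (Proj \<E>2) (Str (mT (fmor_Prod \<E>1 \<E>2 M N)) E) = Str (mB (fmor_Prod \<E>1 \<E>2 M N)) (FO (Proj \<E>1) E)"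
      using E M N by (simp add: lax_Prod_def Let_def)
  qed (use M N in \<open>simp_all add: mor_ok\<close>)
qed

lemma projection_cells [simp]:
  assumes M: "fib_morphism \<E>1 \<E>2 M" and N: "fib_morphism \<E>1 \<E>2 N"
  shows "fib_cell \<E>1 \<E>2 (mk_cell \<E>1 (fmor_Prod \<E>1 \<E>2 M N) M
     (\<lambda>A. Fst (BProd \<E>2) (bO M A) (bO N A)) (\<lambda>E. Fst (TProd \<E>2) (tO M E) (tO N E)))"
    "fib_cell \<E>1 \<E>2 (mk_cell \<E>1 (fmor_Prod \<E>1 \<E>2 M N) N
     (\<lambda>A. Snd (BProd \<E>2) (bO M A) (bO N A)) (\<lambda>E. Snd (TProd \<E>2) (tO M E) (tO N E)))"
  by (rule mk_cell_cell; use M N in \<open>simp add: mor_ok T.lax_Prod_projections B.lax_Prod_projections\<close>)+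

lemma eval_products:
  "A \<in> Obj (Base \<E>1) \<Longrightarrow> preserves_products (fib_hom \<E>1 \<E>2) (fib_hom_prod \<E>1 \<E>2) (BProd \<E>2) (eval_base A)"
  "E \<in> Obj (Total \<E>1) \<Longrightarrow> preserves_products (fib_hom \<E>1 \<E>2) (fib_hom_prod \<E>1 \<E>2) (TProd \<E>2) (eval_total E)"
  by (simp_all add: preserves_products_def)

lemma fib_hom_cartesian: "cartesian_tangent_category (fib_hom \<E>1 \<E>2) (fib_hom_prod \<E>1 \<E>2)"
  by (rule tangent_evaluations.cartesian_of_evaluations[OF fib_hom_evaluations E2.Pi.D.cartesian E2.Pi.C.cartesian])
    (auto simp: eval_products)

end

sublocale to_cartesian_fib \<subseteq> H: cartesian_tangent "fib_hom \<E>1 \<E>2" "fib_hom_prod \<E>1 \<E>2"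
  using fib_hom_tangent_category fib_hom_cartesian
  by (intro cartesian_tangent.intro cartesian_tangent_axioms.intro)

section \<open>The fibration of differential objects\<close>

lemma cartesian_arrow_ex1:
  assumes "cartesian_arrow \<E> \<phi>" "h \<in> Arr (Total \<E>)" "Cod (Total \<E>) h = Cod (Total \<E>) \<phi>"
    "k \<in> Homs (Base \<E>) (FO (Proj \<E>) (Dom (Total \<E>) h)) (FO (Proj \<E>) (Dom (Total \<E>) \<phi>))"
    "FA (Proj \<E>) h = FA (Proj \<E>) \<phi> \<cdot>\<^bsub>Base \<E>\<^esub> k"
  shows "\<exists>!u. u \<in> Homs (Total \<E>) (Dom (Total \<E>) h) (Dom (Total \<E>) \<phi>) \<and> FA (Proj \<E>) u = k \<and> \<phi> \<cdot>\<^bsub>Total \<E>\<^esub> u = h"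
  using assms unfolding cartesian_arrow_def by blast

lemma (in cartesian_tangent) und_functor: "cartesian_functor (DO_cat C P) (DO_prod C P) C P und"
proof -
  interpret DO: tangent_category "DO_cat C P" by (rule DO_tangent_category)
  show ?thesis
    by unfold_locales (auto simp: DO_cartesian und_preserving preserves_products_def)
qed

context cartesian_fib
begin

lemma DO_fib_sel [simp]:
  "Total (DO_fib \<E>) = DO_cat XX (TProd \<E>)" "Base (DO_fib \<E>) = DO_cat BB (BProd \<E>)"
  "Proj (DO_fib \<E>) = Pi.do_ftr" "TProd (DO_fib \<E>) = DO_prod XX (TProd \<E>)" "BProd (DO_fib \<E>) = DO_prod BB (BProd \<E>)"
  "Lift (DO_fib \<E>) f E = tag (do_reindex \<E> f E) E (Lift \<E> (Und f) (do_carrier E))"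
  by (simp_all add: DO_fib_def Pi.do_ftr_def)

lemma cartesian_iso:
  assumes \<phi>: "cartesian_arrow \<E> \<phi>" and v: "v \<in> Arr XX" "Cod XX v = Dom XX \<phi>"
    and u: "u \<in> Arr XX" "Dom XX u = Dom XX \<phi>" "Cod XX u = Dom XX v"
    and uv: "u \<cdot>\<^bsub>XX\<^esub> v = Id XX (Dom XX v)" and vu: "v \<cdot>\<^bsub>XX\<^esub> u = Id XX (Dom XX \<phi>)"
  shows "cartesian_arrow \<E> (\<phi> \<cdot>\<^bsub>XX\<^esub> v)"
proof (rule cartesianI)
  have [simp]: "\<phi> \<in> Arr XX" using \<phi> by simp
  show "\<phi> \<cdot>\<^bsub>XX\<^esub> v \<in> Arr XX" using v by simp
  fix h k assume h: "h \<in> Arr XX" "Cod XX h = Cod XX (\<phi> \<cdot>\<^bsub>XX\<^esub> v)" and k: "k \<in> Arr BB" "Dom BB k = \<Pi>O (Dom XX h)"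
    "Cod BB k = \<Pi>O (Dom XX (\<phi> \<cdot>\<^bsub>XX\<^esub> v))" and eq: "\<Pi>A h = \<Pi>A (\<phi> \<cdot>\<^bsub>XX\<^esub> v) \<cdot>\<^bsub>BB\<^esub> k"
  have e: "\<Pi>A h = \<Pi>A \<phi> \<cdot>\<^bsub>BB\<^esub> (\<Pi>A v \<cdot>\<^bsub>BB\<^esub> k)" using eq v k by simp
  let ?w = "cart_fill \<E> \<phi> h (\<Pi>A v \<cdot>\<^bsub>BB\<^esub> k)"
  have w: "?w \<in> Arr XX" "Dom XX ?w = Dom XX h" "Cod XX ?w = Dom XX \<phi>" "\<Pi>A ?w = \<Pi>A v \<cdot>\<^bsub>BB\<^esub> k" "\<phi> \<cdot>\<^bsub>XX\<^esub> ?w = h"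
    using cart_fill_simps[OF \<phi> _ _ _ _ _ e] h k v by simp_all
  have "\<phi> \<cdot>\<^bsub>XX\<^esub> (v \<cdot>\<^bsub>XX\<^esub> (u \<cdot>\<^bsub>XX\<^esub> ?w)) = h" using X.reassoc[OF vu, of ?w] w u v by simp
  moreover have "\<Pi>A u \<cdot>\<^bsub>BB\<^esub> (\<Pi>A v \<cdot>\<^bsub>BB\<^esub> k) = k"
    using B.reassoc[OF arg_cong[OF uv, of \<Pi>A, unfolded \<Pi>_functor(6)[OF v(1) u(1) u(2)[unfolded v(2)[symmetric], symmetric]]], of k] u v k by simp
  ultimately show "\<exists>x\<in>Arr XX. Dom XX x = Dom XX h \<and> Cod XX x = Dom XX (\<phi> \<cdot>\<^bsub>XX\<^esub> v) \<and> \<Pi>A x = k \<and> (\<phi> \<cdot>\<^bsub>XX\<^esub> v) \<cdot>\<^bsub>XX\<^esub> x = h"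
    using u v w by (intro bexI[of _ "u \<cdot>\<^bsub>XX\<^esub> ?w"]) simp_all
next
  have [simp]: "\<phi> \<in> Arr XX" using \<phi> by simp
  fix a b assume ab: "a \<in> Arr XX" "b \<in> Arr XX" "Dom XX a = Dom XX b" "Cod XX a = Dom XX (\<phi> \<cdot>\<^bsub>XX\<^esub> v)"
    "Cod XX b = Dom XX (\<phi> \<cdot>\<^bsub>XX\<^esub> v)" "(\<phi> \<cdot>\<^bsub>XX\<^esub> v) \<cdot>\<^bsub>XX\<^esub> a = (\<phi> \<cdot>\<^bsub>XX\<^esub> v) \<cdot>\<^bsub>XX\<^esub> b" "\<Pi>A a = \<Pi>A b"
  have "v \<cdot>\<^bsub>XX\<^esub> a = v \<cdot>\<^bsub>XX\<^esub> b" by (rule cartesian_eqI[OF \<phi>]) (use ab v in simp_all)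
  then have "u \<cdot>\<^bsub>XX\<^esub> (v \<cdot>\<^bsub>XX\<^esub> a) = u \<cdot>\<^bsub>XX\<^esub> (v \<cdot>\<^bsub>XX\<^esub> b)" by simp
  then show "a = b" using X.reassoc[OF uv, of a] X.reassoc[OF uv, of b] ab u v by simp
qed

lemma Lift_simps:
  assumes "f \<in> Arr BB" "E \<in> Obj XX" "\<Pi>O E = Cod BB f"
  shows "cartesian_arrow \<E> (Lift \<E> f E)" "Cod XX (Lift \<E> f E) = E" "\<Pi>A (Lift \<E> f E) = f"
    "Lift \<E> f E \<in> Arr XX" "\<Pi>O (Dom XX (Lift \<E> f E)) = Dom BB f"
proof -
  show c: "cartesian_arrow \<E> (Lift \<E> f E)" "Cod XX (Lift \<E> f E) = E" "\<Pi>A (Lift \<E> f E) = f"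
    using tangent_fibration assms by (auto simp: tangent_fibration_def cloven_fibration_def)
  then show "Lift \<E> f E \<in> Arr XX" by simp
  then show "\<Pi>O (Dom XX (Lift \<E> f E)) = Dom BB f" using c(3) \<Pi>_functor(3)[of "Lift \<E> f E"] by simp
qed

text \<open>The arrow with components \<open>f\<close> and \<open>g\<close> is built from two others: \<open>?k\<close> in the base, with components
  \<open>\<Pi> f\<close> and \<open>\<Pi> g\<close>, and \<open>?h\<close> into the tangent object of \<open>E\<close>, with components \<open>\<phi> \<circ> f\<close> and \<open>\<phi> \<circ> g\<close>. The product
  diagram of \<open>\<Pi> E\<close> shows that \<open>?h\<close> lies over \<open>T (\<Pi> \<phi>) \<circ> ?k\<close>, so it factors through the Cartesian
  arrow \<open>T \<phi>\<close>.\<close>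

lemma cartesian_hat_product:
  assumes \<phi>: "cartesian_arrow \<E> \<phi>" and E: "differential_object XX (TProd \<E>) E" and Ec: "Cod XX \<phi> = do_carrier E"
    and h: "h \<in> Homs XX (TO XX (Dom XX \<phi>)) (Dom XX \<phi>)" and \<phi>h: "\<phi> \<cdot>\<^bsub>XX\<^esub> h = do_hat E \<cdot>\<^bsub>XX\<^esub> TA XX \<phi>"
    and b: "is_product BB (\<Pi>O (Dom XX \<phi>)) (\<Pi>O (Dom XX \<phi>)) (TO BB (\<Pi>O (Dom XX \<phi>))) (pT BB (\<Pi>O (Dom XX \<phi>))) (\<Pi>A h)"
    and e: "is_product BB (\<Pi>O (Cod XX \<phi>)) (\<Pi>O (Cod XX \<phi>)) (TO BB (\<Pi>O (Cod XX \<phi>))) (pT BB (\<Pi>O (Cod XX \<phi>))) (\<Pi>A (do_hat E))"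
  shows "is_product XX (Dom XX \<phi>) (Dom XX \<phi>) (TO XX (Dom XX \<phi>)) (pT XX (Dom XX \<phi>)) h"
  unfolding is_product_def
proof (intro conjI allI ballI)
  interpret E: dobj XX "TProd \<E>" E by (rule Pi.C.dobj_axiom[OF E])
  have [simp]: "\<phi> \<in> Arr XX" "h \<in> Arr XX" "Dom XX h = TO XX (Dom XX \<phi>)" "Cod XX h = Dom XX \<phi>" using \<phi> h by simp_all
  have T\<phi>: "cartesian_arrow \<E> (TA XX \<phi>)" by (rule cartesian_T[OF \<phi>])
  have hx: "\<phi> \<cdot>\<^bsub>XX\<^esub> (h \<cdot>\<^bsub>XX\<^esub> x) = do_hat E \<cdot>\<^bsub>XX\<^esub> (TA XX \<phi> \<cdot>\<^bsub>XX\<^esub> x)" if "x \<in> Arr XX" "Cod XX x = TO XX (Dom XX \<phi>)" for x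
    using X.reassoc[OF \<phi>h, of x] that Ec by simp
  have px: "\<phi> \<cdot>\<^bsub>XX\<^esub> (pT XX (Dom XX \<phi>) \<cdot>\<^bsub>XX\<^esub> x) = pT XX E.A \<cdot>\<^bsub>XX\<^esub> (TA XX \<phi> \<cdot>\<^bsub>XX\<^esub> x)"
    if "x \<in> Arr XX" "Cod XX x = TO XX (Dom XX \<phi>)" for x
    using X.p_nat_x[of \<phi> E.A x] that Ec by simp
  fix Y f g assume f: "f \<in> Homs XX Y (Dom XX \<phi>)" and g: "g \<in> Homs XX Y (Dom XX \<phi>)"
  let ?k = "med2 BB (\<Pi>O Y) (TO BB (\<Pi>O (Dom XX \<phi>))) (pT BB (\<Pi>O (Dom XX \<phi>))) (\<Pi>A h) (\<Pi>A f) (\<Pi>A g)"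
  have k: "?k \<in> Arr BB" "Dom BB ?k = \<Pi>O Y" "Cod BB ?k = TO BB (\<Pi>O (Dom XX \<phi>))" "pT BB (\<Pi>O (Dom XX \<phi>)) \<cdot>\<^bsub>BB\<^esub> ?k = \<Pi>A f"
    "\<Pi>A h \<cdot>\<^bsub>BB\<^esub> ?k = \<Pi>A g"
    using B.product_med2[OF b, of "\<Pi>A f" "\<Pi>O Y" "\<Pi>A g"] f g by auto
  let ?h = "med2 XX Y (TO XX E.A) (pT XX E.A) E.ph (\<phi> \<cdot>\<^bsub>XX\<^esub> f) (\<phi> \<cdot>\<^bsub>XX\<^esub> g)"
  have hh: "?h \<in> Arr XX" "Dom XX ?h = Y" "Cod XX ?h = TO XX E.A" "pT XX E.A \<cdot>\<^bsub>XX\<^esub> ?h = \<phi> \<cdot>\<^bsub>XX\<^esub> f" "E.ph \<cdot>\<^bsub>XX\<^esub> ?h = \<phi> \<cdot>\<^bsub>XX\<^esub> g"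
    using X.product_med2[OF E.hat_product, of "\<phi> \<cdot>\<^bsub>XX\<^esub> f" Y "\<phi> \<cdot>\<^bsub>XX\<^esub> g"] f g Ec by auto
  have \<Pi>hx: "\<Pi>A E.ph \<cdot>\<^bsub>BB\<^esub> (TA BB (\<Pi>A \<phi>) \<cdot>\<^bsub>BB\<^esub> x) = \<Pi>A \<phi> \<cdot>\<^bsub>BB\<^esub> (\<Pi>A h \<cdot>\<^bsub>BB\<^esub> x)"
    if "x \<in> Arr BB" "Cod BB x = TO BB (\<Pi>O (Dom XX \<phi>))" for x
    using B.reassoc[of "\<Pi>A \<phi>" "\<Pi>A h" "\<Pi>A E.ph \<cdot>\<^bsub>BB\<^esub> TA BB (\<Pi>A \<phi>)" x] arg_cong[OF \<phi>h, of \<Pi>A] that Ec by simp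
  have eq: "\<Pi>A ?h = \<Pi>A (TA XX \<phi>) \<cdot>\<^bsub>BB\<^esub> ?k"
  proof (rule B.product_eqI[OF e])
    show "pT BB (\<Pi>O (Cod XX \<phi>)) \<cdot>\<^bsub>BB\<^esub> \<Pi>A ?h = pT BB (\<Pi>O (Cod XX \<phi>)) \<cdot>\<^bsub>BB\<^esub> (\<Pi>A (TA XX \<phi>) \<cdot>\<^bsub>BB\<^esub> ?k)"
      using arg_cong[OF hh(4), of \<Pi>A] hh(1-3) k f Ec B.p_nat_x[of "\<Pi>A \<phi>" "\<Pi>O E.A" ?k] by simp
    show "\<Pi>A E.ph \<cdot>\<^bsub>BB\<^esub> \<Pi>A ?h = \<Pi>A E.ph \<cdot>\<^bsub>BB\<^esub> (\<Pi>A (TA XX \<phi>) \<cdot>\<^bsub>BB\<^esub> ?k)"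
      using arg_cong[OF hh(5), of \<Pi>A] hh(1-3) k g Ec \<Pi>hx[of ?k] by simp
  qed (use hh k Ec in simp_all)
  let ?w = "cart_fill \<E> (TA XX \<phi>) ?h ?k"
  have w: "?w \<in> Arr XX" "Dom XX ?w = Y" "Cod XX ?w = TO XX (Dom XX \<phi>)" "\<Pi>A ?w = ?k" "TA XX \<phi> \<cdot>\<^bsub>XX\<^esub> ?w = ?h"
    using cart_fill_simps[OF T\<phi> _ _ _ _ _ eq] hh k Ec by simp_all
  show "\<exists>!u. u \<in> Homs XX Y (TO XX (Dom XX \<phi>)) \<and> pT XX (Dom XX \<phi>) \<cdot>\<^bsub>XX\<^esub> u = f \<and> h \<cdot>\<^bsub>XX\<^esub> u = g"
  proof (rule ex1I[of _ ?w])
    have "pT XX (Dom XX \<phi>) \<cdot>\<^bsub>XX\<^esub> ?w = f"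
      by (rule cartesian_eqI[OF \<phi>]) (use w f k hh px[of ?w] in simp_all)
    moreover have "h \<cdot>\<^bsub>XX\<^esub> ?w = g"
      by (rule cartesian_eqI[OF \<phi>]) (use w g k hh hx[of ?w] in simp_all)
    ultimately show "?w \<in> Homs XX Y (TO XX (Dom XX \<phi>)) \<and> pT XX (Dom XX \<phi>) \<cdot>\<^bsub>XX\<^esub> ?w = f \<and> h \<cdot>\<^bsub>XX\<^esub> ?w = g"
      using w by simp
    fix u assume u: "u \<in> Homs XX Y (TO XX (Dom XX \<phi>)) \<and> pT XX (Dom XX \<phi>) \<cdot>\<^bsub>XX\<^esub> u = f \<and> h \<cdot>\<^bsub>XX\<^esub> u = g"
    then have u': "u \<in> Arr XX" "Dom XX u = Y" "Cod XX u = TO XX (Dom XX \<phi>)" "pT XX (Dom XX \<phi>) \<cdot>\<^bsub>XX\<^esub> u = f" "h \<cdot>\<^bsub>XX\<^esub> u = g"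
      by simp_all
    show "u = ?w"
    proof (rule cartesian_eqI[OF T\<phi>])
      show "TA XX \<phi> \<cdot>\<^bsub>XX\<^esub> u = TA XX \<phi> \<cdot>\<^bsub>XX\<^esub> ?w"
        unfolding w(5) by (rule E.hat_eqI) (use u'(1-3) hh Ec px[OF u'(1,3)] hx[OF u'(1,3)] in \<open>simp_all add: u'(4,5)\<close>)
      show "\<Pi>A u = \<Pi>A ?w" unfolding w(4)
        by (rule B.product_eqI[OF b]) (use u'(1-3) k arg_cong[OF u'(4), of \<Pi>A] arg_cong[OF u'(5), of \<Pi>A] in simp_all)
    qed (use u' w in simp_all)
  qed
qed (use \<phi> h in simp_all)

context
  fixes f :: "(('b, 'bm) dobj, 'bm) tagged" and E :: "('e, 'em) dobj"
  assumes f: "linear_map BB (BProd \<E>) f" and E: "differential_object XX (TProd \<E>) E"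
    and fE: "do_map (Proj \<E>) E = Tgt f"
begin

lemma fE_sel: "do_carrier (Tgt f) = \<Pi>O (do_carrier E)" "do_zero (Tgt f) = \<Pi>A (do_zero E)"
  "do_sum (Tgt f) = \<Pi>A (do_sum E)" "do_hat (Tgt f) = \<Pi>A (do_hat E)"
  by (simp_all flip: fE)

lemma lift_arrow:
  defines "\<phi> \<equiv> Lift \<E> (Und f) (do_carrier E)"
  shows "cartesian_arrow \<E> \<phi>" "Cod XX \<phi> = do_carrier E" "\<Pi>A \<phi> = Und f" "\<phi> \<in> Arr XX"
    "\<Pi>O (Dom XX \<phi>) = do_carrier (Src f)"
  using Lift_simps[of "Und f" "do_carrier E"] f E by (simp_all add: \<phi>_def fE_sel)

text \<open>The fillers that define the zero and the sum exist since \<open>f\<close>, being linear, preserves both.\<close>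

lemma reindex_simps:
  defines "\<phi> \<equiv> Lift \<E> (Und f) (do_carrier E)" and "R \<equiv> do_reindex \<E> f E"
  shows "do_carrier R = Dom XX \<phi>"
    "do_zero R \<in> Homs XX (One (TProd \<E>)) (Dom XX \<phi>)" "\<phi> \<cdot>\<^bsub>XX\<^esub> do_zero R = do_zero E" "\<Pi>A (do_zero R) = do_zero (Src f)"
    "do_sum R \<in> Homs XX (Prod (TProd \<E>) (Dom XX \<phi>) (Dom XX \<phi>)) (Dom XX \<phi>)"
    "\<phi> \<cdot>\<^bsub>XX\<^esub> do_sum R = do_sum E \<cdot>\<^bsub>XX\<^esub> prodmap XX (TProd \<E>) \<phi> \<phi>" "\<Pi>A (do_sum R) = do_sum (Src f)"
    "do_hat R \<in> Homs XX (TO XX (Dom XX \<phi>)) (Dom XX \<phi>)"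
    "\<phi> \<cdot>\<^bsub>XX\<^esub> do_hat R = do_hat E \<cdot>\<^bsub>XX\<^esub> TA XX \<phi>" "\<Pi>A (do_hat R) = do_hat (Src f)"
proof -
  note l = lift_arrow[folded \<phi>_def]
  have r: "do_carrier R = Dom XX \<phi>" "do_zero R = cart_fill \<E> \<phi> (do_zero E) (do_zero (Src f))"
    "do_sum R = cart_fill \<E> \<phi> (do_sum E \<cdot>\<^bsub>XX\<^esub> prodmap XX (TProd \<E>) \<phi> \<phi>) (do_sum (Src f))"
    "do_hat R = cart_fill \<E> \<phi> (do_hat E \<cdot>\<^bsub>XX\<^esub> TA XX \<phi>) (do_hat (Src f))"
    by (simp_all add: R_def do_reindex_def Let_def \<phi>_def)
  show "do_carrier R = Dom XX \<phi>" by (rule r(1))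
  have z: "\<Pi>A (do_zero E) = \<Pi>A \<phi> \<cdot>\<^bsub>BB\<^esub> do_zero (Src f)"
    using Pi.D.linear_zero[OF f] l by (simp add: fE_sel)
  have s: "\<Pi>A (do_sum E \<cdot>\<^bsub>XX\<^esub> prodmap XX (TProd \<E>) \<phi> \<phi>) = \<Pi>A \<phi> \<cdot>\<^bsub>BB\<^esub> do_sum (Src f)"
    using Pi.D.linear_sum[OF f] l E by (simp add: fE_sel del: Pi.C.prodmap_comp Pi.D.prodmap_comp)
  have h: "\<Pi>A (do_hat E \<cdot>\<^bsub>XX\<^esub> TA XX \<phi>) = \<Pi>A \<phi> \<cdot>\<^bsub>BB\<^esub> do_hat (Src f)"
    using Pi.D.linear_hat[OF f] l E by (simp add: fE_sel)
  show "do_zero R \<in> Homs XX (One (TProd \<E>)) (Dom XX \<phi>)" "\<phi> \<cdot>\<^bsub>XX\<^esub> do_zero R = do_zero E" "\<Pi>A (do_zero R) = do_zero (Src f)"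
    unfolding r using cart_fill_simps[OF l(1) _ _ _ _ _ z] l E f by simp_all
  show "do_sum R \<in> Homs XX (Prod (TProd \<E>) (Dom XX \<phi>) (Dom XX \<phi>)) (Dom XX \<phi>)"
    "\<phi> \<cdot>\<^bsub>XX\<^esub> do_sum R = do_sum E \<cdot>\<^bsub>XX\<^esub> prodmap XX (TProd \<E>) \<phi> \<phi>" "\<Pi>A (do_sum R) = do_sum (Src f)"
    unfolding r using cart_fill_simps[OF l(1) _ _ _ _ _ s] l E f by simp_all
  show "do_hat R \<in> Homs XX (TO XX (Dom XX \<phi>)) (Dom XX \<phi>)"
    "\<phi> \<cdot>\<^bsub>XX\<^esub> do_hat R = do_hat E \<cdot>\<^bsub>XX\<^esub> TA XX \<phi>" "\<Pi>A (do_hat R) = do_hat (Src f)"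
    unfolding r using cart_fill_simps[OF l(1) _ _ _ _ _ h] l E f by simp_all
qed

lemma do_map_reindex: "do_map (Proj \<E>) (do_reindex \<E> f E) = Src f"
  by (rule dobj_eqI) (simp_all add: reindex_simps lift_arrow)

text \<open>Two arrows into the source of the Cartesian lift are equal if they agree after the lift and in the
  base. After the lift the laws are those of \<open>E\<close>, in the base those of \<open>Src f\<close>.\<close>

lemma reindex_dobj: "differential_object XX (TProd \<E>) (do_reindex \<E> f E)"
proof -
  let ?\<phi> = "Lift \<E> (Und f) (do_carrier E)"
  note l = lift_arrow and r = reindex_simps
  have S: "differential_object BB (BProd \<E>) (Src f)" using f by simp
  interpret S: dobj BB "BProd \<E>" "Src f" by (rule Pi.D.dobj_axiom[OF S])
  interpret T: dobj BB "BProd \<E>" "Tgt f" by (rule Pi.D.dobj_axiom) (use f in simp)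
  show ?thesis
  proof (rule Pi.C.dobj_by_projections[where K = "{0 :: nat}" and G = "\<lambda>_. E" and \<pi> = "\<lambda>_. ?\<phi>" and R = "\<lambda>u v. \<Pi>A u = \<Pi>A v"])
    show "u = v" if "u \<in> Arr XX" "v \<in> Arr XX" "Dom XX u = Dom XX v" "Cod XX u = do_carrier (do_reindex \<E> f E)"
      "Cod XX v = do_carrier (do_reindex \<E> f E)" "\<And>i. i \<in> {0 :: nat} \<Longrightarrow> ?\<phi> \<cdot>\<^bsub>XX\<^esub> u = ?\<phi> \<cdot>\<^bsub>XX\<^esub> v" "\<Pi>A u = \<Pi>A v" for u v
      by (rule cartesian_eqI[OF l(1)]) (use that r(1) in simp_all)
    show "is_product XX (do_carrier (do_reindex \<E> f E)) (do_carrier (do_reindex \<E> f E)) (TO XX (do_carrier (do_reindex \<E> f E)))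
        (pT XX (do_carrier (do_reindex \<E> f E))) (do_hat (do_reindex \<E> f E))"
      unfolding r(1) by (rule cartesian_hat_product[OF l(1) E l(2) r(8,9)])
        (use l r(10) S.hat_product T.hat_product in \<open>simp_all add: fE_sel\<close>)
  qed (use l r E S.dobj_raw in \<open>simp_all del: Pi.C.prodmap_comp\<close>)
qed

lemma lift_linear: "linear_map XX (TProd \<E>) (Lift (DO_fib \<E>) f E)"
  unfolding DO_fib_sel
  by (rule Pi.C.linear_mapI) (simp_all add: reindex_dobj E lift_arrow reindex_simps)

text \<open>The differential structure on the source of a lift is determined by its image and by linearity of the
  lift. For cloven fibrations this identifies the product of two chosen lifts with a chosen lift.\<close>

lemma reindex_unique:
  assumes D: "linear_map XX (TProd \<E>) (tag D E (Lift \<E> (Und f) (do_carrier E)))" and Df: "do_map (Proj \<E>) D = Src f"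
  shows "do_reindex \<E> f E = D"
proof -
  let ?\<phi> = "Lift \<E> (Und f) (do_carrier E)"
  note l = lift_arrow
  have dD: "differential_object XX (TProd \<E>) D" and Dc: "Dom XX ?\<phi> = do_carrier D"
    using Pi.C.linear_simps(1,4)[OF D] by simp_all
  have s: "\<Pi>A (do_zero D) = do_zero (Src f)" "\<Pi>A (do_sum D) = do_sum (Src f)" "\<Pi>A (do_hat D) = do_hat (Src f)"
    by (simp_all flip: Df)
  show ?thesis
  proof (rule dobj_eqI)
    show "do_carrier (do_reindex \<E> f E) = do_carrier D" by (simp add: reindex_simps Dc)
    show "do_zero (do_reindex \<E> f E) = do_zero D" unfolding do_reindex_def Let_def dobj.simps
      by (rule cart_fill_eqI[OF l(1)]) (use dD Dc s Pi.C.linear_zero[OF D] in simp_all)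
    show "do_sum (do_reindex \<E> f E) = do_sum D" unfolding do_reindex_def Let_def dobj.simps
      by (rule cart_fill_eqI[OF l(1)]) (use dD Dc s Pi.C.linear_sum[OF D] in simp_all)
    show "do_hat (do_reindex \<E> f E) = do_hat D" unfolding do_reindex_def Let_def dobj.simps
      by (rule cart_fill_eqI[OF l(1)]) (use dD Dc s Pi.C.linear_hat[OF D] in simp_all)
  qed
qed

end

text \<open>The filler of the underlying arrows is linear, because the two sides of its linearity equation agree
  after \<open>t\<close> and in the base.\<close>

lemma DO_cartesianI:
  assumes t: "linear_map XX (TProd \<E>) t" and c: "cartesian_arrow \<E> (Und t)"
  shows "cartesian_arrow (DO_fib \<E>) t"
  unfolding cartesian_arrow_def
proof (intro conjI ballI impI)
  show "t \<in> Arr (Total (DO_fib \<E>))" using t by simp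
  fix h k assume a: "h \<in> Arr (Total (DO_fib \<E>))"
    "k \<in> Homs (Base (DO_fib \<E>)) (FO (Proj (DO_fib \<E>)) (Dom (Total (DO_fib \<E>)) h)) (FO (Proj (DO_fib \<E>)) (Dom (Total (DO_fib \<E>)) t))"
    "Cod (Total (DO_fib \<E>)) h = Cod (Total (DO_fib \<E>)) t"
    "FA (Proj (DO_fib \<E>)) h = FA (Proj (DO_fib \<E>)) t \<cdot>\<^bsub>Base (DO_fib \<E>)\<^esub> k"
  have h: "linear_map XX (TProd \<E>) h" and k: "linear_map BB (BProd \<E>) k" "Src k = do_map (Proj \<E>) (Src h)"
    "Tgt k = do_map (Proj \<E>) (Src t)" and ht: "Tgt h = Tgt t" and eq: "\<Pi>A (Und h) = \<Pi>A (Und t) \<cdot>\<^bsub>BB\<^esub> Und k"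
    using a by simp_all
  have kt: "Und k \<in> Arr BB" "Dom BB (Und k) = \<Pi>O (do_carrier (Src h))" "Cod BB (Und k) = \<Pi>O (do_carrier (Src t))"
    using Pi.D.linear_simps(3-5)[OF k(1)] k(2,3) by simp_all
  let ?u = "cart_fill \<E> (Und t) (Und h) (Und k)"
  have u: "?u \<in> Arr XX" "Dom XX ?u = do_carrier (Src h)" "Cod XX ?u = do_carrier (Src t)" "\<Pi>A ?u = Und k" "Und t \<cdot>\<^bsub>XX\<^esub> ?u = Und h"
    using cart_fill_simps[OF c _ _ _ _ _ eq] h t kt ht by simp_all
  have Tu: "TA XX (Und t) \<cdot>\<^bsub>XX\<^esub> TA XX ?u = TA XX (Und h)" using arg_cong[OF u(5), of "TA XX"] u(1-3) t by simp
  have lin: "linear_map XX (TProd \<E>) (tag (Src h) (Src t) ?u)"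
  proof (rule Pi.C.linear_mapI)
    show "?u \<cdot>\<^bsub>XX\<^esub> do_hat (Src h) = do_hat (Src t) \<cdot>\<^bsub>XX\<^esub> TA XX ?u"
    proof (rule cartesian_eqI[OF c])
      show "Und t \<cdot>\<^bsub>XX\<^esub> (?u \<cdot>\<^bsub>XX\<^esub> do_hat (Src h)) = Und t \<cdot>\<^bsub>XX\<^esub> (do_hat (Src t) \<cdot>\<^bsub>XX\<^esub> TA XX ?u)"
        using X.reassoc[OF u(5), of "do_hat (Src h)"] X.reassoc[OF Pi.C.linear_hat[OF t], of "TA XX ?u"]
          u(1-3) t h Tu Pi.C.linear_hat[OF h] ht by simp
      show "\<Pi>A (?u \<cdot>\<^bsub>XX\<^esub> do_hat (Src h)) = \<Pi>A (do_hat (Src t) \<cdot>\<^bsub>XX\<^esub> TA XX ?u)"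
        using u(1-4) t h Pi.D.linear_hat[OF k(1)] k(2,3) by simp
    qed (use u t h in simp_all)
  qed (use u t h in simp_all)
  show "\<exists>!u. u \<in> Homs (Total (DO_fib \<E>)) (Dom (Total (DO_fib \<E>)) h) (Dom (Total (DO_fib \<E>)) t) \<and>
      FA (Proj (DO_fib \<E>)) u = k \<and> t \<cdot>\<^bsub>Total (DO_fib \<E>)\<^esub> u = h"
  proof (rule ex1I[of _ "tag (Src h) (Src t) ?u"])
    show "tag (Src h) (Src t) ?u \<in> Homs (Total (DO_fib \<E>)) (Dom (Total (DO_fib \<E>)) h) (Dom (Total (DO_fib \<E>)) t) \<and>
      FA (Proj (DO_fib \<E>)) (tag (Src h) (Src t) ?u) = k \<and> t \<cdot>\<^bsub>Total (DO_fib \<E>)\<^esub> tag (Src h) (Src t) ?u = h"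
      using lin u k ht by (auto intro: tagged_eqI)
    fix v assume v: "v \<in> Homs (Total (DO_fib \<E>)) (Dom (Total (DO_fib \<E>)) h) (Dom (Total (DO_fib \<E>)) t) \<and>
      FA (Proj (DO_fib \<E>)) v = k \<and> t \<cdot>\<^bsub>Total (DO_fib \<E>)\<^esub> v = h"
    have vl: "linear_map XX (TProd \<E>) v" "Src v = Src h" "Tgt v = Src t" and vk: "\<Pi>A (Und v) = Und k" and tv: "Und t \<cdot>\<^bsub>XX\<^esub> Und v = Und h"
      using v by auto
    have "Und v = ?u" by (rule cartesian_eqI[OF c]) (use vl vk tv u t h in simp_all)
    then show "v = tag (Src h) (Src t) ?u" using vl by (intro tagged_eqI) simp_all
  qed
qed

lemma DO_lift_cartesian:
  assumes "linear_map BB (BProd \<E>) f" "differential_object XX (TProd \<E>) E" "do_map (Proj \<E>) E = Tgt f"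
  shows "cartesian_arrow (DO_fib \<E>) (Lift (DO_fib \<E>) f E)"
  using DO_cartesianI[OF lift_linear[OF assms]] lift_arrow(1)[OF assms] by simp

text \<open>The chosen lift of the image of \<open>t\<close> has a Cartesian underlying arrow. Both it and \<open>t\<close> are Cartesian over
  the same arrow with the same target, so they differ by an isomorphism.\<close>

lemma DO_cartesianD:
  assumes t: "cartesian_arrow (DO_fib \<E>) t"
  shows "linear_map XX (TProd \<E>) t" "cartesian_arrow \<E> (Und t)"
proof -
  interpret DX: tangent_category "DO_cat XX (TProd \<E>)" by (rule Pi.C.DO_tangent_category)
  interpret DB: tangent_category "DO_cat BB (BProd \<E>)" by (rule Pi.D.DO_tangent_category)
  show tl: "linear_map XX (TProd \<E>) t" using t by (simp add: cartesian_arrow_def)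
  let ?f = "FA Pi.do_ftr t"
  have f: "linear_map BB (BProd \<E>) ?f" "differential_object XX (TProd \<E>) (Tgt t)" "do_map (Proj \<E>) (Tgt t) = Tgt ?f"
    using tl by simp_all
  let ?L = "Lift (DO_fib \<E>) ?f (Tgt t)"
  have L: "cartesian_arrow (DO_fib \<E>) ?L" by (rule DO_lift_cartesian[OF f])
  have Ll: "linear_map XX (TProd \<E>) ?L" by (rule lift_linear[OF f])
  note la = lift_arrow[OF f] and rs = reindex_simps[OF f]
  have Ls: "Src ?L = do_reindex \<E> ?f (Tgt t)" "Tgt ?L = Tgt t" "do_map (Proj \<E>) (Src ?L) = do_map (Proj \<E>) (Src t)"
    using do_map_reindex[OF f] by simp_all
  have PL: "FA Pi.do_ftr ?L = ?f"
    by (rule tagged_eqI) (use Ls(3) la in simp_all)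
  \<comment> \<open>\<open>u\<close> and \<open>v\<close> below are the fillers over this identity, from the lift to \<open>t\<close> and back.\<close>
  define I where "I = Id (DO_cat BB (BProd \<E>)) (do_map (Proj \<E>) (Src t))"
  have I: "I \<in> Arr (DO_cat BB (BProd \<E>))" "Src I = do_map (Proj \<E>) (Src t)" "Tgt I = do_map (Proj \<E>) (Src t)"
    using tl DB.Id_simps[of "do_map (Proj \<E>) (Src t)"] unfolding I_def by (simp_all del: DO_cat_sel(5))
  have fI: "?f \<cdot>\<^bsub>DO_cat BB (BProd \<E>)\<^esub> I = ?f" using f(1) tl by (simp add: I_def)
  note F = functor_simps[OF tangent_preserving_functor[OF Pi.do_ftr_preserving]]
  have ex_t: "\<exists>!u. u \<in> Homs (DO_cat XX (TProd \<E>)) (Src h) (Src t) \<and> FA Pi.do_ftr u = I \<and> t \<cdot>\<^bsub>DO_cat XX (TProd \<E>)\<^esub> u = h"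
    if "linear_map XX (TProd \<E>) h" "Tgt h = Tgt t" "do_map (Proj \<E>) (Src h) = do_map (Proj \<E>) (Src t)" "FA Pi.do_ftr h = ?f" for h
    using cartesian_arrow_ex1[OF t, of h I] that I fI by simp
  have ex_L: "\<exists>!u. u \<in> Homs (DO_cat XX (TProd \<E>)) (Src h) (Src ?L) \<and> FA Pi.do_ftr u = I \<and> ?L \<cdot>\<^bsub>DO_cat XX (TProd \<E>)\<^esub> u = h"
    if "linear_map XX (TProd \<E>) h" "Tgt h = Tgt t" "do_map (Proj \<E>) (Src h) = do_map (Proj \<E>) (Src t)" "FA Pi.do_ftr h = ?f" for h
    using cartesian_arrow_ex1[OF L, of h I] that I fI Ls PL by (simp del: DO_fib_sel(6) Pi.do_ftr_sel DO_cat_sel(6)) simp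
  obtain u where u: "linear_map XX (TProd \<E>) u" "Src u = Src ?L" "Tgt u = Src t" "FA Pi.do_ftr u = I" "t \<cdot>\<^bsub>DO_cat XX (TProd \<E>)\<^esub> u = ?L"
    using ex_t[OF Ll Ls(2,3) PL] by (auto simp del: DO_fib_sel(6) Pi.do_ftr_sel DO_cat_sel(6))
  obtain v where v: "linear_map XX (TProd \<E>) v" "Src v = Src t" "Tgt v = Src ?L" "FA Pi.do_ftr v = I" "?L \<cdot>\<^bsub>DO_cat XX (TProd \<E>)\<^esub> v = t"
    using ex_L[OF tl refl refl refl] by (auto simp del: DO_fib_sel(6) Pi.do_ftr_sel DO_cat_sel(6))
  let ?D = "DO_cat XX (TProd \<E>)"
  have II: "I \<cdot>\<^bsub>DO_cat BB (BProd \<E>)\<^esub> I = I" "FA Pi.do_ftr (Id ?D (Src t)) = I" "FA Pi.do_ftr (Id ?D (Src ?L)) = I"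
    using tl Ls(3) Ll F(5)[of "Src t"] F(5)[of "Src ?L"] DB.Comp_unit_simps(1)[OF I(1), of "Src I"] I(2)
    unfolding I_def by (simp_all del: DO_fib_sel(6) DO_cat_sel(5,6) Pi.do_ftr_sel(2))
  have uv: "u \<cdot>\<^bsub>?D\<^esub> v = Id ?D (Src t)"
  proof (rule unique_eqI[OF ex_t[OF tl refl refl refl]])
    have "t \<cdot>\<^bsub>?D\<^esub> (u \<cdot>\<^bsub>?D\<^esub> v) = t" using DX.reassoc[OF u(5), of v] u v tl by (simp del: DO_fib_sel(6) DO_cat_sel(6))
    moreover have "FA Pi.do_ftr (u \<cdot>\<^bsub>?D\<^esub> v) = I" using F(6)[of v u] u v II(1) by (simp del: DO_fib_sel(6) DO_cat_sel(6) Pi.do_ftr_sel)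
    moreover have "u \<cdot>\<^bsub>?D\<^esub> v \<in> Homs ?D (Src t) (Src t)"
      using DX.Comp_simps[of v u] u v by (simp del: DO_fib_sel(6) DO_cat_sel(6))
    ultimately show "u \<cdot>\<^bsub>?D\<^esub> v \<in> Homs ?D (Src t) (Src t) \<and> FA Pi.do_ftr (u \<cdot>\<^bsub>?D\<^esub> v) = I \<and> t \<cdot>\<^bsub>?D\<^esub> (u \<cdot>\<^bsub>?D\<^esub> v) = t" by blast
    show "Id ?D (Src t) \<in> Homs ?D (Src t) (Src t) \<and> FA Pi.do_ftr (Id ?D (Src t)) = I \<and> t \<cdot>\<^bsub>?D\<^esub> Id ?D (Src t) = t"
      using II(2) DX.Comp_unit_simps(1)[of t] DX.Id_simps[of "Src t"] tl by (simp del: DO_cat_sel(5,6) Pi.do_ftr_sel)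
  qed
  have vu: "v \<cdot>\<^bsub>?D\<^esub> u = Id ?D (Src ?L)"
  proof (rule unique_eqI[OF ex_L[OF Ll Ls(2,3) PL]])
    have "?L \<cdot>\<^bsub>?D\<^esub> (v \<cdot>\<^bsub>?D\<^esub> u) = ?L" using DX.reassoc[OF v(5), of u] u v Ll by (simp del: DO_fib_sel(6) DO_cat_sel(6))
    moreover have "FA Pi.do_ftr (v \<cdot>\<^bsub>?D\<^esub> u) = I" using F(6)[of u v] u v II(1) by (simp del: DO_fib_sel(6) DO_cat_sel(6) Pi.do_ftr_sel)
    moreover have "v \<cdot>\<^bsub>?D\<^esub> u \<in> Homs ?D (Src ?L) (Src ?L)"
      using DX.Comp_simps[of u v] u v by (simp del: DO_fib_sel(6) DO_cat_sel(6))
    ultimately show "v \<cdot>\<^bsub>?D\<^esub> u \<in> Homs ?D (Src ?L) (Src ?L) \<and> FA Pi.do_ftr (v \<cdot>\<^bsub>?D\<^esub> u) = I \<and> ?L \<cdot>\<^bsub>?D\<^esub> (v \<cdot>\<^bsub>?D\<^esub> u) = ?L" by blast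
    show "Id ?D (Src ?L) \<in> Homs ?D (Src ?L) (Src ?L) \<and> FA Pi.do_ftr (Id ?D (Src ?L)) = I \<and> ?L \<cdot>\<^bsub>?D\<^esub> Id ?D (Src ?L) = ?L"
      using II(3) DX.Comp_unit_simps(1)[of ?L] DX.Id_simps[of "Src ?L"] Ll by (simp del: DO_fib_sel(6) DO_cat_sel(5,6) Pi.do_ftr_sel)
  qed
  have "Und t = Und ?L \<cdot>\<^bsub>XX\<^esub> Und v" using arg_cong[OF v(5), of Und] by simp
  moreover have "cartesian_arrow \<E> (Und ?L \<cdot>\<^bsub>XX\<^esub> Und v)"
  proof (rule cartesian_iso[where u = "Und u"])
    show "Und u \<cdot>\<^bsub>XX\<^esub> Und v = Id XX (Dom XX (Und v))" using arg_cong[OF uv, of Und] v by simp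
    show "Und v \<cdot>\<^bsub>XX\<^esub> Und u = Id XX (Dom XX (Und ?L))" using arg_cong[OF vu, of Und] rs(1) by simp
    show "cartesian_arrow \<E> (Und ?L)" using la by simp
  qed (use u v Ll rs in simp_all)
  ultimately show "cartesian_arrow \<E> (Und t)" by simp
qed

text \<open>That \<open>T\<close> preserves Cartesian arrows has to be known for all of them, not only for the chosen lifts;
  they are recognised by their underlying arrows.\<close>

theorem DO_fib_tangent_fibration: "tangent_fibration (DO_fib \<E>)"
  unfolding tangent_fibration_def
proof (intro conjI allI impI ballI)
  interpret DX: tangent_category "DO_cat XX (TProd \<E>)" by (rule Pi.C.DO_tangent_category)
  interpret DB: tangent_category "DO_cat BB (BProd \<E>)" by (rule Pi.D.DO_tangent_category)
  show "cloven_fibration (DO_fib \<E>)"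
    unfolding cloven_fibration_def
  proof (intro conjI ballI impI)
    show "is_functor (Total (DO_fib \<E>)) (Base (DO_fib \<E>)) (Proj (DO_fib \<E>))"
      using tangent_preserving_functor[OF Pi.do_ftr_preserving] by simp
    fix f E assume a: "f \<in> Arr (Base (DO_fib \<E>))" "E \<in> Obj (Total (DO_fib \<E>))" "FO (Proj (DO_fib \<E>)) E = Cod (Base (DO_fib \<E>)) f"
    then have b: "linear_map BB (BProd \<E>) f" "differential_object XX (TProd \<E>) E" "do_map (Proj \<E>) E = Tgt f" by simp_all
    show "cartesian_arrow (DO_fib \<E>) (Lift (DO_fib \<E>) f E)" by (rule DO_lift_cartesian[OF b])
    show "Cod (Total (DO_fib \<E>)) (Lift (DO_fib \<E>) f E) = E" by simp
    show "FA (Proj (DO_fib \<E>)) (Lift (DO_fib \<E>) f E) = f"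
      by (rule tagged_eqI) (use b do_map_reindex[OF b] lift_arrow[OF b] in simp_all)
  qed (simp_all add: DX.category_axioms DB.category_axioms)
  show "strict_tangent_morphism (Total (DO_fib \<E>)) (Base (DO_fib \<E>)) (Proj (DO_fib \<E>))"
    using tangent_preserving_lax[OF DX.tangent_category_axioms DB.tangent_category_axioms Pi.do_ftr_preserving] by simp
  fix n :: nat and E assume n: "1 \<le> n" and E: "E \<in> Obj (Total (DO_fib \<E>))"
  show "FO (Proj (DO_fib \<E>)) (Tn (Total (DO_fib \<E>)) n E) = Tn (Base (DO_fib \<E>)) n (FO (Proj (DO_fib \<E>)) E)"
    using n E by simp
  show "FA (Proj (DO_fib \<E>)) (pr (Total (DO_fib \<E>)) n i E) = pr (Base (DO_fib \<E>)) n i (FO (Proj (DO_fib \<E>)) E)" if "i < n" for i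
    using n E that by simp
next
  fix t assume "cartesian_arrow (DO_fib \<E>) t"
  from DO_cartesianD[OF this] show "cartesian_arrow (DO_fib \<E>) (TA (Total (DO_fib \<E>)) t)"
    by (intro DO_cartesianI) (simp_all add: cartesian_T)
qed

theorem DO_fib_cartesian: "cartesian_tangent_fibration k (DO_fib \<E>)"
  unfolding cartesian_tangent_fibration_def
proof (intro conjI ballI impI)
  interpret UX: cartesian_functor "DO_cat XX (TProd \<E>)" "DO_prod XX (TProd \<E>)" XX "TProd \<E>" und
    by (rule Pi.C.und_functor)
  interpret UB: cartesian_functor "DO_cat BB (BProd \<E>)" "DO_prod BB (BProd \<E>)" BB "BProd \<E>" und
    by (rule Pi.D.und_functor)
  show "tangent_fibration (DO_fib \<E>)" by (rule DO_fib_tangent_fibration)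
  fix f g E F assume a: "f \<in> Arr (Base (DO_fib \<E>))" "g \<in> Arr (Base (DO_fib \<E>))" "E \<in> Obj (Total (DO_fib \<E>))"
    "F \<in> Obj (Total (DO_fib \<E>))" "FO (Proj (DO_fib \<E>)) E = Cod (Base (DO_fib \<E>)) f" "FO (Proj (DO_fib \<E>)) F = Cod (Base (DO_fib \<E>)) g"
  then have f: "linear_map BB (BProd \<E>) f" "differential_object XX (TProd \<E>) E" "do_map (Proj \<E>) E = Tgt f"
    and g: "linear_map BB (BProd \<E>) g" "differential_object XX (TProd \<E>) F" "do_map (Proj \<E>) F = Tgt g" by simp_all
  let ?t = "Lift (DO_fib \<E>) f E" and ?u = "Lift (DO_fib \<E>) g F"
  let ?p = "prodmap (DO_cat XX (TProd \<E>)) (DO_prod XX (TProd \<E>)) ?t ?u"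
  let ?q = "prodmap (DO_cat BB (BProd \<E>)) (DO_prod BB (BProd \<E>)) f g"
  have tu: "linear_map XX (TProd \<E>) ?t" "linear_map XX (TProd \<E>) ?u" by (rule lift_linear[OF f], rule lift_linear[OF g])
  have p: "linear_map XX (TProd \<E>) ?p" "Src ?p = do_Prod XX (TProd \<E>) (Src ?t) (Src ?u)" "Tgt ?p = do_Prod XX (TProd \<E>) E F"
    "Und ?p = prodmap XX (TProd \<E>) (Und ?t) (Und ?u)"
    using UX.C.prodmap_simps(1-3)[of ?t ?u] UX.F_prodmap[of ?t ?u] tu by simp_all
  have q: "linear_map BB (BProd \<E>) ?q" "Src ?q = do_Prod BB (BProd \<E>) (Src f) (Src g)" "Tgt ?q = do_Prod BB (BProd \<E>) (Tgt f) (Tgt g)"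
    "Und ?q = prodmap BB (BProd \<E>) (Und f) (Und g)"
    using UB.C.prodmap_simps(1-3)[of f g] UB.F_prodmap[of f g] f g by simp_all
  show "case k of Plain \<Rightarrow> cartesian_arrow (DO_fib \<E>) (prodmap (Total (DO_fib \<E>)) (TProd (DO_fib \<E>)) ?t ?u)
    | Cloven \<Rightarrow> prodmap (Total (DO_fib \<E>)) (TProd (DO_fib \<E>)) ?t ?u =
       Lift (DO_fib \<E>) (prodmap (Base (DO_fib \<E>)) (BProd (DO_fib \<E>)) f g) (Prod (TProd (DO_fib \<E>)) E F)"
  proof (cases k)
    case Plain
    have "cartesian_arrow (DO_fib \<E>) ?p"
      by (rule DO_cartesianI[OF p(1)]) (use p(4) lift_arrow(1)[OF f] lift_arrow(1)[OF g] in \<open>simp add: prodmap_cartesian\<close>)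
    then show ?thesis using Plain by simp
  next
    case Cloven
    have "do_carrier (Tgt f) = \<Pi>O (do_carrier E)" "do_carrier (Tgt g) = \<Pi>O (do_carrier F)"
      by (simp_all flip: f(3) g(3))
    then have l: "prodmap XX (TProd \<E>) (Und ?t) (Und ?u) = Lift \<E> (Und ?q) (Prod (TProd \<E>) (do_carrier E) (do_carrier F))"
      using ctf f g Cloven q(4) by (simp add: cartesian_tangent_fibration_def)
    have EF: "differential_object XX (TProd \<E>) (do_Prod XX (TProd \<E>) E F)" "do_map (Proj \<E>) (do_Prod XX (TProd \<E>) E F) = Tgt ?q"
      using f g q(3) by simp_all
    have "do_reindex \<E> ?q (do_Prod XX (TProd \<E>) E F) = Src ?p"
    proof (rule reindex_unique[OF q(1) EF])
      have "?p = tag (Src ?p) (do_Prod XX (TProd \<E>) E F) (Lift \<E> (Und ?q) (do_carrier (do_Prod XX (TProd \<E>) E F)))"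
        using p l by (intro tagged_eqI) simp_all
      then show "linear_map XX (TProd \<E>) (tag (Src ?p) (do_Prod XX (TProd \<E>) E F) (Lift \<E> (Und ?q) (do_carrier (do_Prod XX (TProd \<E>) E F))))"
        using p(1) by simp
      show "do_map (Proj \<E>) (Src ?p) = Src ?q"
        using p(2) q(2) do_map_reindex[OF f] do_map_reindex[OF g] reindex_dobj[OF f] reindex_dobj[OF g] by simp
    qed
    then have "?p = Lift (DO_fib \<E>) ?q (do_Prod XX (TProd \<E>) E F)"
      using p l by (intro tagged_eqI) simp_all
    then show ?thesis using Cloven by simp
  qed
qed (use Pi.do_ftr_products Pi.C.DO_cartesian Pi.D.DO_cartesian in \<open>simp_all add: preserves_products_def\<close>)

end

section \<open>The universal differential object\<close>

lemma (in to_cartesian_fib) eval_cartesian_functor: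
  "A \<in> Obj (Base \<E>1) \<Longrightarrow> cartesian_functor (fib_hom \<E>1 \<E>2) (fib_hom_prod \<E>1 \<E>2) (Base \<E>2) (BProd \<E>2) (eval_base A)"
  "E \<in> Obj (Total \<E>1) \<Longrightarrow> cartesian_functor (fib_hom \<E>1 \<E>2) (fib_hom_prod \<E>1 \<E>2) (Total \<E>2) (TProd \<E>2) (eval_total E)"
  by (unfold_locales; simp add: eval_base_preserving eval_total_preserving eval_products)+

lemma (in to_cartesian_fib) dobj_of_evaluations:
  assumes arrows: "fib_morphism \<E>1 \<E>2 (do_carrier D)"
    "do_zero D \<in> Homs (fib_hom \<E>1 \<E>2) (One (fib_hom_prod \<E>1 \<E>2)) (do_carrier D)"
    "do_sum D \<in> Homs (fib_hom \<E>1 \<E>2) (fmor_Prod \<E>1 \<E>2 (do_carrier D) (do_carrier D)) (do_carrier D)"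
    "do_hat D \<in> Homs (fib_hom \<E>1 \<E>2) (fmor_T \<E>1 \<E>2 (do_carrier D)) (do_carrier D)"
    and base: "\<And>A. A \<in> Obj (Base \<E>1) \<Longrightarrow> differential_object (Base \<E>2) (BProd \<E>2) (do_map (eval_base A) D)"
    and total: "\<And>E. E \<in> Obj (Total \<E>1) \<Longrightarrow> differential_object (Total \<E>2) (TProd \<E>2) (do_map (eval_total E) D)"
  shows "differential_object (fib_hom \<E>1 \<E>2) (fib_hom_prod \<E>1 \<E>2) D"
proof -
  let ?H = "fib_hom \<E>1 \<E>2" and ?P = "fib_hom_prod \<E>1 \<E>2"
  interpret V: tangent_evaluations ?H "Base \<E>2" "Total \<E>2" "eval_base ` Obj (Base \<E>1)" "eval_total ` Obj (Total \<E>1)"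
    by (rule fib_hom_evaluations)
  note fb = eval_cartesian_functor(1) and ft = eval_cartesian_functor(2)
  have ty: "do_carrier D \<in> Obj ?H" "do_zero D \<in> Arr ?H" "Dom ?H (do_zero D) = One ?P" "Cod ?H (do_zero D) = do_carrier D"
    "do_sum D \<in> Arr ?H" "Dom ?H (do_sum D) = Prod ?P (do_carrier D) (do_carrier D)" "Cod ?H (do_sum D) = do_carrier D"
    "do_hat D \<in> Arr ?H" "Dom ?H (do_hat D) = TO ?H (do_carrier D)" "Cod ?H (do_hat D) = do_carrier D"
    using arrows by simp_all
  have eqI: "u = v" if uv: "u \<in> Arr ?H" "v \<in> Arr ?H" "Dom ?H u = Dom ?H v" "Cod ?H u = Cod ?H v"
    and b: "\<And>A. A \<in> Obj (Base \<E>1) \<Longrightarrow> FA (eval_base A) u = FA (eval_base A) v"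
    and t: "\<And>E. E \<in> Obj (Total \<E>1) \<Longrightarrow> FA (eval_total E) u = FA (eval_total E) v" for u v
    by (rule V.faithful[OF uv]) (use b t in auto)
  note [simp del] = fib_hom_sel fib_hom_prod_sel eval_sel
  let ?A = "do_carrier D" and ?\<zeta> = "do_zero D" and ?\<sigma> = "do_sum D" and ?ph = "do_hat D"
  let ?AA = "Prod ?P ?A ?A"
  \<comment> \<open>The equations as a list of pairs, so that faithfulness of the evaluations is applied to all at once.\<close>
  define laws where "laws = [
    (?\<sigma> \<cdot>\<^bsub>?H\<^esub> pair ?H ?P (?\<zeta> \<cdot>\<^bsub>?H\<^esub> bang ?H ?P ?A) (Id ?H ?A), Id ?H ?A),
    (?\<sigma> \<cdot>\<^bsub>?H\<^esub> pair ?H ?P (Snd ?P ?A ?A) (Fst ?P ?A ?A), ?\<sigma>),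
    (?\<sigma> \<cdot>\<^bsub>?H\<^esub> pair ?H ?P (?\<sigma> \<cdot>\<^bsub>?H\<^esub> Fst ?P ?AA ?A) (Snd ?P ?AA ?A),
      ?\<sigma> \<cdot>\<^bsub>?H\<^esub> pair ?H ?P (Fst ?P ?A ?A \<cdot>\<^bsub>?H\<^esub> Fst ?P ?AA ?A)
        (?\<sigma> \<cdot>\<^bsub>?H\<^esub> pair ?H ?P (Snd ?P ?A ?A \<cdot>\<^bsub>?H\<^esub> Fst ?P ?AA ?A) (Snd ?P ?AA ?A))),
    (?ph \<cdot>\<^bsub>?H\<^esub> TA ?H ?\<zeta>, ?\<zeta> \<cdot>\<^bsub>?H\<^esub> bang ?H ?P (TO ?H (One ?P))),
    (?ph \<cdot>\<^bsub>?H\<^esub> TA ?H ?\<sigma>, ?\<sigma> \<cdot>\<^bsub>?H\<^esub> pair ?H ?P (?ph \<cdot>\<^bsub>?H\<^esub> TA ?H (Fst ?P ?A ?A)) (?ph \<cdot>\<^bsub>?H\<^esub> TA ?H (Snd ?P ?A ?A))),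
    (?ph \<cdot>\<^bsub>?H\<^esub> zT ?H ?A, ?\<zeta> \<cdot>\<^bsub>?H\<^esub> bang ?H ?P ?A),
    (?ph \<cdot>\<^bsub>?H\<^esub> sT ?H ?A, ?\<sigma> \<cdot>\<^bsub>?H\<^esub> pair ?H ?P (?ph \<cdot>\<^bsub>?H\<^esub> pr ?H 2 0 ?A) (?ph \<cdot>\<^bsub>?H\<^esub> pr ?H 2 1 ?A)),
    (?ph \<cdot>\<^bsub>?H\<^esub> (TA ?H ?ph \<cdot>\<^bsub>?H\<^esub> lT ?H ?A), ?ph)]"
  have laws_ty: "\<forall>p\<in>set laws. fst p \<in> Arr ?H \<and> snd p \<in> Arr ?H \<and> Dom ?H (fst p) = Dom ?H (snd p) \<and> Cod ?H (fst p) = Cod ?H (snd p)"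
    unfolding laws_def using ty by simp
  have laws_b: "\<forall>p\<in>set laws. FA (eval_base A) (fst p) = FA (eval_base A) (snd p)" if A: "A \<in> Obj (Base \<E>1)" for A
  proof -
    interpret F: cartesian_functor ?H ?P "Base \<E>2" "BProd \<E>2" "eval_base A" by (rule fb[OF A])
    interpret d: dobj "Base \<E>2" "BProd \<E>2" "do_map (eval_base A) D" by (rule E2.Pi.D.dobj_axiom[OF base[OF A]])
    show ?thesis unfolding laws_def using ty d.dobj_raw by simp
  qed
  have laws_t: "\<forall>p\<in>set laws. FA (eval_total A) (fst p) = FA (eval_total A) (snd p)" if A: "A \<in> Obj (Total \<E>1)" for A
  proof -
    interpret F: cartesian_functor ?H ?P "Total \<E>2" "TProd \<E>2" "eval_total A" by (rule ft[OF A])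
    interpret d: dobj "Total \<E>2" "TProd \<E>2" "do_map (eval_total A) D" by (rule E2.Pi.C.dobj_axiom[OF total[OF A]])
    show ?thesis unfolding laws_def using ty d.dobj_raw by simp
  qed
  have "\<forall>p\<in>set laws. fst p = snd p"
    using laws_ty laws_b laws_t by (blast intro: eqI)
  note eqs = this[unfolded laws_def list.set ball_simps fst_conv snd_conv]
  show ?thesis
  proof (rule H.dobjI)
    show "is_product ?H (do_carrier D) (do_carrier D) (TO ?H (do_carrier D)) (pT ?H (do_carrier D)) (do_hat D)"
    proof (rule V.product_of_evaluations)
      fix F :: "(('e1, 'em1, 'b1, 'bm1, 'e2, 'em2, 'b2, 'bm2) fmor,
        ('e1, 'em1, 'b1, 'bm1, 'e2, 'em2, 'b2, 'bm2) fcell, 'b2, 'bm2) ftr"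
      assume "F \<in> eval_base ` Obj (Base \<E>1)"
      then obtain A where A: "A \<in> Obj (Base \<E>1)" "F = eval_base A" by auto
      interpret F: cartesian_functor ?H ?P "Base \<E>2" "BProd \<E>2" "eval_base A" by (rule fb[OF A(1)])
      interpret d: dobj "Base \<E>2" "BProd \<E>2" "do_map (eval_base A) D" by (rule E2.Pi.D.dobj_axiom[OF base[OF A(1)]])
      have "is_product (Base \<E>2) (FO F (do_carrier D)) (FO F (do_carrier D)) (FO F (TO ?H (do_carrier D)))
          (FA F (pT ?H (do_carrier D))) (FA F (do_hat D))"
        using d.hat_product ty A by simp
      then show "is_product (Base \<E>2) (FO F (do_carrier D)) (FO F (do_carrier D)) (FO F (TO ?H (do_carrier D)))
          (FA F (pT ?H (do_carrier D))) (FA F (do_hat D)) \<and>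
        is_product (Base \<E>2) (TO (Base \<E>2) (FO F (do_carrier D))) (TO (Base \<E>2) (FO F (do_carrier D)))
          (TO (Base \<E>2) (FO F (TO ?H (do_carrier D))))
          (TA (Base \<E>2) (FA F (pT ?H (do_carrier D)))) (TA (Base \<E>2) (FA F (do_hat D)))"
        using E2.Pi.D.T_products by blast
    next
      fix F :: "(('e1, 'em1, 'b1, 'bm1, 'e2, 'em2, 'b2, 'bm2) fmor,
        ('e1, 'em1, 'b1, 'bm1, 'e2, 'em2, 'b2, 'bm2) fcell, 'e2, 'em2) ftr"
      assume "F \<in> eval_total ` Obj (Total \<E>1)"
      then obtain A where A: "A \<in> Obj (Total \<E>1)" "F = eval_total A" by auto
      interpret F: cartesian_functor ?H ?P "Total \<E>2" "TProd \<E>2" "eval_total A" by (rule ft[OF A(1)])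
      interpret d: dobj "Total \<E>2" "TProd \<E>2" "do_map (eval_total A) D" by (rule E2.Pi.C.dobj_axiom[OF total[OF A(1)]])
      have "is_product (Total \<E>2) (FO F (do_carrier D)) (FO F (do_carrier D)) (FO F (TO ?H (do_carrier D)))
          (FA F (pT ?H (do_carrier D))) (FA F (do_hat D))"
        using d.hat_product ty A by simp
      then show "is_product (Total \<E>2) (FO F (do_carrier D)) (FO F (do_carrier D)) (FO F (TO ?H (do_carrier D)))
          (FA F (pT ?H (do_carrier D))) (FA F (do_hat D)) \<and>
        is_product (Total \<E>2) (TO (Total \<E>2) (FO F (do_carrier D))) (TO (Total \<E>2) (FO F (do_carrier D)))
          (TO (Total \<E>2) (FO F (TO ?H (do_carrier D))))
          (TA (Total \<E>2) (FA F (pT ?H (do_carrier D)))) (TA (Total \<E>2) (FA F (do_hat D)))"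
        using E2.Pi.C.T_products by blast
    qed (use ty in simp_all)
  qed (use ty eqs in \<open>(elim conjE, simp; fail)+\<close>)
qed

context cartesian_tangent
begin

lemma lax_forget_sel [simp]:
  "differential_object C P D \<Longrightarrow> FO (Fun (lax_forget C P)) D = do_carrier D"
  "linear_map C P t \<Longrightarrow> FA (Fun (lax_forget C P)) t = Und t"
  "differential_object C P D \<Longrightarrow> Str (lax_forget C P) D = Id C (TO C (do_carrier D))"
  by (simp_all add: lax_forget_def ftr_restrict_def)

lemma lax_forget_ok: "lax_ok (DO_cat C P) C (lax_forget C P)"
proof -
  have 1: "lax_tangent_morphism (DO_cat C P) C und (\<lambda>D. Id C (FO und (TO (DO_cat C P) D)))"
    using tangent_preserving_lax[OF DO_tangent_category tangent_category_axioms und_preserving]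
    by (simp add: strict_tangent_morphism_def)
  have "lax_tangent_morphism (DO_cat C P) C (Fun (lax_forget C P)) (Str (lax_forget C P))"
    by (rule lax_cong[OF 1]) simp_all
  then show ?thesis by (simp add: lax_ok_def) (simp add: lax_forget_def ftr_restrict_def)
qed

text \<open>Naturality of the zero and the sum is the fact that linear maps preserve them.\<close>

lemma forget_nat:
  shows "tangent_nat (DO_cat C P) C (lax_One (DO_cat C P) C P) (lax_forget C P) do_zero"
    "tangent_nat (DO_cat C P) C (lax_Prod (DO_cat C P) C P (lax_forget C P) (lax_forget C P)) (lax_forget C P) do_sum"
    "tangent_nat (DO_cat C P) C (lax_T (DO_cat C P) C (lax_forget C P)) (lax_forget C P) do_hat"
proof -
  interpret DO: tangent_category "DO_cat C P" by (rule DO_tangent_category)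
  interpret L: to_cartesian "DO_cat C P" C P ..
  show "tangent_nat (DO_cat C P) C (lax_One (DO_cat C P) C P) (lax_forget C P) do_zero"
  proof (rule tangent_natI)
    fix D assume D: "D \<in> Obj (DO_cat C P)"
    interpret D: dobj C P D by (rule dobj_axiom) (use D in simp)
    show "TA C (do_zero D) \<cdot> Str (lax_One (DO_cat C P) C P) D = Str (lax_forget C P) D \<cdot> do_zero (TO (DO_cat C P) D)"
      using D by simp
  qed (use linear_zero in simp_all)
  show "tangent_nat (DO_cat C P) C (lax_Prod (DO_cat C P) C P (lax_forget C P) (lax_forget C P)) (lax_forget C P) do_sum"
  proof (rule tangent_natI)
    fix D assume D: "D \<in> Obj (DO_cat C P)"
    interpret D: dobj C P D by (rule dobj_axiom) (use D in simp)
    show "TA C (do_sum D) \<cdot> Str (lax_Prod (DO_cat C P) C P (lax_forget C P) (lax_forget C P)) D =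
      Str (lax_forget C P) D \<cdot> do_sum (TO (DO_cat C P) D)"
      using D D.do_T_dobj by (simp add: lax_Prod_def Let_def)
  qed (use linear_sum in simp_all)
  show "tangent_nat (DO_cat C P) C (lax_T (DO_cat C P) C (lax_forget C P)) (lax_forget C P) do_hat"
    by (rule tangent_natI) (use linear_hat in simp_all)
qed

end

locale fibration_of_DO = cartesian_fib

sublocale fibration_of_DO \<subseteq> DF: tangent_fib "DO_fib \<E>"
  by unfold_locales (rule DO_fib_tangent_fibration)

sublocale fibration_of_DO \<subseteq> W: to_cartesian_fib "DO_fib \<E>" \<E> k ..

context fibration_of_DO
begin

lemma DO_forget_sel [simp]: "mB (DO_forget \<E>) = lax_forget BB (BProd \<E>)" "mT (DO_forget \<E>) = lax_forget XX (TProd \<E>)"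
  by (simp_all add: DO_forget_def)

lemma DO_forget_mor: "fib_morphism (DO_fib \<E>) \<E> (DO_forget \<E>)"
  unfolding fib_morphism_def
proof (intro conjI allI impI ballI)
  fix t assume "cartesian_arrow (DO_fib \<E>) t"
  from DO_cartesianD[OF this] show "cartesian_arrow \<E> (FA (Fun (mT (DO_forget \<E>))) t)" by simp
qed (simp_all add: Pi.C.lax_forget_ok Pi.D.lax_forget_ok)

lemma DO_forget_strict: "strict_fib_morphism (DO_fib \<E>) \<E> (DO_forget \<E>)"
  unfolding strict_fib_morphism_def using DO_forget_mor by simp

lemma DO_universal_sel:
  "do_carrier (DO_universal \<E>) = DO_forget \<E>"
  "do_zero (DO_universal \<E>) = mk_cell (DO_fib \<E>) (One (fib_hom_prod (DO_fib \<E>) \<E>)) (DO_forget \<E>) do_zero do_zero"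
  "do_sum (DO_universal \<E>) = mk_cell (DO_fib \<E>) (fmor_Prod (DO_fib \<E>) \<E> (DO_forget \<E>) (DO_forget \<E>)) (DO_forget \<E>) do_sum do_sum"
  "do_hat (DO_universal \<E>) = mk_cell (DO_fib \<E>) (fmor_T (DO_fib \<E>) \<E> (DO_forget \<E>)) (DO_forget \<E>) do_hat do_hat"
  by (simp_all add: DO_universal_def Let_def)

lemma DO_universal_cells:
  "fib_cell (DO_fib \<E>) \<E> (do_zero (DO_universal \<E>))"
  "fib_cell (DO_fib \<E>) \<E> (do_sum (DO_universal \<E>))"
  "fib_cell (DO_fib \<E>) \<E> (do_hat (DO_universal \<E>))"
  unfolding DO_universal_sel
  by (rule W.mk_cell_cell; simp add: DO_forget_mor Pi.C.forget_nat Pi.D.forget_nat)+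

lemma eval_universal:
  "differential_object BB (BProd \<E>) D \<Longrightarrow> do_map (eval_base D) (DO_universal \<E>) = D"
  "differential_object XX (TProd \<E>) E \<Longrightarrow> do_map (eval_total E) (DO_universal \<E>) = E"
  by (rule dobj_eqI; simp add: do_map_def DO_universal_sel)+

lemma DO_universal_dobj: "differential_object (fib_hom (DO_fib \<E>) \<E>) (fib_hom_prod (DO_fib \<E>) \<E>) (DO_universal \<E>)"
proof (rule W.dobj_of_evaluations)
  show "differential_object BB (BProd \<E>) (do_map (eval_base A) (DO_universal \<E>))" if "A \<in> Obj (Base (DO_fib \<E>))" for A
    using that by (simp add: eval_universal)
  show "differential_object XX (TProd \<E>) (do_map (eval_total A) (DO_universal \<E>))" if "A \<in> Obj (Total (DO_fib \<E>))" for A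
    using that by (simp add: eval_universal)
qed (use DO_universal_cells DO_forget_mor in \<open>simp_all add: DO_universal_sel\<close>)

lemma DO_universal_pointwise: "pointwise (DO_fib \<E>) \<E> (DO_universal \<E>)"
  unfolding pointwise_def Let_def
proof (intro conjI ballI)
  fix A assume "A \<in> Obj (Base (DO_fib \<E>))"
  then interpret A: dobj BB "BProd \<E>" A by (intro Pi.D.dobj_axiom) simp
  show "is_product BB (bO (do_carrier (DO_universal \<E>)) A) (bO (do_carrier (DO_universal \<E>)) A)
    (TO BB (bO (do_carrier (DO_universal \<E>)) A)) (pT BB (bO (do_carrier (DO_universal \<E>)) A)) (fst (Und (do_hat (DO_universal \<E>))) A)"
    using A.hat_product A.dobj by (simp add: DO_universal_sel)
next
  fix A assume "A \<in> Obj (Total (DO_fib \<E>))"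
  then interpret A: dobj XX "TProd \<E>" A by (intro Pi.C.dobj_axiom) simp
  show "is_product XX (tO (do_carrier (DO_universal \<E>)) A) (tO (do_carrier (DO_universal \<E>)) A)
    (TO XX (tO (do_carrier (DO_universal \<E>)) A)) (pT XX (tO (do_carrier (DO_universal \<E>)) A)) (snd (Und (do_hat (DO_universal \<E>))) A)"
    using A.hat_product A.dobj by (simp add: DO_universal_sel)
qed

end

section \<open>Differential objects of a hom-category are computed pointwise\<close>

context to_cartesian_fib
begin

lemma eval_dobj:
  assumes D: "differential_object (fib_hom \<E>1 \<E>2) (fib_hom_prod \<E>1 \<E>2) D"
  shows "A \<in> Obj (Base \<E>1) \<Longrightarrow> differential_object (Base \<E>2) (BProd \<E>2) (do_map (eval_base A) D)"
    "E \<in> Obj (Total \<E>1) \<Longrightarrow> differential_object (Total \<E>2) (TProd \<E>2) (do_map (eval_total E) D)"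
  using cartesian_functor.do_map_dobj[OF eval_cartesian_functor(1) D] cartesian_functor.do_map_dobj[OF eval_cartesian_functor(2) D]
  by simp_all

lemma full_sub_eq:
  assumes "category C" "Obj C \<subseteq> S"
  shows "full_sub C S = C"
proof -
  interpret category C by fact
  have "{A \<in> Obj C. A \<in> S} = Obj C" "{f \<in> Arr C. Dom C f \<in> S \<and> Cod C f \<in> S} = Arr C"
    using assms(2) Dom_in Cod_in by blast+
  then show ?thesis by (simp add: full_sub_def)
qed

text \<open>Evaluations preserve the tangent structure and the chosen products, so they preserve differential
  objects; the product diagram of every differential object is therefore one at each object.\<close>

lemma pointwise_DO_eq: "pointwise_DO \<E>1 \<E>2 = DO_cat (fib_hom \<E>1 \<E>2) (fib_hom_prod \<E>1 \<E>2)"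
  unfolding pointwise_DO_def
proof (rule full_sub_eq[OF H.DO_category], rule subsetI)
  fix D assume "D \<in> Obj (DO_cat (fib_hom \<E>1 \<E>2) (fib_hom_prod \<E>1 \<E>2))"
  then have D: "differential_object (fib_hom \<E>1 \<E>2) (fib_hom_prod \<E>1 \<E>2) D" by simp
  show "D \<in> {D. pointwise \<E>1 \<E>2 D}"
    unfolding pointwise_def Let_def mem_Collect_eq
  proof (intro conjI ballI)
    fix A assume "A \<in> Obj (Base \<E>1)"
    then interpret A: dobj "Base \<E>2" "BProd \<E>2" "do_map (eval_base A) D"
      by (intro E2.Pi.D.dobj_axiom eval_dobj(1)[OF D])
    show "is_product (Base \<E>2) (bO (do_carrier D) A) (bO (do_carrier D) A) (TO (Base \<E>2) (bO (do_carrier D) A))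
        (pT (Base \<E>2) (bO (do_carrier D) A)) (fst (Und (do_hat D)) A)"
      using A.hat_product by (simp add: do_map_def)
  next
    fix A assume "A \<in> Obj (Total \<E>1)"
    then interpret A: dobj "Total \<E>2" "TProd \<E>2" "do_map (eval_total A) D"
      by (intro E2.Pi.C.dobj_axiom eval_dobj(2)[OF D])
    show "is_product (Total \<E>2) (tO (do_carrier D) A) (tO (do_carrier D) A) (TO (Total \<E>2) (tO (do_carrier D) A))
        (pT (Total \<E>2) (tO (do_carrier D) A)) (snd (Und (do_hat D)) A)"
      using A.hat_product by (simp add: do_map_def)
  qed
qed

lemma fib_dobj_eqI:
  assumes D: "differential_object (fib_hom \<E>1 \<E>2) (fib_hom_prod \<E>1 \<E>2) D"
    and D': "differential_object (fib_hom \<E>1 \<E>2) (fib_hom_prod \<E>1 \<E>2) D'"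
    and c: "do_carrier D = do_carrier D'"
    and b: "\<And>A. A \<in> Obj (Base \<E>1) \<Longrightarrow> do_map (eval_base A) D = do_map (eval_base A) D'"
    and t: "\<And>E. E \<in> Obj (Total \<E>1) \<Longrightarrow> do_map (eval_total E) D = do_map (eval_total E) D'"
  shows "D = D'"
proof -
  note z = H.dobj_simps(2-4)[OF D, unfolded fib_hom_sel] H.dobj_simps(2-4)[OF D', unfolded fib_hom_sel]
  note s = H.dobj_simps(5-7)[OF D, unfolded fib_hom_sel] H.dobj_simps(5-7)[OF D', unfolded fib_hom_sel]
  note h = H.dobj_simps(8-10)[OF D, unfolded fib_hom_sel] H.dobj_simps(8-10)[OF D', unfolded fib_hom_sel]
  have bb: "fst (Und (do_zero D)) A = fst (Und (do_zero D')) A" "fst (Und (do_sum D)) A = fst (Und (do_sum D')) A"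
    "fst (Und (do_hat D)) A = fst (Und (do_hat D')) A" if "A \<in> Obj (Base \<E>1)" for A
    using b[OF that] by (simp_all add: do_map_def)
  have tt: "snd (Und (do_zero D)) A = snd (Und (do_zero D')) A" "snd (Und (do_sum D)) A = snd (Und (do_sum D')) A"
    "snd (Und (do_hat D)) A = snd (Und (do_hat D')) A" if "A \<in> Obj (Total \<E>1)" for A
    using t[OF that] by (simp_all add: do_map_def)
  show ?thesis
  proof (rule dobj_eqI[OF c])
    show "do_zero D = do_zero D'" by (rule cell_eqI[OF z(1,4) _ _ bb(1) tt(1)]) (simp_all add: z c)
    show "do_sum D = do_sum D'" by (rule cell_eqI[OF s(1,4) _ _ bb(2) tt(2)]) (simp_all add: s c)
    show "do_hat D = do_hat D'" by (rule cell_eqI[OF h(1,4) _ _ bb(3) tt(3)]) (simp_all add: h c)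
  qed
qed

end

section \<open>Lax morphisms into differential objects\<close>

lemma lax_eqI:
  assumes "lax_ok C D L" "lax_ok C D L'" "\<And>A. A \<in> Obj C \<Longrightarrow> FO (Fun L) A = FO (Fun L') A"
    "\<And>f. f \<in> Arr C \<Longrightarrow> FA (Fun L) f = FA (Fun L') f" "\<And>A. A \<in> Obj C \<Longrightarrow> Str L A = Str L' A"
  shows "L = L'"
proof -
  have "FO (Fun L) = FO (Fun L')"
    by (rule extensionalityI[OF lax_ok_ext(1)[OF assms(1)] lax_ok_ext(1)[OF assms(2)] assms(3)])
  moreover have "FA (Fun L) = FA (Fun L')"
    by (rule extensionalityI[OF lax_ok_ext(2)[OF assms(1)] lax_ok_ext(2)[OF assms(2)] assms(4)])
  moreover have "Str L = Str L'"
    by (rule extensionalityI[OF lax_ok_ext(3)[OF assms(1)] lax_ok_ext(3)[OF assms(2)] assms(5)])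
  ultimately show "L = L'" by (cases L; cases L'; cases "Fun L"; cases "Fun L'") auto
qed

lemma fmor_eqI: "\<lbrakk>mB M = mB N; mT M = mT N\<rbrakk> \<Longrightarrow> M = (N :: ('e1, 'em1, 'b1, 'bm1, 'e2, 'em2, 'b2, 'bm2) fmor)"
  by (cases M; cases N) simp

locale lax_DO = cartesian_tangent C P for C :: "('o, 'm, 'x) tcat_scheme" (structure) and P +
  fixes C0 :: "('o0, 'm0, 'z) tcat_scheme" and H
  assumes ok: "lax_ok C0 (DO_cat C P) H"

sublocale lax_DO \<subseteq> L: lax_object C0 "DO_cat C P" H
  by (rule lax_objectI[OF ok])

sublocale lax_DO \<subseteq> Q: to_cartesian C0 C P ..

sublocale lax_DO \<subseteq> R: to_cartesian "DO_cat C P" C P ..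

context lax_DO
begin

lemma H_simps [simp]:
  "A \<in> Obj C0 \<Longrightarrow> differential_object C P (FO (Fun H) A)"
  "f \<in> Arr C0 \<Longrightarrow> linear_map C P (FA (Fun H) f)"
  "f \<in> Arr C0 \<Longrightarrow> Src (FA (Fun H) f) = FO (Fun H) (Dom C0 f)"
  "f \<in> Arr C0 \<Longrightarrow> Tgt (FA (Fun H) f) = FO (Fun H) (Cod C0 f)"
  "A \<in> Obj C0 \<Longrightarrow> linear_map C P (Str H A)"
  "A \<in> Obj C0 \<Longrightarrow> Src (Str H A) = FO (Fun H) (TO C0 A)"
  "A \<in> Obj C0 \<Longrightarrow> Tgt (Str H A) = do_T C P (FO (Fun H) A)"
  using L.F_simps(1)[of A] L.F_simps(2-4)[of f] L.\<alpha>_simps[of A] by simp_all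

abbreviation F where "F \<equiv> lax_forget C P"
abbreviation FH where "FH \<equiv> lax_comp C0 C F H"

lemma FH_ok: "lax_ok C0 C FH"
  by (rule lax_comp_ok[OF ok lax_forget_ok])

lemma FH_Str [simp]: "A \<in> Obj C0 \<Longrightarrow> Str FH A = Und (Str H A)"
  by simp

text \<open>Composition with \<open>H\<close> commutes strictly with the operations on lax morphisms. Hence the structure of
  the universal differential object, restricted along \<open>H\<close>, is typed by the operations on the composite.\<close>

lemma comp_One: "lax_comp C0 C (lax_One (DO_cat C P) C P) H = lax_One C0 C P"
  by (rule lax_eqI[OF lax_comp_ok[OF ok R.lax_One_ok] Q.lax_One_ok]) simp_all

lemma comp_Prod: "lax_comp C0 C (lax_Prod (DO_cat C P) C P F F) H = lax_Prod C0 C P FH FH"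
proof (rule lax_eqI[OF lax_comp_ok[OF ok R.lax_Prod_ok[OF lax_forget_ok lax_forget_ok]] Q.lax_Prod_ok[OF FH_ok FH_ok]])
  fix A assume A: "A \<in> Obj C0"
  show "Str (lax_comp C0 C (lax_Prod (DO_cat C P) C P F F) H) A = Str (lax_Prod C0 C P FH FH) A"
    using A by (simp add: lax_Prod_def Let_def ftr_restrict_def)
qed simp_all

lemma comp_T: "lax_comp C0 C (lax_T (DO_cat C P) C F) H = lax_T C0 C FH"
  by (rule lax_eqI[OF lax_comp_ok[OF ok lax_T_ok[OF lax_forget_ok]] lax_T_ok[OF FH_ok]]) simp_all

lemma T_comp: "lax_comp C0 C F (lax_T C0 (DO_cat C P) H) = lax_T C0 C FH"
proof -
  interpret N: lax_DO C P C0 "lax_T C0 (DO_cat C P) H" by unfold_locales (rule lax_T_ok[OF ok])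
  show ?thesis
    by (rule lax_eqI[OF N.FH_ok lax_T_ok[OF FH_ok]])
      (use N.H_simps(2,5) in simp_all)
qed

lemma Tn_comp:
  assumes n: "1 \<le> n"
  shows "lax_comp C0 C F (lax_Tn C0 (DO_cat C P) n H) = lax_Tn C0 C n FH"
proof -
  interpret M: lax_object C0 C FH by (rule lax_objectI[OF FH_ok])
  note TnF = tangent_preserving_TnF[OF L.D.pre_tangent_category_axioms pre_tangent_category_axioms und_preserving _ n]
  have lin: "linear_map C P (FA (TnF (DO_cat C P) n) (FA (Fun H) f))" if "f \<in> Arr C0" for f
    using L.D.TnF_simps(1)[of "FA (Fun H) f" n] that n by simp
  show ?thesis
  proof (rule lax_eqI[OF lax_comp_ok[OF L.lax_Tn_ok[OF n] lax_forget_ok] M.lax_Tn_ok[OF n]])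
    fix f assume f: "f \<in> Arr C0"
    show "FA (Fun (lax_comp C0 C F (lax_Tn C0 (DO_cat C P) n H))) f = FA (Fun (lax_Tn C0 C n FH)) f"
      using f lin[OF f] TnF[of "FA (Fun H) f"] by simp
  next
    fix A assume A: "A \<in> Obj C0"
    note s = L.lax_Tn_Str[OF A] and t = M.lax_Tn_Str[OF A]
    let ?S = "Str (lax_Tn C0 (DO_cat C P) n H) A"
    have S: "linear_map C P ?S" "Src ?S = do_Tn C P n (FO (Fun H) (TO C0 A))" "Tgt ?S = do_T C P (do_Tn C P n (FO (Fun H) A))"
      using s(1-3)[OF n] A by simp_all
    have pr: "TA C (pr C n i (do_carrier (FO (Fun H) A))) \<cdot> Und ?S =
        cT C (do_carrier (FO (Fun H) A)) \<cdot> (TA C (Und (Str H A)) \<cdot> pr C n i (do_carrier (FO (Fun H) (TO C0 A))))" if "i < n" for i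
      using arg_cong[OF s(4)[OF that], of Und] by simp
    have "Und ?S = Str (lax_Tn C0 C n FH) A"
    proof (rule TTn_eqI[where n = n and A = "do_carrier (FO (Fun H) A)"])
      show "TA C (pr C n i (do_carrier (FO (Fun H) A))) \<cdot> Und ?S = TA C (pr C n i (do_carrier (FO (Fun H) A))) \<cdot> Str (lax_Tn C0 C n FH) A"
        if "i < n" for i using pr[OF that] t(4)[OF that] A by simp
    qed (use S t(1-3)[OF n] A n in simp_all)
    then show "Str (lax_comp C0 C F (lax_Tn C0 (DO_cat C P) n H)) A = Str (lax_Tn C0 C n FH) A"
      using A S n t(1-3)[OF n] by simp
  qed (use n in simp_all)
qed

end

text \<open>The factorisation of \<open>M\<close> through differential objects that is determined by a differential object
  \<open>X A\<close> over each value: on arrows and for the lax structure, only the tags are new.\<close>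

definition lift_lax ::
  "('o0, 'm0, 'z) tcat_scheme \<Rightarrow> ('o, 'm, 'x) tcat_scheme \<Rightarrow> ('o, 'm) products \<Rightarrow> ('o0, 'm0, 'o, 'm) lax \<Rightarrow>
   ('o0 \<Rightarrow> ('o, 'm) dobj) \<Rightarrow> ('o0, 'm0, ('o, 'm) dobj, (('o, 'm) dobj, 'm) tagged) lax" where
  "lift_lax C0 C P M X =
     \<lparr>Fun = ftr_restrict C0 \<lparr>FO = X, FA = (\<lambda>f. tag (X (Dom C0 f)) (X (Cod C0 f)) (FA (Fun M) f))\<rparr>,
      Str = (\<lambda>A\<in>Obj C0. tag (X (TO C0 A)) (do_T C P (X A)) (Str M A))\<rparr>"

lemma lift_lax_sel [simp]:
  "A \<in> Obj C0 \<Longrightarrow> FO (Fun (lift_lax C0 C P M X)) A = X A"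
  "f \<in> Arr C0 \<Longrightarrow> FA (Fun (lift_lax C0 C P M X)) f = tag (X (Dom C0 f)) (X (Cod C0 f)) (FA (Fun M) f)"
  "A \<in> Obj C0 \<Longrightarrow> Str (lift_lax C0 C P M X) A = tag (X (TO C0 A)) (do_T C P (X A)) (Str M A)"
  by (simp_all add: lift_lax_def ftr_restrict_def)

text \<open>Naturality of the projections says that \<open>M\<close> sends arrows to linear maps, their compatibility with
  the lax structures that the structure arrows of \<open>M\<close> are linear.\<close>

lemma (in cartesian_tangent) lift_lax_ok:
  assumes M: "lax_ok C0 C M"
    and X: "\<And>A. A \<in> Obj C0 \<Longrightarrow> differential_object C P (X A)"
    and XM: "\<And>A. A \<in> Obj C0 \<Longrightarrow> do_carrier (X A) = FO (Fun M) A"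
    and hat: "tangent_nat C0 C (lax_T C0 C M) M (\<lambda>A. do_hat (X A))"
  shows "lax_ok C0 (DO_cat C P) (lift_lax C0 C P M X)"
proof -
  interpret M: lax_object C0 C M by (rule lax_objectI[OF M])
  interpret D: tangent_category "DO_cat C P" by (rule DO_tangent_category)
  interpret U: cartesian_functor "DO_cat C P" "DO_prod C P" C P und by (rule und_functor)
  note h = tangent_natD[OF hat]
  let ?L = "lift_lax C0 C P M X"
  have lf: "linear_map C P (tag (X (Dom C0 f)) (X (Cod C0 f)) (FA (Fun M) f))" if "f \<in> Arr C0" for f
    by (rule linear_mapI) (use that X XM h(4)[OF that] in simp_all)
  have ls: "linear_map C P (tag (X (TO C0 A)) (do_T C P (X A)) (Str M A))" if "A \<in> Obj C0" for A
    by (rule linear_mapI) (use that X XM h(5)[OF that] in simp_all)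
  have "lax_tangent_morphism C0 (DO_cat C P) (Fun ?L) (Str ?L)"
  proof (rule laxI)
    show "is_functor C0 (DO_cat C P) (Fun ?L)"
      unfolding is_functor_def using X XM lf by simp
    fix A assume A: "A \<in> Obj C0"
    note x = X[OF A] XM[OF A]
    show "Str ?L A \<in> Homs (DO_cat C P) (FO (Fun ?L) (TO C0 A)) (TO (DO_cat C P) (FO (Fun ?L) A))"
      using A ls by simp
    show "pT (DO_cat C P) (FO (Fun ?L) A) \<cdot>\<^bsub>DO_cat C P\<^esub> Str ?L A = FA (Fun ?L) (pT C0 A)"
      using A XM by (simp add: M.lax_laws)
    show "Str ?L A \<cdot>\<^bsub>DO_cat C P\<^esub> FA (Fun ?L) (zT C0 A) = zT (DO_cat C P) (FO (Fun ?L) A)"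
      using A XM by (simp add: M.lax_laws)
    show "lT (DO_cat C P) (FO (Fun ?L) A) \<cdot>\<^bsub>DO_cat C P\<^esub> Str ?L A =
      TA (DO_cat C P) (Str ?L A) \<cdot>\<^bsub>DO_cat C P\<^esub> (Str ?L (TO C0 A) \<cdot>\<^bsub>DO_cat C P\<^esub> FA (Fun ?L) (lT C0 A))"
      using A XM by (simp add: M.lax_laws)
    show "cT (DO_cat C P) (FO (Fun ?L) A) \<cdot>\<^bsub>DO_cat C P\<^esub> (TA (DO_cat C P) (Str ?L A) \<cdot>\<^bsub>DO_cat C P\<^esub> Str ?L (TO C0 A)) =
      TA (DO_cat C P) (Str ?L A) \<cdot>\<^bsub>DO_cat C P\<^esub> (Str ?L (TO C0 A) \<cdot>\<^bsub>DO_cat C P\<^esub> FA (Fun ?L) (cT C0 A))"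
      using A XM by (simp add: M.lax_laws)
    let ?u = "Str ?L A \<cdot>\<^bsub>DO_cat C P\<^esub> FA (Fun ?L) (pr C0 2 0 A)" and ?v = "Str ?L A \<cdot>\<^bsub>DO_cat C P\<^esub> FA (Fun ?L) (pr C0 2 1 A)"
    let ?t = "T2pair (DO_cat C P) (X (Tn C0 2 A)) (X A) ?u ?v"
    have uv: "?u \<in> Arr (DO_cat C P)" "?v \<in> Arr (DO_cat C P)" "Dom (DO_cat C P) ?u = X (Tn C0 2 A)" "Dom (DO_cat C P) ?v = X (Tn C0 2 A)"
      "Cod (DO_cat C P) ?u = TO (DO_cat C P) (X A)" "Cod (DO_cat C P) ?v = TO (DO_cat C P) (X A)"
      using A D.Comp_simps[of "FA (Fun ?L) (pr C0 2 0 A)" "Str ?L A"] D.Comp_simps[of "FA (Fun ?L) (pr C0 2 1 A)" "Str ?L A"]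
        ls[OF A] lf[of "pr C0 2 0 A"] lf[of "pr C0 2 1 A"] by simp_all
    have p: "pT (DO_cat C P) (X A) \<cdot>\<^bsub>DO_cat C P\<^esub> ?u = pT (DO_cat C P) (X A) \<cdot>\<^bsub>DO_cat C P\<^esub> ?v"
      using A XM by (simp add: M.lax_laws)
    have XA: "X A \<in> Obj (DO_cat C P)" using x by simp
    have t: "?t \<in> Arr (DO_cat C P)" "Dom (DO_cat C P) ?t = X (Tn C0 2 A)" "Cod (DO_cat C P) ?t = do_Tn C P 2 (X A)"
      "FA und ?t = T2pair C (FO und (X (Tn C0 2 A))) (FO und (X A)) (FA und ?u) (FA und ?v)"
      using D.T2pair_simps(1-3)[OF XA uv p] U.F_pairing(1)[OF XA uv p] by simp_all
    show "Str ?L A \<cdot>\<^bsub>DO_cat C P\<^esub> FA (Fun ?L) (sT C0 A) =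
      sT (DO_cat C P) (FO (Fun ?L) A) \<cdot>\<^bsub>DO_cat C P\<^esub> T2pair (DO_cat C P) (FO (Fun ?L) (Tn C0 2 A)) (FO (Fun ?L) A) ?u ?v"
      using A XM t by (intro tagged_eqI) (simp_all add: M.lax_laws)
  next
    fix f assume f: "f \<in> Arr C0"
    show "Str ?L (Cod C0 f) \<cdot>\<^bsub>DO_cat C P\<^esub> FA (Fun ?L) (TA C0 f) = TA (DO_cat C P) (FA (Fun ?L) f) \<cdot>\<^bsub>DO_cat C P\<^esub> Str ?L (Dom C0 f)"
      using f by (simp add: M.\<alpha>_nat)
  qed (simp_all add: M.C.tangent_category_axioms D.tangent_category_axioms)
  then show ?thesis by (simp add: lax_ok_def) (simp add: lift_lax_def ftr_restrict_def)
qed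

lemma (in cartesian_tangent) forget_lift_lax:
  assumes M: "lax_ok C0 C M"
    and X: "\<And>A. A \<in> Obj C0 \<Longrightarrow> differential_object C P (X A)"
    and XM: "\<And>A. A \<in> Obj C0 \<Longrightarrow> do_carrier (X A) = FO (Fun M) A"
    and hat: "tangent_nat C0 C (lax_T C0 C M) M (\<lambda>A. do_hat (X A))"
  shows "lax_comp C0 C (lax_forget C P) (lift_lax C0 C P M X) = M"
proof -
  interpret L: lax_DO C P C0 "lift_lax C0 C P M X" by unfold_locales (rule lift_lax_ok[OF assms])
  interpret M: lax_object C0 C M by (rule lax_objectI[OF M])
  show ?thesis
  proof (rule lax_eqI[OF L.FH_ok M])
    show "FA (Fun L.FH) f = FA (Fun M) f" if "f \<in> Arr C0" for f
      using that L.H_simps(2)[OF that] by simp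
    show "Str L.FH A = Str M A" if "A \<in> Obj C0" for A
      using L.FH_Str[OF that] that by simp
  qed (use X XM in simp_all)
qed

section \<open>The comparison functor\<close>

locale comparison = fibration_of_DO \<E> k + E0: tangent_fib \<E>0
  for \<E> :: "('e, 'em, 'b, 'bm) ctfib" and k and \<E>0 :: "('e0, 'em0, 'b0, 'bm0, 'z) tfib_scheme"

sublocale comparison \<subseteq> K: to_cartesian_fib \<E>0 \<E> k ..

sublocale comparison \<subseteq> L: tangent_fibrations \<E>0 "DO_fib \<E>" ..

context comparison
begin

abbreviation "B0 \<equiv> Base \<E>0"
abbreviation "X0 \<equiv> Total \<E>0"
abbreviation "PB \<equiv> BProd \<E>"
abbreviation "PX \<equiv> TProd \<E>"
abbreviation "U \<equiv> DO_forget \<E>"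
abbreviation "V \<equiv> DO_universal \<E>"
abbreviation "pull \<equiv> pullback_dobj \<E>0 \<E> V"
abbreviation "cmp \<equiv> fmor_comp \<E>0 \<E>"
abbreviation "G \<equiv> DO_comparison \<E>0 \<E> V"
abbreviation "hom0 \<equiv> fib_hom \<E>0 \<E>"
abbreviation "prod0 \<equiv> fib_hom_prod \<E>0 \<E>"

lemma laxB: "fib_morphism \<E>0 (DO_fib \<E>) H \<Longrightarrow> lax_DO BB PB B0 (mB H)"
  and laxT: "fib_morphism \<E>0 (DO_fib \<E>) H \<Longrightarrow> lax_DO XX PX X0 (mT H)"
  using L.mor_ok[of H] by (unfold_locales; simp)+

lemma mor_DO_simps [simp]:
  assumes "fib_morphism \<E>0 (DO_fib \<E>) H"
  shows "A \<in> Obj B0 \<Longrightarrow> differential_object BB PB (bO H A)" "f \<in> Arr B0 \<Longrightarrow> linear_map BB PB (FA (Fun (mB H)) f)"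
    "f \<in> Arr B0 \<Longrightarrow> Src (FA (Fun (mB H)) f) = bO H (Dom B0 f)" "f \<in> Arr B0 \<Longrightarrow> Tgt (FA (Fun (mB H)) f) = bO H (Cod B0 f)"
    "A \<in> Obj B0 \<Longrightarrow> linear_map BB PB (Str (mB H) A)"
    "A \<in> Obj B0 \<Longrightarrow> Src (Str (mB H) A) = bO H (TO B0 A)" "A \<in> Obj B0 \<Longrightarrow> Tgt (Str (mB H) A) = do_T BB PB (bO H A)"
    "E \<in> Obj X0 \<Longrightarrow> differential_object XX PX (tO H E)" "g \<in> Arr X0 \<Longrightarrow> linear_map XX PX (FA (Fun (mT H)) g)"
    "g \<in> Arr X0 \<Longrightarrow> Src (FA (Fun (mT H)) g) = tO H (Dom X0 g)" "g \<in> Arr X0 \<Longrightarrow> Tgt (FA (Fun (mT H)) g) = tO H (Cod X0 g)"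
    "E \<in> Obj X0 \<Longrightarrow> linear_map XX PX (Str (mT H) E)"
    "E \<in> Obj X0 \<Longrightarrow> Src (Str (mT H) E) = tO H (TO X0 E)" "E \<in> Obj X0 \<Longrightarrow> Tgt (Str (mT H) E) = do_T XX PX (tO H E)"
  by (rule lax_DO.H_simps[OF laxB[OF assms]] lax_DO.H_simps[OF laxT[OF assms]]; assumption)+

lemma cell_DO_simps [simp]:
  assumes "fib_cell \<E>0 (DO_fib \<E>) t"
  shows "A \<in> Obj B0 \<Longrightarrow> linear_map BB PB (fst (Und t) A)" "A \<in> Obj B0 \<Longrightarrow> Src (fst (Und t) A) = bO (Src t) A"
    "A \<in> Obj B0 \<Longrightarrow> Tgt (fst (Und t) A) = bO (Tgt t) A"
    "E \<in> Obj X0 \<Longrightarrow> linear_map XX PX (snd (Und t) E)" "E \<in> Obj X0 \<Longrightarrow> Src (snd (Und t) E) = tO (Src t) E"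
    "E \<in> Obj X0 \<Longrightarrow> Tgt (snd (Und t) E) = tO (Tgt t) E"
  using L.cell_simps(3-5)[OF assms, of A] L.cell_simps(6-8)[OF assms, of E] by simp_all

lemma comp_sel [simp]: "mB (cmp N H) = lax_comp B0 BB (mB N) (mB H)" "mT (cmp N H) = lax_comp X0 XX (mT N) (mT H)"
  by (simp_all add: fmor_comp_def)

lemma comp_mor [simp]:
  assumes N: "fib_morphism (DO_fib \<E>) \<E> N" and H: "fib_morphism \<E>0 (DO_fib \<E>) H"
  shows "fib_morphism \<E>0 \<E> (cmp N H)"
proof -
  interpret Nb: lax_object "Base (DO_fib \<E>)" BB "mB N" by (rule W.morB[OF N])
  interpret Nt: lax_object "Total (DO_fib \<E>)" XX "mT N" by (rule W.morT[OF N])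
  show ?thesis
    unfolding fib_morphism_def
  proof (intro conjI allI impI ballI)
    show "lax_ok B0 BB (mB (cmp N H))" "lax_ok X0 XX (mT (cmp N H))"
      using lax_comp_ok[OF L.mor_ok(1)[OF H] W.mor_ok(1)[OF N]] lax_comp_ok[OF L.mor_ok(2)[OF H] W.mor_ok(2)[OF N]] by simp_all
    fix E assume E: "E \<in> Obj X0"
    have o: "tO H E \<in> Obj (Total (DO_fib \<E>))" "Str (mT H) E \<in> Arr (Total (DO_fib \<E>))"
      "bO H (FO (Proj \<E>0) E) \<in> Obj (Base (DO_fib \<E>))" "Str (mB H) (FO (Proj \<E>0) E) \<in> Arr (Base (DO_fib \<E>))"
      using H E by simp_all
    have p: "do_map (Proj \<E>) (tO H E) = bO H (FO (Proj \<E>0) E)" "FA Pi.do_ftr (Str (mT H) E) = Str (mB H) (FO (Proj \<E>0) E)"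
      using L.mor_simps(3,6)[OF H E] by simp_all
    show "\<Pi>O (tO (cmp N H) E) = bO (cmp N H) (FO (Proj \<E>0) E)"
      using W.mor_simps(3)[OF N o(1)] E p(1) by simp
    show "\<Pi>A (Str (mT (cmp N H)) E) = Str (mB (cmp N H)) (FO (Proj \<E>0) E)"
      using W.mor_simps(4)[OF N o(2)] W.mor_simps(6)[OF N o(1)] E p o Nt.\<alpha>_simps[OF o(1)] Nt.F_simps(2-4)[OF o(2)] H
      by simp
  next
    fix f assume f: "f \<in> Arr X0"
    have o: "FA (Fun (mT H)) f \<in> Arr (Total (DO_fib \<E>))" using H f by simp
    have "FA Pi.do_ftr (FA (Fun (mT H)) f) = FA (Fun (mB H)) (FA (Proj \<E>0) f)"
      using L.mor_simps(4)[OF H f] by simp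
    then show "\<Pi>A (FA (Fun (mT (cmp N H))) f) = FA (Fun (mB (cmp N H))) (FA (Proj \<E>0) f)"
      using W.mor_simps(4)[OF N o] f by simp
  next
    fix \<phi> assume "cartesian_arrow \<E>0 \<phi>"
    then show "cartesian_arrow \<E> (FA (Fun (mT (cmp N H))) \<phi>)"
      using W.mor_simps(5)[OF N L.mor_simps(5)[OF H]] by simp
  qed
qed

lemma comp_One: "fib_morphism \<E>0 (DO_fib \<E>) H \<Longrightarrow> cmp (One (fib_hom_prod (DO_fib \<E>) \<E>)) H = One prod0"
  using lax_DO.comp_One[OF laxB] lax_DO.comp_One[OF laxT] by (intro fmor_eqI) simp_all

lemma comp_Prod: "fib_morphism \<E>0 (DO_fib \<E>) H \<Longrightarrow> cmp (fmor_Prod (DO_fib \<E>) \<E> U U) H = fmor_Prod \<E>0 \<E> (cmp U H) (cmp U H)"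
  using lax_DO.comp_Prod[OF laxB] lax_DO.comp_Prod[OF laxT] by (intro fmor_eqI) simp_all

lemma comp_T: "fib_morphism \<E>0 (DO_fib \<E>) H \<Longrightarrow> cmp (fmor_T (DO_fib \<E>) \<E> U) H = fmor_T \<E>0 \<E> (cmp U H)"
  using lax_DO.comp_T[OF laxB] lax_DO.comp_T[OF laxT] by (intro fmor_eqI) simp_all

lemma T_comp: "fib_morphism \<E>0 (DO_fib \<E>) H \<Longrightarrow> cmp U (fmor_T \<E>0 (DO_fib \<E>) H) = fmor_T \<E>0 \<E> (cmp U H)"
  using lax_DO.T_comp[OF laxB] lax_DO.T_comp[OF laxT] by (intro fmor_eqI) simp_all

lemma Tn_comp: "fib_morphism \<E>0 (DO_fib \<E>) H \<Longrightarrow> 1 \<le> n \<Longrightarrow> cmp U (fmor_Tn \<E>0 (DO_fib \<E>) n H) = fmor_Tn \<E>0 \<E> n (cmp U H)"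
  using lax_DO.Tn_comp[OF laxB] lax_DO.Tn_comp[OF laxT] by (intro fmor_eqI) simp_all

lemma whisker_source_nat:
  assumes H: "lax_ok C0 C1 H" and M: "lax_ok C1 C2 M" and N: "lax_ok C1 C2 N" and t: "tangent_nat C1 C2 M N \<phi>"
  shows "tangent_nat C0 C2 (lax_comp C0 C2 M H) (lax_comp C0 C2 N H) (\<lambda>A. \<phi> (FO (Fun H) A))"
proof -
  interpret H: lax_object C0 C1 H by (rule lax_objectI[OF H])
  interpret M: lax_object C1 C2 M by (rule lax_objectI[OF M])
  interpret N: lax_object C1 C2 N by (rule lax_objectI[OF N])
  note n = tangent_natD[OF t]
  show ?thesis
  proof (rule tangent_natI)
    fix A assume A: "A \<in> Obj C0"
    show "TA C2 (\<phi> (H.mO A)) \<cdot>\<^bsub>C2\<^esub> Str (lax_comp C0 C2 M H) A = Str (lax_comp C0 C2 N H) A \<cdot>\<^bsub>C2\<^esub> \<phi> (H.mO (TO C0 A))"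
      using A n(1-3) n(4)[of "Str H A"] M.D.reassoc[OF n(5)[of "H.mO A"], of "M.mA (Str H A)"] by simp
  next
    fix f assume f: "f \<in> Arr C0"
    show "\<phi> (H.mO (Cod C0 f)) \<cdot>\<^bsub>C2\<^esub> FA (Fun (lax_comp C0 C2 M H)) f = FA (Fun (lax_comp C0 C2 N H)) f \<cdot>\<^bsub>C2\<^esub> \<phi> (H.mO (Dom C0 f))"
      using f n(4)[of "H.mA f"] by simp
  qed (use n(1-3) in simp_all)
qed

lemma whisker_target_nat:
  assumes M: "lax_ok C0 C1 M" and N: "lax_ok C0 C1 N" and t: "tangent_nat C0 C1 M N \<phi>" and H: "lax_ok C1 C2 H"
  shows "tangent_nat C0 C2 (lax_comp C0 C2 H M) (lax_comp C0 C2 H N) (\<lambda>A. FA (Fun H) (\<phi> A))"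
proof -
  interpret M: lax_object C0 C1 M by (rule lax_objectI[OF M])
  interpret N: lax_object C0 C1 N by (rule lax_objectI[OF N])
  interpret H: lax_object C1 C2 H by (rule lax_objectI[OF H])
  note n = tangent_natD[OF t]
  show ?thesis
  proof (rule tangent_natI)
    fix f assume f: "f \<in> Arr C0"
    show "H.mA (\<phi> (Cod C0 f)) \<cdot>\<^bsub>C2\<^esub> FA (Fun (lax_comp C0 C2 H M)) f = FA (Fun (lax_comp C0 C2 H N)) f \<cdot>\<^bsub>C2\<^esub> H.mA (\<phi> (Dom C0 f))"
      using f n(1-3) arg_cong[OF n(4)[OF f], of H.mA] by simp
  next
    fix A assume A: "A \<in> Obj C0"
    show "TA C2 (H.mA (\<phi> A)) \<cdot>\<^bsub>C2\<^esub> Str (lax_comp C0 C2 H M) A = Str (lax_comp C0 C2 H N) A \<cdot>\<^bsub>C2\<^esub> H.mA (\<phi> (TO C0 A))"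
      using A n(1-3) arg_cong[OF n(5)[OF A], of H.mA] H.\<alpha>_nat_x[of "\<phi> A" "N.mO A" "H.mA (Str M A)"] by simp
  qed (use n(1-3) in simp_all)
qed

lemma whisker_source_cell:
  assumes H: "fib_morphism \<E>0 (DO_fib \<E>) H" and c: "fib_cell (DO_fib \<E>) \<E> c"
  shows "fib_cell \<E>0 \<E> (whisker_source \<E>0 \<E> c H)"
  unfolding whisker_source_def
proof (rule K.mk_cell_cell)
  have MN: "fib_morphism (DO_fib \<E>) \<E> (Src c)" "fib_morphism (DO_fib \<E>) \<E> (Tgt c)" using c by simp_all
  show "tangent_nat B0 BB (mB (cmp (Src c) H)) (mB (cmp (Tgt c) H)) (\<lambda>A. fst (Und c) (bO H A))"
    using whisker_source_nat[OF L.mor_ok(1)[OF H] W.mor_ok(1)[OF MN(1)] W.mor_ok(1)[OF MN(2)] W.cell_nat(1)[OF c]] by simp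
  show "tangent_nat X0 XX (mT (cmp (Src c) H)) (mT (cmp (Tgt c) H)) (\<lambda>A. snd (Und c) (tO H A))"
    using whisker_source_nat[OF L.mor_ok(2)[OF H] W.mor_ok(2)[OF MN(1)] W.mor_ok(2)[OF MN(2)] W.cell_nat(2)[OF c]] by simp
  fix E assume E: "E \<in> Obj X0"
  then have o: "tO H E \<in> Obj (Total (DO_fib \<E>))" using H by simp
  show "\<Pi>A (snd (Und c) (tO H E)) = fst (Und c) (bO H (FO (Proj \<E>0) E))"
    using W.cell_simps(9)[OF c o] L.mor_simps(3)[OF H E] by simp
qed (use H c in simp_all)

lemma whisker_target_cell:
  assumes t: "fib_cell \<E>0 (DO_fib \<E>) t"
  shows "fib_cell \<E>0 \<E> (whisker_target \<E>0 \<E> U t)"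
  unfolding whisker_target_def
proof (rule K.mk_cell_cell)
  have MN: "fib_morphism \<E>0 (DO_fib \<E>) (Src t)" "fib_morphism \<E>0 (DO_fib \<E>) (Tgt t)" using t by simp_all
  note U = W.mor_ok[OF DO_forget_mor]
  show "tangent_nat B0 BB (mB (cmp U (Src t))) (mB (cmp U (Tgt t))) (\<lambda>A. FA (Fun (mB U)) (fst (Und t) A))"
    using whisker_target_nat[OF L.mor_ok(1)[OF MN(1)] L.mor_ok(1)[OF MN(2)] L.cell_nat(1)[OF t] U(1)] by simp
  show "tangent_nat X0 XX (mT (cmp U (Src t))) (mT (cmp U (Tgt t))) (\<lambda>A. FA (Fun (mT U)) (snd (Und t) A))"
    using whisker_target_nat[OF L.mor_ok(2)[OF MN(1)] L.mor_ok(2)[OF MN(2)] L.cell_nat(2)[OF t] U(2)] by simp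
  fix E assume E: "E \<in> Obj X0"
  show "\<Pi>A (FA (Fun (mT U)) (snd (Und t) E)) = FA (Fun (mB U)) (fst (Und t) (FO (Proj \<E>0) E))"
    using arg_cong[OF L.cell_simps(9)[OF t E], of Und] E t by simp
qed (use DO_forget_mor t in simp_all)

lemma pull_sel:
  "do_carrier (pull H) = cmp U H" "do_zero (pull H) = whisker_source \<E>0 \<E> (do_zero V) H"
  "do_sum (pull H) = whisker_source \<E>0 \<E> (do_sum V) H" "do_hat (pull H) = whisker_source \<E>0 \<E> (do_hat V) H"
  by (simp_all add: pullback_dobj_def DO_universal_sel)

text \<open>The universal differential object restricted along \<open>H\<close> has the values of \<open>H\<close> as its values. All
  properties of the comparison are read off from this, one component at a time.\<close>

lemma pull_eval [simp]:
  assumes H: "fib_morphism \<E>0 (DO_fib \<E>) H"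
  shows "A \<in> Obj B0 \<Longrightarrow> do_map (eval_base A) (pull H) = bO H A" "E \<in> Obj X0 \<Longrightarrow> do_map (eval_total E) (pull H) = tO H E"
  by (rule dobj_eqI; use H in \<open>simp add: do_map_def pull_sel whisker_source_def DO_universal_sel\<close>)+

lemma pull_dobj [simp]:
  assumes H: "fib_morphism \<E>0 (DO_fib \<E>) H"
  shows "differential_object hom0 prod0 (pull H)"
proof (rule K.dobj_of_evaluations)
  note c = whisker_source_cell[OF H DO_universal_cells(1)] whisker_source_cell[OF H DO_universal_cells(2)]
    whisker_source_cell[OF H DO_universal_cells(3)]
  have d: "Src (whisker_source \<E>0 \<E> c H) = cmp (Src c) H" "Tgt (whisker_source \<E>0 \<E> c H) = cmp (Tgt c) H" for c
    by (simp_all add: whisker_source_def)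
  show "do_zero (pull H) \<in> Homs hom0 (One prod0) (do_carrier (pull H))"
    using c(1) by (simp add: pull_sel d) (simp add: DO_universal_sel comp_One[OF H])
  show "do_sum (pull H) \<in> Homs hom0 (fmor_Prod \<E>0 \<E> (do_carrier (pull H)) (do_carrier (pull H))) (do_carrier (pull H))"
    using c(2) by (simp add: pull_sel d) (simp add: DO_universal_sel comp_Prod[OF H])
  show "do_hat (pull H) \<in> Homs hom0 (fmor_T \<E>0 \<E> (do_carrier (pull H))) (do_carrier (pull H))"
    using c(3) by (simp add: pull_sel d) (simp add: DO_universal_sel comp_T[OF H])
qed (use H DO_forget_mor in \<open>simp_all add: pull_sel\<close>)

lemma G_sel: "FO G H = pull H" "FA G t = tag (pull (Src t)) (pull (Tgt t)) (whisker_target \<E>0 \<E> U t)"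
  by (simp_all add: DO_comparison_def DO_universal_sel)

lemma whisker_target_sel [simp]:
  assumes "fib_cell \<E>0 (DO_fib \<E>) t"
  shows "Src (whisker_target \<E>0 \<E> U t) = cmp U (Src t)" "Tgt (whisker_target \<E>0 \<E> U t) = cmp U (Tgt t)"
    "A \<in> Obj B0 \<Longrightarrow> fst (Und (whisker_target \<E>0 \<E> U t)) A = Und (fst (Und t) A)"
    "E \<in> Obj X0 \<Longrightarrow> snd (Und (whisker_target \<E>0 \<E> U t)) E = Und (snd (Und t) E)"
  using assms by (simp_all add: whisker_target_def)

lemma pull_hat:
  assumes H: "fib_morphism \<E>0 (DO_fib \<E>) H"
  shows "A \<in> Obj B0 \<Longrightarrow> fst (Und (do_hat (pull H))) A = do_hat (bO H A)" "E \<in> Obj X0 \<Longrightarrow> snd (Und (do_hat (pull H))) E = do_hat (tO H E)"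
  using H by (simp_all add: pull_sel whisker_source_def DO_universal_sel)

lemma G_linear:
  assumes t: "fib_cell \<E>0 (DO_fib \<E>) t"
  shows "linear_map hom0 prod0 (FA G t)"
  unfolding G_sel
proof (rule K.H.linear_mapI)
  have MN: "fib_morphism \<E>0 (DO_fib \<E>) (Src t)" "fib_morphism \<E>0 (DO_fib \<E>) (Tgt t)" using t by simp_all
  note w = whisker_target_cell[OF t]
  show d: "differential_object hom0 prod0 (pull (Src t))" "differential_object hom0 prod0 (pull (Tgt t))" using MN by simp_all
  note h = K.H.dobj_simps(8-10)[OF d(1), unfolded fib_hom_sel] K.H.dobj_simps(8-10)[OF d(2), unfolded fib_hom_sel]
  show w': "whisker_target \<E>0 \<E> U t \<in> Arr hom0" "Dom hom0 (whisker_target \<E>0 \<E> U t) = do_carrier (pull (Src t))"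
    "Cod hom0 (whisker_target \<E>0 \<E> U t) = do_carrier (pull (Tgt t))"
    using w t by (simp_all add: pull_sel)
  note h' = K.H.dobj_simps(8-10)[OF d(1)] K.H.dobj_simps(8-10)[OF d(2)]
  have l: "whisker_target \<E>0 \<E> U t \<cdot>\<^bsub>hom0\<^esub> do_hat (pull (Src t)) \<in> Arr hom0"
    "do_hat (pull (Tgt t)) \<cdot>\<^bsub>hom0\<^esub> TA hom0 (whisker_target \<E>0 \<E> U t) \<in> Arr hom0"
    by (rule K.H.Comp_simps(1)[OF h'(1) w'(1)], simp only: h' w')
      (rule K.H.Comp_simps(1)[OF K.H.T_simps(2)[OF w'(1)] h'(4)], simp only: K.H.T_simps(4)[OF w'(1)] h' w')
  show "whisker_target \<E>0 \<E> U t \<cdot>\<^bsub>hom0\<^esub> do_hat (pull (Src t)) =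
    do_hat (pull (Tgt t)) \<cdot>\<^bsub>hom0\<^esub> TA hom0 (whisker_target \<E>0 \<E> U t)"
  proof (rule K.cell_eqI)
    show "fib_cell \<E>0 \<E> (whisker_target \<E>0 \<E> U t \<cdot>\<^bsub>hom0\<^esub> do_hat (pull (Src t)))"
      "fib_cell \<E>0 \<E> (do_hat (pull (Tgt t)) \<cdot>\<^bsub>hom0\<^esub> TA hom0 (whisker_target \<E>0 \<E> U t))" using l by (simp_all only: fib_hom_sel(2))
    fix A assume A: "A \<in> Obj B0"
    show "fst (Und (whisker_target \<E>0 \<E> U t \<cdot>\<^bsub>hom0\<^esub> do_hat (pull (Src t)))) A =
      fst (Und (do_hat (pull (Tgt t)) \<cdot>\<^bsub>hom0\<^esub> TA hom0 (whisker_target \<E>0 \<E> U t))) A"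
      using A t MN Pi.D.linear_hat[of "fst (Und t) A"] by (simp add: pull_hat)
  next
    fix A assume A: "A \<in> Obj X0"
    show "snd (Und (whisker_target \<E>0 \<E> U t \<cdot>\<^bsub>hom0\<^esub> do_hat (pull (Src t)))) A =
      snd (Und (do_hat (pull (Tgt t)) \<cdot>\<^bsub>hom0\<^esub> TA hom0 (whisker_target \<E>0 \<E> U t))) A"
      using A t MN Pi.C.linear_hat[of "snd (Und t) A"] by (simp add: pull_hat)
  qed (use h t in \<open>simp_all add: pull_sel(1)\<close>)
qed

lemma pull_T:
  assumes H: "fib_morphism \<E>0 (DO_fib \<E>) H"
  shows "pull (fmor_T \<E>0 (DO_fib \<E>) H) = do_T hom0 prod0 (pull H)"
proof (rule K.fib_dobj_eqI)
  have d: "differential_object hom0 prod0 (pull H)" using H by simp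
  show "differential_object hom0 prod0 (pull (fmor_T \<E>0 (DO_fib \<E>) H))" using H by simp
  show "differential_object hom0 prod0 (do_T hom0 prod0 (pull H))" using d by simp
  show "do_carrier (pull (fmor_T \<E>0 (DO_fib \<E>) H)) = do_carrier (do_T hom0 prod0 (pull H))"
    using d H by (simp add: pull_sel T_comp)
  show "do_map (eval_base A) (pull (fmor_T \<E>0 (DO_fib \<E>) H)) = do_map (eval_base A) (do_T hom0 prod0 (pull H))" if A: "A \<in> Obj B0" for A
    using cartesian_functor.do_map_T[OF K.eval_cartesian_functor(1)[OF A] d] H A by simp
  show "do_map (eval_total A) (pull (fmor_T \<E>0 (DO_fib \<E>) H)) = do_map (eval_total A) (do_T hom0 prod0 (pull H))" if A: "A \<in> Obj X0" for A
    using cartesian_functor.do_map_T[OF K.eval_cartesian_functor(2)[OF A] d] H A by simp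
qed

lemma pull_Tn:
  assumes H: "fib_morphism \<E>0 (DO_fib \<E>) H" and n: "1 \<le> n"
  shows "pull (fmor_Tn \<E>0 (DO_fib \<E>) n H) = do_Tn hom0 prod0 n (pull H)"
proof (rule K.fib_dobj_eqI)
  have d: "differential_object hom0 prod0 (pull H)" using H by simp
  show "differential_object hom0 prod0 (pull (fmor_Tn \<E>0 (DO_fib \<E>) n H))" using H n by simp
  show "differential_object hom0 prod0 (do_Tn hom0 prod0 n (pull H))" using d n by simp
  show "do_carrier (pull (fmor_Tn \<E>0 (DO_fib \<E>) n H)) = do_carrier (do_Tn hom0 prod0 n (pull H))"
    using d H n by (simp add: pull_sel Tn_comp)
  show "do_map (eval_base A) (pull (fmor_Tn \<E>0 (DO_fib \<E>) n H)) = do_map (eval_base A) (do_Tn hom0 prod0 n (pull H))" if A: "A \<in> Obj B0" for A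
    using cartesian_functor.do_map_Tn[OF K.eval_cartesian_functor(1)[OF A] d n] H A n lax_object.lax_Tn_FO[OF L.morB[OF H]] by simp
  show "do_map (eval_total A) (pull (fmor_Tn \<E>0 (DO_fib \<E>) n H)) = do_map (eval_total A) (do_Tn hom0 prod0 n (pull H))" if A: "A \<in> Obj X0" for A
    using cartesian_functor.do_map_Tn[OF K.eval_cartesian_functor(2)[OF A] d n] H A n lax_object.lax_Tn_FO[OF L.morT[OF H]] by simp
qed

lemma G_eqI:
  assumes t: "fib_cell \<E>0 (DO_fib \<E>) t" and u: "linear_map hom0 prod0 u" and s: "Src u = pull (Src t)" "Tgt u = pull (Tgt t)"
    and b: "\<And>A. A \<in> Obj B0 \<Longrightarrow> Und (fst (Und t) A) = fst (Und (Und u)) A"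
    and x: "\<And>E. E \<in> Obj X0 \<Longrightarrow> Und (snd (Und t) E) = snd (Und (Und u)) E"
  shows "FA G t = u"
proof (rule tagged_eqI)
  note l = K.H.linear_simps(3-5)[OF u, unfolded fib_hom_sel]
  show "Und (FA G t) = Und u"
    by (rule K.cell_eqI) (use t whisker_target_cell[OF t] l s b x in \<open>simp_all add: G_sel pull_sel\<close>)
qed (simp_all add: G_sel s)

abbreviation "homL \<equiv> fib_hom \<E>0 (DO_fib \<E>)"

lemma G_structure:
  assumes H: "fib_morphism \<E>0 (DO_fib \<E>) H"
  shows "FA G (pT homL H) = pT (DO_cat hom0 prod0) (FO G H)" "FA G (zT homL H) = zT (DO_cat hom0 prod0) (FO G H)"
    "FA G (sT homL H) = sT (DO_cat hom0 prod0) (FO G H)" "FA G (lT homL H) = lT (DO_cat hom0 prod0) (FO G H)"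
    "FA G (cT homL H) = cT (DO_cat hom0 prod0) (FO G H)" "i < n \<Longrightarrow> FA G (pr homL n i H) = pr (DO_cat hom0 prod0) n i (FO G H)"
    "FA G (Id homL H) = Id (DO_cat hom0 prod0) (FO G H)"
proof -
  have d: "differential_object hom0 prod0 (pull H)" using H by simp
  note c = L.structure_cells[OF H] L.Id_cell[OF H] and l = K.H.structure_linear[OF d]
  note T = pull_T[OF H] pull_T[of "fmor_T \<E>0 (DO_fib \<E>) H"] pull_Tn[OF H]
  have [simp]: "do_carrier (pull H) = cmp U H" by (simp add: pull_sel)
  show "FA G (pT homL H) = pT (DO_cat hom0 prod0) (FO G H)"
    by (rule G_eqI) (use H c l T in \<open>simp_all add: G_sel\<close>)
  show "FA G (zT homL H) = zT (DO_cat hom0 prod0) (FO G H)"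
    by (rule G_eqI) (use H c l T in \<open>simp_all add: G_sel\<close>)
  show "FA G (sT homL H) = sT (DO_cat hom0 prod0) (FO G H)"
    by (rule G_eqI) (use H c l T in \<open>simp_all add: G_sel\<close>)
  show "FA G (lT homL H) = lT (DO_cat hom0 prod0) (FO G H)"
    by (rule G_eqI) (use H c l T in \<open>simp_all add: G_sel\<close>)
  show "FA G (cT homL H) = cT (DO_cat hom0 prod0) (FO G H)"
    by (rule G_eqI) (use H c l T in \<open>simp_all add: G_sel\<close>)
  show "FA G (pr homL n i H) = pr (DO_cat hom0 prod0) n i (FO G H)" if "i < n"
    by (rule G_eqI) (use H c(6)[OF that] l(7)[OF that] T less_imp_one_le[OF that] that in \<open>simp_all add: G_sel\<close>)
  show "FA G (Id homL H) = Id (DO_cat hom0 prod0) (FO G H)"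
    by (rule G_eqI) (use H c l T in \<open>simp_all add: G_sel\<close>)
qed

lemma G_preserving: "tangent_preserving homL (DO_cat hom0 prod0) G"
  unfolding tangent_preserving_def is_functor_def
proof (intro conjI ballI allI impI)
  fix t assume t: "t \<in> Arr homL"
  then show "FA G t \<in> Homs (DO_cat hom0 prod0) (FO G (Dom homL t)) (FO G (Cod homL t))"
    using G_linear[of t] by (simp add: G_sel)
  have l: "linear_map hom0 prod0 (FA G t)" using t G_linear by simp
  have c: "fib_cell \<E>0 (DO_fib \<E>) (TA homL t)" using t L.T_cell[of t] by (simp only: fib_hom_sel)
  show "FA G (TA homL t) = TA (DO_cat hom0 prod0) (FA G t)"
    by (rule G_eqI[OF c]) (use t l K.H.T_linear[OF l] in \<open>simp_all add: G_sel pull_T\<close>)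
next
  fix f g assume a: "f \<in> Arr homL" "g \<in> Arr homL" "Cod homL f = Dom homL g"
  have c: "fib_cell \<E>0 (DO_fib \<E>) (g \<cdot>\<^bsub>homL\<^esub> f)" using a L.Comp_cell[of g f] by (simp only: fib_hom_sel)
  have lin: "linear_map hom0 prod0 (FA G f)" "linear_map hom0 prod0 (FA G g)" using a G_linear by simp_all
  show "FA G (g \<cdot>\<^bsub>homL\<^esub> f) = FA G g \<cdot>\<^bsub>DO_cat hom0 prod0\<^esub> FA G f"
    by (rule G_eqI[OF c]) (use a K.H.Comp_linear[OF lin(2,1)] in \<open>simp_all add: G_sel\<close>)
qed (((rule G_structure; simp; fail) | (simp add: G_sel pull_T pull_Tn; fail))+)

section \<open>The comparison is bijective\<close>

text \<open>By \<open>pull_eval\<close> the values of \<open>H\<close> can be recovered, and by composition with \<open>U\<close> its action on arrows.\<close>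

lemma pull_inj:
  assumes H: "fib_morphism \<E>0 (DO_fib \<E>) H" and H': "fib_morphism \<E>0 (DO_fib \<E>) H'" and eq: "pull H = pull H'"
  shows "H = H'"
proof -
  have b: "bO H A = bO H' A" if "A \<in> Obj B0" for A using pull_eval(1)[OF H that] pull_eval(1)[OF H' that] eq by simp
  have t: "tO H A = tO H' A" if "A \<in> Obj X0" for A using pull_eval(2)[OF H that] pull_eval(2)[OF H' that] eq by simp
  have c: "cmp U H = cmp U H'" using eq by (metis pull_sel(1))
  then have cB: "lax_comp B0 BB (lax_forget BB PB) (mB H) = lax_comp B0 BB (lax_forget BB PB) (mB H')"
    and cT: "lax_comp X0 XX (lax_forget XX PX) (mT H) = lax_comp X0 XX (lax_forget XX PX) (mT H')"
    by (metis comp_sel DO_forget_sel)+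
  show ?thesis
  proof (rule fmor_eqI)
    show "mB H = mB H'"
    proof (rule lax_eqI[OF L.mor_ok(1)[OF H] L.mor_ok(1)[OF H']])
      fix f assume f: "f \<in> Arr (Base \<E>0)"
      show "FA (Fun (mB H)) f = FA (Fun (mB H')) f"
        by (rule tagged_eqI) (use f b H H' arg_cong[OF cB, of "\<lambda>M. FA (Fun M) f"] in simp_all)
    next
      fix A assume A: "A \<in> Obj (Base \<E>0)"
      show "Str (mB H) A = Str (mB H') A"
        by (rule tagged_eqI) (use A b H H' arg_cong[OF cB, of "\<lambda>M. Str M A"] in simp_all)
    qed (rule b)
    show "mT H = mT H'"
    proof (rule lax_eqI[OF L.mor_ok(2)[OF H] L.mor_ok(2)[OF H']])
      fix f assume f: "f \<in> Arr (Total \<E>0)"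
      show "FA (Fun (mT H)) f = FA (Fun (mT H')) f"
        by (rule tagged_eqI) (use f t H H' arg_cong[OF cT, of "\<lambda>M. FA (Fun M) f"] in simp_all)
    next
      fix A assume A: "A \<in> Obj (Total \<E>0)"
      show "Str (mT H) A = Str (mT H') A"
        by (rule tagged_eqI) (use A t H H' arg_cong[OF cT, of "\<lambda>M. Str M A"] in simp_all)
    qed (rule t)
  qed
qed

text \<open>The values of \<open>D\<close> are differential objects over the values of its carrier, and \<open>do_hat D\<close> is a cell;
  both halves of the carrier therefore factor by \<open>lift_lax\<close>.\<close>

lemma pull_surj:
  assumes D: "differential_object hom0 prod0 D"
  obtains H where "fib_morphism \<E>0 (DO_fib \<E>) H" "pull H = D"
proof -
  let ?M = "do_carrier D"
  have M: "fib_morphism \<E>0 \<E> ?M" using K.H.dobj_simps(1)[OF D] by simp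
  have hat: "fib_cell \<E>0 \<E> (do_hat D)" "Src (do_hat D) = fmor_T \<E>0 \<E> ?M" "Tgt (do_hat D) = ?M"
    using K.H.dobj_simps(8-10)[OF D] by simp_all
  have cells: "fib_cell \<E>0 \<E> (do_zero D)" "fib_cell \<E>0 \<E> (do_sum D)"
    using K.H.dobj_simps(2,5)[OF D] by simp_all
  have hb: "tangent_nat B0 BB (lax_T B0 BB (mB ?M)) (mB ?M) (\<lambda>A. do_hat (do_map (eval_base A) D))"
    using K.cell_nat(1)[OF hat(1)] hat(2,3) by (simp add: do_map_def)
  have ht: "tangent_nat X0 XX (lax_T X0 XX (mT ?M)) (mT ?M) (\<lambda>E. do_hat (do_map (eval_total E) D))"
    using K.cell_nat(2)[OF hat(1)] hat(2,3) by (simp add: do_map_def)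
  have cb: "do_carrier (do_map (eval_base A) D) = bO ?M A" for A by (simp add: do_map_def)
  have ct: "do_carrier (do_map (eval_total E) D) = tO ?M E" for E by (simp add: do_map_def)
  note db = K.eval_dobj(1)[OF D] and dt = K.eval_dobj(2)[OF D]
  note lb = Pi.D.lift_lax_ok[OF K.mor_ok(1)[OF M] db cb hb] Pi.D.forget_lift_lax[OF K.mor_ok(1)[OF M] db cb hb]
  note lt = Pi.C.lift_lax_ok[OF K.mor_ok(2)[OF M] dt ct ht] Pi.C.forget_lift_lax[OF K.mor_ok(2)[OF M] dt ct ht]
  define H where "H = \<lparr>mB = lift_lax B0 BB PB (mB ?M) (\<lambda>A. do_map (eval_base A) D),
    mT = lift_lax X0 XX PX (mT ?M) (\<lambda>E. do_map (eval_total E) D)\<rparr>"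
  have H_sel [simp]: "mB H = lift_lax B0 BB PB (mB ?M) (\<lambda>A. do_map (eval_base A) D)"
    "mT H = lift_lax X0 XX PX (mT ?M) (\<lambda>E. do_map (eval_total E) D)" by (simp_all add: H_def)
  \<comment> \<open>The structure cells of \<open>D\<close> lie over each other, so its total values lie over its base values.\<close>
  have PiE: "do_map (Proj \<E>) (do_map (eval_total E) D) = do_map (eval_base (FO (Proj \<E>0) E)) D" if "E \<in> Obj X0" for E
    by (rule dobj_eqI) (use that M hat cells in \<open>simp_all add: do_map_def\<close>)
  interpret bl: lax_DO BB PB B0 "mB H" by unfold_locales (simp add: lb)
  interpret tl: lax_DO XX PX X0 "mT H" by unfold_locales (simp add: lt)
  have H: "fib_morphism \<E>0 (DO_fib \<E>) H"
    unfolding fib_morphism_def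
  proof (intro conjI ballI allI impI)
    show "lax_ok (Base \<E>0) (Base (DO_fib \<E>)) (mB H)" "lax_ok (Total \<E>0) (Total (DO_fib \<E>)) (mT H)"
      using bl.ok tl.ok by simp_all
    show "FO (Proj (DO_fib \<E>)) (tO H E) = bO H (FO (Proj \<E>0) E)" if "E \<in> Obj X0" for E
      using that PiE by simp
    show "FA (Proj (DO_fib \<E>)) (FA (Fun (mT H)) f) = FA (Fun (mB H)) (FA (Proj \<E>0) f)" if "f \<in> Arr X0" for f
      by (rule tagged_eqI) (use that PiE M in simp_all)
    show "FA (Proj (DO_fib \<E>)) (Str (mT H) E) = Str (mB H) (FO (Proj \<E>0) E)" if "E \<in> Obj X0" for E
      by (rule tagged_eqI) (use that PiE M dt in simp_all)
    fix \<phi> assume \<phi>: "cartesian_arrow \<E>0 \<phi>"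
    then have a: "\<phi> \<in> Arr X0" by simp
    show "cartesian_arrow (DO_fib \<E>) (FA (Fun (mT H)) \<phi>)"
      by (rule DO_cartesianI[OF tl.H_simps(2)[OF a]]) (use a K.mor_simps(5)[OF M \<phi>] in simp)
  qed
  have "pull H = D"
  proof (rule K.fib_dobj_eqI[OF pull_dobj[OF H] D])
    show "do_carrier (pull H) = ?M"
      unfolding pull_sel by (rule fmor_eqI) (simp_all add: lb lt)
  qed (use H in simp_all)
  with H show thesis by (rule that)
qed

text \<open>A linear map of differential objects of the hom-category has linear components, and these form a cell
  because the underlying arrows do.\<close>

lemma G_full:
  assumes H: "fib_morphism \<E>0 (DO_fib \<E>) H" and H': "fib_morphism \<E>0 (DO_fib \<E>) H'"
    and u: "linear_map hom0 prod0 u" "Src u = pull H" "Tgt u = pull H'"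
  obtains t where "fib_cell \<E>0 (DO_fib \<E>) t" "FA G t = u"
proof -
  let ?\<phi> = "\<lambda>A. tag (bO H A) (bO H' A) (fst (Und (Und u)) A)" and ?\<psi> = "\<lambda>E. tag (tO H E) (tO H' E) (snd (Und (Und u)) E)"
  have c: "fib_cell \<E>0 \<E> (Und u)" "Src (Und u) = cmp U H" "Tgt (Und u) = cmp U H'"
    using K.H.linear_simps(3-5)[OF u(1)] u(2,3) by (simp_all add: pull_sel)
  have lb: "linear_map BB PB (?\<phi> A)" if A: "A \<in> Obj B0" for A
    using cartesian_functor.do_map_linear[OF K.eval_cartesian_functor(1)[OF A] u(1)] u(2,3) H H' A by simp
  have lt: "linear_map XX PX (?\<psi> E)" if E: "E \<in> Obj X0" for E
    using cartesian_functor.do_map_linear[OF K.eval_cartesian_functor(2)[OF E] u(1)] u(2,3) H H' E by simp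
  have nb: "tangent_nat B0 BB (mB (cmp U H)) (mB (cmp U H')) (fst (Und (Und u)))"
    and nt: "tangent_nat X0 XX (mT (cmp U H)) (mT (cmp U H')) (snd (Und (Und u)))"
    using K.cell_nat[OF c(1)] c(2,3) by simp_all
  note b = tangent_natD[OF nb] and n = tangent_natD[OF nt]
  define t where "t = mk_cell \<E>0 H H' ?\<phi> ?\<psi>"
  have t: "fib_cell \<E>0 (DO_fib \<E>) t"
    unfolding t_def
  proof (rule L.mk_cell_cell[OF H H'])
    show "tangent_nat (Base \<E>0) (Base (DO_fib \<E>)) (mB H) (mB H') ?\<phi>"
    proof (rule tangent_natI)
      fix f assume f: "f \<in> Arr (Base \<E>0)"
      show "?\<phi> (Cod B0 f) \<cdot>\<^bsub>Base (DO_fib \<E>)\<^esub> FA (Fun (mB H)) f = FA (Fun (mB H')) f \<cdot>\<^bsub>Base (DO_fib \<E>)\<^esub> ?\<phi> (Dom B0 f)"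
        by (rule tagged_eqI) (use f H H' b(4)[OF f] in simp_all)
    next
      fix A assume A: "A \<in> Obj (Base \<E>0)"
      show "TA (Base (DO_fib \<E>)) (?\<phi> A) \<cdot>\<^bsub>Base (DO_fib \<E>)\<^esub> Str (mB H) A = Str (mB H') A \<cdot>\<^bsub>Base (DO_fib \<E>)\<^esub> ?\<phi> (TO B0 A)"
        by (rule tagged_eqI) (use A H H' b(5)[OF A] in simp_all)
    qed (use lb in simp)
    show "tangent_nat (Total \<E>0) (Total (DO_fib \<E>)) (mT H) (mT H') ?\<psi>"
    proof (rule tangent_natI)
      fix f assume f: "f \<in> Arr (Total \<E>0)"
      show "?\<psi> (Cod X0 f) \<cdot>\<^bsub>Total (DO_fib \<E>)\<^esub> FA (Fun (mT H)) f = FA (Fun (mT H')) f \<cdot>\<^bsub>Total (DO_fib \<E>)\<^esub> ?\<psi> (Dom X0 f)"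
        by (rule tagged_eqI) (use f H H' n(4)[OF f] in simp_all)
    next
      fix A assume A: "A \<in> Obj (Total \<E>0)"
      show "TA (Total (DO_fib \<E>)) (?\<psi> A) \<cdot>\<^bsub>Total (DO_fib \<E>)\<^esub> Str (mT H) A = Str (mT H') A \<cdot>\<^bsub>Total (DO_fib \<E>)\<^esub> ?\<psi> (TO X0 A)"
        by (rule tagged_eqI) (use A H H' n(5)[OF A] in simp_all)
    qed (use lt in simp)
    fix E assume E: "E \<in> Obj (Total \<E>0)"
    show "FA (Proj (DO_fib \<E>)) (?\<psi> E) = ?\<phi> (FO (Proj \<E>0) E)"
      by (rule tagged_eqI) (use E L.mor_simps(3)[OF H E] L.mor_simps(3)[OF H' E] K.cell_simps(9)[OF c(1) E] in simp_all)
  qed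
  have "FA G t = u" by (rule G_eqI[OF t u(1)]) (use u in \<open>simp_all add: t_def\<close>)
  with t show thesis by (rule that)
qed

lemma G_faithful:
  assumes t: "fib_cell \<E>0 (DO_fib \<E>) t" and u: "fib_cell \<E>0 (DO_fib \<E>) u" and eq: "FA G t = FA G u"
  shows "t = u"
proof -
  have p: "pull (Src t) = pull (Src u)" "pull (Tgt t) = pull (Tgt u)" and w: "whisker_target \<E>0 \<E> U t = whisker_target \<E>0 \<E> U u"
    using eq by (simp_all add: G_sel)
  have s: "Src t = Src u" "Tgt t = Tgt u"
    using pull_inj[OF _ _ p(1)] pull_inj[OF _ _ p(2)] t u by simp_all
  have "Und (fst (Und t) A) = Und (fst (Und u) A)" if "A \<in> Obj B0" for A
    using arg_cong[OF w, of "\<lambda>c. fst (Und c) A"] t u that by simp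
  moreover have "Und (snd (Und t) A) = Und (snd (Und u) A)" if "A \<in> Obj X0" for A
    using arg_cong[OF w, of "\<lambda>c. snd (Und c) A"] t u that by simp
  ultimately show ?thesis
    by (intro L.cell_eqI[OF t u s] tagged_eqI) (use t u s in simp_all)
qed

theorem comparison_iso: "tangent_iso homL (pointwise_DO \<E>0 \<E>) G"
  unfolding tangent_iso_def K.pointwise_DO_eq
proof (intro conjI)
  show "strict_tangent_morphism homL (DO_cat hom0 prod0) G"
    by (rule tangent_preserving_lax[OF L.fib_hom_tangent_category K.H.DO_tangent_category G_preserving])
  show "bij_betw (FO G) (Obj homL) (Obj (DO_cat hom0 prod0))"
    unfolding bij_betw_def
  proof (intro conjI equalityI subsetI)
    show "inj_on (FO G) (Obj homL)" by (rule inj_onI) (use pull_inj in \<open>simp add: G_sel\<close>)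
    show "D \<in> Obj (DO_cat hom0 prod0)" if "D \<in> FO G ` Obj homL" for D using that by (auto simp: G_sel)
    show "D \<in> FO G ` Obj homL" if "D \<in> Obj (DO_cat hom0 prod0)" for D
    proof -
      have d: "differential_object hom0 prod0 D" using that by simp
      obtain H where "fib_morphism \<E>0 (DO_fib \<E>) H" "pull H = D" by (rule pull_surj[OF d])
      then show ?thesis by (intro image_eqI[of _ _ H]) (simp_all add: G_sel)
    qed
  qed
  show "bij_betw (FA G) (Arr homL) (Arr (DO_cat hom0 prod0))"
    unfolding bij_betw_def
  proof (intro conjI equalityI subsetI)
    show "inj_on (FA G) (Arr homL)" by (rule inj_onI) (use G_faithful in simp)
    show "u \<in> Arr (DO_cat hom0 prod0)" if "u \<in> FA G ` Arr homL" for u using that G_linear by auto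
    show "u \<in> FA G ` Arr homL" if "u \<in> Arr (DO_cat hom0 prod0)" for u
    proof -
      have u: "linear_map hom0 prod0 u" using that by simp
      obtain H where H: "fib_morphism \<E>0 (DO_fib \<E>) H" "pull H = Src u" by (rule pull_surj[OF K.H.linear_simps(1)[OF u]])
      obtain H' where H': "fib_morphism \<E>0 (DO_fib \<E>) H'" "pull H' = Tgt u" by (rule pull_surj[OF K.H.linear_simps(2)[OF u]])
      obtain t where "fib_cell \<E>0 (DO_fib \<E>) t" "FA G t = u"
        by (rule G_full[OF H(1) H'(1) u H(2)[symmetric] H'(2)[symmetric]])
      then show ?thesis by (intro image_eqI[of _ _ t]) simp_all
    qed
  qed
qed

end

section \<open>The tangentad of differential objects\<close>

theorem DO_fib_tangentad:
  fixes \<E> :: "('e, 'em, 'b, 'bm) ctfib"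
  assumes "cartesian_tangent_fibration k \<E>"
  shows "tangentad_of_differential_objects k \<E> (DO_fib \<E>) (DO_universal \<E>) TYPE(('e0, 'em0, 'b0, 'bm0) tfib)"
proof -
  interpret fibration_of_DO \<E> k
    by unfold_locales (use assms in \<open>simp_all add: cartesian_tangent_fibration_def\<close>)
  show ?thesis
    unfolding tangentad_of_differential_objects_def
  proof (intro conjI allI impI)
    show "strict_fib_morphism (DO_fib \<E>) \<E> (do_carrier (DO_universal \<E>))"
      using DO_forget_strict by (simp add: DO_universal_sel)
    fix \<E>0 :: "('e0, 'em0, 'b0, 'bm0) tfib"
    assume "tangent_fibration \<E>0"
    then interpret comparison \<E> k \<E>0 by unfold_locales
    show "tangent_iso (fib_hom \<E>0 (DO_fib \<E>)) (pointwise_DO \<E>0 \<E>) (DO_comparison \<E>0 \<E> (DO_universal \<E>))"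
      by (rule comparison_iso)
  qed (rule DO_fib_cartesian DO_universal_dobj DO_universal_pointwise)+
qed

theorem theorem3p17:
  fixes k :: fib_kind
    and \<E> :: "('e, 'em, 'b, 'bm) ctfib"
  assumes "cartesian_tangent_fibration k \<E>"
  shows
    "admits_differential_objects k \<E>
       TYPE((('e, 'em) dobj, (('e, 'em) dobj, 'em) tagged,
             ('b, 'bm) dobj, (('b, 'bm) dobj, 'bm) tagged) ctfib)
       TYPE(('e0, 'em0, 'b0, 'bm0) tfib)
     \<and> tangentad_of_differential_objects k \<E> (DO_fib \<E>) (DO_universal \<E>)
         TYPE(('e0, 'em0, 'b0, 'bm0) tfib)
     \<and> Total (DO_fib \<E>) = DO_cat (Total \<E>) (TProd \<E>)
     \<and> Base (DO_fib \<E>) = DO_cat (Base \<E>) (BProd \<E>)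
     \<and> (\<forall>E\<in>Obj (DO_cat (Total \<E>) (TProd \<E>)).
          FO (Proj (DO_fib \<E>)) E =
            \<lparr>do_carrier = FO (Proj \<E>) (do_carrier E),
             do_zero = FA (Proj \<E>) (do_zero E),
             do_sum = FA (Proj \<E>) (do_sum E),
             do_hat = FA (Proj \<E>) (do_hat E)\<rparr>)"
  using DO_fib_tangentad[OF assms]
  by (auto simp: admits_differential_objects_def DO_fib_def do_map_def)

end
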